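(* Let $\varepsilon>0$. Then there exist positive constants $C_0=C_0(\varepsilon)$ and $C_1=C_1(\varepsilon)$ such that for every $V>\overline{V}$ and for every minimizer $\widetilde h_V$ of $G_V$, $$\|\widetilde h_V-\bar h_s\|_{L^2(\widetilde I_s)}\le C_0\exp(-C_1V^{1/5})\qquad\text{for all } s\ge\varepsilon.$$
   Context: For a nonnegative $h\in H^1(\mathbb{R})$ (identified with its continuous representative), let $\Omega_h:=\{(x,y)\in\mathbb{R}^2: 0<y<h(x)\}$. For $V>0$, let $\mathcal{A}_V$ be the set of pairs $(u,h)$ with $h\in H^1(\mathbb{R})$, $h\ge 0$, $u\in H^1(\Omega_h)$ real-valued, $\int_{\mathbb{R}}h\,dx=V$, and $u(x,0)=x$ (in the sense of traces) for $x\in\operatorname{supp}h$. Set $$E_V(u,h):=\int_{\Omega_h}|\nabla u|^2\,dx\,dy,\qquad S_V(h):=\int_{\mathbb{R}}h'^2\,dx,\qquad F_s(V):=\inf\{E_V(u,h)+S_V(h): (u,h)\in\mathcal{A}_V\}.$$ One always has $F_s(V)\le V$. The critical volume $\overline{V}\in(0,\infty)$ is the maximal number such that $F_s(V)=V$ for all $V\in(0,\overline{V}]$; one has $F_s(V)<V$ for $V>\overline{V}$. For $(u,h)\in\mathcal{A}_V$ with $u$ the minimizer of the Dirichlet energy in $\Omega_h$ subject to the boundary condition, put $\widetilde h(x):=V^{-3/5}h(V^{2/5}x)$ (so $\int_{\mathbb{R}}\widetilde h\,dx=1$) and $$G_V(\widetilde h):=V^{-4/5}\left(S_V(h)+E_V(u,h)\right)=\int_{\mathbb{R}}\widetilde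 h'^2\,dx+V^{-4/5}\int_{\Omega_h}|\nabla u|^2\,dx\,dy;$$ thus minimizers $\widetilde h_V$ of $G_V$ are exactly the rescaled profiles of minimizers of $F_s(V)$. Given a minimizer $\widetilde h_V$ and $s>0$, $\widetilde I_s$ denotes the largest connected component of $\{\widetilde h_V>s\}$, and $\bar h_s$ denotes the minimizer of $\int_{\widetilde I_s}h'^2\,dx$ under the constraints $\int_{\widetilde I_s}h\,dx=\int_{\widetilde I_s}\widetilde h_V\,dx$ and $h=\widetilde h_V$ on the boundary of $\widetilde I_s$ (nothing is asserted if $\{\widetilde h_V>s\}=\emptyset$). *)

theory Defs
  imports "HOL-Analysis.Analysis"
begin

section \<open>Sobolev functions\<close>

primrec Ck :: "nat \<Rightarrow> ('a::euclidean_space \<Rightarrow> real) \<Rightarrow> bool" where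
  "Ck 0 f \<longleftrightarrow> continuous_on UNIV f"
| "Ck (Suc n) f \<longleftrightarrow> (\<forall>x. f differentiable (at x)) \<and>
     (\<forall>b\<in>Basis. Ck n (\<lambda>x. frechet_derivative f (at x) b))"

definition smooth :: "('a::euclidean_space \<Rightarrow> real) \<Rightarrow> bool" where
  "smooth f \<longleftrightarrow> (\<forall>n. Ck n f)"

definition test_function :: "'a::euclidean_space set \<Rightarrow> ('a \<Rightarrow> real) \<Rightarrow> bool" where
  "test_function U \<phi> \<longleftrightarrow> smooth \<phi> \<and> (\<exists>K. compact K \<and> K \<subseteq> U \<and> (\<forall>x. x \<notin> K \<longrightarrow> \<phi> x = 0))"

definition L2 :: "'a::euclidean_space set \<Rightarrow> ('a \<Rightarrow> 'b::euclidean_space) \<Rightarrow> bool" where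
  "L2 U f \<longleftrightarrow> f \<in> borel_measurable (lebesgue_on U) \<and> integrable (lebesgue_on U) (\<lambda>x. (norm (f x))\<^sup>2)"

definition L2_norm :: "'a::euclidean_space set \<Rightarrow> ('a \<Rightarrow> 'b::euclidean_space) \<Rightarrow> real" where
  "L2_norm U f = sqrt (LINT x|lebesgue_on U. (norm (f x))\<^sup>2)"

definition has_weak_gradient ::
    "'a::euclidean_space set \<Rightarrow> ('a \<Rightarrow> real) \<Rightarrow> ('a \<Rightarrow> 'a) \<Rightarrow> bool" where
  "has_weak_gradient U u g \<longleftrightarrow> L2 U g \<and>
     (\<forall>\<phi>. test_function U \<phi> \<longrightarrow> (\<forall>b\<in>Basis.
        (LINT x|lebesgue_on U. u x * frechet_derivative \<phi> (at x) b)
        = - (LINT x|lebesgue_on U. (g x \<bullet> b) * \<phi> x)))"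

definition H1 :: "'a::euclidean_space set \<Rightarrow> ('a \<Rightarrow> real) \<Rightarrow> bool" where
  "H1 U u \<longleftrightarrow> L2 U u \<and> (\<exists>g. has_weak_gradient U u g)"

text \<open>Weak gradients are unique only almost everywhere; below they occur only under integrals, so the
  choice of representative is immaterial. On the real line the weak gradient is the weak derivative.\<close>

definition weak_gradient :: "'a::euclidean_space set \<Rightarrow> ('a \<Rightarrow> real) \<Rightarrow> 'a \<Rightarrow> 'a" where
  "weak_gradient U u = (SOME g. has_weak_gradient U u g)"

definition dirichlet_energy :: "'a::euclidean_space set \<Rightarrow> ('a \<Rightarrow> real) \<Rightarrow> real" where
  "dirichlet_energy U u = (LINT x|lebesgue_on U. (norm (weak_gradient U u x))\<^sup>2)"

definition H1_norm :: "'a::euclidean_space set \<Rightarrow> ('a \<Rightarrow> real) \<Rightarrow> real" where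
  "H1_norm U u = sqrt ((L2_norm U u)\<^sup>2 + dirichlet_energy U u)"

text \<open>The trace operator of a rectangle is the continuous extension to \<open>H1\<close> of the restriction of
  smooth functions to the boundary; here only its component on the bottom edge is needed.\<close>

definition has_bottom_trace ::
    "real \<Rightarrow> real \<Rightarrow> real \<Rightarrow> (real \<times> real \<Rightarrow> real) \<Rightarrow> (real \<Rightarrow> real) \<Rightarrow> bool" where
  "has_bottom_trace a b d u t \<longleftrightarrow> (\<exists>w. (\<forall>n::nat. smooth (w n)) \<and>
     (\<lambda>n. H1_norm ({a<..<b} \<times> {0<..<d}) (\<lambda>z. w n z - u z)) \<longlonglongrightarrow> 0 \<and>
     (\<lambda>n. L2_norm {a<..<b} (\<lambda>x. w n (x, 0) - t x)) \<longlonglongrightarrow> 0)"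

section \<open>The variational problem\<close>

definition Omega :: "(real \<Rightarrow> real) \<Rightarrow> (real \<times> real) set" where
  "Omega h = {(x, y). 0 < y \<and> y < h x}"

text \<open>\<open>Omega h\<close> need not be a Lipschitz domain, so the boundary condition is imposed on every
  rectangle in \<open>Omega h\<close> standing on the axis. As \<open>h\<close> is continuous, the bottom edges of
  these rectangles cover \<open>{x. h x > 0}\<close>, which is the part of the axis lying above which there are
  points of \<open>Omega h\<close>; no trace exists at the remaining points of the support of \<open>h\<close>.\<close>

definition boundary_admissible :: "(real \<Rightarrow> real) \<Rightarrow> (real \<times> real \<Rightarrow> real) \<Rightarrow> bool" where
  "boundary_admissible h u \<longleftrightarrow> H1 (Omega h) u \<and>
     (\<forall>a b d. a < b \<and> 0 < d \<and> {a<..<b} \<times> {0<..<d} \<subseteq> Omega h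
        \<longrightarrow> has_bottom_trace a b d u (\<lambda>x. x))"

definition admissible :: "real \<Rightarrow> ((real \<times> real \<Rightarrow> real) \<times> (real \<Rightarrow> real)) set" where
  "admissible V = {(u, h). 0 < V \<and> continuous_on UNIV h \<and> H1 UNIV h \<and> (\<forall>x. 0 \<le> h x) \<and>
     integrable lebesgue h \<and> (LINT x|lebesgue. h x) = V \<and> boundary_admissible h u}"

definition elastic_energy :: "(real \<times> real \<Rightarrow> real) \<Rightarrow> (real \<Rightarrow> real) \<Rightarrow> real" where
  "elastic_energy u h = dirichlet_energy (Omega h) u"

definition surface_energy :: "(real \<Rightarrow> real) \<Rightarrow> real" where
  "surface_energy h = dirichlet_energy UNIV h"

definition Fs :: "real \<Rightarrow> real" where
  "Fs V = (INF (u, h)\<in>admissible V. elastic_energy u h + surface_energy h)"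

definition critical_volume :: real where
  "critical_volume = (GREATEST V. 0 < V \<and> (\<forall>W. 0 < W \<and> W \<le> V \<longrightarrow> Fs W = W))"

definition dirichlet_minimizer :: "(real \<Rightarrow> real) \<Rightarrow> (real \<times> real \<Rightarrow> real) \<Rightarrow> bool" where
  "dirichlet_minimizer h u \<longleftrightarrow> boundary_admissible h u \<and>
     (\<forall>v. boundary_admissible h v \<longrightarrow> elastic_energy u h \<le> elastic_energy v h)"

definition rescale :: "real \<Rightarrow> (real \<Rightarrow> real) \<Rightarrow> real \<Rightarrow> real" where
  "rescale V h = (\<lambda>x. V powr (- 3/5) * h (V powr (2/5) * x))"

definition unscale :: "real \<Rightarrow> (real \<Rightarrow> real) \<Rightarrow> real \<Rightarrow> real" where
  "unscale V k = (\<lambda>x. V powr (3/5) * k (V powr (- 2/5) * x))"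

lemma unscale_rescale: "0 < V \<Longrightarrow> unscale V (rescale V h) = h"
  by (rule ext) (simp add: unscale_def rescale_def mult.assoc [symmetric] powr_add [symmetric])

definition rescaled_profiles :: "real \<Rightarrow> (real \<Rightarrow> real) set" where
  "rescaled_profiles V = {rescale V h | u h. (u, h) \<in> admissible V \<and> dirichlet_minimizer h u}"

definition G :: "real \<Rightarrow> (real \<Rightarrow> real) \<Rightarrow> real" where
  "G V k = (let h = unscale V k; u = (SOME u. dirichlet_minimizer h u)
            in V powr (- 4/5) * (surface_energy h + elastic_energy u h))"

definition G_minimizer :: "real \<Rightarrow> (real \<Rightarrow> real) \<Rightarrow> bool" where
  "G_minimizer V k \<longleftrightarrow> k \<in> rescaled_profiles V \<and> (\<forall>k'\<in>rescaled_profiles V. G V k \<le> G V k')"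

definition largest_component :: "real set \<Rightarrow> real set \<Rightarrow> bool" where
  "largest_component S I \<longleftrightarrow> I \<in> components S \<and>
     (\<forall>J\<in>components S. measure lebesgue J \<le> measure lebesgue I)"

text \<open>Competitors are represented by their extension that is continuous up to the boundary of \<open>I\<close>,
  so that their boundary values are defined pointwise.\<close>

definition constrained_competitor :: "(real \<Rightarrow> real) \<Rightarrow> real set \<Rightarrow> (real \<Rightarrow> real) \<Rightarrow> bool" where
  "constrained_competitor h I k \<longleftrightarrow> H1 I k \<and> continuous_on (closure I) k \<and>
     (LINT x|lebesgue_on I. k x) = (LINT x|lebesgue_on I. h x) \<and> (\<forall>x\<in>frontier I. k x = h x)"

definition constrained_minimizer :: "(real \<Rightarrow> real) \<Rightarrow> real set \<Rightarrow> (real \<Rightarrow> real) \<Rightarrow> bool" where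
  "constrained_minimizer h I k \<longleftrightarrow> constrained_competitor h I k \<and>
     (\<forall>k'. constrained_competitor h I k' \<longrightarrow> dirichlet_energy I k \<le> dirichlet_energy I k')"

end

theory Submission
  imports Defs
begin

text \<open>Let \<open>h\<close> be the profile of a minimizer of the total energy for the volume \<open>V\<close>, and \<open>u\<close> its displacement.
  On a component of a superlevel set the profile is, up to an exponentially small error in the elastic
  energy, a minimizer of the surface energy alone, because the elastic energy that is stored high up
  in the domain is exponentially small.

  \<^emph>\<open>Decay.\<close> A component of \<open>{x. h x > t}\<close> has length at most \<open>V / t\<close>, so above it the subgraph is a tower which is
  narrow when \<open>t\<close> is large. Replacing \<open>u\<close> by a constant above a level \<open>\<tau>\<close>, with a cutoff in a strip of
  height \<open>\<delta>\<close> not smaller than the width of the tower, costs a fixed multiple of the energy in a strip of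
  height \<open>2 * \<delta>\<close> around \<open>\<tau>\<close>, whatever the shape of the tower is (\<open>tower_competitor\<close>, based on the Poincare inequality
  \<open>strip_Poincare\<close>). As \<open>u\<close> is minimal, hole filling shows that the energy of the tower decreases by
  the factor \<open>decay_rate\<close> over a height of \<open>2 * \<delta>\<close> (\<open>tower_energy_decay\<close>). The number of such steps in half of a tower of height \<open>T\<close>
  is proportional to \<open>T\<^sup>2 / V\<close>, and \<open>T = V powr (3/5) * s\<close> turns this into \<open>s\<^sup>2 * V powr (1/5)\<close>.

  \<^emph>\<open>Comparison.\<close> The competitor which is constant near the top is admissible for every profile that differs from
  \<open>h\<close> only above the level \<open>T\<close> (\<open>reshaped_competitor\<close>). Hence reshaping the top of the tower can lower the surface energy
  at most by an exponentially small multiple of the elastic energy (\<open>reshaped_surface_energy\<close>). The comparison profile is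
  the parabola with the same boundary values and the same volume. Its derivative is affine
  and therefore orthogonal to the derivative of every variation that vanishes at the end points and has mean
  zero. So the gain in surface energy is exactly the squared norm of the difference
  of the derivatives, which by the Poincare inequality controls the difference of the functions
  (\<open>parabola_excess\<close>), and the constrained minimizer is the parabola (\<open>constrained_minimizer_near\<close>). The total energy of a minimizer
  grows only polynomially in \<open>V\<close> (\<open>total_energy_bound\<close>), which the exponential absorbs.

  Most of the text provides the analysis behind this: smooth cutoffs, completeness of \<open>L2\<close>, uniqueness of weak
  gradients, Poincare inequalities, existence of Dirichlet minimizers on a subgraph, and the
  equivalence of weak derivatives and primitives on intervals. Because a subgraph can be
  irregular, inequalities on it are proved for smooth functions on rectangles standing on the axis, called
  pillars, and are transferred by approximation and exhaustion (\<open>pillar_exhaustion\<close>).\<close>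

section \<open>Smooth functions\<close>

lemma Ck_SucD: "Ck (Suc n) f \<Longrightarrow> Ck n f"
proof (induction n arbitrary: f)
  case 0
  then show ?case
    by (auto intro!: continuous_at_imp_continuous_on intro: differentiable_imp_continuous_within)
next
  case (Suc n)
  then show ?case by simp
qed

lemma Ck_continuous: "Ck n f \<Longrightarrow> continuous_on UNIV f"
  by (induction n) (use Ck_SucD in auto)

lemma Ck_SucI:
  assumes "\<And>x. (f has_derivative (\<lambda>v. D v x)) (at x)" "\<And>b. b \<in> Basis \<Longrightarrow> Ck n (D b)"
  shows "Ck (Suc n) f"
proof -
  have "frechet_derivative f (at x) = (\<lambda>v. D v x)" for x
    using frechet_derivative_at[OF assms(1)] by simp
  then show ?thesis using assms by (auto simp: differentiable_def)
qed

lemma Ck_SucD_has_derivative: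
  "Ck (Suc n) f \<Longrightarrow> (f has_derivative (\<lambda>v. frechet_derivative f (at x) v)) (at x)"
  using frechet_derivative_works by auto

lemma Ck_const: "Ck n (\<lambda>x::'a::euclidean_space. c)"
proof (induction n arbitrary: c)
  case (Suc n)
  show ?case by (rule Ck_SucI[where D="\<lambda>v x. 0"]) (use Suc in auto)
qed simp

lemma Ck_add: "Ck n f \<Longrightarrow> Ck n g \<Longrightarrow> Ck n (\<lambda>x. f x + g x)"
proof (induction n arbitrary: f g)
  case 0
  then show ?case by (auto intro: continuous_intros)
next
  case (Suc n)
  show ?case
    by (rule Ck_SucI[where D="\<lambda>v x. frechet_derivative f (at x) v + frechet_derivative g (at x) v"],
        intro has_derivative_add Ck_SucD_has_derivative[OF Suc.prems(1)] Ck_SucD_has_derivative[OF Suc.prems(2)])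
      (use Suc in auto)
qed

lemma Ck_mult: "Ck n f \<Longrightarrow> Ck n g \<Longrightarrow> Ck n (\<lambda>x. f x * g x)"
proof (induction n arbitrary: f g)
  case 0
  then show ?case by (auto intro: continuous_intros)
next
  case (Suc n)
  have D: "(f has_derivative frechet_derivative f (at x)) (at x)"
    "(g has_derivative frechet_derivative g (at x)) (at x)" for x
    by (rule Ck_SucD_has_derivative[OF Suc.prems(1)], rule Ck_SucD_has_derivative[OF Suc.prems(2)])
  have C: "Ck n f" "Ck n g" using Suc.prems Ck_SucD by blast+
  show ?case
    by (rule Ck_SucI[where D="\<lambda>v x. f x * frechet_derivative g (at x) v + frechet_derivative f (at x) v * g x"])
      (use Suc C in \<open>auto intro!: has_derivative_mult D Ck_add\<close>)
qed

lemma Ck_affine: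
  fixes f :: "real \<Rightarrow> real" and a :: "'a::euclidean_space"
  shows "Ck n f \<Longrightarrow> Ck n (\<lambda>x. f (a \<bullet> x + c))"
proof (induction n arbitrary: f)
  case 0
  then have "continuous_on UNIV f" by simp
  then show ?case
    by (auto intro!: continuous_on_compose2[of UNIV f] continuous_intros)
next
  case (Suc n)
  have D: "(f has_derivative frechet_derivative f (at x)) (at x)" for x
    by (rule Ck_SucD_has_derivative[OF Suc.prems])
  have lin: "frechet_derivative f (at y) t = t * frechet_derivative f (at y) 1" for y t
    using linear_cmul[OF has_derivative_linear[OF D], of y t 1] by simp
  show ?case
  proof (rule Ck_SucI[where D="\<lambda>v x. (a \<bullet> v) * frechet_derivative f (at (a \<bullet> x + c)) 1"])
    fix x
    have "((\<lambda>x. f (a \<bullet> x + c)) has_derivative (\<lambda>v. frechet_derivative f (at (a \<bullet> x + c)) (a \<bullet> v))) (at x)"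
      by (rule has_derivative_compose[OF _ D]) (auto intro!: derivative_eq_intros)
    then show "((\<lambda>x. f (a \<bullet> x + c)) has_derivative (\<lambda>v. (a \<bullet> v) * frechet_derivative f (at (a \<bullet> x + c)) 1)) (at x)"
      by (subst (asm) lin)
  next
    fix b :: 'a assume "b \<in> Basis"
    have "Ck n (\<lambda>x. frechet_derivative f (at x) 1)" using Suc.prems by simp
    from Suc.IH[OF this] show "Ck n (\<lambda>x. a \<bullet> b * frechet_derivative f (at (a \<bullet> x + c)) 1)"
      by (intro Ck_mult Ck_const)
  qed
qed

text \<open>Smoothness is local. This is used for functions that are given by different smooth formulas on the parts of an
  open cover, such as a test function multiplied by a cutoff which jumps outside of the domain.\<close>

lemma Ck_local:
  assumes "\<And>x. \<exists>U f'. open U \<and> x \<in> U \<and> Ck n f' \<and> (\<forall>y\<in>U. f y = f' y)"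
  shows "Ck n f"
  using assms
proof (induction n arbitrary: f)
  case 0
  show ?case
    unfolding Ck.simps
  proof (rule continuous_at_imp_continuous_on, safe)
    fix x
    obtain U f' where U: "open U" "x \<in> U" "continuous_on UNIV f'" "\<forall>y\<in>U. f y = f' y"
      using 0[of x] by auto
    then have "isCont f' x" by (simp add: continuous_on_eq_continuous_at)
    then show "isCont f x"
      by (subst isCont_cong[of f f' x]) (use U in \<open>auto simp: eventually_nhds\<close>)
  qed
next
  case (Suc n)
  have E: "\<exists>U f'. open U \<and> x \<in> U \<and> Ck (Suc n) f' \<and> 
      (\<forall>y\<in>U. f y = f' y \<and> f differentiable (at y) \<and> frechet_derivative f (at y) = frechet_derivative f' (at y))" for x
  proof -
    obtain U f' where U: "open U" "x \<in> U" "Ck (Suc n) f'" "\<forall>y\<in>U. f y = f' y"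
      using Suc.prems[of x] by blast
    have "(f has_derivative frechet_derivative f' (at y)) (at y)" if "y \<in> U" for y
      by (rule has_derivative_transform_within_open[OF _ U(1) that])
        (use U that Ck_SucD_has_derivative in auto)
    then have "\<forall>y\<in>U. f y = f' y \<and> f differentiable (at y) \<and> frechet_derivative f (at y) = frechet_derivative f' (at y)"
      using U(4) frechet_derivative_at by (metis differentiable_def)
    then show ?thesis using U by blast
  qed
  show ?case
    unfolding Ck.simps
  proof (intro conjI allI ballI)
    fix x show "f differentiable at x" using E[of x] by blast
  next
    fix b :: 'a assume b: "b \<in> Basis"
    show "Ck n (\<lambda>x. frechet_derivative f (at x) b)"
    proof (rule Suc.IH)
      fix x
      obtain U f' where U: "open U" "x \<in> U" "Ck (Suc n) f'" 
        "\<forall>y\<in>U. frechet_derivative f (at y) = frechet_derivative f' (at y)"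
        using E[of x] by blast
      then show "\<exists>U f'. open U \<and> x \<in> U \<and> Ck n f' \<and> (\<forall>y\<in>U. frechet_derivative f (at y) b = f' y)"
        using b by (intro exI[of _ U] exI[of _ "\<lambda>y. frechet_derivative f' (at y) b"]) auto
    qed
  qed
qed

lemma smooth_const: "smooth (\<lambda>x. c)" by (simp add: smooth_def Ck_const)
lemma smooth_add: "smooth f \<Longrightarrow> smooth g \<Longrightarrow> smooth (\<lambda>x. f x + g x)" by (simp add: smooth_def Ck_add)
lemma smooth_mult: "smooth f \<Longrightarrow> smooth g \<Longrightarrow> smooth (\<lambda>x. f x * g x)" by (simp add: smooth_def Ck_mult)
lemma smooth_affine: "smooth f \<Longrightarrow> smooth (\<lambda>x. f (a \<bullet> x + c))" for f :: "real \<Rightarrow> real"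
  by (simp add: smooth_def Ck_affine)
lemma smooth_diff: "smooth f \<Longrightarrow> smooth g \<Longrightarrow> smooth (\<lambda>x. f x - g x)"
  using smooth_add[of f "\<lambda>x. (-1) * g x"] smooth_mult[OF smooth_const[of "-1"], of g] by simp
lemma smooth_prod: "(\<And>i. i \<in> A \<Longrightarrow> smooth (f i)) \<Longrightarrow> smooth (\<lambda>x. \<Prod>i\<in>A. f i x)"
  by (induction A rule: infinite_finite_induct) (auto intro: smooth_const smooth_mult)
lemma smooth_local:
  assumes "\<And>x. \<exists>U f'. open U \<and> x \<in> U \<and> smooth f' \<and> (\<forall>y\<in>U. f y = f' y)"
  shows "smooth f"
  unfolding smooth_def
proof (intro allI Ck_local)
  fix n x
  obtain U f' where U: "open U" "x \<in> U" "smooth f'" "\<forall>y\<in>U. f y = f' y" using assms[of x] by blast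
  then have "Ck n f'" by (simp add: smooth_def)
  with U show "\<exists>U f'. open U \<and> x \<in> U \<and> Ck n f' \<and> (\<forall>y\<in>U. f y = f' y)"
    by (intro exI[of _ U] exI[of _ f']) simp
qed
lemma smooth_continuous: "smooth f \<Longrightarrow> continuous_on S f"
  using continuous_on_subset[OF Ck_continuous[of 0 f], of S] unfolding smooth_def by blast
lemma smooth_has_derivative: "smooth f \<Longrightarrow> (f has_derivative frechet_derivative f (at x)) (at x)"
  using Ck_SucD_has_derivative[of 0 f x] by (simp add: smooth_def del: Ck.simps)
lemma smooth_frechet: "smooth f \<Longrightarrow> b \<in> Basis \<Longrightarrow> smooth (\<lambda>x. frechet_derivative f (at x) b)"
  unfolding smooth_def using Ck.simps(2) by blast
lemma smooth_inner: "smooth (\<lambda>x. a \<bullet> x)"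
proof -
  have "Ck n (\<lambda>x::real. x)" for n
    by (cases n) (auto intro!: Ck_SucI[where D="\<lambda>v x. v"] Ck_const simp del: Ck.simps(2))
  then have "Ck n (\<lambda>x. a \<bullet> x + 0)" for n by (rule Ck_affine)
  then show ?thesis by (simp add: smooth_def)
qed

text \<open>The functions \<open>exp (-1/x) / x^k\<close>, extended by zero, are closed under differentiation up to
  linear combination, which makes every one of them smooth.\<close>

definition flat_exp :: "nat \<Rightarrow> real \<Rightarrow> real" where
  "flat_exp k x = (if x > 0 then exp (- 1 / x) * (1 / x) ^ k else 0)"

lemma power_le_fact_exp:
  assumes "0 \<le> (y :: real)"
  shows "y ^ n \<le> fact n * exp y"
proof -
  have "y ^ n / fact n \<le> (\<Sum>k. y ^ k / fact k)"
    using sum_le_suminf[of "\<lambda>k. y ^ k / fact k" "{n}"] summable_exp[of y] assms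
    by (simp add: field_simps)
  also have "\<dots> = exp y" by (simp add: exp_def scaleR_conv_of_real field_simps)
  finally show ?thesis by (simp add: field_simps)
qed

text \<open>A quadratic bound at the origin gives differentiability there, with derivative zero.\<close>

lemma flat_exp_bound: "\<bar>flat_exp k x\<bar> \<le> fact (k + 2) * x\<^sup>2"
proof (cases "x > 0")
  case True
  define y where "y = 1 / x"
  have y: "y > 0" "x = 1 / y" using True by (auto simp: y_def)
  have "y ^ (k + 2) \<le> fact (k + 2) * exp y" by (rule power_le_fact_exp) (use y in simp)
  then have "exp (- y) * y ^ k \<le> fact (k + 2) / y\<^sup>2"
    using y by (simp add: exp_minus field_simps power_add power2_eq_square)
  then show ?thesis using True y by (simp add: flat_exp_def power_divide)
qed (simp add: flat_exp_def)

lemma flat_exp_derivative: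
  "(flat_exp k has_real_derivative (flat_exp (k + 2) x - real k * flat_exp (k + 1) x)) (at x)"
proof (cases x "0::real" rule: linorder_cases)
  case less
  have "((\<lambda>x. 0) has_real_derivative 0) (at x)" by simp
  then have "(flat_exp k has_real_derivative 0) (at x)"
    by (rule has_field_derivative_transform_within_open[where S="{..<0}"]) (use less in \<open>auto simp: flat_exp_def\<close>)
  then show ?thesis using less by (simp add: flat_exp_def)
next
  case equal
  have "(\<lambda>h. flat_exp k h / h) \<midarrow>0\<rightarrow> 0"
  proof (rule Lim_null_comparison)
    show "\<forall>\<^sub>F h in at 0. norm (flat_exp k h / h) \<le> fact (k + 2) * \<bar>h\<bar>"
    proof (intro always_eventually allI)
      fix h :: real
      show "norm (flat_exp k h / h) \<le> fact (k + 2) * \<bar>h\<bar>"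
      proof (cases "h = 0")
        case False
        have "\<bar>flat_exp k h\<bar> \<le> (fact (k + 2) * \<bar>h\<bar>) * \<bar>h\<bar>"
          using flat_exp_bound[of k h] by (metis (no_types) abs_mult_self_eq mult.assoc power2_eq_square)
        then show ?thesis using False by (simp add: abs_divide pos_divide_le_eq del: fact_Suc)
      qed simp
    qed
    show "((\<lambda>h. fact (k + 2) * \<bar>h\<bar>) \<longlongrightarrow> 0) (at (0::real))"
      by (auto intro!: tendsto_eq_intros)
  qed
  then show ?thesis using equal by (simp add: DERIV_def flat_exp_def)
next
  case greater
  have "((\<lambda>x. exp (- 1 / x) * (1 / x) ^ k) has_real_derivative (flat_exp (k + 2) x - real k * flat_exp (k + 1) x)) (at x)"
  proof -
    have "((\<lambda>x. exp (- 1 / x)) has_real_derivative exp (- 1 / x) * (1 / x)\<^sup>2) (at x)"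
      using greater by (auto intro!: derivative_eq_intros simp: power2_eq_square)
    moreover have "((\<lambda>x. (1 / x) ^ k) has_real_derivative - (real k * (1 / x) ^ (k + 1))) (at x)"
    proof (cases k)
      case (Suc m)
      have "((\<lambda>x. 1 / x) has_real_derivative - ((1 / x) * (1 / x))) (at x)"
        using greater by (auto intro!: derivative_eq_intros)
      from DERIV_power[OF this, of k] show ?thesis by (simp add: Suc mult_ac)
    qed simp
    ultimately have "((\<lambda>x. exp (- 1 / x) * (1 / x) ^ k) has_real_derivative
        exp (- 1 / x) * (1 / x)\<^sup>2 * (1 / x) ^ k + - (real k * (1 / x) ^ (k + 1)) * exp (- 1 / x)) (at x)"
      by (rule DERIV_mult)
    moreover have "exp (- 1 / x) * (1 / x)\<^sup>2 * (1 / x) ^ k + - (real k * (1 / x) ^ (k + 1)) * exp (- 1 / x)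
      = flat_exp (k + 2) x - real k * flat_exp (k + 1) x"
      using greater by (simp add: flat_exp_def power_add algebra_simps power2_eq_square)
    ultimately show ?thesis by simp
  qed
  then show ?thesis
    by (rule has_field_derivative_transform_within_open[where S="{0<..}"]) (use greater in \<open>auto simp: flat_exp_def\<close>)
qed

lemma smooth_real_SucI:
  fixes f :: "real \<Rightarrow> real"
  assumes "\<And>x. (f has_real_derivative f' x) (at x)" "Ck n f'"
  shows "Ck (Suc n) f"
  by (rule Ck_SucI[where D="\<lambda>v x. f' x * v"])
    (use assms in \<open>auto simp: has_field_derivative_def mult_commute_abs\<close>)

lemma smooth_flat_exp: "smooth (flat_exp k)"
  unfolding smooth_def
proof
  fix n show "Ck n (flat_exp k)"
  proof (induction n arbitrary: k)
    case 0
    then show ?case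
      using flat_exp_derivative by (auto intro!: continuous_at_imp_continuous_on DERIV_isCont)
  next
    case (Suc n)
    have "Ck n (\<lambda>x. flat_exp (k + 2) x + (- real k) * flat_exp (k + 1) x)"
      by (intro Ck_add Ck_mult Ck_const Suc)
    then show ?case
      by (intro smooth_real_SucI[OF flat_exp_derivative]) simp
  qed
qed

definition bump :: "real \<Rightarrow> real" where
  "bump x = flat_exp 0 x * flat_exp 0 (1 - x)"

lemma smooth_bump: "smooth bump"
proof -
  have "smooth (\<lambda>x. flat_exp 0 x * flat_exp 0 ((-1) \<bullet> x + 1))"
    by (intro smooth_mult smooth_affine smooth_flat_exp)
  then show ?thesis by (simp add: bump_def[abs_def])
qed

lemma bump_pos: "0 < x \<Longrightarrow> x < 1 \<Longrightarrow> 0 < bump x"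
  and bump_nonneg: "0 \<le> bump x"
  and bump_zero: "x \<le> 0 \<or> 1 \<le> x \<Longrightarrow> bump x = 0"
  by (auto simp: bump_def flat_exp_def)

definition bump_mass :: real where "bump_mass = integral {0..1} bump"

lemma bump_integrable: "bump integrable_on {a..b}"
  using smooth_continuous[OF smooth_bump] by (rule integrable_continuous_interval)

lemma bump_mass_pos: "0 < bump_mass"
proof -
  have "0 \<le> bump_mass" unfolding bump_mass_def by (intro integral_nonneg bump_integrable bump_nonneg)
  moreover have "bump_mass \<noteq> 0"
  proof
    assume "bump_mass = 0"
    then have "(bump has_integral 0) (cbox 0 1)"
      unfolding bump_mass_def using bump_integrable[of 0 1] by (metis integrable_integral box_real(2))
    then have "bump (1/2) = 0"
      by (rule has_integral_0_cbox_imp_0[rotated 2])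
        (auto intro: smooth_continuous[OF smooth_bump] bump_nonneg)
    then show False using bump_pos[of "1/2"] by simp
  qed
  ultimately show ?thesis by linarith
qed

definition smooth_step :: "real \<Rightarrow> real" where
  "smooth_step x = integral {0..x} bump / bump_mass"

lemma bump_integral_zero: "b \<le> 0 \<or> 1 \<le> a \<Longrightarrow> integral {a..b} bump = 0"
  using integral_cong[of "{a..b}" bump "\<lambda>_. 0"] by (auto simp: bump_zero)

lemma smooth_step_0: "x \<le> 0 \<Longrightarrow> smooth_step x = 0"
  by (simp add: smooth_step_def bump_integral_zero)

lemma smooth_step_1: "1 \<le> x \<Longrightarrow> smooth_step x = 1"
  using Henstock_Kurzweil_Integration.integral_combine[of 0 1 x bump] bump_integrable bump_integral_zero[of x 1] bump_mass_pos
  by (simp add: smooth_step_def bump_mass_def)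

lemma smooth_step_deriv: "(smooth_step has_real_derivative bump x / bump_mass) (at x)"
proof -
  define R where "R = \<bar>x\<bar> + 1"
  have eq: "integral {-R..y} bump = integral {0..y} bump" if "y \<ge> -R" for y
  proof (cases "y \<ge> 0")
    case True
    then show ?thesis
      using Henstock_Kurzweil_Integration.integral_combine[of "-R" 0 y bump] bump_integrable bump_integral_zero[of 0 "-R"]
      by (simp add: R_def)
  qed (simp add: bump_integral_zero)
  have "((\<lambda>y. integral {-R..y} bump) has_real_derivative bump x) (at x within {-R..R})"
    by (rule integral_has_real_derivative[OF smooth_continuous[OF smooth_bump]]) (auto simp: R_def)
  moreover have "at x within {-R..R} = at x"
    by (rule at_within_interior) (auto simp: R_def interior_atLeastAtMost_real)
  ultimately have "((\<lambda>y. integral {-R..y} bump / bump_mass) has_real_derivative bump x / bump_mass) (at x)"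
    using DERIV_cdivide by simp
  then show ?thesis
    by (rule has_field_derivative_transform_within_open[where S="{-R<..}"])
      (auto simp: smooth_step_def eq, auto simp: R_def)
qed

lemma smooth_smooth_step: "smooth smooth_step"
  unfolding smooth_def
proof
  fix n
  have "Ck n (\<lambda>x. bump x * (1 / bump_mass))" for n
    using smooth_mult[OF smooth_bump smooth_const[of "1 / bump_mass"]] by (simp add: smooth_def)
  then have "Ck (Suc n) smooth_step"
    by (intro smooth_real_SucI[OF smooth_step_deriv]) simp
  then show "Ck n smooth_step" by (rule Ck_SucD)
qed

lemma smooth_step_range: "0 \<le> smooth_step x" "smooth_step x \<le> 1"
proof -
  have mono: "mono smooth_step"
    by (rule monoI, rule DERIV_nonneg_imp_nondecreasing)
      (use smooth_step_deriv bump_nonneg bump_mass_pos in \<open>auto intro!: exI divide_nonneg_pos\<close>)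
  show "0 \<le> smooth_step x"
    using monoD[OF mono, of "min x 0" x] smooth_step_0[of "min x 0"] by simp
  show "smooth_step x \<le> 1"
    using monoD[OF mono, of x "max x 1"] smooth_step_1[of "max x 1"] by simp
qed

lemma bump_bound: "\<bar>bump x / bump_mass\<bar> \<le> 1 / bump_mass"
proof -
  have "flat_exp 0 y \<le> 1" "0 \<le> flat_exp 0 y" for y by (auto simp: flat_exp_def)
  then have "bump x \<le> 1 * 1" unfolding bump_def by (intro mult_mono) auto
  then show ?thesis using bump_mass_pos bump_nonneg[of x] by (simp add: field_simps)
qed

section \<open>Square integrals\<close>

text \<open>Squared \<open>L2\<close> norms are taken in the extended nonnegative reals, so that sums, limits and suprema of them need no
  integrability conditions.\<close>

definition sqi :: "'a::euclidean_space set \<Rightarrow> ('a \<Rightarrow> 'b::euclidean_space) \<Rightarrow> ennreal" where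
  "sqi U f = (\<integral>\<^sup>+x. ennreal ((norm (f x))\<^sup>2) \<partial>lebesgue_on U)"

abbreviation lmeas :: "'a::euclidean_space set \<Rightarrow> ('a \<Rightarrow> 'b::euclidean_space) \<Rightarrow> bool" where
  "lmeas U f \<equiv> f \<in> borel_measurable (lebesgue_on U)"

lemma nn_lebesgue_on:
  assumes "U \<in> sets lebesgue"
  shows "(\<integral>\<^sup>+x. f x \<partial>lebesgue_on U) = (\<integral>\<^sup>+x. f x * indicator U x \<partial>lborel)"
  using assms by (simp add: nn_integral_restrict_space nn_integral_completion)

lemma lmeas_subset: "lmeas U f \<Longrightarrow> A \<subseteq> U \<Longrightarrow> lmeas A f"
  by (rule measurable_restrict_mono)

lemma lmeas_continuous: "continuous_on UNIV f \<Longrightarrow> lmeas U f"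
  by (intro measurable_restrict_space1 measurable_completion) (simp add: borel_measurable_continuous_onI)

lemma L2_iff: "L2 U f \<longleftrightarrow> lmeas U f \<and> sqi U f < \<infinity>"
  unfolding L2_def sqi_def integrable_iff_bounded by auto

lemma L2_lmeas: "L2 U f \<Longrightarrow> lmeas U f" by (simp add: L2_def)

lemma sqi_L2: "L2 U f \<Longrightarrow> ennreal (LINT x|lebesgue_on U. (norm (f x))\<^sup>2) = sqi U f"
  unfolding L2_def sqi_def by (auto intro: nn_integral_eq_integral[symmetric])

lemma L2_norm_sqi: "L2 U f \<Longrightarrow> ennreal ((L2_norm U f)\<^sup>2) = sqi U f"
  by (simp add: sqi_L2[symmetric] L2_norm_def)

lemma sqi_mono_set: "A \<subseteq> B \<Longrightarrow> A \<in> sets lebesgue \<Longrightarrow> B \<in> sets lebesgue \<Longrightarrow> sqi A f \<le> sqi B f"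
  unfolding sqi_def by (simp add: nn_lebesgue_on) (intro nn_integral_mono, auto split: split_indicator)

lemma sqi_mono:
  "(\<And>x. x \<in> U \<Longrightarrow> norm (f x) \<le> norm (g x)) \<Longrightarrow> sqi U f \<le> sqi U g"
  unfolding sqi_def by (intro nn_integral_mono ennreal_leI power_mono) auto

lemma sqi_cong: "(\<And>x. x \<in> U \<Longrightarrow> f x = g x) \<Longrightarrow> sqi U f = sqi U g"
  unfolding sqi_def by (intro nn_integral_cong) auto

lemma sqi_cong_AE: "AE x in lebesgue_on U. f x = g x \<Longrightarrow> sqi U f = sqi U g"
  unfolding sqi_def by (intro nn_integral_cong_AE) auto

lemma sqi_Un: 
  assumes "A \<in> sets lebesgue" "B \<in> sets lebesgue" "A \<inter> B = {}" "lmeas (A \<union> B) f"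
  shows "sqi (A \<union> B) f = sqi A f + sqi B f"
proof -
  have "(\<lambda>x. ennreal ((norm (f x))\<^sup>2)) \<in> borel_measurable (lebesgue_on (A \<union> B))"
    using assms(4) by measurable
  then have m: "(\<lambda>x. ennreal ((norm (f x))\<^sup>2) * indicator (A \<union> B) x) \<in> borel_measurable lebesgue"
    using assms by (subst borel_measurable_restrict_space_iff_ennreal[symmetric]) auto
  have "sqi (A \<union> B) f = (\<integral>\<^sup>+x. ennreal ((norm (f x))\<^sup>2) * indicator (A \<union> B) x \<partial>lebesgue)"
    unfolding sqi_def using assms by (subst nn_integral_restrict_space) auto
  also have "\<dots> = (\<integral>\<^sup>+x. (ennreal ((norm (f x))\<^sup>2) * indicator (A \<union> B) x) * indicator A x
     + (ennreal ((norm (f x))\<^sup>2) * indicator (A \<union> B) x) * indicator B x \<partial>lebesgue)"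
    using assms by (intro nn_integral_cong) (auto split: split_indicator)
  also have "\<dots> = (\<integral>\<^sup>+x. (ennreal ((norm (f x))\<^sup>2) * indicator (A \<union> B) x) * indicator A x \<partial>lebesgue)
     + (\<integral>\<^sup>+x. (ennreal ((norm (f x))\<^sup>2) * indicator (A \<union> B) x) * indicator B x \<partial>lebesgue)"
    using assms m by (intro nn_integral_add borel_measurable_times) auto
  also have "\<dots> = sqi A f + sqi B f"
    unfolding sqi_def using assms
    by (subst (1 2) nn_integral_restrict_space) (auto intro!: arg_cong2[where f="(+)"] nn_integral_cong split: split_indicator)
  finally show ?thesis .
qed

lemma sqi_cmult: "lmeas U f \<Longrightarrow> sqi U (\<lambda>x. c *\<^sub>R f x) = ennreal (c\<^sup>2) * sqi U f"
  unfolding sqi_def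
  by (subst nn_integral_cmult[symmetric]) (auto simp: power_mult_distrib ennreal_mult intro!: nn_integral_cong)

lemma sqi_minus: "sqi U (\<lambda>x. - f x) = sqi U f"
  by (simp add: sqi_def)

lemma sqi_diff_commute: "sqi U (\<lambda>x. f x - g x) = sqi U (\<lambda>x. g x - f x)"
  by (simp add: sqi_def norm_minus_commute)

text \<open>Young's inequality with a free parameter: \<open>t = 1\<close> gives a triangle inequality for squares, and letting \<open>t\<close> tend to zero
  lets the factor of the first term tend to one.\<close>

lemma norm_add_sq_le:
  fixes x y :: "'b::real_inner"
  assumes "t > 0"
  shows "(norm (x + y))\<^sup>2 \<le> (1 + t) * (norm x)\<^sup>2 + (1 + 1 / t) * (norm y)\<^sup>2"
proof -
  have "0 \<le> (norm (t *\<^sub>R x - y))\<^sup>2 / t" using assms by simp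
  also have "\<dots> = t * (norm x)\<^sup>2 + (norm y)\<^sup>2 / t - 2 * (x \<bullet> y)"
    using assms unfolding power2_norm_eq_inner
    by (simp add: inner_diff_left inner_diff_right inner_commute field_simps)
  finally show ?thesis
    by (simp add: power2_norm_eq_inner inner_add_left inner_add_right inner_commute algebra_simps)
qed

lemma sqi_add:
  assumes "lmeas U f" "lmeas U g" "t > 0"
  shows "sqi U (\<lambda>x. f x + g x) \<le> ennreal (1 + t) * sqi U f + ennreal (1 + 1 / t) * sqi U g"
proof -
  have "sqi U (\<lambda>x. f x + g x) \<le> (\<integral>\<^sup>+x. ennreal (1 + t) * ennreal ((norm (f x))\<^sup>2) + ennreal (1 + 1 / t) * ennreal ((norm (g x))\<^sup>2) \<partial>lebesgue_on U)"
    unfolding sqi_def using assms(3)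
    by (intro nn_integral_mono)
      (auto simp flip: ennreal_mult ennreal_plus intro!: ennreal_leI norm_add_sq_le)
  also have "\<dots> = ennreal (1 + t) * sqi U f + ennreal (1 + 1 / t) * sqi U g"
    unfolding sqi_def using assms by (subst nn_integral_add) (auto simp: nn_integral_cmult)
  finally show ?thesis .
qed

lemma sqi_add2:
  assumes "lmeas U f" "lmeas U g"
  shows "sqi U (\<lambda>x. f x + g x) \<le> 2 * sqi U f + 2 * sqi U g"
  using sqi_add[OF assms, of 1] by simp

lemma sqi_triangle:
  assumes "lmeas U f" "lmeas U g" "lmeas U k"
  shows "sqi U (\<lambda>x. f x - k x) \<le> 2 * sqi U (\<lambda>x. f x - g x) + 2 * sqi U (\<lambda>x. g x - k x)"
  using sqi_add2[where U=U and f="\<lambda>x. f x - g x" and g="\<lambda>x. g x - k x"] assms by simp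

lemma L2_add: "L2 U f \<Longrightarrow> L2 U g \<Longrightarrow> L2 U (\<lambda>x. f x + g x)"
  unfolding L2_iff using sqi_add2[where U=U and f=f and g=g]
  by (auto simp: ennreal_mult_less_top intro!: le_less_trans[of "sqi U (\<lambda>x. f x + g x)" "2 * sqi U f + 2 * sqi U g"])

lemma L2_cmult: "L2 U f \<Longrightarrow> L2 U (\<lambda>x. c *\<^sub>R f x)"
  unfolding L2_iff by (auto simp: sqi_cmult ennreal_mult_less_top)

lemma L2_diff: "L2 U f \<Longrightarrow> L2 U g \<Longrightarrow> L2 U (\<lambda>x. f x - g x)"
  using L2_add[where U=U and f=f and g="\<lambda>x. (-1) *\<^sub>R g x"] L2_cmult[where U=U and f=g and c="-1"] by simp

lemma L2_subset: "L2 U f \<Longrightarrow> A \<subseteq> U \<Longrightarrow> A \<in> sets lebesgue \<Longrightarrow> U \<in> sets lebesgue \<Longrightarrow> L2 A f"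
  unfolding L2_iff using lmeas_subset sqi_mono_set le_less_trans by blast

lemma L2_mono: "L2 U g \<Longrightarrow> lmeas U f \<Longrightarrow> (\<And>x. x \<in> U \<Longrightarrow> norm (f x) \<le> norm (g x)) \<Longrightarrow> L2 U f"
  unfolding L2_iff using sqi_mono le_less_trans by blast

lemma L2_inner: "L2 U g \<Longrightarrow> b \<in> Basis \<Longrightarrow> L2 U (\<lambda>x. g x \<bullet> b)"
  by (rule L2_mono[of U g]) (auto simp: Basis_le_norm L2_def intro: borel_measurable_inner)

lemma L2_pair_integrable:
  fixes f g :: "'a::euclidean_space \<Rightarrow> real"
  assumes "L2 U f" "L2 U g"
  shows "integrable (lebesgue_on U) (\<lambda>x. f x * g x)"
proof (rule Bochner_Integration.integrable_bound[where f="\<lambda>x. (norm (f x))\<^sup>2 + (norm (g x))\<^sup>2"])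
  show "AE x in lebesgue_on U. norm (f x * g x) \<le> norm ((norm (f x))\<^sup>2 + (norm (g x))\<^sup>2)"
  proof (rule AE_I2)
    fix x 
    have "2 * (\<bar>f x\<bar> * \<bar>g x\<bar>) \<le> \<bar>f x\<bar>\<^sup>2 + \<bar>g x\<bar>\<^sup>2" using sum_squares_bound[of "\<bar>f x\<bar>" "\<bar>g x\<bar>"] by simp
    moreover have "0 \<le> \<bar>f x\<bar> * \<bar>g x\<bar>" by simp
    ultimately have "\<bar>f x\<bar> * \<bar>g x\<bar> \<le> \<bar>f x\<bar>\<^sup>2 + \<bar>g x\<bar>\<^sup>2" by linarith
    then show "norm (f x * g x) \<le> norm ((norm (f x))\<^sup>2 + (norm (g x))\<^sup>2)"
      by (simp add: abs_mult)
  qed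
qed (use assms in \<open>auto simp: L2_def\<close>)

lemma L2_Cauchy_Schwarz:
  fixes f g :: "'a::euclidean_space \<Rightarrow> real"
  assumes "L2 U f" "L2 U g"
  shows "ennreal ((LINT x|lebesgue_on U. f x * g x)\<^sup>2) \<le> sqi U f * sqi U g"
proof -
  have [measurable]: "lmeas U f" "lmeas U g" using assms by (auto simp: L2_def)
  have "ennreal ((LINT x|lebesgue_on U. f x * g x)\<^sup>2) = (ennreal (norm (LINT x|lebesgue_on U. f x * g x)))\<^sup>2"
    by (simp add: ennreal_power)
  also have "\<dots> \<le> (\<integral>\<^sup>+x. ennreal (norm (f x * g x)) \<partial>lebesgue_on U)\<^sup>2"
    using integral_norm_bound_ennreal[OF L2_pair_integrable[OF assms]] by (rule power_mono) simp
  also have "\<dots> = (\<integral>\<^sup>+x. ennreal \<bar>f x\<bar> * ennreal \<bar>g x\<bar> \<partial>lebesgue_on U)\<^sup>2"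
    by (simp add: abs_mult ennreal_mult)
  also have "\<dots> \<le> (\<integral>\<^sup>+x. ennreal \<bar>f x\<bar> ^ 2 \<partial>lebesgue_on U) * (\<integral>\<^sup>+x. ennreal \<bar>g x\<bar> ^ 2 \<partial>lebesgue_on U)"
    by (rule Cauchy_Schwarz_nn_integral) measurable
  also have "\<dots> = sqi U f * sqi U g"
    by (simp add: sqi_def ennreal_power)
  finally show ?thesis .
qed

lemma L2_pair_tendsto:
  fixes f :: "'a::euclidean_space \<Rightarrow> real"
  assumes "\<And>n. L2 U (F n)" "L2 U f" "L2 U g" "(\<lambda>n. sqi U (\<lambda>x. F n x - f x)) \<longlonglongrightarrow> 0"
  shows "(\<lambda>n. LINT x|lebesgue_on U. F n x * g x) \<longlonglongrightarrow> (LINT x|lebesgue_on U. f x * g x)"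
proof -
  have d: "L2 U (\<lambda>x. F n x - f x)" for n using assms by (intro L2_diff) auto
  have "(\<lambda>n. sqi U (\<lambda>x. F n x - f x) * sqi U g) \<longlonglongrightarrow> 0 * sqi U g"
    using assms by (intro tendsto_mult_ennreal tendsto_const) (auto simp: L2_iff)
  then have "(\<lambda>n. sqi U (\<lambda>x. F n x - f x) * sqi U g) \<longlonglongrightarrow> 0" by simp
  then have "(\<lambda>n. ennreal ((LINT x|lebesgue_on U. (F n x - f x) * g x)\<^sup>2)) \<longlonglongrightarrow> 0"
    by (rule tendsto_sandwich[where f="\<lambda>_. 0", rotated 3])
      (auto intro!: always_eventually L2_Cauchy_Schwarz d assms)
  then have "(\<lambda>n. (LINT x|lebesgue_on U. (F n x - f x) * g x)\<^sup>2) \<longlonglongrightarrow> 0"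
    by (simp flip: ennreal_0)
  then have "(\<lambda>n. LINT x|lebesgue_on U. (F n x - f x) * g x) \<longlonglongrightarrow> 0"
    by (simp add: tendsto_null_power)
  then have "(\<lambda>n. (LINT x|lebesgue_on U. F n x * g x) - (LINT x|lebesgue_on U. f x * g x)) \<longlonglongrightarrow> 0"
    using L2_pair_integrable[OF assms(1) assms(3)] L2_pair_integrable[OF assms(2) assms(3)]
    by (simp add: left_diff_distrib)
  then show ?thesis by (simp add: LIM_zero_iff)
qed

lemma L2_bounded_set:
  fixes f :: "'a::euclidean_space \<Rightarrow> 'b::euclidean_space"
  assumes "lmeas A f" "bounded A" "A \<in> sets lebesgue" "\<And>x. x \<in> A \<Longrightarrow> norm (f x) \<le> B"
  shows "L2 A f"
proof -
  have A: "emeasure lebesgue A < \<infinity>" 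
    using fmeasurableD2[OF bounded_set_imp_lmeasurable[OF assms(2,3)]]
    by (simp only: infinity_ennreal_def less_top)
  have "sqi A f \<le> (\<integral>\<^sup>+x. ennreal (B\<^sup>2) \<partial>lebesgue_on A)"
    unfolding sqi_def using assms(4) by (intro nn_integral_mono ennreal_leI power_mono) auto
  also have "\<dots> = ennreal (B\<^sup>2) * emeasure lebesgue A"
    using assms by (simp add: emeasure_restrict_space)
  also have "\<dots> < \<infinity>" using A by (simp add: ennreal_mult_less_top)
  finally show ?thesis using assms by (simp add: L2_iff)
qed

lemma L2_continuous_bounded:
  fixes f :: "'a::euclidean_space \<Rightarrow> 'b::euclidean_space"
  assumes "continuous_on UNIV f" "bounded A" "A \<in> sets lebesgue"
  shows "L2 A f"
proof -
  have "compact (closure A)" using assms(2) by (simp add: compact_closure)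
  then have "bounded (f ` closure A)"
    using compact_continuous_image[OF continuous_on_subset[OF assms(1)]] compact_imp_bounded by blast
  then obtain B where "\<And>x. x \<in> closure A \<Longrightarrow> norm (f x) \<le> B"
    unfolding bounded_iff by blast
  then show ?thesis
    using assms closure_subset by (intro L2_bounded_set[where B=B] lmeas_continuous) auto
qed

lemma tendsto_0_ennrealI:
  fixes f :: "nat \<Rightarrow> ennreal"
  assumes "\<And>e. e > 0 \<Longrightarrow> \<forall>\<^sub>F n in sequentially. f n \<le> ennreal e"
  shows "f \<longlonglongrightarrow> 0"
proof (rule order_tendstoI)
  fix a :: ennreal assume "0 < a"
  obtain e where "0 < e" "ennreal e < a"
  proof (cases a)
    case (real r)
    then have "0 < r" using \<open>0 < a\<close> by simp
    then show ?thesis using that[of "r / 2"] real by (simp add: ennreal_less_iff)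
  next
    case top
    then show ?thesis using that[of 1] by simp
  qed
  then show "\<forall>\<^sub>F n in sequentially. f n < a"
    using assms[of e] by (auto elim!: eventually_mono)
qed auto

text \<open>Completeness: along a subsequence the increments decay geometrically, so the subsequence
  converges almost everywhere, and Fatou's lemma identifies its limit as the limit in the mean.\<close>

lemma Riesz_Fischer:
  fixes F :: "nat \<Rightarrow> 'a::euclidean_space \<Rightarrow> 'b::euclidean_space"
  assumes L: "\<And>n. L2 U (F n)"
    and C: "\<And>e. e > 0 \<Longrightarrow> \<exists>N. \<forall>m\<ge>N. \<forall>n\<ge>N. sqi U (\<lambda>x. F m x - F n x) \<le> ennreal e"
  obtains f where "L2 U f" "(\<lambda>n. sqi U (\<lambda>x. F n x - f x)) \<longlonglongrightarrow> 0"
proof -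
  let ?M = "lebesgue_on U"
  have [measurable]: "F n \<in> borel_measurable ?M" for n using L by (auto simp: L2_def)
  \<comment> \<open>\<open>(1/8)^k\<close> leaves room for the weight \<open>2^k\<close>, by which \<open>norm d \<le> 2^k * (norm d)\<^sup>2 + (1/2)^k\<close> turns a convergent sum of squares into absolute convergence\<close>
  have "\<exists>N. \<forall>m\<ge>N. \<forall>n\<ge>N. sqi U (\<lambda>x. F m x - F n x) \<le> ennreal ((1/8)^k)" for k :: nat
    by (rule C) simp
  then obtain N where N: "\<And>k m n. N k \<le> m \<Longrightarrow> N k \<le> n \<Longrightarrow> sqi U (\<lambda>x. F m x - F n x) \<le> ennreal ((1/8)^k)"
    by metis
  define r where "r k = (MAX i\<in>{..k}. N i)" for k
  have rN: "N k \<le> r k" for k unfolding r_def by (intro Max_ge) auto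
  have rm: "r k \<le> r (Suc k)" for k unfolding r_def by (intro Max_mono) auto
  have rN': "N k \<le> r j" if "k \<le> j" for k j unfolding r_def using that by (intro Max_ge) auto
  define D where "D k x = F (r (Suc k)) x - F (r k) x" for k x
  have [measurable]: "D k \<in> borel_measurable ?M" for k unfolding D_def by measurable
  have "(\<integral>\<^sup>+x. (\<Sum>k. ennreal (2^k * (norm (D k x))\<^sup>2)) \<partial>?M) = (\<Sum>k. \<integral>\<^sup>+x. ennreal (2^k * (norm (D k x))\<^sup>2) \<partial>?M)"
    by (rule nn_integral_suminf) measurable
  also have "\<dots> \<le> (\<Sum>k. ennreal ((1/4)^k))"
  proof (intro suminf_le summableI)
    fix k
    have "(\<integral>\<^sup>+x. ennreal (2^k * (norm (D k x))\<^sup>2) \<partial>?M) = ennreal (2^k) * sqi U (D k)"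
      unfolding sqi_def by (subst nn_integral_cmult[symmetric]) (auto simp: ennreal_mult)
    also have "\<dots> \<le> ennreal (2^k) * ennreal ((1/8)^k)"
      unfolding D_def using N[of k "r (Suc k)" "r k"] rN[of k] rm[of k] by (intro mult_left_mono) auto
    also have "\<dots> = ennreal ((1/4)^k)"
      by (simp add: power_mult_distrib[symmetric] flip: ennreal_mult)
    finally show "(\<integral>\<^sup>+x. ennreal (2^k * (norm (D k x))\<^sup>2) \<partial>?M) \<le> ennreal ((1/4)^k)" .
  qed
  also have "\<dots> = ennreal (\<Sum>k. (1/4)^k)" by (intro suminf_ennreal2 summable_geometric) auto
  also have "\<dots> < \<infinity>" by simp
  finally have fin: "(\<integral>\<^sup>+x. (\<Sum>k. ennreal (2^k * (norm (D k x))\<^sup>2)) \<partial>?M) \<noteq> \<infinity>" by simp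
  have "AE x in ?M. (\<Sum>k. ennreal (2^k * (norm (D k x))\<^sup>2)) \<noteq> \<infinity>"
    by (rule nn_integral_PInf_AE[OF _ fin]) measurable
  then have conv: "AE x in ?M. convergent (\<lambda>k. F (r k) x)"
  proof eventually_elim
    case (elim x)
    have "summable (\<lambda>k. 2^k * (norm (D k x))\<^sup>2)"
      using elim by (intro summable_suminf_not_top) auto
    then have "summable (\<lambda>k. 2^k * (norm (D k x))\<^sup>2 + (1/2)^k)"
      by (intro summable_add summable_geometric) auto
    then have "summable (\<lambda>k. D k x)"
    proof (rule summable_comparison_test'[where N=0])
      fix k :: nat
      have "norm (D k x) * 1 \<le> 2^k * (norm (D k x))\<^sup>2 + (1/2)^k"
      proof -
        have "0 \<le> (2^k * norm (D k x) - 1)\<^sup>2" by simp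
        also have "\<dots> = 2^k * (2^k * (norm (D k x))\<^sup>2 + (1/2)^k - 2 * norm (D k x))"
          by (simp add: power2_eq_square algebra_simps power_one_over)
        finally have "0 \<le> 2^k * (norm (D k x))\<^sup>2 + (1/2)^k - 2 * norm (D k x)"
          using mult_pos_neg[of "2^k" "2^k * (norm (D k x))\<^sup>2 + (1/2)^k - 2 * norm (D k x)"] by fastforce
        then show ?thesis using norm_ge_zero[of "D k x"] by linarith
      qed
      then show "norm (D k x) \<le> 2^k * (norm (D k x))\<^sup>2 + (1/2)^k" by simp
    qed
    then have "convergent (\<lambda>n. \<Sum>k<n. D k x)" by (simp add: summable_iff_convergent)
    then have "convergent (\<lambda>n. (\<Sum>k<n. D k x) + F (r 0) x)" by (intro convergent_add convergent_const)
    moreover have "(\<Sum>k<n. D k x) + F (r 0) x = F (r n) x" for n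
      unfolding D_def by (subst sum_lessThan_telescope) simp
    ultimately show ?case by simp
  qed
  define f where "f x = lim (\<lambda>k. F (r k) x)" for x
  have [measurable]: "f \<in> borel_measurable ?M" unfolding f_def by measurable
  have ft: "AE x in ?M. (\<lambda>k. F (r k) x) \<longlonglongrightarrow> f x"
    using conv by eventually_elim (simp add: f_def convergent_LIMSEQ_iff)
  have lim: "sqi U (\<lambda>x. F m x - f x) \<le> ennreal ((1/8)^k)" if "N k \<le> m" for m k
  proof -
    have "sqi U (\<lambda>x. F m x - f x) = (\<integral>\<^sup>+x. liminf (\<lambda>j. ennreal ((norm (F m x - F (r j) x))\<^sup>2)) \<partial>?M)"
      unfolding sqi_def
    proof (rule nn_integral_cong_AE)
      show "AE x in ?M. ennreal ((norm (F m x - f x))\<^sup>2) = liminf (\<lambda>j. ennreal ((norm (F m x - F (r j) x))\<^sup>2))"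
        using ft
      proof eventually_elim
        case (elim x)
        have "(\<lambda>j. ennreal ((norm (F m x - F (r j) x))\<^sup>2)) \<longlonglongrightarrow> ennreal ((norm (F m x - f x))\<^sup>2)"
          by (intro tendsto_ennrealI tendsto_intros elim)
        then show ?case by (rule lim_imp_Liminf[symmetric, rotated]) simp
      qed
    qed
    also have "\<dots> \<le> liminf (\<lambda>j. \<integral>\<^sup>+x. ennreal ((norm (F m x - F (r j) x))\<^sup>2) \<partial>?M)"
      by (rule nn_integral_liminf) measurable
    also have "\<dots> \<le> liminf (\<lambda>j. ennreal ((1/8)^k))"
      using N[of k m] that rN'[of k]
      by (intro Liminf_mono eventually_mono[OF eventually_ge_at_top[of k]]) (auto simp: sqi_def)
    finally show ?thesis by (simp add: Liminf_const)
  qed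
  have "L2 U f"
  proof -
    have "sqi U (\<lambda>x. F (N 0) x - f x) < \<infinity>" using lim[of 0 "N 0"] by (auto simp: le_less_trans)
    then have "L2 U (\<lambda>x. F (N 0) x - f x)" by (simp add: L2_iff)
    from L2_diff[OF L[of "N 0"] this] show ?thesis by simp
  qed
  moreover have "(\<lambda>n. sqi U (\<lambda>x. F n x - f x)) \<longlonglongrightarrow> 0"
  proof (rule tendsto_0_ennrealI)
    fix e :: real assume "e > 0"
    then obtain k where "(1/8::real)^k < e" using real_arch_pow_inv[of e "1/8"] by auto
    then have "sqi U (\<lambda>x. F m x - f x) \<le> ennreal e" if "m \<ge> N k" for m
      using lim[OF that] by (meson ennreal_leI less_imp_le order_trans)
    then show "\<forall>\<^sub>F n in sequentially. sqi U (\<lambda>x. F n x - f x) \<le> ennreal e"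
      by (intro eventually_sequentiallyI[of "N k"]) auto
  qed
  ultimately show thesis by (rule that)
qed

section \<open>Weak gradients\<close>

lemma test_functionE:
  assumes "test_function U \<phi>"
  obtains K where "compact K" "K \<subseteq> U" "\<And>x. x \<notin> K \<Longrightarrow> \<phi> x = 0" "smooth \<phi>"
  using assms unfolding test_function_def by blast

lemma test_functionI: "smooth \<phi> \<Longrightarrow> compact K \<Longrightarrow> K \<subseteq> U \<Longrightarrow> (\<And>x. x \<notin> K \<Longrightarrow> \<phi> x = 0) \<Longrightarrow> test_function U \<phi>"
  unfolding test_function_def by blast

lemma frechet_derivative_zero_outside:
  assumes "closed K" "\<And>x. x \<notin> K \<Longrightarrow> f x = 0" "x \<notin> K"
  shows "frechet_derivative f (at x) = (\<lambda>_. 0)"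
proof -
  have "(f has_derivative (\<lambda>_. 0)) (at x)"
    by (rule has_derivative_transform_within_open[where f="\<lambda>_. 0" and s="-K"]) (use assms in auto)
  then show ?thesis using frechet_derivative_at by metis
qed

lemma test_function_frechet:
  assumes "test_function U \<phi>" "b \<in> Basis"
  shows "test_function U (\<lambda>x. frechet_derivative \<phi> (at x) b)"
proof -
  obtain K where K: "compact K" "K \<subseteq> U" "\<And>x. x \<notin> K \<Longrightarrow> \<phi> x = 0" "smooth \<phi>"
    using test_functionE[OF assms(1)] by blast
  show ?thesis
    using K smooth_frechet[OF K(4) assms(2)] frechet_derivative_zero_outside[OF compact_imp_closed[OF K(1)] K(3)]
    by (intro test_functionI[of _ K]) auto
qed

lemma test_function_L2:
  assumes "test_function U \<phi>" "A \<in> sets lebesgue"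
  shows "L2 A \<phi>"
proof -
  obtain K where K: "compact K" "K \<subseteq> U" "\<And>x. x \<notin> K \<Longrightarrow> \<phi> x = 0" "smooth \<phi>"
    using test_functionE[OF assms(1)] by blast
  have c: "continuous_on UNIV \<phi>" using K smooth_continuous by blast
  have Km: "K \<in> sets lebesgue" using K(1) by (simp add: compact_imp_closed lmeasurable_compact fmeasurableD)
  have "L2 K \<phi>" using K c Km by (intro L2_continuous_bounded) (auto simp: compact_imp_bounded)
  moreover have "sqi A \<phi> \<le> sqi K \<phi>"
    unfolding sqi_def using assms K Km
    by (subst (1 2) nn_lebesgue_on) (auto intro!: nn_integral_mono split: split_indicator)
  ultimately show ?thesis using c by (auto simp: L2_iff lmeas_continuous intro: le_less_trans)
qed

lemma test_function_UNIV_integral: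
  assumes "U \<in> sets lebesgue" "\<And>x. x \<notin> U \<Longrightarrow> f x = (0::real)"
  shows "(LINT x|lebesgue_on U. f x) = (LINT x|lebesgue. f x)"
proof -
  have "(LINT x|lebesgue_on U. f x) = (LINT x|lebesgue. indicator U x *\<^sub>R f x)"
    using assms(1) by (simp add: integral_restrict_space)
  also have "\<dots> = (LINT x|lebesgue. f x)"
    using assms(2) by (intro Bochner_Integration.integral_cong) (auto split: split_indicator)
  finally show ?thesis .
qed

text \<open>These test functions converge pointwise to the indicator of the open box, so integrals against test functions determine
  integrals over boxes.\<close>

definition box_cutoff :: "'a::euclidean_space \<Rightarrow> 'a \<Rightarrow> nat \<Rightarrow> 'a \<Rightarrow> real" where
  "box_cutoff l u n x = (\<Prod>b\<in>Basis. smooth_step (real n * (x \<bullet> b - l \<bullet> b)) * smooth_step (real n * (u \<bullet> b - x \<bullet> b)))"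

lemma smooth_box_cutoff: "smooth (box_cutoff l u n)"
proof -
  have 1: "smooth (\<lambda>x. smooth_step ((real n *\<^sub>R b) \<bullet> x + (- real n * (l \<bullet> b))))" 
    and 2: "smooth (\<lambda>x. smooth_step ((- real n *\<^sub>R b) \<bullet> x + (real n * (u \<bullet> b))))" for b
    by (intro smooth_affine smooth_smooth_step)+
  have "smooth (\<lambda>x. smooth_step (real n * (x \<bullet> b - l \<bullet> b)) * smooth_step (real n * (u \<bullet> b - x \<bullet> b)))" for b
    using smooth_mult[OF 1[of b] 2[of b]] by (simp add: algebra_simps inner_commute)
  then show ?thesis unfolding box_cutoff_def[abs_def] by (intro smooth_prod)
qed

lemma box_cutoff_outside: "x \<notin> box l u \<Longrightarrow> box_cutoff l u n x = 0"
  unfolding box_cutoff_def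
proof (rule prod_zero)
  assume "x \<notin> box l u"
  then obtain b where "b \<in> Basis" "x \<bullet> b \<le> l \<bullet> b \<or> u \<bullet> b \<le> x \<bullet> b" by (auto simp: mem_box)
  then show "\<exists>b\<in>Basis. smooth_step (real n * (x \<bullet> b - l \<bullet> b)) * smooth_step (real n * (u \<bullet> b - x \<bullet> b)) = 0"
    by (intro bexI[of _ b]) (auto simp: smooth_step_0 mult_nonneg_nonpos)
qed simp

lemma box_cutoff_range: "0 \<le> box_cutoff l u n x" "box_cutoff l u n x \<le> 1"
  unfolding box_cutoff_def using smooth_step_range
  by (auto intro!: prod_nonneg prod_le_1 mult_nonneg_nonneg mult_le_one)

lemma box_cutoff_tendsto: "(\<lambda>n. box_cutoff l u n x) \<longlonglongrightarrow> indicator (box l u) x"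
proof (cases "x \<in> box l u")
  case True
  have ev: "\<forall>\<^sub>F n in sequentially. smooth_step (real n * d) = 1" if "d > 0" for d
  proof -
    obtain N :: nat where "1 / d < real N" using reals_Archimedean2 by blast
    then have "1 \<le> real n * d" if "n \<ge> N" for n
    proof -
      have "1 / d \<le> real n" using that \<open>1 / d < real N\<close> by linarith
      then show ?thesis using \<open>d > 0\<close> by (simp add: field_simps)
    qed
    note big = this
    show ?thesis using eventually_ge_at_top[of N] by eventually_elim (auto intro: smooth_step_1 big)
  qed
  then have "\<forall>\<^sub>F n in sequentially. \<forall>b\<in>Basis. smooth_step (real n * (x \<bullet> b - l \<bullet> b)) * smooth_step (real n * (u \<bullet> b - x \<bullet> b)) = 1"
  proof (intro eventually_ball_finite ballI)
    fix b :: 'a assume "b \<in> Basis"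
    then have "x \<bullet> b - l \<bullet> b > 0" "u \<bullet> b - x \<bullet> b > 0" using True by (auto simp: mem_box)
    from this[THEN ev]
    show "\<forall>\<^sub>F n in sequentially. smooth_step (real n * (x \<bullet> b - l \<bullet> b)) * smooth_step (real n * (u \<bullet> b - x \<bullet> b)) = 1"
      by eventually_elim simp
  qed simp
  then have "\<forall>\<^sub>F n in sequentially. box_cutoff l u n x = 1"
    by eventually_elim (simp add: box_cutoff_def)
  then show ?thesis using True by (simp add: tendsto_eventually)
qed (simp add: box_cutoff_outside)

lemma box_cutoff_test:
  assumes "cbox l u \<subseteq> U"
  shows "test_function U (box_cutoff l u n)"
  by (rule test_functionI[of _ "cbox l u"]) 
    (use assms in \<open>auto simp: smooth_box_cutoff intro!: box_cutoff_outside dest: subsetD[OF box_subset_cbox]\<close>)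

text \<open>The positive and the negative part of \<open>f\<close> are densities of finite measures which agree on boxes. Boxes are stable
  under intersection and generate the Borel sets, so the measures coincide.\<close>

lemma fundamental_lemma_box:
  fixes f :: "'a::euclidean_space \<Rightarrow> real"
  assumes f: "integrable lebesgue f" and z: "\<And>l u. (LINT x|lebesgue. f x * indicator (box l u) x) = 0"
  shows "AE x in lebesgue. f x = 0"
proof -
  obtain f' where [measurable]: "f' \<in> borel_measurable lborel" and f': "AE x in lborel. f x = f' x"
    using completion_ex_borel_measurable_real[of f lborel] f by auto
  have f'': "AE x in lebesgue. f x = f' x" using f' by (rule AE_completion)
  have f'i: "integrable lebesgue f'"
    by (rule Bochner_Integration.integrable_cong_AE_imp[OF f _ f'']) (intro measurable_completion, simp)
  then have i: "integrable lborel f'" by (simp add: integrable_completion)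
  have z': "(LINT x|lborel. f' x * indicator (box l u) x) = 0" for l u
  proof -
    have "(LINT x|lborel. f' x * indicator (box l u) x) = (LINT x|lebesgue. f' x * indicator (box l u) x)"
      by (subst integral_completion) auto
    also have "\<dots> = (LINT x|lebesgue. f x * indicator (box l u) x)"
      using f'' by (intro integral_cong_AE borel_measurable_times borel_measurable_integrable[OF f] borel_measurable_integrable[OF f'i]
          borel_measurable_indicator) (auto elim: AE_mp)
    finally show ?thesis using z by simp
  qed
  let ?M1 = "density lborel (\<lambda>x. ennreal (f' x))" and ?M2 = "density lborel (\<lambda>x. ennreal (- f' x))"
  have fin: "(\<integral>\<^sup>+x. ennreal (f' x) * indicator B x \<partial>lborel) < \<infinity>" "(\<integral>\<^sup>+x. ennreal (- f' x) * indicator B x \<partial>lborel) < \<infinity>" for B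
  proof -
    have "(\<integral>\<^sup>+x. ennreal (norm (f' x)) \<partial>lborel) < \<infinity>" using i by (simp add: integrable_iff_bounded)
    moreover have "(\<integral>\<^sup>+x. ennreal (f' x) * indicator B x \<partial>lborel) \<le> (\<integral>\<^sup>+x. ennreal (norm (f' x)) \<partial>lborel)"
      "(\<integral>\<^sup>+x. ennreal (- f' x) * indicator B x \<partial>lborel) \<le> (\<integral>\<^sup>+x. ennreal (norm (f' x)) \<partial>lborel)"
      by (auto intro!: nn_integral_mono ennreal_leI split: split_indicator)
    ultimately show "(\<integral>\<^sup>+x. ennreal (f' x) * indicator B x \<partial>lborel) < \<infinity>" "(\<integral>\<^sup>+x. ennreal (- f' x) * indicator B x \<partial>lborel) < \<infinity>"
      by auto
  qed
  have "?M1 = ?M2"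
  proof (rule measure_eqI_generator_eq)
    let ?E = "range (\<lambda>(a, b). box a b::'a set)"
    show "Int_stable ?E" by (auto simp: Int_stable_def box_Int_box)
    show "?E \<subseteq> Pow UNIV" "sets ?M1 = sigma_sets UNIV ?E" "sets ?M2 = sigma_sets UNIV ?E"
      by (simp_all add: borel_eq_box)
    let ?A = "\<lambda>n::nat. box (- (real n *\<^sub>R One)) (real n *\<^sub>R One) :: 'a set"
    show "range ?A \<subseteq> ?E" "(\<Union>i. ?A i) = UNIV"
      unfolding UN_box_eq_UNIV by auto
    show "emeasure ?M1 (?A i) \<noteq> \<infinity>" for i using fin(1)[of "?A i"] by (simp add: emeasure_density)
    show "emeasure ?M1 X = emeasure ?M2 X" if "X \<in> ?E" for X
    proof -
      have "\<exists>l u. X = box l u" using that by (force simp: image_iff)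
      then obtain l u where X: "X = box l u" by blast
      have "integrable lborel (\<lambda>x. f' x * indicator X x)"
        using integrable_mult_indicator[OF _ i, of X] X by (simp add: mult.commute)
      then have "0 = enn2real (\<integral>\<^sup>+x. ennreal (f' x * indicator X x) \<partial>lborel) - enn2real (\<integral>\<^sup>+x. ennreal (- (f' x * indicator X x)) \<partial>lborel)"
        using z'[of l u] X by (simp add: real_lebesgue_integral_def)
      moreover have "ennreal (f' x * indicator X x) = ennreal (f' x) * indicator X x" 
        "ennreal (- (f' x * indicator X x)) = ennreal (- f' x) * indicator X x" for x
        by (auto split: split_indicator)
      ultimately have "enn2real (\<integral>\<^sup>+x. ennreal (f' x) * indicator X x \<partial>lborel) = enn2real (\<integral>\<^sup>+x. ennreal (- f' x) * indicator X x \<partial>lborel)"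
        by simp
      then have "(\<integral>\<^sup>+x. ennreal (f' x) * indicator X x \<partial>lborel) = (\<integral>\<^sup>+x. ennreal (- f' x) * indicator X x \<partial>lborel)"
        using fin[of X] by (metis ennreal_enn2real infinity_ennreal_def)
      then show ?thesis using X by (simp add: emeasure_density)
    qed
  qed
  then have "AE x in lborel. ennreal (f' x) = ennreal (- f' x)"
    by (intro sigma_finite_measure.density_unique[OF sigma_finite_lborel]) auto
  then have "AE x in lborel. f' x = 0"
  proof eventually_elim
    case (elim x)
    then show ?case by (cases "f' x \<ge> 0") (auto simp: ennreal_neg ennreal_eq_0_iff)
  qed
  then have "AE x in lborel. f x = 0" using f' by eventually_elim simp
  then show ?thesis by (rule AE_completion)
qed

text \<open>Box cutoffs reduce the claim to boxes inside \<open>U\<close>, of which countably many cover \<open>U\<close>.\<close>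

lemma fundamental_lemma:
  fixes f :: "'a::euclidean_space \<Rightarrow> real"
  assumes U: "open U" and f: "L2 U f" 
    and z: "\<And>\<phi>. test_function U \<phi> \<Longrightarrow> (LINT x|lebesgue_on U. f x * \<phi> x) = 0"
  shows "AE x in lebesgue_on U. f x = 0"
proof -
  have Um: "U \<in> sets lebesgue" using U by auto
  have fm: "lmeas U f" using f by (simp add: L2_def)
  have box: "AE x in lebesgue. x \<in> box L R \<longrightarrow> f x = 0" if LR: "cbox L R \<subseteq> U" for L R
  proof -
    have "AE x in lebesgue. f x * indicator (box L R) x = 0"
    proof (rule fundamental_lemma_box)
      have B: "L2 (box L R) f" by (rule L2_subset[OF f]) (use LR box_subset_cbox Um in auto)
      have "L2 (box L R) (\<lambda>_. 1::real)" by (intro L2_continuous_bounded) auto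
      from L2_pair_integrable[OF B this] have "integrable (lebesgue_on (box L R)) f" by simp
      then show int: "integrable lebesgue (\<lambda>x. f x * indicator (box L R) x)"
        by (simp add: integrable_restrict_space mult.commute)
      fix l u :: 'a
      \<comment> \<open>a box \<open>box l u\<close> need not lie in \<open>U\<close>; its intersection with \<open>box L R\<close> is a box that does\<close>
      define l' where "l' = (\<Sum>b\<in>Basis. max (L \<bullet> b) (l \<bullet> b) *\<^sub>R b)"
      define u' where "u' = (\<Sum>b\<in>Basis. min (R \<bullet> b) (u \<bullet> b) *\<^sub>R b)"
      have lu: "box L R \<inter> box l u = box l' u'" by (simp add: box_Int_box l'_def u'_def)
      have sub: "cbox l' u' \<subseteq> cbox L R" by (auto simp: mem_box l'_def u'_def)
      have sub': "box l' u' \<subseteq> box L R" using lu by blast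
      have "(\<lambda>n. LINT x|lebesgue. f x * indicator (box L R) x * box_cutoff l' u' n x) \<longlonglongrightarrow>
          (LINT x|lebesgue. f x * indicator (box L R) x * indicator (box l' u') x)"
      proof (rule integral_dominated_convergence[where w="\<lambda>x. \<bar>f x * indicator (box L R) x\<bar>"])
        show "(\<lambda>x. f x * indicator (box L R) x * box_cutoff l' u' i x) \<in> borel_measurable lebesgue" for i
          using lmeas_continuous[OF smooth_continuous[OF smooth_box_cutoff[of l' u' i]], of UNIV]
          by (intro borel_measurable_times[OF borel_measurable_integrable[OF int]]) (auto simp: lebesgue_on_UNIV_eq)
        show "AE x in lebesgue. norm (f x * indicator (box L R) x * box_cutoff l' u' i x) \<le> \<bar>f x * indicator (box L R) x\<bar>" for i
          using box_cutoff_range[of l' u' i] by (auto simp: abs_mult mult_left_le)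
        show "(\<lambda>x. f x * indicat_real (box L R) x * indicat_real (box l' u') x) \<in> borel_measurable lebesgue"
          by (intro borel_measurable_times[OF borel_measurable_integrable[OF int]] borel_measurable_indicator) auto
      qed (use int in \<open>auto intro!: tendsto_mult box_cutoff_tendsto\<close>)
      moreover have "(LINT x|lebesgue. f x * indicator (box L R) x * box_cutoff l' u' n x) = 0" for n
      proof -
        have "(LINT x|lebesgue. f x * indicator (box L R) x * box_cutoff l' u' n x) = (LINT x|lebesgue. f x * box_cutoff l' u' n x)"
          using box_cutoff_outside[of _ l' u' n] sub' by (intro Bochner_Integration.integral_cong) (auto split: split_indicator)
        also have "\<dots> = (LINT x|lebesgue_on U. f x * box_cutoff l' u' n x)"
          using box_cutoff_outside[of _ l' u' n] sub' box_subset_cbox[of L R] LR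
          by (intro test_function_UNIV_integral[symmetric] Um) auto
        also have "\<dots> = 0" using sub LR by (intro z box_cutoff_test) auto
        finally show ?thesis .
      qed
      ultimately have "(LINT x|lebesgue. f x * indicator (box L R) x * indicator (box l' u') x) = 0"
        by (simp add: LIMSEQ_const_iff)
      moreover have "f x * indicator (box L R) x * indicator (box l' u') x = f x * indicator (box L R) x * indicator (box l u) x" for x
        unfolding lu[symmetric] by (auto split: split_indicator)
      ultimately show "(LINT x|lebesgue. f x * indicator (box L R) x * indicator (box l u) x) = 0" by simp
    qed
    then show ?thesis by eventually_elim (auto split: split_indicator)
  qed
  obtain \<D> where D: "countable \<D>" "\<And>X. X \<in> \<D> \<Longrightarrow> X \<subseteq> U" "\<And>X. X \<in> \<D> \<Longrightarrow> \<exists>a b. X = cbox a b" "\<Union>\<D> = U"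
    using open_countable_Union_open_cbox[OF U] by (metis Pow_iff subsetD)
  have "AE x in lebesgue. x \<in> X \<longrightarrow> f x = 0" if XD: "X \<in> \<D>" for X
  proof -
    obtain a b where X: "X = cbox a b" using D XD by blast
    have "cbox a b - box a b \<in> null_sets lebesgue"
      using negligible_frontier_interval[of a b] by (simp add: negligible_iff_null_sets)
    then have "AE x in lebesgue. x \<notin> cbox a b - box a b" by (rule AE_not_in)
    moreover have "AE x in lebesgue. x \<in> box a b \<longrightarrow> f x = 0" using box D XD X by blast
    ultimately show ?thesis unfolding X by eventually_elim auto
  qed
  then have "AE x in lebesgue. \<forall>X\<in>\<D>. x \<in> X \<longrightarrow> f x = 0" by (subst AE_ball_countable[OF D(1)]) blast
  then have "AE x in lebesgue. x \<in> U \<longrightarrow> f x = 0" by eventually_elim (use D(4) in blast)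
  then show ?thesis using Um by (simp add: AE_restrict_space_iff)
qed

lemma has_weak_gradientD:
  assumes "has_weak_gradient U u g" "test_function U \<phi>" "b \<in> Basis"
  shows "(LINT x|lebesgue_on U. u x * frechet_derivative \<phi> (at x) b) = - (LINT x|lebesgue_on U. (g x \<bullet> b) * \<phi> x)"
  using assms unfolding has_weak_gradient_def by blast

lemma has_weak_gradient_L2: "has_weak_gradient U u g \<Longrightarrow> L2 U g"
  by (simp add: has_weak_gradient_def)

lemma weak_gradient_unique:
  fixes u :: "'a::euclidean_space \<Rightarrow> real"
  assumes U: "open U" and g: "has_weak_gradient U u g" "has_weak_gradient U u g'"
  shows "AE x in lebesgue_on U. g x = g' x"
proof -
  have L: "L2 U g" "L2 U g'" using g by (auto simp: has_weak_gradient_def)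
  have Um: "U \<in> sets lebesgue" using U by auto
  have "AE x in lebesgue_on U. g x \<bullet> b - g' x \<bullet> b = 0" if b: "b \<in> Basis" for b
  proof (rule fundamental_lemma[OF U])
    show "L2 U (\<lambda>x. g x \<bullet> b - g' x \<bullet> b)" by (rule L2_diff[OF L2_inner[OF L(1) b] L2_inner[OF L(2) b]])
    fix \<phi> :: "'a \<Rightarrow> real" assume t: "test_function U \<phi>"
    have i: "integrable (lebesgue_on U) (\<lambda>x. (g x \<bullet> b) * \<phi> x)" "integrable (lebesgue_on U) (\<lambda>x. (g' x \<bullet> b) * \<phi> x)"
      by (rule L2_pair_integrable[OF L2_inner[OF L(1) b] test_function_L2[OF t Um]],
          rule L2_pair_integrable[OF L2_inner[OF L(2) b] test_function_L2[OF t Um]])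
    have "(LINT x|lebesgue_on U. (g x \<bullet> b) * \<phi> x) = (LINT x|lebesgue_on U. (g' x \<bullet> b) * \<phi> x)"
      using has_weak_gradientD[OF g(1) t b] has_weak_gradientD[OF g(2) t b] by linarith
    then show "(LINT x|lebesgue_on U. (g x \<bullet> b - g' x \<bullet> b) * \<phi> x) = 0"
      using i by (simp add: left_diff_distrib)
  qed
  then have "AE x in lebesgue_on U. \<forall>b\<in>Basis. g x \<bullet> b - g' x \<bullet> b = 0"
    by (intro AE_finite_allI finite_Basis) auto
  then show ?thesis by eventually_elim (auto intro: euclidean_eqI)
qed

text \<open>The energy is defined with an arbitrarily chosen weak gradient. Uniqueness almost everywhere permits to compute it
  with any other one.\<close>

lemma dirichlet_energy_eq:
  assumes "open U" "has_weak_gradient U u g"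
  shows "ennreal (dirichlet_energy U u) = sqi U g"
proof -
  have w: "has_weak_gradient U u (weak_gradient U u)"
    unfolding weak_gradient_def by (rule someI[of "has_weak_gradient U u", OF assms(2)])
  then have "ennreal (dirichlet_energy U u) = sqi U (weak_gradient U u)"
    unfolding dirichlet_energy_def by (intro sqi_L2) (simp add: has_weak_gradient_def)
  also have "\<dots> = sqi U g" by (intro sqi_cong_AE weak_gradient_unique[OF assms(1) w assms(2)])
  finally show ?thesis .
qed

lemma dirichlet_energy_nonneg: "0 \<le> dirichlet_energy U u"
  unfolding dirichlet_energy_def by (intro integral_nonneg_AE) auto

lemma compact_support_integrable:
  fixes f :: "'a::euclidean_space \<Rightarrow> real"
  assumes "continuous_on UNIV f" "compact K" "\<And>x. x \<notin> K \<Longrightarrow> f x = 0"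
  shows "integrable lborel f" "integrable lebesgue f"
proof -
  have "integrable lborel (\<lambda>x. indicator K x *\<^sub>R f x)"
    by (rule borel_integrable_compact[OF assms(2) continuous_on_subset[OF assms(1)]]) simp
  moreover have "(\<lambda>x. indicator K x *\<^sub>R f x) = f" using assms(3) by (auto split: split_indicator)
  ultimately show "integrable lborel f" by simp
  then show "integrable lebesgue f" 
    by (subst integrable_completion) (auto intro: borel_measurable_integrable)
qed

text \<open>Translation invariance makes the integral of every difference quotient vanish; the quotients
  are dominated because the support is compact.\<close>

lemma integral_partial_derivative_zero:
  fixes \<psi> :: "'a::euclidean_space \<Rightarrow> real"
  assumes D: "\<And>x. (\<psi> has_derivative D x) (at x)" and c: "continuous_on UNIV (\<lambda>x. D x b)"
    and K: "compact K" "\<And>x. x \<notin> K \<Longrightarrow> \<psi> x = 0"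
  shows "(LINT x|lebesgue. D x b) = 0"
proof -
  have D0: "D x b = 0" if "x \<notin> K" for x
    using frechet_derivative_zero_outside[OF compact_imp_closed[OF K(1)] K(2) that]
      frechet_derivative_at[OF D[of x]] by simp
  obtain B0 where B0: "\<And>x. x \<in> K \<Longrightarrow> norm (D x b) \<le> B0"
    using compact_imp_bounded[OF compact_continuous_image[OF continuous_on_subset[OF c subset_UNIV] K(1)]]
    unfolding bounded_iff by blast
  define B where "B = max B0 0"
  have B: "\<bar>D x b\<bar> \<le> B" for x using B0[of x] D0[of x] by (cases "x \<in> K") (auto simp: B_def)
  obtain R where R: "\<And>x. x \<in> K \<Longrightarrow> norm x \<le> R"
    using compact_imp_bounded[OF K(1)] unfolding bounded_iff by blast
  have \<psi>c: "continuous_on UNIV \<psi>"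
    by (intro continuous_at_imp_continuous_on ballI has_derivative_continuous[OF D])
  have line: "((\<lambda>s. \<psi> (x + s *\<^sub>R b)) has_real_derivative D (x + s *\<^sub>R b) b) (at s)" for x s
  proof -
    have "((\<lambda>s. \<psi> (x + s *\<^sub>R b)) has_derivative (\<lambda>h. D (x + s *\<^sub>R b) (h *\<^sub>R b))) (at s)"
      by (rule has_derivative_compose[OF _ D]) (auto intro!: derivative_eq_intros)
    moreover have "D (x + s *\<^sub>R b) (h *\<^sub>R b) = D (x + s *\<^sub>R b) b * h" for h
      using linear_cmul[OF has_derivative_linear[OF D]] by (simp add: mult.commute)
    ultimately show ?thesis by (simp add: has_field_derivative_def)
  qed
  \<comment> \<open>difference quotients with increments \<open>1 / (n + 1)\<close>; by the mean value theorem they are bounded by \<open>B\<close>\<close>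
  define t where "t n = 1 / real (Suc n)" for n
  have t: "t n > 0" "t n \<le> 1" for n by (auto simp: t_def)
  define q where "q n x = (\<psi> (x + t n *\<^sub>R b) - \<psi> x) / t n" for n x
  have qc: "continuous_on UNIV (q n)" for n
    unfolding q_def using t[of n] by (intro continuous_intros continuous_on_compose2[OF \<psi>c]) auto
  have i\<psi>: "integrable lborel \<psi>" by (rule compact_support_integrable[OF \<psi>c K])
  have i\<psi>': "integrable lborel (\<lambda>x. \<psi> (x + v))" "(LINT x|lborel. \<psi> (x + v)) = (LINT x|lborel. \<psi> x)" for v
  proof -
    have m: "(+) v \<in> lborel \<rightarrow>\<^sub>M borel" by simp
    have bm: "\<psi> \<in> borel_measurable borel" using \<psi>c by (rule borel_measurable_continuous_onI)
    show "(LINT x|lborel. \<psi> (x + v)) = (LINT x|lborel. \<psi> x)"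
      using integral_distr[OF m bm] by (simp add: lborel_distr_plus add.commute)
    show "integrable lborel (\<lambda>x. \<psi> (x + v))"
      using integrable_distr_eq[OF m bm] i\<psi> by (simp add: lborel_distr_plus add.commute)
  qed
  have "(LINT x|lborel. q n x) = 0" for n
    unfolding q_def using i\<psi>' i\<psi> by simp
  moreover have "(\<lambda>n. LINT x|lborel. q n x) \<longlonglongrightarrow> (LINT x|lborel. D x b)"
  proof (rule integral_dominated_convergence[where w="\<lambda>x. B * indicator (cball 0 (R + norm b)) x"])
    show "(\<lambda>x. D x b) \<in> borel_measurable lborel" using borel_measurable_continuous_onI[OF c] by simp
    show "q n \<in> borel_measurable lborel" for n using borel_measurable_continuous_onI[OF qc] by simp
    show "integrable lborel (\<lambda>x. B * indicator (cball 0 (R + norm b)) (x::'a))"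
      using emeasure_lborel_cball_finite[of "0::'a" "R + norm b"] by (intro integrable_mult_right integrable_real_indicator) auto
    show "AE x in lborel. (\<lambda>n. q n x) \<longlonglongrightarrow> D x b"
    proof (rule AE_I2)
      fix x
      have "((\<lambda>h. (\<psi> (x + h *\<^sub>R b) - \<psi> x) / h) \<longlongrightarrow> D x b) (at 0)"
        using line[of x 0] by (simp add: DERIV_def)
      moreover have "filterlim t (at 0) sequentially"
        unfolding filterlim_at
      proof
        show "\<forall>\<^sub>F n in sequentially. t n \<in> UNIV \<and> t n \<noteq> 0"
          using t(1) by (intro always_eventually allI) (simp add: less_imp_neq[symmetric])
        show "t \<longlonglongrightarrow> 0"
          unfolding t_def[abs_def] using LIMSEQ_inverse_real_of_nat by (simp only: inverse_eq_divide)
      qed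
      ultimately show "(\<lambda>n. q n x) \<longlonglongrightarrow> D x b"
        unfolding q_def by (rule filterlim_compose)
    qed
    show "AE x in lborel. norm (q n x) \<le> B * indicator (cball 0 (R + norm b)) x" for n
    proof (rule AE_I2)
      fix x
      show "norm (q n x) \<le> B * indicator (cball 0 (R + norm b)) x"
      proof (cases "norm x \<le> R + norm b")
        case True
        obtain z where "\<psi> (x + t n *\<^sub>R b) - \<psi> (x + 0 *\<^sub>R b) = (t n - 0) * D (x + z *\<^sub>R b) b"
          using MVT2[of 0 "t n" "\<lambda>s. \<psi> (x + s *\<^sub>R b)" "\<lambda>s. D (x + s *\<^sub>R b) b"] t[of n] line by blast
        then have "q n x = D (x + z *\<^sub>R b) b" using t[of n] by (simp add: q_def)
        then show ?thesis using B True by simp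
      next
        case False
        have "norm x - norm b \<le> norm (x + t n *\<^sub>R b)"
        proof -
          have "norm x \<le> norm (x + t n *\<^sub>R b) + norm (t n *\<^sub>R b)"
            using norm_triangle_ineq4[of "x + t n *\<^sub>R b" "t n *\<^sub>R b"] by simp
          moreover have "norm (t n *\<^sub>R b) \<le> norm b" using t[of n] by (simp add: mult_left_le_one_le)
          ultimately show ?thesis by linarith
        qed
        then have "\<not> norm (x + t n *\<^sub>R b) \<le> R" "\<not> norm x \<le> R" using False norm_ge_zero[of b] by linarith+
        then have "x + t n *\<^sub>R b \<notin> K" "x \<notin> K" using R by blast+
        then show ?thesis using K False by (simp add: q_def)
      qed
    qed
  qed
  ultimately have "(LINT x|lborel. D x b) = 0" by (simp add: LIMSEQ_const_iff)
  then show ?thesis by (subst integral_completion) (use borel_measurable_continuous_onI[OF c] in auto)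
qed

definition grad :: "('a::euclidean_space \<Rightarrow> real) \<Rightarrow> 'a \<Rightarrow> 'a" where
  "grad w x = (\<Sum>b\<in>Basis. frechet_derivative w (at x) b *\<^sub>R b)"

lemma grad_inner: "b \<in> Basis \<Longrightarrow> grad w x \<bullet> b = frechet_derivative w (at x) b"
  unfolding grad_def by (rule inner_sum_left_Basis)

lemma grad_inner_smooth:
  assumes "smooth w"
  shows "grad w x \<bullet> v = frechet_derivative w (at x) v"
proof -
  have l: "linear (frechet_derivative w (at x))"
    using has_derivative_linear[OF smooth_has_derivative[OF assms]] .
  have "frechet_derivative w (at x) v = frechet_derivative w (at x) (\<Sum>b\<in>Basis. (v \<bullet> b) *\<^sub>R b)"
    by (simp add: euclidean_representation)
  also have "\<dots> = (\<Sum>b\<in>Basis. (v \<bullet> b) * frechet_derivative w (at x) b)"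
    using l by (simp add: linear_sum linear_cmul)
  also have "\<dots> = grad w x \<bullet> v"
    unfolding grad_def by (simp add: inner_sum_right inner_sum_left inner_commute[of _ v] mult.commute)
  finally show ?thesis by simp
qed

lemma continuous_grad: "smooth w \<Longrightarrow> continuous_on UNIV (grad w)"
  unfolding grad_def[abs_def] by (intro continuous_intros smooth_continuous smooth_frechet)

text \<open>The integral of the derivative of \<open>w * \<phi>\<close> vanishes.\<close>

lemma smooth_weak_gradient:
  assumes w: "smooth w" and U: "U \<in> sets lebesgue" and L: "L2 U (grad w)"
  shows "has_weak_gradient U w (grad w)"
  unfolding has_weak_gradient_def
proof (intro conjI L allI impI ballI)
  fix \<phi> :: "'a \<Rightarrow> real" and b :: 'a assume t: "test_function U \<phi>" and b: "b \<in> Basis"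
  obtain K where K: "compact K" "K \<subseteq> U" "\<And>x. x \<notin> K \<Longrightarrow> \<phi> x = 0" "smooth \<phi>"
    using test_functionE[OF t] by blast
  have D0: "frechet_derivative \<phi> (at x) b = 0" if "x \<notin> K" for x
    using frechet_derivative_zero_outside[OF compact_imp_closed[OF K(1)] K(3) that] by simp
  have c1: "continuous_on UNIV (\<lambda>x. w x * frechet_derivative \<phi> (at x) b)"
    and c2: "continuous_on UNIV (\<lambda>x. frechet_derivative w (at x) b * \<phi> x)"
    by (intro continuous_intros smooth_continuous smooth_frechet w K b)+
  have "(LINT x|lebesgue. (\<lambda>v. w x * frechet_derivative \<phi> (at x) v + frechet_derivative w (at x) v * \<phi> x) b) = 0"
    by (rule integral_partial_derivative_zero[where \<psi>="\<lambda>x. w x * \<phi> x" and K=K, OF has_derivative_mult])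
      (use K w c1 c2 in \<open>auto intro!: smooth_has_derivative continuous_intros\<close>)
  moreover have "integrable lebesgue (\<lambda>x. w x * frechet_derivative \<phi> (at x) b)"
    by (rule compact_support_integrable[OF c1 K(1)]) (simp add: D0)
  moreover have "integrable lebesgue (\<lambda>x. frechet_derivative w (at x) b * \<phi> x)"
    by (rule compact_support_integrable[OF c2 K(1)]) (simp add: K)
  ultimately have "(LINT x|lebesgue. w x * frechet_derivative \<phi> (at x) b) = - (LINT x|lebesgue. frechet_derivative w (at x) b * \<phi> x)"
    by simp
  moreover have "(LINT x|lebesgue_on U. w x * frechet_derivative \<phi> (at x) b) = (LINT x|lebesgue. w x * frechet_derivative \<phi> (at x) b)"
    using K D0 by (intro test_function_UNIV_integral U) auto
  moreover have "(LINT x|lebesgue_on U. frechet_derivative w (at x) b * \<phi> x) = (LINT x|lebesgue. frechet_derivative w (at x) b * \<phi> x)"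
    using K by (intro test_function_UNIV_integral U) auto
  ultimately show "(LINT x|lebesgue_on U. w x * frechet_derivative \<phi> (at x) b) = - (LINT x|lebesgue_on U. (grad w x \<bullet> b) * \<phi> x)"
    using b by (simp add: grad_inner)
qed

lemma has_weak_gradient_add:
  assumes "L2 U u" "L2 U v" "has_weak_gradient U u g" "has_weak_gradient U v k" "U \<in> sets lebesgue"
  shows "has_weak_gradient U (\<lambda>x. u x + v x) (\<lambda>x. g x + k x)"
  unfolding has_weak_gradient_def
proof (intro conjI allI impI ballI)
  show "L2 U (\<lambda>x. g x + k x)" using assms by (intro L2_add has_weak_gradient_L2)
  fix \<phi> :: "'a \<Rightarrow> real" and b :: 'a assume t: "test_function U \<phi>" and b: "b \<in> Basis"
  note T = test_function_L2[OF t assms(5)] test_function_L2[OF test_function_frechet[OF t b] assms(5)]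
  note I = L2_pair_integrable[OF assms(1) T(2)] L2_pair_integrable[OF assms(2) T(2)]
    L2_pair_integrable[OF L2_inner[OF has_weak_gradient_L2[OF assms(3)] b] T(1)]
    L2_pair_integrable[OF L2_inner[OF has_weak_gradient_L2[OF assms(4)] b] T(1)]
  show "(LINT x|lebesgue_on U. (u x + v x) * frechet_derivative \<phi> (at x) b) = - (LINT x|lebesgue_on U. ((g x + k x) \<bullet> b) * \<phi> x)"
    using has_weak_gradientD[OF assms(3) t b] has_weak_gradientD[OF assms(4) t b] I
    by (simp add: distrib_right inner_add_left)
qed

lemma has_weak_gradient_cmult:
  assumes "has_weak_gradient U u g" 
  shows "has_weak_gradient U (\<lambda>x. c * u x) (\<lambda>x. c *\<^sub>R g x)"
  unfolding has_weak_gradient_def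
proof (intro conjI allI impI ballI)
  show "L2 U (\<lambda>x. c *\<^sub>R g x)" using assms by (intro L2_cmult has_weak_gradient_L2)
  fix \<phi> :: "'a \<Rightarrow> real" and b :: 'a assume t: "test_function U \<phi>" and b: "b \<in> Basis"
  show "(LINT x|lebesgue_on U. c * u x * frechet_derivative \<phi> (at x) b) = - (LINT x|lebesgue_on U. (c *\<^sub>R g x \<bullet> b) * \<phi> x)"
    using has_weak_gradientD[OF assms t b] by (simp add: mult.assoc)
qed

lemma has_weak_gradient_diff:
  assumes "L2 U u" "L2 U v" "has_weak_gradient U u g" "has_weak_gradient U v k" "U \<in> sets lebesgue"
  shows "has_weak_gradient U (\<lambda>x. u x - v x) (\<lambda>x. g x - k x)"
  using has_weak_gradient_add[OF assms(1) L2_cmult[OF assms(2), of "-1"] assms(3), of "\<lambda>x. (-1) *\<^sub>R k x"]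
    has_weak_gradient_cmult[OF assms(4), of "-1"] assms(5) by simp

lemma has_weak_gradient_subset:
  assumes "has_weak_gradient U u g" "A \<subseteq> U" "A \<in> sets lebesgue" "U \<in> sets lebesgue"
  shows "has_weak_gradient A u g"
  unfolding has_weak_gradient_def
proof (intro conjI allI impI ballI)
  show "L2 A g" using assms by (intro L2_subset[OF has_weak_gradient_L2])
  fix \<phi> :: "'a \<Rightarrow> real" and b :: 'a assume t: "test_function A \<phi>" and b: "b \<in> Basis"
  obtain K where K: "compact K" "K \<subseteq> A" "\<And>x. x \<notin> K \<Longrightarrow> \<phi> x = 0" "smooth \<phi>"
    using test_functionE[OF t] by blast
  have D0: "frechet_derivative \<phi> (at x) b = 0" if "x \<notin> K" for x
    using frechet_derivative_zero_outside[OF compact_imp_closed[OF K(1)] K(3) that] by simp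
  have t': "test_function U \<phi>" using K assms(2) by (intro test_functionI[of \<phi> K]) auto
  have "(LINT x|lebesgue_on B. u x * frechet_derivative \<phi> (at x) b) = (LINT x|lebesgue. u x * frechet_derivative \<phi> (at x) b)"
    "(LINT x|lebesgue_on B. (g x \<bullet> b) * \<phi> x) = (LINT x|lebesgue. (g x \<bullet> b) * \<phi> x)" if B: "B \<in> {A, U}" for B
  proof -
    have "x \<notin> K" if "x \<notin> B" for x using K(2) assms(2) B that by blast
    then show "(LINT x|lebesgue_on B. u x * frechet_derivative \<phi> (at x) b) = (LINT x|lebesgue. u x * frechet_derivative \<phi> (at x) b)"
      "(LINT x|lebesgue_on B. (g x \<bullet> b) * \<phi> x) = (LINT x|lebesgue. (g x \<bullet> b) * \<phi> x)"
      using assms(3,4) B D0 K(3) by (intro test_function_UNIV_integral; auto)+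
  qed
  then show "(LINT x|lebesgue_on A. u x * frechet_derivative \<phi> (at x) b) = - (LINT x|lebesgue_on A. (g x \<bullet> b) * \<phi> x)"
    using has_weak_gradientD[OF assms(1) t' b] by simp
qed

lemma has_weak_gradient_limit:
  assumes L: "\<And>n. L2 U (u n)" "L2 U v" and g: "\<And>n. has_weak_gradient U (u n) (g n)" and k: "L2 U k"
    and lim: "(\<lambda>n. sqi U (\<lambda>x. u n x - v x)) \<longlonglongrightarrow> 0" "(\<lambda>n. sqi U (\<lambda>x. g n x - k x)) \<longlonglongrightarrow> 0" 
    and U: "U \<in> sets lebesgue"
  shows "has_weak_gradient U v k"
  unfolding has_weak_gradient_def
proof (intro conjI allI impI ballI k)
  fix \<phi> :: "'a \<Rightarrow> real" and b :: 'a assume t: "test_function U \<phi>" and b: "b \<in> Basis"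
  note T = test_function_L2[OF t U] test_function_L2[OF test_function_frechet[OF t b] U]
  have "(\<lambda>n. LINT x|lebesgue_on U. u n x * frechet_derivative \<phi> (at x) b) \<longlonglongrightarrow> (LINT x|lebesgue_on U. v x * frechet_derivative \<phi> (at x) b)"
    by (rule L2_pair_tendsto[OF L T(2) lim(1)])
  moreover have "(\<lambda>n. LINT x|lebesgue_on U. (g n x \<bullet> b) * \<phi> x) \<longlonglongrightarrow> (LINT x|lebesgue_on U. (k x \<bullet> b) * \<phi> x)"
  proof (rule L2_pair_tendsto[OF L2_inner[OF has_weak_gradient_L2[OF g] b] L2_inner[OF k b] T(1)])
    show "(\<lambda>n. sqi U (\<lambda>x. g n x \<bullet> b - k x \<bullet> b)) \<longlonglongrightarrow> 0"
    proof (rule tendsto_sandwich[where f="\<lambda>_. 0", OF _ _ _ lim(2)])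
      show "\<forall>\<^sub>F n in sequentially. sqi U (\<lambda>x. g n x \<bullet> b - k x \<bullet> b) \<le> sqi U (\<lambda>x. g n x - k x)"
        using b by (intro always_eventually allI sqi_mono) (simp add: inner_diff_left[symmetric] Basis_le_norm)
    qed auto
  qed
  then have "(\<lambda>n. - (LINT x|lebesgue_on U. (g n x \<bullet> b) * \<phi> x)) \<longlonglongrightarrow> - (LINT x|lebesgue_on U. (k x \<bullet> b) * \<phi> x)"
    by (rule tendsto_minus)
  then have "(\<lambda>n. LINT x|lebesgue_on U. u n x * frechet_derivative \<phi> (at x) b) \<longlonglongrightarrow> - (LINT x|lebesgue_on U. (k x \<bullet> b) * \<phi> x)"
    using has_weak_gradientD[OF g t b] by simp
  ultimately show "(LINT x|lebesgue_on U. v x * frechet_derivative \<phi> (at x) b) = - (LINT x|lebesgue_on U. (k x \<bullet> b) * \<phi> x)"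
    by (rule LIMSEQ_unique)
qed

section \<open>Traces on pillars\<close>

abbreviation pillar :: "real \<Rightarrow> real \<Rightarrow> real \<Rightarrow> (real \<times> real) set" where
  "pillar a b d \<equiv> {a<..<b} \<times> {0<..<d}"

lemma pillar_box: "pillar a b d = box (a, 0) (b, d)"
  by (auto simp: mem_box Basis_prod_def)

lemma pillar_open: "open (pillar a b d)"
  and pillar_bounded: "bounded (pillar a b d)"
  and pillar_lebesgue: "pillar a b d \<in> sets lebesgue"
  unfolding pillar_box by auto

text \<open>The trace condition with the weak gradient \<open>g\<close> as a parameter and with nonnegative integrals instead of norms. In this form
  it is stable under linear combinations and limits, and approximating functions can be multiplied by cutoffs.\<close>

definition trace_approx :: "real \<Rightarrow> real \<Rightarrow> real \<Rightarrow> (real \<times> real \<Rightarrow> real) \<Rightarrow> (real \<times> real \<Rightarrow> real \<times> real) \<Rightarrow> (real \<Rightarrow> real) \<Rightarrow> bool" where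
  "trace_approx a b d u g t \<longleftrightarrow> (\<forall>e>0. \<exists>w. smooth w \<and> sqi (pillar a b d) (\<lambda>z. w z - u z) \<le> ennreal e
     \<and> sqi (pillar a b d) (\<lambda>z. grad w z - g z) \<le> ennreal e \<and> sqi {a<..<b} (\<lambda>x. w (x, 0) - t x) \<le> ennreal e)"

lemma H1_norm_pillar:
  assumes u: "L2 (pillar a b d) u" "has_weak_gradient (pillar a b d) u g" and w: "smooth w"
  shows "ennreal ((H1_norm (pillar a b d) (\<lambda>z. w z - u z))\<^sup>2) = sqi (pillar a b d) (\<lambda>z. w z - u z) + sqi (pillar a b d) (\<lambda>z. grad w z - g z)"
proof -
  let ?Q = "pillar a b d"
  have Lw: "L2 ?Q w" "L2 ?Q (grad w)"
    by (intro L2_continuous_bounded smooth_continuous w continuous_grad pillar_bounded pillar_lebesgue)+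
  have wg: "has_weak_gradient ?Q (\<lambda>z. w z - u z) (\<lambda>z. grad w z - g z)"
    by (intro has_weak_gradient_diff Lw u smooth_weak_gradient w pillar_lebesgue)
  have "ennreal ((H1_norm ?Q (\<lambda>z. w z - u z))\<^sup>2) = ennreal ((L2_norm ?Q (\<lambda>z. w z - u z))\<^sup>2) + ennreal (dirichlet_energy ?Q (\<lambda>z. w z - u z))"
    using dirichlet_energy_nonneg[of ?Q "\<lambda>z. w z - u z"] by (simp add: H1_norm_def)
  also have "\<dots> = sqi ?Q (\<lambda>z. w z - u z) + sqi ?Q (\<lambda>z. grad w z - g z)"
    using L2_norm_sqi[OF L2_diff[OF Lw(1) u(1)]] dirichlet_energy_eq[OF pillar_open wg] by simp
  finally show ?thesis .
qed

lemma continuous_trace: "smooth w \<Longrightarrow> continuous_on UNIV (\<lambda>x. w (x, 0))"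
  by (rule continuous_on_compose2[OF smooth_continuous[of w UNIV]]) (auto intro!: continuous_intros)

lemma trace_L2:
  fixes w :: "real \<times> real \<Rightarrow> real"
  assumes "smooth w" "continuous_on UNIV t"
  shows "L2 {a<..<b} (\<lambda>x. w (x, 0) - t x)"
  by (rule L2_continuous_bounded; (intro continuous_on_diff continuous_trace assms)?) auto

text \<open>Sequences are traded for an arbitrary error bound; the norm of \<open>H1\<close> is computed with the given weak gradient.\<close>

lemma bottom_trace_iff:
  assumes u: "L2 (pillar a b d) u" "has_weak_gradient (pillar a b d) u g" and t: "continuous_on UNIV t"
  shows "has_bottom_trace a b d u t \<longleftrightarrow> trace_approx a b d u g t"
proof
  let ?Q = "pillar a b d"
  assume "has_bottom_trace a b d u t"
  then obtain w where w: "\<And>n. smooth (w n)" 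
    and 1: "(\<lambda>n. H1_norm ?Q (\<lambda>z. w n z - u z)) \<longlonglongrightarrow> 0" 
    and 2: "(\<lambda>n. L2_norm {a<..<b} (\<lambda>x. w n (x, 0) - t x)) \<longlonglongrightarrow> 0"
    unfolding has_bottom_trace_def by blast
  show "trace_approx a b d u g t"
    unfolding trace_approx_def
  proof (intro allI impI)
    fix e :: real assume e: "e > 0"
    have "(\<lambda>n. (H1_norm ?Q (\<lambda>z. w n z - u z))\<^sup>2) \<longlonglongrightarrow> 0" "(\<lambda>n. (L2_norm {a<..<b} (\<lambda>x. w n (x, 0) - t x))\<^sup>2) \<longlonglongrightarrow> 0"
      using tendsto_power[OF 1, of 2] tendsto_power[OF 2, of 2] by auto
    then have "\<forall>\<^sub>F n in sequentially. (H1_norm ?Q (\<lambda>z. w n z - u z))\<^sup>2 < e \<and> (L2_norm {a<..<b} (\<lambda>x. w n (x, 0) - t x))\<^sup>2 < e"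
      using e by (intro eventually_conj order_tendstoD(2)) auto
    then obtain n where n: "(H1_norm ?Q (\<lambda>z. w n z - u z))\<^sup>2 < e" "(L2_norm {a<..<b} (\<lambda>x. w n (x, 0) - t x))\<^sup>2 < e"
      by (auto simp: eventually_sequentially)
    have "sqi ?Q (\<lambda>z. w n z - u z) + sqi ?Q (\<lambda>z. grad (w n) z - g z) \<le> ennreal e"
      using H1_norm_pillar[OF u w[of n]] n(1) by (simp flip: H1_norm_pillar[OF u w[of n]] add: ennreal_leI)
    moreover have "sqi {a<..<b} (\<lambda>x. w n (x, 0) - t x) \<le> ennreal e"
      unfolding L2_norm_sqi[OF trace_L2[OF w t], symmetric] using n(2) by (intro ennreal_leI) simp
    ultimately show "\<exists>w. smooth w \<and> sqi ?Q (\<lambda>z. w z - u z) \<le> ennreal e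
     \<and> sqi ?Q (\<lambda>z. grad w z - g z) \<le> ennreal e \<and> sqi {a<..<b} (\<lambda>x. w (x, 0) - t x) \<le> ennreal e"
      using w[of n] by (intro exI[of _ "w n"]) (auto intro: order_trans[rotated])
  qed
next
  let ?Q = "pillar a b d"
  assume A: "trace_approx a b d u g t"
  have "\<exists>w. smooth w \<and> sqi ?Q (\<lambda>z. w z - u z) \<le> ennreal (1 / Suc n)
     \<and> sqi ?Q (\<lambda>z. grad w z - g z) \<le> ennreal (1 / Suc n) \<and> sqi {a<..<b} (\<lambda>x. w (x, 0) - t x) \<le> ennreal (1 / Suc n)" for n
    using A[unfolded trace_approx_def, rule_format, of "1 / Suc n"] by simp
  then have "\<forall>n. \<exists>w. smooth w \<and> sqi ?Q (\<lambda>z. w z - u z) \<le> ennreal (1 / Suc n)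
     \<and> sqi ?Q (\<lambda>z. grad w z - g z) \<le> ennreal (1 / Suc n) \<and> sqi {a<..<b} (\<lambda>x. w (x, 0) - t x) \<le> ennreal (1 / Suc n)"
    by (rule allI)
  from choice[OF this] obtain w where W: "\<forall>n. smooth (w n) \<and> sqi ?Q (\<lambda>z. w n z - u z) \<le> ennreal (1 / Suc n)
     \<and> sqi ?Q (\<lambda>z. grad (w n) z - g z) \<le> ennreal (1 / Suc n) \<and> sqi {a<..<b} (\<lambda>x. w n (x, 0) - t x) \<le> ennreal (1 / Suc n)"
    by (elim exE)
  have w: "\<And>n. smooth (w n)" 
    and 1: "\<And>n. sqi ?Q (\<lambda>z. w n z - u z) \<le> ennreal (1 / Suc n)" 
     "\<And>n. sqi ?Q (\<lambda>z. grad (w n) z - g z) \<le> ennreal (1 / Suc n)"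
    and 2: "\<And>n. sqi {a<..<b} (\<lambda>x. w n (x, 0) - t x) \<le> ennreal (1 / Suc n)"
    using W[THEN spec] by simp_all
  have to0: "f \<longlonglongrightarrow> 0" if "\<And>n. (f n)\<^sup>2 \<le> 2 / Suc n" for f :: "nat \<Rightarrow> real"
  proof -
    have "(\<lambda>n. 2 * inverse (real (Suc n))) \<longlonglongrightarrow> 2 * 0"
      by (intro tendsto_mult tendsto_const LIMSEQ_inverse_real_of_nat)
    then have l: "(\<lambda>n. 2 / real (Suc n)) \<longlonglongrightarrow> 0" by (simp add: divide_inverse)
    have "(\<lambda>n. (f n)\<^sup>2) \<longlonglongrightarrow> 0"
      by (rule tendsto_sandwich[where f="\<lambda>_. 0", OF _ _ _ l]) (use that in auto)
    then show ?thesis by simp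
  qed
  have "(H1_norm ?Q (\<lambda>z. w n z - u z))\<^sup>2 \<le> 2 / Suc n" for n
  proof -
    have "ennreal ((H1_norm ?Q (\<lambda>z. w n z - u z))\<^sup>2) \<le> ennreal (1 / Suc n) + ennreal (1 / Suc n)"
      unfolding H1_norm_pillar[OF u w] by (intro add_mono 1)
    also have "\<dots> = ennreal (2 / Suc n)" by (simp flip: ennreal_plus)
    finally show ?thesis by (subst (asm) ennreal_le_iff) auto
  qed
  moreover have "(L2_norm {a<..<b} (\<lambda>x. w n (x, 0) - t x))\<^sup>2 \<le> 2 / Suc n" for n
  proof -
    have "ennreal ((L2_norm {a<..<b} (\<lambda>x. w n (x, 0) - t x))\<^sup>2) \<le> ennreal (1 / Suc n)"
      unfolding L2_norm_sqi[OF trace_L2[OF w t]] by (rule 2)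
    then have "(L2_norm {a<..<b} (\<lambda>x. w n (x, 0) - t x))\<^sup>2 \<le> 1 / Suc n" by (subst (asm) ennreal_le_iff) auto
    also have "\<dots> \<le> 2 / Suc n" by (intro divide_right_mono) auto
    finally show ?thesis .
  qed
  ultimately show "has_bottom_trace a b d u t"
    unfolding has_bottom_trace_def using w to0 by (intro exI[of _ w]) auto
qed

lemma grad_diff:
  assumes "smooth v" "smooth w" shows "grad (\<lambda>z. v z - w z) z = grad v z - grad w z"
proof -
  have "frechet_derivative (\<lambda>z. v z - w z) (at z) = (\<lambda>y. frechet_derivative v (at z) y - frechet_derivative w (at z) y)"
    by (rule frechet_derivative_at[symmetric]) (intro has_derivative_diff smooth_has_derivative assms)
  then show ?thesis by (simp add: grad_def scaleR_diff_left sum_subtractf)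
qed

lemma grad_add:
  assumes "smooth v" "smooth w" shows "grad (\<lambda>z. v z + w z) z = grad v z + grad w z"
proof -
  have "frechet_derivative (\<lambda>z. v z + w z) (at z) = (\<lambda>y. frechet_derivative v (at z) y + frechet_derivative w (at z) y)"
    by (rule frechet_derivative_at[symmetric]) (intro has_derivative_add smooth_has_derivative assms)
  then show ?thesis by (simp add: grad_def scaleR_add_left sum.distrib)
qed

lemma grad_mult:
  assumes "smooth v" "smooth w" shows "grad (\<lambda>z. v z * w z) z = v z *\<^sub>R grad w z + w z *\<^sub>R grad v z"
proof -
  have "frechet_derivative (\<lambda>z. v z * w z) (at z) = (\<lambda>y. v z * frechet_derivative w (at z) y + frechet_derivative v (at z) y * w z)"
    by (rule frechet_derivative_at[symmetric]) (intro has_derivative_mult smooth_has_derivative assms)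
  then show ?thesis by (simp add: grad_def scaleR_add_left sum.distrib scaleR_sum_right mult.commute)
qed

lemma grad_const: "grad (\<lambda>z. c) z = 0"
  by (simp add: grad_def)

section \<open>Poincare inequalities\<close>

lemma square_increment_le:
  fixes f :: "real \<Rightarrow> real"
  assumes ab: "a \<le> b" and f: "\<And>x. (f has_real_derivative f' x) (at x)" and c: "continuous_on UNIV f'"
  shows "ennreal ((f b - f a)\<^sup>2) \<le> ennreal (b - a) * (\<integral>\<^sup>+x. ennreal ((f' x)\<^sup>2) * indicator {a<..<b} x \<partial>lborel)"
proof -
  let ?I = "{a<..<b}"
  have "bounded ?I" "?I \<in> sets lebesgue" unfolding box_real(1)[symmetric] by auto
  then have L: "L2 ?I f'" "L2 ?I (\<lambda>_. 1::real)"
    using L2_continuous_bounded[OF c] L2_continuous_bounded[OF continuous_on_const[of "UNIV :: real set" "1::real"]] by auto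
  have "(f' has_integral (f b - f a)) {a..b}"
    by (intro fundamental_theorem_of_calculus ab)
      (use f in \<open>auto simp: has_real_derivative_iff_has_vector_derivative[symmetric] intro: has_field_derivative_at_within\<close>)
  then have "(f' has_integral (f b - f a)) ?I" by (simp add: has_integral_Icc_iff_Ioo)
  moreover have i: "integrable (lebesgue_on ?I) f'" using L2_pair_integrable[OF L] by simp
  ultimately have eq: "(LINT x|lebesgue_on ?I. f' x * 1) = f b - f a"
    using lebesgue_integral_eq_integral[OF i] by (simp add: integral_unique)
  have "sqi ?I (\<lambda>_. 1::real) = ennreal (b - a)"
    unfolding sqi_def using ab by (subst nn_lebesgue_on) auto
  moreover have "sqi ?I f' = (\<integral>\<^sup>+x. ennreal ((f' x)\<^sup>2) * indicator ?I x \<partial>lborel)"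
    unfolding sqi_def by (subst nn_lebesgue_on) auto
  ultimately show ?thesis
    using L2_Cauchy_Schwarz[OF L] unfolding eq by (simp add: mult.commute)
qed

lemma nn_integral_translate:
  fixes v :: "'a::euclidean_space"
  assumes "f \<in> borel_measurable borel"
  shows "(\<integral>\<^sup>+z. f (z + v) \<partial>lborel) = (\<integral>\<^sup>+z. f z \<partial>lborel)"
proof -
  have "(\<integral>\<^sup>+z. f z \<partial>lborel) = (\<integral>\<^sup>+z. f z \<partial>distr lborel borel ((+) v))" by (simp add: lborel_distr_plus)
  also have "\<dots> = (\<integral>\<^sup>+z. f (v + z) \<partial>lborel)" using assms by (subst nn_integral_distr) auto
  finally show ?thesis by (simp add: add.commute)
qed

lemma measurable_translate_lebesgue: "(\<lambda>z. z + v) \<in> lebesgue \<rightarrow>\<^sub>M (lebesgue :: 'a::euclidean_space measure)"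
  using lebesgue_affine_measurable[where c="\<lambda>_. 1" and t=v] by (simp add: euclidean_representation add.commute)

lemma nn_integral_translate_lebesgue:
  fixes v :: "'a::euclidean_space"
  assumes f: "f \<in> borel_measurable lebesgue"
  shows "(\<integral>\<^sup>+z. f (z + v) \<partial>lebesgue) = (\<integral>\<^sup>+z. f z \<partial>lebesgue)"
proof -
  have eq: "lebesgue = density (distr lebesgue lebesgue (\<lambda>z. z + v)) (\<lambda>_. 1)"
    using lebesgue_affine_euclidean[where c="\<lambda>_. 1" and t=v] by (simp add: euclidean_representation add.commute)
  have "(\<integral>\<^sup>+z. f z \<partial>lebesgue) = (\<integral>\<^sup>+z. f z \<partial>distr lebesgue lebesgue (\<lambda>z. z + v))"
    by (subst eq) (simp add: density_1)
  also have "\<dots> = (\<integral>\<^sup>+z. f (z + v) \<partial>lebesgue)"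
    using f by (intro nn_integral_distr measurable_translate_lebesgue) auto
  finally show ?thesis by simp
qed

lemma directional_derivative:
  assumes "smooth w"
  shows "((\<lambda>s. w (z + s *\<^sub>R e)) has_real_derivative grad w (z + s *\<^sub>R e) \<bullet> e) (at s)"
proof -
  have "((\<lambda>s. w (z + s *\<^sub>R e)) has_derivative (\<lambda>h. frechet_derivative w (at (z + s *\<^sub>R e)) (h *\<^sub>R e))) (at s)"
    by (rule has_derivative_compose[OF _ smooth_has_derivative[OF assms]]) (auto intro!: derivative_eq_intros)
  moreover have "frechet_derivative w (at (z + s *\<^sub>R e)) (h *\<^sub>R e) = (grad w (z + s *\<^sub>R e) \<bullet> e) * h" for h
    unfolding grad_inner_smooth[OF assms, symmetric] by simp
  ultimately show ?thesis by (simp add: has_field_derivative_def)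
qed

text \<open>Integrate the fundamental theorem of calculus along the segments from \<open>z\<close> to \<open>z + e\<close>. After exchanging the integrals,
  every translate of \<open>A\<close> along the segments stays in \<open>A'\<close>.\<close>

lemma smooth_translation_ineq:
  fixes w :: "'a::euclidean_space \<Rightarrow> real"
  assumes w: "smooth w" and A: "A \<in> sets borel" "A' \<in> sets borel" 
    and seg: "\<And>z s. z \<in> A \<Longrightarrow> 0 < s \<Longrightarrow> s < 1 \<Longrightarrow> z + s *\<^sub>R e \<in> A'"
  shows "(\<integral>\<^sup>+z. ennreal ((w (z + e) - w z)\<^sup>2) * indicator A z \<partial>lborel)
     \<le> ennreal ((norm e)\<^sup>2) * (\<integral>\<^sup>+z. ennreal ((norm (grad w z))\<^sup>2) * indicator A' z \<partial>lborel)"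
proof -
  define F where "F z = ennreal ((grad w z \<bullet> e)\<^sup>2)" for z
  have gm[measurable]: "grad w \<in> borel_measurable borel" by (intro borel_measurable_continuous_onI continuous_grad w)
  have [measurable]: "F \<in> borel_measurable borel" unfolding F_def by measurable
  note A[measurable]
  have "(\<integral>\<^sup>+z. ennreal ((w (z + e) - w z)\<^sup>2) * indicator A z \<partial>lborel)
      \<le> (\<integral>\<^sup>+z. (\<integral>\<^sup>+s. F (z + s *\<^sub>R e) * indicator {0<..<1} s * indicator A z \<partial>lborel) \<partial>lborel)"
  proof (intro nn_integral_mono)
    fix z
    have c: "continuous_on UNIV (\<lambda>s. grad w (z + s *\<^sub>R e) \<bullet> e)"
      by (intro continuous_intros continuous_on_compose2[OF continuous_grad[OF w]]) auto
    have "ennreal ((w (z + e) - w z)\<^sup>2) \<le> (\<integral>\<^sup>+s. F (z + s *\<^sub>R e) * indicator {0<..<1} s \<partial>lborel)"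
      using square_increment_le[OF _ directional_derivative[OF w, of z e] c, of 0 1] by (simp add: F_def)
    then show "ennreal ((w (z + e) - w z)\<^sup>2) * indicator A z \<le> (\<integral>\<^sup>+s. F (z + s *\<^sub>R e) * indicator {0<..<1} s * indicator A z \<partial>lborel)"
      by (subst nn_integral_multc) (auto intro: mult_right_mono)
  qed
  also have "\<dots> = (\<integral>\<^sup>+s. (\<integral>\<^sup>+z. F (z + s *\<^sub>R e) * indicator {0<..<1} s * indicator A z \<partial>lborel) \<partial>lborel)"
    by (rule lborel_pair.Fubini') measurable
  also have "\<dots> \<le> (\<integral>\<^sup>+s. (\<integral>\<^sup>+z. F z * indicator A' z \<partial>lborel) * indicator {0<..<1::real} s \<partial>lborel)"
  proof (intro nn_integral_mono)
    fix s :: real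
    have "(\<integral>\<^sup>+z. F (z + s *\<^sub>R e) * indicator {0<..<1} s * indicator A z \<partial>lborel)
        \<le> (\<integral>\<^sup>+z. F (z + s *\<^sub>R e) * indicator A' (z + s *\<^sub>R e) * indicator {0<..<1} s \<partial>lborel)"
      using seg by (intro nn_integral_mono) (auto split: split_indicator)
    also have "\<dots> = (\<integral>\<^sup>+z. F (z + s *\<^sub>R e) * indicator A' (z + s *\<^sub>R e) \<partial>lborel) * indicator {0<..<1} s"
      by (rule nn_integral_multc) measurable
    also have "(\<integral>\<^sup>+z. F (z + s *\<^sub>R e) * indicator A' (z + s *\<^sub>R e) \<partial>lborel) = (\<integral>\<^sup>+z. F z * indicator A' z \<partial>lborel)"
      by (rule nn_integral_translate[of "\<lambda>z. F z * indicator A' z"]) measurable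
    finally show "(\<integral>\<^sup>+z. F (z + s *\<^sub>R e) * indicator {0<..<1} s * indicator A z \<partial>lborel) \<le> (\<integral>\<^sup>+z. F z * indicator A' z \<partial>lborel) * indicator {0<..<1} s" .
  qed
  also have "\<dots> = (\<integral>\<^sup>+z. F z * indicator A' z \<partial>lborel)"
    by (subst nn_integral_cmult) auto
  also have "\<dots> \<le> (\<integral>\<^sup>+z. ennreal ((norm e)\<^sup>2) * (ennreal ((norm (grad w z))\<^sup>2) * indicator A' z) \<partial>lborel)"
  proof (intro nn_integral_mono)
    fix z
    have "(grad w z \<bullet> e)\<^sup>2 \<le> (norm e)\<^sup>2 * (norm (grad w z))\<^sup>2"
      using Cauchy_Schwarz_ineq[of "grad w z" e] by (simp add: power2_norm_eq_inner mult.commute)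
    then have "F z \<le> ennreal ((norm e)\<^sup>2) * ennreal ((norm (grad w z))\<^sup>2)"
      unfolding F_def by (simp add: ennreal_mult[symmetric] ennreal_leI)
    then show "F z * indicator A' z \<le> ennreal ((norm e)\<^sup>2) * (ennreal ((norm (grad w z))\<^sup>2) * indicator A' z)"
      by (simp add: mult_right_mono mult.assoc[symmetric])
  qed
  also have "\<dots> = ennreal ((norm e)\<^sup>2) * (\<integral>\<^sup>+z. ennreal ((norm (grad w z))\<^sup>2) * indicator A' z \<partial>lborel)"
    by (rule nn_integral_cmult) measurable
  finally show ?thesis .
qed

lemma sqi_lborel: "U \<in> sets lebesgue \<Longrightarrow> sqi U f = (\<integral>\<^sup>+z. ennreal ((norm (f z))\<^sup>2) * indicator U z \<partial>lborel)"
  unfolding sqi_def by (rule nn_lebesgue_on)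

text \<open>The mean square oscillation over pairs of points of a box is an average of translation increments, so the value at
  some point of the box is close to \<open>w\<close> in the mean. The increments fill a box of the double side lengths, whence the
  factor \<open>2 ^ DIM('a)\<close>. The error \<open>e\<close> makes the averaging argument a strict inequality.\<close>

lemma smooth_box_Poincare:
  fixes w :: "'a::euclidean_space \<Rightarrow> real"
  assumes w: "smooth w" and ne: "\<And>b. b \<in> Basis \<Longrightarrow> l \<bullet> b < u \<bullet> b" and e: "e > 0"
  shows "\<exists>c. sqi (box l u) (\<lambda>z. w z - c) \<le> ennreal (2 ^ DIM('a) * (norm (u - l))\<^sup>2) * sqi (box l u) (grad w) + ennreal e"
proof (rule ccontr)
  let ?R = "box l u" and ?D = "box (l - u) (u - l)"
  define X where "X = sqi ?R (grad w)"
  define N where "N = (norm (u - l))\<^sup>2"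
  define Y where "Y = ennreal (2 ^ DIM('a) * N) * X"
  have L: "L2 ?R (grad w)" by (intro L2_continuous_bounded continuous_grad w) auto
  then have Xf: "X < \<infinity>" by (simp add: L2_iff X_def)
  have Yf: "Y < \<infinity>" unfolding Y_def using Xf by (simp add: ennreal_mult_less_top)
  have [measurable]: "w \<in> borel_measurable borel" by (intro borel_measurable_continuous_onI smooth_continuous w)
  have D: "emeasure lborel ?D = ennreal (2 ^ DIM('a)) * emeasure lborel ?R"
  proof -
    have "emeasure lborel ?D = ennreal (\<Prod>b\<in>Basis. 2 * ((u - l) \<bullet> b))"
      using ne by (subst emeasure_lborel_box) (auto simp: inner_diff_left less_imp_le intro!: arg_cong[where f=ennreal] prod.cong)
    also have "\<dots> = ennreal (2 ^ DIM('a) * (\<Prod>b\<in>Basis. (u - l) \<bullet> b))"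
      by (simp add: prod.distrib)
    also have "\<dots> = ennreal (2 ^ DIM('a)) * emeasure lborel ?R"
      using ne by (subst emeasure_lborel_box) (auto simp: less_imp_le inner_diff_left intro!: ennreal_mult prod_nonneg)
    finally show ?thesis .
  qed
  have "0 < (\<Prod>b\<in>Basis. (u - l) \<bullet> b)" using ne by (intro prod_pos) (simp add: inner_diff_left)
  then have R0: "emeasure lborel ?R \<noteq> 0" "emeasure lborel ?R < \<infinity>"
    using ne emeasure_lborel_box_finite[of l u] by (auto simp: emeasure_lborel_box_eq less_imp_le ennreal_eq_0_iff)
  assume "\<not> ?thesis"
  then have no: "Y + ennreal e < sqi ?R (\<lambda>z. w z - c)" for c
    unfolding Y_def X_def N_def by (simp add: not_le)
  have "(Y + ennreal e) * emeasure lborel ?R = (\<integral>\<^sup>+z. (Y + ennreal e) * indicator ?R z \<partial>lborel)"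
    by (simp add: nn_integral_cmult_indicator)
  also have "\<dots> \<le> (\<integral>\<^sup>+z. (\<integral>\<^sup>+z'. ennreal ((w z' - w z)\<^sup>2) * indicator ?R z' \<partial>lborel) * indicator ?R z \<partial>lborel)"
  proof (intro nn_integral_mono mult_right_mono)
    fix z
    show "Y + ennreal e \<le> (\<integral>\<^sup>+z'. ennreal ((w z' - w z)\<^sup>2) * indicator ?R z' \<partial>lborel)"
      using no[of "w z"] by (simp add: sqi_lborel)
  qed simp
  also have "\<dots> = (\<integral>\<^sup>+z. (\<integral>\<^sup>+v. ennreal ((w (v + z) - w z)\<^sup>2) * indicator ?R (v + z) * indicator ?R z \<partial>lborel) \<partial>lborel)"
  proof (intro nn_integral_cong)
    fix z
    have "(\<integral>\<^sup>+z'. ennreal ((w z' - w z)\<^sup>2) * indicator ?R z' \<partial>lborel) = (\<integral>\<^sup>+v. ennreal ((w (v + z) - w z)\<^sup>2) * indicator ?R (v + z) \<partial>lborel)"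
      by (rule nn_integral_translate[symmetric]) measurable
    then show "(\<integral>\<^sup>+z'. ennreal ((w z' - w z)\<^sup>2) * indicator ?R z' \<partial>lborel) * indicator ?R z
        = (\<integral>\<^sup>+v. ennreal ((w (v + z) - w z)\<^sup>2) * indicator ?R (v + z) * indicator ?R z \<partial>lborel)"
      by (subst nn_integral_multc) auto
  qed
  also have "\<dots> = (\<integral>\<^sup>+v. (\<integral>\<^sup>+z. ennreal ((w (v + z) - w z)\<^sup>2) * indicator ?R (v + z) * indicator ?R z \<partial>lborel) \<partial>lborel)"
    by (rule lborel_pair.Fubini') measurable
  also have "\<dots> \<le> (\<integral>\<^sup>+v. (ennreal N * X) * indicator ?D v \<partial>lborel)"
  proof (intro nn_integral_mono)
    fix v
    define A where "A = {z. v + z \<in> ?R \<and> z \<in> ?R}"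
    have A: "A = (+) (- v) ` ?R \<inter> ?R" by (auto simp: A_def image_iff intro!: bexI[of _ "v + _"])
    have "open A" unfolding A by (intro open_Int open_translation open_box)
    show "(\<integral>\<^sup>+z. ennreal ((w (v + z) - w z)\<^sup>2) * indicator ?R (v + z) * indicator ?R z \<partial>lborel) \<le> (ennreal N * X) * indicator ?D v"
    proof (cases "v \<in> ?D")
      case True
      have "(\<integral>\<^sup>+z. ennreal ((w (v + z) - w z)\<^sup>2) * indicator ?R (v + z) * indicator ?R z \<partial>lborel)
        = (\<integral>\<^sup>+z. ennreal ((w (z + v) - w z)\<^sup>2) * indicator A z \<partial>lborel)"
        by (intro nn_integral_cong) (auto simp: A_def add.commute split: split_indicator)
      also have "\<dots> \<le> ennreal ((norm v)\<^sup>2) * (\<integral>\<^sup>+z. ennreal ((norm (grad w z))\<^sup>2) * indicator ?R z \<partial>lborel)"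
      proof (rule smooth_translation_ineq[OF w])
        fix z s assume z: "z \<in> A" and s: "0 < s" "s < (1::real)"
        have "(1 - s) *\<^sub>R z + s *\<^sub>R (v + z) \<in> ?R"
          using z s by (intro convexD[OF convex_box(2)]) (auto simp: A_def)
        then show "z + s *\<^sub>R v \<in> ?R" by (simp add: algebra_simps)
      qed (use \<open>open A\<close> in auto)
      also have "\<dots> = ennreal ((norm v)\<^sup>2) * X" unfolding X_def by (subst sqi_lborel) auto
      also have "\<dots> \<le> ennreal N * X"
      proof (intro mult_right_mono ennreal_leI)
        have "norm v \<le> norm (u - l)"
        proof (rule norm_le_componentwise)
          fix b :: 'a assume "b \<in> Basis"
          then show "\<bar>v \<bullet> b\<bar> \<le> \<bar>(u - l) \<bullet> b\<bar>"
            using True ne[of b] by (force simp: mem_box inner_diff_left abs_le_iff)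
        qed
        then show "(norm v)\<^sup>2 \<le> N" unfolding N_def by (intro power_mono) auto
      qed simp
      finally show ?thesis using True by simp
    next
      case False
      have "\<not> (v + z \<in> ?R \<and> z \<in> ?R)" for z
      proof
        assume "v + z \<in> ?R \<and> z \<in> ?R"
        then have "v \<in> ?D" by (force simp: mem_box inner_add_left inner_diff_left)
        then show False using False by simp
      qed
      then have "(\<integral>\<^sup>+z. ennreal ((w (v + z) - w z)\<^sup>2) * indicator ?R (v + z) * indicator ?R z \<partial>lborel) = (\<integral>\<^sup>+z. 0 \<partial>(lborel :: 'a measure))"
        by (intro nn_integral_cong) (auto split: split_indicator)
      then show ?thesis by simp
    qed
  qed
  also have "\<dots> = (ennreal N * X) * (ennreal (2 ^ DIM('a)) * emeasure lborel ?R)"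
    by (simp add: nn_integral_cmult_indicator D)
  also have "\<dots> = Y * emeasure lborel ?R"
    unfolding Y_def N_def by (simp add: ennreal_mult mult_ac)
  finally have "Y * emeasure lborel ?R + ennreal e * emeasure lborel ?R \<le> Y * emeasure lborel ?R" by (simp add: distrib_right)
  moreover have "Y * emeasure lborel ?R < top" using Yf R0 by (simp add: ennreal_mult_less_top)
  ultimately have "ennreal e * emeasure lborel ?R \<le> 0"
    using ennreal_add_left_cancel_le[of "Y * emeasure lborel ?R" "ennreal e * emeasure lborel ?R" 0] by auto
  then show False using R0 e by (simp add: ennreal_eq_0_iff)
qed

text \<open>Approximation by smooth functions costs a factor of two for the function and another one for the gradient.\<close>

lemma box_Poincare:
  fixes u :: "'a::euclidean_space \<Rightarrow> real"
  assumes ne: "\<And>b. b \<in> Basis \<Longrightarrow> l \<bullet> b < r \<bullet> b" and e: "e > 0"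
    and u: "lmeas (box l r) u" "lmeas (box l r) g"
    and app: "\<And>e. e > 0 \<Longrightarrow> \<exists>w. smooth w \<and> sqi (box l r) (\<lambda>z. w z - u z) \<le> ennreal e \<and> sqi (box l r) (\<lambda>z. grad w z - g z) \<le> ennreal e"
  shows "\<exists>c. sqi (box l r) (\<lambda>z. u z - c) \<le> ennreal (2 ^ (DIM('a) + 2) * (norm (r - l))\<^sup>2) * sqi (box l r) g + ennreal e"
proof -
  let ?R = "box l r"
  define k where "k = 2 ^ DIM('a) * (norm (r - l))\<^sup>2"
  have k: "k \<ge> 0" by (simp add: k_def)
  define e' where "e' = e / (4 + 4 * k)"
  have e': "e' > 0" using e k by (simp add: e'_def)
  obtain w where w: "smooth w" "sqi ?R (\<lambda>z. w z - u z) \<le> ennreal e'" "sqi ?R (\<lambda>z. grad w z - g z) \<le> ennreal e'"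
    using app[OF e'] by blast
  obtain c where c: "sqi ?R (\<lambda>z. w z - c) \<le> ennreal k * sqi ?R (grad w) + ennreal e'"
    using smooth_box_Poincare[OF w(1) ne e'] unfolding k_def by blast
  note m = lmeas_continuous[OF smooth_continuous[OF w(1)], of ?R] lmeas_continuous[OF continuous_grad[OF w(1)], of ?R]
  have "sqi ?R (grad w) \<le> 2 * sqi ?R (\<lambda>z. grad w z - g z) + 2 * sqi ?R g"
    using sqi_triangle[OF m(2) u(2), of "\<lambda>_. 0"] by simp
  also have "\<dots> \<le> 2 * ennreal e' + 2 * sqi ?R g" by (intro add_mono mult_left_mono w) auto
  finally have gw: "sqi ?R (grad w) \<le> 2 * ennreal e' + 2 * sqi ?R g" .
  have "sqi ?R (\<lambda>z. u z - c) \<le> 2 * sqi ?R (\<lambda>z. w z - u z) + 2 * sqi ?R (\<lambda>z. w z - c)"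
    using sqi_triangle[OF u(1) m(1), of "\<lambda>_. c"] by (simp add: sqi_diff_commute[of ?R u])
  also have "\<dots> \<le> 2 * ennreal e' + 2 * (ennreal k * (2 * ennreal e' + 2 * sqi ?R g) + ennreal e')"
    by (intro add_mono mult_left_mono w order_trans[OF c] gw) auto
  also have "\<dots> = ennreal (4 * k) * sqi ?R g + ennreal ((4 + 4 * k) * e')"
  proof -
    have alg: "2 * x + 2 * (K * (2 * x + 2 * s) + x) = (4 * K) * s + (4 + 4 * K) * x" for x K s :: ennreal
    proof -
      have "x * 2 + x * 2 = x * 4" by (simp flip: distrib_left)
      then show ?thesis by (simp add: distrib_left distrib_right mult_ac add_ac)
    qed
    have "ennreal ((4 + 4 * k) * e') = (4 + 4 * ennreal k) * ennreal e'" "ennreal (4 * k) = 4 * ennreal k"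
      using k e' by (simp_all add: ennreal_mult ennreal_plus)
    then show ?thesis unfolding alg by simp
  qed
  also have "(4 + 4 * k) * e' = e" using k by (simp add: e'_def)
  also have "4 * k = 2 ^ (DIM('a) + 2) * (norm (r - l))\<^sup>2" by (simp add: k_def power_add)
  finally show ?thesis by blast
qed

section \<open>Exhaustion of subgraphs by pillars\<close>

lemma Omega_iff: "z \<in> Omega h \<longleftrightarrow> 0 < snd z \<and> snd z < h (fst z)"
  by (cases z) (simp add: Omega_def)

lemma Omega_open:
  assumes "continuous_on UNIV h" shows "open (Omega h)"
proof -
  have "continuous_on UNIV (\<lambda>z::real \<times> real. h (fst z))"
    by (rule continuous_on_compose2[OF assms]) (auto intro: continuous_intros)
  then have "open ({z. 0 < snd z} \<inter> {z. snd z < h (fst z)})"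
    by (intro open_Int open_Collect_less continuous_intros)
  moreover have "Omega h = {z. 0 < snd z} \<inter> {z. snd z < h (fst z)}" by (auto simp: Omega_iff)
  ultimately show ?thesis by simp
qed

lemma Omega_lebesgue: "continuous_on UNIV h \<Longrightarrow> Omega h \<in> sets lebesgue"
  using Omega_open by auto

lemma sqi_indicator_measurable:
  assumes "lmeas U f" "U \<in> sets lebesgue"
  shows "(\<lambda>z. ennreal ((norm (f z))\<^sup>2) * indicator U z) \<in> borel_measurable lebesgue"
proof -
  have "(\<lambda>x. ennreal ((norm (f x))\<^sup>2)) \<in> borel_measurable (lebesgue_on U)" using assms(1) by measurable
  then show ?thesis using assms(2) by (subst borel_measurable_restrict_space_iff_ennreal[symmetric]) auto
qed

lemma sqi_lebesgue:
  assumes "U \<in> sets lebesgue" shows "sqi U f = (\<integral>\<^sup>+z. ennreal ((norm (f z))\<^sup>2) * indicator U z \<partial>lebesgue)"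
  unfolding sqi_def using assms by (subst nn_integral_restrict_space) auto

lemma AE_fst_irrational: "AE z in (lebesgue :: (real \<times> real) measure). fst z \<notin> \<rat>"
proof -
  have "{z::real \<times> real. fst z = q} \<in> null_sets lebesgue" for q
  proof -
    have "{z::real \<times> real. fst z = q} = {z. z \<bullet> (1, 0) = q}" by (auto simp: inner_prod_def)
    moreover have "negligible {z::real \<times> real. z \<bullet> (1, 0) = q}"
      by (rule negligible_standard_hyperplane) (simp add: Basis_prod_def)
    ultimately show ?thesis by (simp add: negligible_iff_null_sets)
  qed
  then have "(\<Union>q\<in>\<rat>. {z::real \<times> real. fst z = q}) \<in> null_sets lebesgue"
    by (intro null_sets_UN' countable_rat) auto
  then have "AE z in (lebesgue :: (real \<times> real) measure). z \<notin> (\<Union>q\<in>\<rat>. {z. fst z = q})" by (rule AE_not_in)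
  then show ?thesis by eventually_elim auto
qed

text \<open>Lower Riemann sums: \<open>Omega h\<close> is exhausted, up to vertical lines, by the pillars below the minima of
  \<open>h\<close> on the cells of a fine partition, so that inequalities on pillars pass to \<open>Omega h\<close>.\<close>

lemma pillar_exhaustion:
  fixes F G :: "real \<times> real \<Rightarrow> ennreal"
  assumes h: "continuous_on UNIV h" and FG: "F \<in> borel_measurable lebesgue" "G \<in> borel_measurable lebesgue"
    and H: "\<And>a b d. a < b \<Longrightarrow> 0 < d \<Longrightarrow> pillar a b d \<subseteq> Omega h \<Longrightarrow>
       (\<integral>\<^sup>+z. F z * indicator (pillar a b d) z \<partial>lebesgue) \<le> (\<integral>\<^sup>+z. G z * indicator (pillar a b d) z \<partial>lebesgue)"
  shows "(\<integral>\<^sup>+z. F z * indicator (Omega h) z \<partial>lebesgue) \<le> (\<integral>\<^sup>+z. G z * indicator (Omega h) z \<partial>lebesgue)"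
proof -
  define N where "N n = real (Suc n)" for n
  have N: "N n > 0" for n by (simp add: N_def)
  define I where "I n j = {real_of_int j / N n .. (real_of_int j + 1) / N n}" for n j
  \<comment> \<open>height of the pillar over the cell \<open>I n j\<close>; it may be negative, and the pillar is then empty\<close>
  define m where "m n j = (SOME \<mu>. (\<exists>x\<in>I n j. h x = \<mu>) \<and> (\<forall>y\<in>I n j. \<mu> \<le> h y))" for n j
  have m: "(\<exists>x\<in>I n j. h x = m n j) \<and> (\<forall>y\<in>I n j. m n j \<le> h y)" for n j
  proof -
    have "I n j \<noteq> {}" using N[of n] by (auto simp: I_def divide_right_mono)
    then have "\<exists>x\<in>I n j. \<forall>y\<in>I n j. h x \<le> h y"
      by (intro continuous_attains_inf continuous_on_subset[OF h]) (auto simp: I_def)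
    then have "\<exists>\<mu>. (\<exists>x\<in>I n j. h x = \<mu>) \<and> (\<forall>y\<in>I n j. \<mu> \<le> h y)" by blast
    then show ?thesis unfolding m_def by (rule someI_ex)
  qed
  define P where "P n j = pillar (real_of_int j / N n) ((real_of_int j + 1) / N n) (m n j)" for n j
  \<comment> \<open>finitely many cells of width \<open>1 / (n + 1)\<close> that cover the interval of radius \<open>n + 1\<close>\<close>
  define J where "J n = {- int ((Suc n)\<^sup>2)..int ((Suc n)\<^sup>2)}" for n
  have Pm: "P n j \<in> sets lebesgue" for n j unfolding P_def by (rule pillar_lebesgue)
  have Psub: "P n j \<subseteq> Omega h" for n j
  proof
    fix z assume "z \<in> P n j"
    then have "fst z \<in> I n j" "0 < snd z" "snd z < m n j" by (auto simp: P_def I_def)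
    then show "z \<in> Omega h" using m[of n j] by (fastforce simp: Omega_iff)
  qed
  have Pfloor: "j = \<lfloor>fst z * N n\<rfloor>" if "z \<in> P n j" for n j z
  proof -
    have "real_of_int j / N n < fst z" "fst z < (real_of_int j + 1) / N n" using that by (auto simp: P_def)
    then have "real_of_int j < fst z * N n" "fst z * N n < real_of_int j + 1"
      using N[of n] by (simp_all add: pos_divide_less_eq pos_less_divide_eq)
    then show ?thesis by linarith
  qed
  \<comment> \<open>every point lies in at most one pillar of a partition, so the sum has at most one term\<close>
  have Psum: "(\<Sum>j\<in>J n. K z * indicator (P n j) z) = (if \<lfloor>fst z * N n\<rfloor> \<in> J n then K z * indicator (P n \<lfloor>fst z * N n\<rfloor>) z else 0)"
    for n z and K :: "real \<times> real \<Rightarrow> ennreal"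
  proof -
    have "(\<Sum>j\<in>J n. K z * indicator (P n j) z) = (\<Sum>j\<in>J n. if j = \<lfloor>fst z * N n\<rfloor> then K z * indicator (P n j) z else 0)"
      using Pfloor by (intro sum.cong refl) (auto split: split_indicator)
    also have "\<dots> = (if \<lfloor>fst z * N n\<rfloor> \<in> J n then K z * indicator (P n \<lfloor>fst z * N n\<rfloor>) z else 0)"
      by (subst sum.delta) (auto simp: J_def)
    finally show ?thesis .
  qed
  have mK: "(\<lambda>z. K z * indicator (P n j) z) \<in> borel_measurable lebesgue" if "K \<in> borel_measurable lebesgue" for K :: "real \<times> real \<Rightarrow> ennreal" and n j
    using that Pm by (intro borel_measurable_times_ennreal borel_measurable_indicator) auto
  have bound: "(\<integral>\<^sup>+z. (\<Sum>j\<in>J n. F z * indicator (P n j) z) \<partial>lebesgue) \<le> (\<integral>\<^sup>+z. G z * indicator (Omega h) z \<partial>lebesgue)" for n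
  proof -
    have "(\<integral>\<^sup>+z. (\<Sum>j\<in>J n. F z * indicator (P n j) z) \<partial>lebesgue) = (\<Sum>j\<in>J n. \<integral>\<^sup>+z. F z * indicator (P n j) z \<partial>lebesgue)"
      by (intro nn_integral_sum mK FG)
    also have "\<dots> \<le> (\<Sum>j\<in>J n. \<integral>\<^sup>+z. G z * indicator (P n j) z \<partial>lebesgue)"
    proof (intro sum_mono)
      fix j
      show "(\<integral>\<^sup>+z. F z * indicator (P n j) z \<partial>lebesgue) \<le> (\<integral>\<^sup>+z. G z * indicator (P n j) z \<partial>lebesgue)"
      proof (cases "m n j > 0")
        case True
        show ?thesis unfolding P_def
          by (rule H) (use True Psub[of n j] N[of n] in \<open>auto simp: P_def divide_strict_right_mono\<close>)
      next
        case False
        then have "P n j = {}" by (auto simp: P_def)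
        then show ?thesis by simp
      qed
    qed
    also have "\<dots> = (\<integral>\<^sup>+z. (\<Sum>j\<in>J n. G z * indicator (P n j) z) \<partial>lebesgue)"
      by (intro nn_integral_sum[symmetric] mK FG)
    also have "\<dots> \<le> (\<integral>\<^sup>+z. G z * indicator (Omega h) z \<partial>lebesgue)"
    proof (intro nn_integral_mono)
      fix z
      show "(\<Sum>j\<in>J n. G z * indicator (P n j) z) \<le> G z * indicator (Omega h) z"
        unfolding Psum using Psub[of n "\<lfloor>fst z * N n\<rfloor>"] by (auto split: split_indicator)
    qed
    finally show ?thesis .
  qed
  have "(\<integral>\<^sup>+z. F z * indicator (Omega h) z \<partial>lebesgue) \<le> (\<integral>\<^sup>+z. liminf (\<lambda>n. \<Sum>j\<in>J n. F z * indicator (P n j) z) \<partial>lebesgue)"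
  proof (rule nn_integral_mono_AE)
    show "AE z in lebesgue. F z * indicator (Omega h) z \<le> liminf (\<lambda>n. \<Sum>j\<in>J n. F z * indicator (P n j) z)"
      \<comment> \<open>an irrational abscissa is never an end point of a cell\<close>
      using AE_fst_irrational
    proof eventually_elim
      case (elim z)
      show ?case
      proof (cases "z \<in> Omega h")
        case True
        define x y where "x = fst z" and "y = snd z"
        have y: "0 < y" "y < h x" using True by (auto simp: Omega_iff x_def y_def)
        have "isCont h x" using h by (simp add: continuous_on_eq_continuous_at)
        then have "\<forall>\<^sub>F x' in nhds x. y < h x'"
          using y(2) by (intro order_tendstoD(1)) (simp add: continuous_at tendsto_at_iff_tendsto_nhds)
        then obtain r where r: "r > 0" "\<And>x'. dist x' x < r \<Longrightarrow> y < h x'"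
          unfolding eventually_nhds_metric by blast
        obtain n0 :: nat where n0: "max (1 / r) (\<bar>x\<bar> + 1) < real n0" using reals_Archimedean2 by blast
        have "z \<in> P n \<lfloor>x * N n\<rfloor> \<and> \<lfloor>x * N n\<rfloor> \<in> J n" if n: "n \<ge> n0" for n
        proof -
          define j where "j = \<lfloor>x * N n\<rfloor>"
          have Nn: "1 / r < N n" "\<bar>x\<bar> + 1 < N n" using n0 n by (auto simp: N_def)
          have j: "real_of_int j \<le> x * N n" "x * N n < real_of_int j + 1" by (auto simp: j_def)
          have "real_of_int j \<noteq> x * N n"
          proof
            assume "real_of_int j = x * N n"
            then have "x = real_of_int j / real_of_int (int (Suc n))" using N[of n] by (simp add: N_def field_simps)
            then have "x \<in> \<rat>" by (metis Rats_divide Rats_of_int)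
            then show False using elim by (simp add: x_def)
          qed
          then have j': "real_of_int j < x * N n" using j by simp
          have xI: "real_of_int j / N n < x" "x < (real_of_int j + 1) / N n"
            using j' j N[of n] by (simp_all add: pos_divide_less_eq pos_less_divide_eq)
          have "1 / N n < r" using Nn r N[of n] by (simp add: field_simps)
          obtain x' where x': "x' \<in> I n j" "h x' = m n j" using m[of n j] by blast
          have "real_of_int j / N n \<le> x'" "x' \<le> real_of_int j / N n + 1 / N n"
            using x' by (auto simp: I_def add_divide_distrib)
          then have "dist x' x < r" using xI \<open>1 / N n < r\<close> by (auto simp: dist_real_def add_divide_distrib abs_less_iff)
          then have "y < m n j" using r x' by metis
          then have 1: "z \<in> P n j" using xI y by (cases z) (auto simp: P_def x_def y_def)
          have "\<bar>x\<bar> * N n + 1 \<le> N n * N n"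
          proof -
            have "1 \<le> N n" by (simp add: N_def)
            then have "\<bar>x\<bar> * N n + 1 \<le> (\<bar>x\<bar> + 1) * N n" by (simp add: distrib_right)
            also have "\<dots> \<le> N n * N n" using Nn N[of n] by (intro mult_right_mono) auto
            finally show ?thesis .
          qed
          moreover have "\<bar>x * N n\<bar> = \<bar>x\<bar> * N n" using N[of n] by (simp add: abs_mult)
          ultimately have "\<bar>real_of_int j\<bar> \<le> N n * N n" using j by linarith
          then have "\<bar>real_of_int j\<bar> \<le> real_of_int (int ((Suc n)\<^sup>2))" by (simp add: N_def power2_eq_square algebra_simps)
          then have "\<bar>j\<bar> \<le> int ((Suc n)\<^sup>2)" by linarith
          then have "j \<in> J n" by (auto simp: J_def)
          with 1 show ?thesis by (simp add: j_def)
        qed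
        then have "\<forall>\<^sub>F n in sequentially. F z * indicator (Omega h) z \<le> (\<Sum>j\<in>J n. F z * indicator (P n j) z)"
          unfolding Psum x_def by (intro eventually_sequentiallyI[of n0]) (auto split: split_indicator)
        then show ?thesis by (rule Liminf_bounded)
      qed simp
    qed
  qed
  also have "\<dots> \<le> liminf (\<lambda>n. \<integral>\<^sup>+z. (\<Sum>j\<in>J n. F z * indicator (P n j) z) \<partial>lebesgue)"
    by (rule nn_integral_liminf) (intro borel_measurable_sum mK FG)
  also have "\<dots> \<le> liminf (\<lambda>n::nat. \<integral>\<^sup>+z. G z * indicator (Omega h) z \<partial>lebesgue)"
    by (intro Liminf_mono always_eventually allI bound)
  finally show ?thesis by (simp add: Liminf_const)
qed

text \<open>Integrate upwards from the axis: the value at \<open>(x, y)\<close> is the value at \<open>(x, 0)\<close> plus an integral of the derivative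
  over a segment of length at most \<open>d\<close>.\<close>

lemma smooth_pillar_trace:
  fixes w :: "real \<times> real \<Rightarrow> real"
  assumes w: "smooth w" and d: "0 < d"
  shows "sqi (pillar a b d) w \<le> ennreal (2 * d) * sqi {a<..<b} (\<lambda>x. w (x, 0)) + ennreal (2 * d\<^sup>2) * sqi (pillar a b d) (grad w)"
proof -
  have c: "continuous_on UNIV w" "continuous_on UNIV (grad w)" using w by (auto intro: smooth_continuous continuous_grad)
  have [measurable]: "w \<in> borel_measurable (borel \<Otimes>\<^sub>M borel)" "grad w \<in> borel_measurable (borel \<Otimes>\<^sub>M borel)"
    using c by (auto simp: borel_prod intro: borel_measurable_continuous_onI)
  define K where "K x = (\<integral>\<^sup>+y. ennreal ((norm (grad w (x, y)))\<^sup>2) * indicator {0<..<d} y \<partial>lborel)" for x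
  have [measurable]: "K \<in> borel_measurable borel" unfolding K_def by measurable
  have Ton: "sqi (pillar a b d) f = (\<integral>\<^sup>+x. (\<integral>\<^sup>+y. ennreal ((norm (f (x, y)))\<^sup>2) * indicator {0<..<d} y \<partial>lborel) * indicator {a<..<b} x \<partial>lborel)"
    if [measurable]: "f \<in> borel_measurable (borel \<Otimes>\<^sub>M borel)" for f :: "real \<times> real \<Rightarrow> 'b::euclidean_space"
  proof -
    have "sqi (pillar a b d) f = (\<integral>\<^sup>+z. ennreal ((norm (f z))\<^sup>2) * (indicator {a<..<b} (fst z) * indicator {0<..<d} (snd z)) \<partial>(lborel \<Otimes>\<^sub>M lborel))"
      unfolding lborel_prod by (subst sqi_lborel[OF pillar_lebesgue]) (auto intro!: nn_integral_cong split: split_indicator)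
    also have "\<dots> = (\<integral>\<^sup>+x. (\<integral>\<^sup>+y. ennreal ((norm (f (x, y)))\<^sup>2) * (indicator {a<..<b} x * indicator {0<..<d} y) \<partial>lborel) \<partial>lborel)"
      by (subst lborel.nn_integral_fst[symmetric]) auto
    also have "\<dots> = (\<integral>\<^sup>+x. (\<integral>\<^sup>+y. ennreal ((norm (f (x, y)))\<^sup>2) * indicator {0<..<d} y \<partial>lborel) * indicator {a<..<b} x \<partial>lborel)"
      by (auto intro!: nn_integral_cong split: split_indicator)
    finally show ?thesis .
  qed
  have inner: "(\<integral>\<^sup>+y. ennreal ((norm (w (x, y)))\<^sup>2) * indicator {0<..<d} y \<partial>lborel) \<le> ennreal (2 * d) * ennreal ((norm (w (x, 0)))\<^sup>2) + ennreal (2 * d\<^sup>2) * K x" for x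
  proof -
    have pt: "ennreal ((norm (w (x, y)))\<^sup>2) * indicator {0<..<d} y \<le> (2 * ennreal ((norm (w (x, 0)))\<^sup>2) + 2 * (ennreal d * K x)) * indicator {0<..<d} y" for y
    proof (cases "y \<in> {0<..<d}")
      case True
      have c': "continuous_on UNIV (\<lambda>s. grad w ((x, 0) + s *\<^sub>R (0, 1)) \<bullet> (0, 1))"
        by (intro continuous_intros continuous_on_compose2[OF c(2)]) auto
      have "ennreal ((w (x, y) - w (x, 0))\<^sup>2) \<le> ennreal y * (\<integral>\<^sup>+s. ennreal ((grad w (x, s) \<bullet> (0, 1))\<^sup>2) * indicator {0<..<y} s \<partial>lborel)"
        using square_increment_le[OF _ directional_derivative[OF w, of "(x, 0)" "(0, 1)"] c', of 0 y] True by simp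
      also have "\<dots> \<le> ennreal d * K x"
        unfolding K_def
      proof (rule mult_mono[OF _ nn_integral_mono])
        fix s
        have "(grad w (x, s) \<bullet> (0, 1))\<^sup>2 \<le> (norm (grad w (x, s)))\<^sup>2"
          using Cauchy_Schwarz_ineq[of "grad w (x, s)" "(0, 1)"] by (simp add: power2_norm_eq_inner)
        then show "ennreal ((grad w (x, s) \<bullet> (0, 1))\<^sup>2) * indicator {0<..<y} s \<le> ennreal ((norm (grad w (x, s)))\<^sup>2) * indicator {0<..<d} s"
          using True by (auto intro: ennreal_leI split: split_indicator)
      qed (use True in \<open>auto intro: ennreal_leI\<close>)
      finally have 1: "ennreal ((w (x, y) - w (x, 0))\<^sup>2) \<le> ennreal d * K x" .
      have "(norm (w (x, y)))\<^sup>2 \<le> 2 * (norm (w (x, 0)))\<^sup>2 + 2 * (w (x, y) - w (x, 0))\<^sup>2"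
        using norm_add_sq_le[of 1 "w (x, 0)" "w (x, y) - w (x, 0)"] by simp
      then have "ennreal ((norm (w (x, y)))\<^sup>2) \<le> ennreal (2 * (norm (w (x, 0)))\<^sup>2 + 2 * (w (x, y) - w (x, 0))\<^sup>2)"
        by (rule ennreal_leI)
      also have "\<dots> = 2 * ennreal ((norm (w (x, 0)))\<^sup>2) + 2 * ennreal ((w (x, y) - w (x, 0))\<^sup>2)"
        by (simp add: ennreal_plus ennreal_mult)
      also have "\<dots> \<le> 2 * ennreal ((norm (w (x, 0)))\<^sup>2) + 2 * (ennreal d * K x)"
        by (intro add_mono mult_left_mono 1) auto
      finally show ?thesis using True by simp
    qed simp
    have "(\<integral>\<^sup>+y. ennreal ((norm (w (x, y)))\<^sup>2) * indicator {0<..<d} y \<partial>lborel) \<le> (\<integral>\<^sup>+y. (2 * ennreal ((norm (w (x, 0)))\<^sup>2) + 2 * (ennreal d * K x)) * indicator {0<..<d} y \<partial>lborel)"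
      by (intro nn_integral_mono pt)
    also have "\<dots> = (2 * ennreal ((norm (w (x, 0)))\<^sup>2) + 2 * (ennreal d * K x)) * ennreal d"
      using d by (subst nn_integral_cmult_indicator) auto
    also have "\<dots> = ennreal (2 * d) * ennreal ((norm (w (x, 0)))\<^sup>2) + ennreal (2 * d\<^sup>2) * K x"
      using d by (simp add: distrib_left distrib_right ennreal_mult power2_eq_square mult_ac)
    finally show ?thesis .
  qed
  have "sqi (pillar a b d) w \<le> (\<integral>\<^sup>+x. (ennreal (2 * d) * ennreal ((norm (w (x, 0)))\<^sup>2) + ennreal (2 * d\<^sup>2) * K x) * indicator {a<..<b} x \<partial>lborel)"
    by (subst Ton, measurable) (intro nn_integral_mono mult_right_mono inner, simp)
  also have "\<dots> = (\<integral>\<^sup>+x. ennreal (2 * d) * (ennreal ((norm (w (x, 0)))\<^sup>2) * indicator {a<..<b} x) + ennreal (2 * d\<^sup>2) * (K x * indicator {a<..<b} x) \<partial>lborel)"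
    by (intro nn_integral_cong) (simp add: distrib_right mult.assoc)
  also have "\<dots> = ennreal (2 * d) * (\<integral>\<^sup>+x. ennreal ((norm (w (x, 0)))\<^sup>2) * indicator {a<..<b} x \<partial>lborel) + ennreal (2 * d\<^sup>2) * (\<integral>\<^sup>+x. K x * indicator {a<..<b} x \<partial>lborel)"
    by (subst nn_integral_add) (auto simp: nn_integral_cmult)
  also have "(\<integral>\<^sup>+x. K x * indicator {a<..<b} x \<partial>lborel) = sqi (pillar a b d) (grad w)"
    by (subst Ton) (auto simp: K_def)
  also have "(\<integral>\<^sup>+x. ennreal ((norm (w (x, 0)))\<^sup>2) * indicator {a<..<b} x \<partial>lborel) = sqi {a<..<b} (\<lambda>x. w (x, 0))"
    by (subst sqi_lborel) auto
  finally show ?thesis .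
qed

lemma ennreal_le_mult_epsilon:
  assumes "C \<ge> 0" "\<And>e. e > 0 \<Longrightarrow> X \<le> Y + ennreal (C * e)"
  shows "X \<le> Y"
proof (rule ennreal_le_epsilon)
  fix e :: real assume "0 < e"
  then have "X \<le> Y + ennreal (C * (e / (C + 1)))" using assms by (intro assms(2)) auto
  also have "\<dots> \<le> Y + ennreal e"
    using assms(1) \<open>0 < e\<close> by (intro add_left_mono ennreal_leI) (simp add: field_simps)
  finally show "X \<le> Y + ennreal e" .
qed

lemma pillar_trace_Poincare:
  assumes d: "0 < d" and u: "lmeas (pillar a b d) u" "lmeas (pillar a b d) g" and app: "trace_approx a b d u g (\<lambda>_. 0)"
  shows "sqi (pillar a b d) u \<le> ennreal (8 * d\<^sup>2) * sqi (pillar a b d) g"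
proof (rule ennreal_le_mult_epsilon)
  let ?Q = "pillar a b d"
  fix e :: real assume e: "e > 0"
  obtain w where w: "smooth w" "sqi ?Q (\<lambda>z. w z - u z) \<le> ennreal e" "sqi ?Q (\<lambda>z. grad w z - g z) \<le> ennreal e"
    "sqi {a<..<b} (\<lambda>x. w (x, 0)) \<le> ennreal e"
    using app e unfolding trace_approx_def by force
  note m = lmeas_continuous[OF smooth_continuous[OF w(1)], of ?Q] lmeas_continuous[OF continuous_grad[OF w(1)], of ?Q]
  have "sqi ?Q (grad w) \<le> 2 * sqi ?Q (\<lambda>z. grad w z - g z) + 2 * sqi ?Q g"
    using sqi_triangle[OF m(2) u(2), of "\<lambda>_. 0"] by simp
  also have "\<dots> \<le> 2 * ennreal e + 2 * sqi ?Q g" by (intro add_mono mult_left_mono w) auto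
  finally have gw: "sqi ?Q (grad w) \<le> 2 * ennreal e + 2 * sqi ?Q g" .
  have "sqi ?Q u \<le> 2 * sqi ?Q (\<lambda>z. w z - u z) + 2 * sqi ?Q w"
    using sqi_triangle[OF u(1) m(1), of "\<lambda>_. 0"] by (simp add: sqi_diff_commute[of ?Q u])
  also have "\<dots> \<le> 2 * ennreal e + 2 * (ennreal (2 * d) * ennreal e + ennreal (2 * d\<^sup>2) * (2 * ennreal e + 2 * sqi ?Q g))"
    by (intro add_mono mult_left_mono w order_trans[OF smooth_pillar_trace[OF w(1) d]] gw) auto
  also have "\<dots> = ennreal (8 * d\<^sup>2) * sqi ?Q g + ennreal ((2 + 4 * d + 8 * d\<^sup>2) * e)"
  proof -
    have "ennreal ((2 + 4 * d + 8 * d\<^sup>2) * e) = 2 * ennreal e + 4 * (ennreal d * ennreal e) + 8 * (ennreal (d\<^sup>2) * ennreal e)"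
      "ennreal (8 * d\<^sup>2) = 8 * ennreal (d\<^sup>2)" "ennreal (2 * d) = 2 * ennreal d" "ennreal (2 * d\<^sup>2) = 2 * ennreal (d\<^sup>2)"
      using d e by (simp_all add: ennreal_mult ennreal_plus distrib_right mult.assoc)
    then show ?thesis by (simp only:) (simp add: distrib_left distrib_right mult_ac add_ac)
  qed
  finally show "sqi ?Q u \<le> ennreal (8 * d\<^sup>2) * sqi ?Q g + ennreal ((2 + 4 * d + 8 * d\<^sup>2) * e)" .
qed (use d in auto)

text \<open>A pillar inside the subgraph has height at most \<open>M\<close>, so the inequality on pillars has a uniform constant.\<close>

lemma Omega_trace_Poincare:
  assumes h: "continuous_on UNIV h" "\<And>x. h x \<le> M" and u: "lmeas (Omega h) u" "lmeas (Omega h) g"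
    and app: "\<And>a b d. a < b \<Longrightarrow> 0 < d \<Longrightarrow> pillar a b d \<subseteq> Omega h \<Longrightarrow> trace_approx a b d u g (\<lambda>_. 0)"
  shows "sqi (Omega h) u \<le> ennreal (8 * M\<^sup>2) * sqi (Omega h) g"
proof -
  let ?O = "Omega h"
  have O: "?O \<in> sets lebesgue" using Omega_lebesgue[OF h(1)] .
  let ?F = "\<lambda>z. ennreal ((norm (u z))\<^sup>2) * indicator ?O z"
  let ?G = "\<lambda>z. ennreal (8 * M\<^sup>2) * (ennreal ((norm (g z))\<^sup>2) * indicator ?O z)"
  have gm: "(\<lambda>z. ennreal ((norm (g z))\<^sup>2) * indicator ?O z) \<in> borel_measurable lebesgue" by (intro sqi_indicator_measurable u O)
  have "(\<integral>\<^sup>+z. ?F z * indicator ?O z \<partial>lebesgue) \<le> (\<integral>\<^sup>+z. ?G z * indicator ?O z \<partial>lebesgue)"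
  proof (rule pillar_exhaustion[OF h(1)])
    show "?F \<in> borel_measurable lebesgue" by (intro sqi_indicator_measurable u O)
    show "?G \<in> borel_measurable lebesgue" by (rule borel_measurable_times_ennreal[OF borel_measurable_const gm])
    fix a b d :: real assume ab: "a < b" and d: "0 < d" and sub: "pillar a b d \<subseteq> ?O"
    let ?Q = "pillar a b d"
    note Q = pillar_lebesgue[of a b d]
    have "((a + b) / 2, d') \<in> ?O" if "0 < d'" "d' < d" for d' using sub ab that by auto
    then have "d' \<le> M" if "0 < d'" "d' < d" for d' using that h(2)[of "(a + b) / 2"] by (force simp: Omega_iff)
    then have "d \<le> M" using d by (intro dense_le_bounded[of 0 d M]) auto
    have "(\<integral>\<^sup>+z. ?F z * indicator ?Q z \<partial>lebesgue) = sqi ?Q u"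
      using subsetD[OF sub] by (subst sqi_lebesgue[OF Q]) (fastforce intro!: nn_integral_cong split: split_indicator)
    also have "\<dots> \<le> ennreal (8 * d\<^sup>2) * sqi ?Q g"
      by (intro pillar_trace_Poincare d app ab sub lmeas_subset[OF u(1) sub] lmeas_subset[OF u(2) sub])
    also have "\<dots> \<le> ennreal (8 * M\<^sup>2) * sqi ?Q g"
      using d \<open>d \<le> M\<close> by (intro mult_right_mono ennreal_leI) (auto intro!: power_mono)
    also have "\<dots> = (\<integral>\<^sup>+z. ennreal (8 * M\<^sup>2) * ((ennreal ((norm (g z))\<^sup>2) * indicator ?O z) * indicator ?Q z) \<partial>lebesgue)"
    proof (subst nn_integral_cmult)
      show "(\<lambda>z. ennreal ((norm (g z))\<^sup>2) * indicator ?O z * indicator ?Q z) \<in> borel_measurable lebesgue"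
        using gm Q by (intro borel_measurable_times_ennreal[OF gm] borel_measurable_indicator)
      show "ennreal (8 * M\<^sup>2) * sqi ?Q g = ennreal (8 * M\<^sup>2) * (\<integral>\<^sup>+z. ennreal ((norm (g z))\<^sup>2) * indicator ?O z * indicator ?Q z \<partial>lebesgue)"
      proof -
        have "sqi ?Q g = (\<integral>\<^sup>+z. ennreal ((norm (g z))\<^sup>2) * indicator ?O z * indicator ?Q z \<partial>lebesgue)"
          using subsetD[OF sub] by (subst sqi_lebesgue[OF Q]) (fastforce intro!: nn_integral_cong split: split_indicator)
        then show ?thesis by simp
      qed
    qed
    also have "\<dots> = (\<integral>\<^sup>+z. ?G z * indicator ?Q z \<partial>lebesgue)" by (simp add: mult.assoc)
    finally show "(\<integral>\<^sup>+z. ?F z * indicator ?Q z \<partial>lebesgue) \<le> (\<integral>\<^sup>+z. ?G z * indicator ?Q z \<partial>lebesgue)" .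
  qed
  also have "\<dots> = (\<integral>\<^sup>+z. ?G z \<partial>lebesgue)" by (auto intro!: nn_integral_cong split: split_indicator)
  also have "\<dots> = ennreal (8 * M\<^sup>2) * sqi ?O g"
    using gm by (subst nn_integral_cmult) (auto simp: sqi_lebesgue[OF O])
  also have "(\<integral>\<^sup>+z. ?F z * indicator ?O z \<partial>lebesgue) = sqi ?O u"
    by (subst sqi_lebesgue[OF O]) (auto intro!: nn_integral_cong split: split_indicator)
  finally show ?thesis .
qed

section \<open>Existence of Dirichlet minimizers\<close>

lemma sqi_lincomb:
  assumes "lmeas U f" "lmeas U g"
  shows "sqi U (\<lambda>z. \<alpha> *\<^sub>R f z + \<beta> *\<^sub>R g z) \<le> ennreal (2 * \<alpha>\<^sup>2) * sqi U f + ennreal (2 * \<beta>\<^sup>2) * sqi U g"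
proof -
  have "sqi U (\<lambda>z. \<alpha> *\<^sub>R f z + \<beta> *\<^sub>R g z) \<le> 2 * sqi U (\<lambda>z. \<alpha> *\<^sub>R f z) + 2 * sqi U (\<lambda>z. \<beta> *\<^sub>R g z)"
    using assms by (intro sqi_add2 borel_measurable_scaleR borel_measurable_const)
  also have "\<dots> = ennreal (2 * \<alpha>\<^sup>2) * sqi U f + ennreal (2 * \<beta>\<^sup>2) * sqi U g"
    using assms by (simp add: sqi_cmult ennreal_mult mult.assoc)
  finally show ?thesis .
qed

lemma grad_lincomb:
  assumes "smooth v" "smooth w"
  shows "smooth (\<lambda>z. \<alpha> * v z + \<beta> * w z)" "grad (\<lambda>z. \<alpha> * v z + \<beta> * w z) z = \<alpha> *\<^sub>R grad v z + \<beta> *\<^sub>R grad w z"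
proof -
  have s: "smooth (\<lambda>z. \<alpha> * v z)" "smooth (\<lambda>z. \<beta> * w z)" using assms by (auto intro: smooth_mult smooth_const)
  show "smooth (\<lambda>z. \<alpha> * v z + \<beta> * w z)" by (rule smooth_add[OF s])
  show "grad (\<lambda>z. \<alpha> * v z + \<beta> * w z) z = \<alpha> *\<^sub>R grad v z + \<beta> *\<^sub>R grad w z"
    unfolding grad_add[OF s] grad_mult[OF smooth_const assms(1)] grad_mult[OF smooth_const assms(2)] by (simp add: grad_const)
qed

lemma trace_approx_lincomb:
  assumes u: "trace_approx a b d u g t" "lmeas (pillar a b d) u" "lmeas (pillar a b d) g"
    and v: "trace_approx a b d v k s" "lmeas (pillar a b d) v" "lmeas (pillar a b d) k"
    and ts: "continuous_on UNIV t" "continuous_on UNIV s"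
  shows "trace_approx a b d (\<lambda>z. \<alpha> * u z + \<beta> * v z) (\<lambda>z. \<alpha> *\<^sub>R g z + \<beta> *\<^sub>R k z) (\<lambda>x. \<alpha> * t x + \<beta> * s x)"
  unfolding trace_approx_def
proof (intro allI impI)
  let ?Q = "pillar a b d"
  fix e :: real assume e: "e > 0"
  define C where "C = 2 * \<alpha>\<^sup>2 + 2 * \<beta>\<^sup>2"
  have C: "C \<ge> 0" by (simp add: C_def)
  define e' where "e' = e / (C + 1)"
  have e': "e' > 0" using e C by (simp add: e'_def)
  have Ce: "C * e' \<le> e" using e C by (simp add: e'_def field_simps)
  obtain w where w: "smooth w" "sqi ?Q (\<lambda>z. w z - u z) \<le> ennreal e'" "sqi ?Q (\<lambda>z. grad w z - g z) \<le> ennreal e'"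
    "sqi {a<..<b} (\<lambda>x. w (x, 0) - t x) \<le> ennreal e'"
    using u(1) e' unfolding trace_approx_def by blast
  obtain y where y: "smooth y" "sqi ?Q (\<lambda>z. y z - v z) \<le> ennreal e'" "sqi ?Q (\<lambda>z. grad y z - k z) \<le> ennreal e'"
    "sqi {a<..<b} (\<lambda>x. y (x, 0) - s x) \<le> ennreal e'"
    using v(1) e' unfolding trace_approx_def by blast
  have m: "lmeas ?Q w" "lmeas ?Q y" "lmeas ?Q (grad w)" "lmeas ?Q (grad y)" 
    using w(1) y(1) by (auto intro: lmeas_continuous smooth_continuous continuous_grad)
  have *: "sqi U (\<lambda>z. \<alpha> *\<^sub>R F z + \<beta> *\<^sub>R K z) \<le> ennreal e" 
    if "lmeas U F" "lmeas U K" "sqi U F \<le> ennreal e'" "sqi U K \<le> ennreal e'"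
    for U :: "'c::euclidean_space set" and F K :: "'c \<Rightarrow> 'd::euclidean_space"
  proof -
    have "sqi U (\<lambda>z. \<alpha> *\<^sub>R F z + \<beta> *\<^sub>R K z) \<le> ennreal (2 * \<alpha>\<^sup>2) * ennreal e' + ennreal (2 * \<beta>\<^sup>2) * ennreal e'"
      by (intro order_trans[OF sqi_lincomb[OF that(1,2)]] add_mono mult_left_mono that) auto
    also have "\<dots> = ennreal (C * e')" 
      using e' by (simp add: C_def distrib_right ennreal_mult[symmetric] ennreal_plus[symmetric] del: ennreal_plus)
    also have "\<dots> \<le> ennreal e" using Ce by (rule ennreal_leI)
    finally show ?thesis .
  qed
  have "sqi ?Q (\<lambda>z. \<alpha> *\<^sub>R (w z - u z) + \<beta> *\<^sub>R (y z - v z)) \<le> ennreal e"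
    by (intro * w y borel_measurable_diff m u v)
  moreover have "sqi ?Q (\<lambda>z. \<alpha> *\<^sub>R (grad w z - g z) + \<beta> *\<^sub>R (grad y z - k z)) \<le> ennreal e"
    by (intro * w y borel_measurable_diff m u v)
  moreover have "sqi {a<..<b} (\<lambda>x. \<alpha> *\<^sub>R (w (x, 0) - t x) + \<beta> *\<^sub>R (y (x, 0) - s x)) \<le> ennreal e"
    by (intro * w y L2_lmeas[OF trace_L2] ts)
  ultimately show "\<exists>w. smooth w \<and> sqi ?Q (\<lambda>z. w z - (\<alpha> * u z + \<beta> * v z)) \<le> ennreal e \<and>
      sqi ?Q (\<lambda>z. grad w z - (\<alpha> *\<^sub>R g z + \<beta> *\<^sub>R k z)) \<le> ennreal e \<and>
      sqi {a<..<b} (\<lambda>x. w (x, 0) - (\<alpha> * t x + \<beta> * s x)) \<le> ennreal e"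
    using grad_lincomb[OF w(1) y(1), of \<alpha> \<beta>]
    by (intro exI[of _ "\<lambda>z. \<alpha> * w z + \<beta> * y z"]) (simp add: algebra_simps)
qed

lemma trace_approx_limit:
  assumes u: "\<And>n. trace_approx a b d (u n) (g n) t" "\<And>n. lmeas (pillar a b d) (u n)" "\<And>n. lmeas (pillar a b d) (g n)"
    and v: "lmeas (pillar a b d) v" "lmeas (pillar a b d) k"
    and lim: "(\<lambda>n. sqi (pillar a b d) (\<lambda>z. u n z - v z)) \<longlonglongrightarrow> 0" "(\<lambda>n. sqi (pillar a b d) (\<lambda>z. g n z - k z)) \<longlonglongrightarrow> 0"
  shows "trace_approx a b d v k t"
  unfolding trace_approx_def
proof (intro allI impI)
  let ?Q = "pillar a b d"
  fix e :: real assume e: "e > 0"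
  then have e4: "0 < ennreal (e / 4)" by simp
  have "\<forall>\<^sub>F n in sequentially. sqi ?Q (\<lambda>z. u n z - v z) < ennreal (e / 4) \<and> sqi ?Q (\<lambda>z. g n z - k z) < ennreal (e / 4)"
    by (intro eventually_conj order_tendstoD(2)[OF lim(1) e4] order_tendstoD(2)[OF lim(2) e4])
  then obtain n where n: "sqi ?Q (\<lambda>z. u n z - v z) \<le> ennreal (e / 4)" "sqi ?Q (\<lambda>z. g n z - k z) \<le> ennreal (e / 4)"
    unfolding eventually_sequentially by (meson less_imp_le order_refl)
  obtain w where w: "smooth w" "sqi ?Q (\<lambda>z. w z - u n z) \<le> ennreal (e / 4)" "sqi ?Q (\<lambda>z. grad w z - g n z) \<le> ennreal (e / 4)"
    "sqi {a<..<b} (\<lambda>x. w (x, 0) - t x) \<le> ennreal (e / 4)"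
    using u(1)[of n] e unfolding trace_approx_def by (meson divide_pos_pos zero_less_numeral)
  have m: "lmeas ?Q w" "lmeas ?Q (grad w)"
    using w(1) by (auto intro: lmeas_continuous smooth_continuous continuous_grad)
  have E: "2 * ennreal (e / 4) + 2 * ennreal (e / 4) = ennreal e"
    using e by (simp add: ennreal_mult[symmetric] ennreal_plus[symmetric] flip: ennreal_numeral del: ennreal_plus)
  have "sqi ?Q (\<lambda>z. w z - v z) \<le> 2 * ennreal (e / 4) + 2 * ennreal (e / 4)"
    by (intro order_trans[OF sqi_triangle[OF m(1) u(2)[of n] v(1)]] add_mono mult_left_mono w n) auto
  moreover have "sqi ?Q (\<lambda>z. grad w z - k z) \<le> 2 * ennreal (e / 4) + 2 * ennreal (e / 4)"
    by (intro order_trans[OF sqi_triangle[OF m(2) u(3)[of n] v(2)]] add_mono mult_left_mono w n) auto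
  moreover have "sqi {a<..<b} (\<lambda>x. w (x, 0) - t x) \<le> ennreal e"
    using e by (intro order_trans[OF w(4)] ennreal_leI) auto
  ultimately show "\<exists>w. smooth w \<and> sqi ?Q (\<lambda>z. w z - v z) \<le> ennreal e \<and> sqi ?Q (\<lambda>z. grad w z - k z) \<le> ennreal e \<and>
      sqi {a<..<b} (\<lambda>x. w (x, 0) - t x) \<le> ennreal e"
    using w(1) unfolding E by blast
qed

text \<open>A competitor together with a weak gradient. Carrying the gradient along avoids the choice in
  \<open>weak_gradient\<close>.\<close>

definition admissible_pair :: "(real \<Rightarrow> real) \<Rightarrow> (real \<times> real \<Rightarrow> real) \<Rightarrow> (real \<times> real \<Rightarrow> real \<times> real) \<Rightarrow> bool" where
  "admissible_pair h u g \<longleftrightarrow> L2 (Omega h) u \<and> has_weak_gradient (Omega h) u g \<and>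
     (\<forall>a b d. a < b \<and> 0 < d \<and> pillar a b d \<subseteq> Omega h \<longrightarrow> trace_approx a b d u g (\<lambda>x. x))"

lemma admissible_pairD:
  assumes "admissible_pair h u g"
  shows "L2 (Omega h) u" "has_weak_gradient (Omega h) u g" "L2 (Omega h) g"
    "a < b \<Longrightarrow> 0 < d \<Longrightarrow> pillar a b d \<subseteq> Omega h \<Longrightarrow> trace_approx a b d u g (\<lambda>x. x)"
  using assms by (auto simp: admissible_pair_def has_weak_gradient_def)

lemma admissible_pair_iff:
  assumes h: "continuous_on UNIV h" and u: "L2 (Omega h) u" "has_weak_gradient (Omega h) u g"
  shows "admissible_pair h u g \<longleftrightarrow> boundary_admissible h u"
proof -
  have "has_bottom_trace a b d u (\<lambda>x. x) \<longleftrightarrow> trace_approx a b d u g (\<lambda>x. x)" if sub: "pillar a b d \<subseteq> Omega h" for a b d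
    by (intro bottom_trace_iff L2_subset[OF u(1) sub] has_weak_gradient_subset[OF u(2) sub] pillar_lebesgue Omega_lebesgue[OF h] continuous_on_id)
  moreover have "H1 (Omega h) u" using u by (auto simp: H1_def)
  ultimately show ?thesis using u unfolding admissible_pair_def boundary_admissible_def by blast
qed

lemma boundary_admissible_iff:
  assumes h: "continuous_on UNIV h"
  shows "boundary_admissible h u \<longleftrightarrow> (\<exists>g. admissible_pair h u g)"
proof
  assume b: "boundary_admissible h u"
  then obtain g where g: "L2 (Omega h) u" "has_weak_gradient (Omega h) u g" by (auto simp: boundary_admissible_def H1_def)
  have "admissible_pair h u g" using b admissible_pair_iff[OF h g] by blast
  then show "\<exists>g. admissible_pair h u g" by blast
next
  assume "\<exists>g. admissible_pair h u g"
  then obtain g where g: "admissible_pair h u g" by blast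
  then show "boundary_admissible h u" using admissible_pair_iff[OF h admissible_pairD(1,2)[OF g]] by blast
qed

lemma elastic_energy_eq:
  assumes "continuous_on UNIV h" "admissible_pair h u g"
  shows "ennreal (elastic_energy u h) = sqi (Omega h) g"
  unfolding elastic_energy_def by (intro dirichlet_energy_eq Omega_open assms admissible_pairD(2)[OF assms(2)])

lemma elastic_energy_nonneg: "0 \<le> elastic_energy u h"
  unfolding elastic_energy_def by (rule dirichlet_energy_nonneg)

lemma admissible_pair_mid:
  assumes h: "continuous_on UNIV h" and u: "admissible_pair h u g" and v: "admissible_pair h v k"
  shows "admissible_pair h (\<lambda>z. (1/2) * u z + (1/2) * v z) (\<lambda>z. (1/2) *\<^sub>R g z + (1/2) *\<^sub>R k z)"
proof -
  note U = admissible_pairD[OF u] and V = admissible_pairD[OF v]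
  note O = Omega_lebesgue[OF h]
  have "L2 (Omega h) (\<lambda>z. (1/2) * u z + (1/2) * v z)"
    using L2_add[OF L2_cmult[OF U(1), of "1/2"] L2_cmult[OF V(1), of "1/2"]] by simp
  moreover have "has_weak_gradient (Omega h) (\<lambda>z. (1/2) * u z + (1/2) * v z) (\<lambda>z. (1/2) *\<^sub>R g z + (1/2) *\<^sub>R k z)"
    using L2_cmult[OF U(1), of "1/2"] L2_cmult[OF V(1), of "1/2"]
    by (intro has_weak_gradient_add has_weak_gradient_cmult U V O) auto
  moreover have "trace_approx a b d (\<lambda>z. (1/2) * u z + (1/2) * v z) (\<lambda>z. (1/2) *\<^sub>R g z + (1/2) *\<^sub>R k z) (\<lambda>x. x)"
    if P: "a < b" "0 < d" "pillar a b d \<subseteq> Omega h" for a b d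
    using trace_approx_lincomb[OF U(4)[OF P] lmeas_subset[OF L2_lmeas[OF U(1)] P(3)] lmeas_subset[OF L2_lmeas[OF U(3)] P(3)]
        V(4)[OF P] lmeas_subset[OF L2_lmeas[OF V(1)] P(3)] lmeas_subset[OF L2_lmeas[OF V(3)] P(3)] continuous_on_id continuous_on_id, of "1/2" "1/2"]
    by (simp add: id_def)
  ultimately show ?thesis unfolding admissible_pair_def by blast
qed

lemma admissible_pair_diff_le:
  assumes h: "continuous_on UNIV h" "\<And>x. h x \<le> M" and u: "admissible_pair h u g" and v: "admissible_pair h v k"
  shows "sqi (Omega h) (\<lambda>z. u z - v z) \<le> ennreal (8 * M\<^sup>2) * sqi (Omega h) (\<lambda>z. g z - k z)"
proof (rule Omega_trace_Poincare[OF h])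
  note U = admissible_pairD[OF u] and V = admissible_pairD[OF v]
  show "lmeas (Omega h) (\<lambda>z. u z - v z)" "lmeas (Omega h) (\<lambda>z. g z - k z)"
    using L2_diff[OF U(1) V(1)] L2_diff[OF U(3) V(3)] by (auto intro: L2_lmeas)
  show "trace_approx a b d (\<lambda>z. u z - v z) (\<lambda>z. g z - k z) (\<lambda>_. 0)"
    if P: "a < b" "0 < d" "pillar a b d \<subseteq> Omega h" for a b d
    using trace_approx_lincomb[OF U(4)[OF P] lmeas_subset[OF L2_lmeas[OF U(1)] P(3)] lmeas_subset[OF L2_lmeas[OF U(3)] P(3)]
        V(4)[OF P] lmeas_subset[OF L2_lmeas[OF V(1)] P(3)] lmeas_subset[OF L2_lmeas[OF V(3)] P(3)] continuous_on_id continuous_on_id, of 1 "-1"]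
    by (simp add: id_def)
qed

lemma sqi_parallelogram:
  assumes [measurable]: "lmeas U f" "lmeas U g"
  shows "sqi U (\<lambda>z. f z - g z) + 4 * sqi U (\<lambda>z. (1/2) *\<^sub>R f z + (1/2) *\<^sub>R g z) = 2 * sqi U f + 2 * sqi U g"
proof -
  let ?M = "lebesgue_on U"
  have "sqi U (\<lambda>z. f z - g z) + 4 * sqi U (\<lambda>z. (1/2) *\<^sub>R f z + (1/2) *\<^sub>R g z) =
     (\<integral>\<^sup>+z. ennreal ((norm (f z - g z))\<^sup>2) + 4 * ennreal ((norm ((1/2) *\<^sub>R f z + (1/2) *\<^sub>R g z))\<^sup>2) \<partial>?M)"
    unfolding sqi_def by (subst nn_integral_add) (auto simp: nn_integral_cmult)
  also have "\<dots> = (\<integral>\<^sup>+z. 2 * ennreal ((norm (f z))\<^sup>2) + 2 * ennreal ((norm (g z))\<^sup>2) \<partial>?M)"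
  proof (intro nn_integral_cong)
    fix z
    have "(norm (f z - g z))\<^sup>2 + 4 * (norm ((1/2) *\<^sub>R f z + (1/2) *\<^sub>R g z))\<^sup>2 = 2 * (norm (f z))\<^sup>2 + 2 * (norm (g z))\<^sup>2"
      unfolding power2_norm_eq_inner by (simp add: inner_add_left inner_add_right inner_diff_left inner_diff_right inner_commute)
    then have "ennreal ((norm (f z - g z))\<^sup>2 + 4 * (norm ((1/2) *\<^sub>R f z + (1/2) *\<^sub>R g z))\<^sup>2) = ennreal (2 * (norm (f z))\<^sup>2 + 2 * (norm (g z))\<^sup>2)"
      by (rule arg_cong)
    then show "ennreal ((norm (f z - g z))\<^sup>2) + 4 * ennreal ((norm ((1/2) *\<^sub>R f z + (1/2) *\<^sub>R g z))\<^sup>2) = 2 * ennreal ((norm (f z))\<^sup>2) + 2 * ennreal ((norm (g z))\<^sup>2)"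
      by (simp add: ennreal_plus ennreal_mult)
  qed
  also have "\<dots> = 2 * sqi U f + 2 * sqi U g"
    unfolding sqi_def by (subst nn_integral_add) (auto simp: nn_integral_cmult)
  finally show ?thesis .
qed

text \<open>Lower semicontinuity, from Young's inequality with \<open>t\<close> tending to zero after \<open>n\<close> tends to infinity.\<close>

lemma sqi_le_limit:
  assumes f: "\<And>n. lmeas U (F n)" "lmeas U f" and lim: "(\<lambda>n. sqi U (\<lambda>z. F n z - f z)) \<longlonglongrightarrow> 0"
    and m: "(\<lambda>n. sqi U (F n)) \<longlonglongrightarrow> ennreal m" "m \<ge> 0"
  shows "sqi U f \<le> ennreal m"
proof (rule ennreal_le_mult_epsilon[OF m(2)])
  fix t :: real assume t: "t > 0"
  have "sqi U f \<le> ennreal (1 + t) * sqi U (F n) + ennreal (1 + 1 / t) * sqi U (\<lambda>z. F n z - f z)" for n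
    using sqi_add[OF f(1)[of n] borel_measurable_diff[OF f(2) f(1)[of n]] t] by (simp add: sqi_diff_commute[of U f])
  moreover have "(\<lambda>n. ennreal (1 + t) * sqi U (F n) + ennreal (1 + 1 / t) * sqi U (\<lambda>z. F n z - f z))
      \<longlonglongrightarrow> ennreal (1 + t) * ennreal m + ennreal (1 + 1 / t) * 0"
    by (intro tendsto_add ennreal_tendsto_cmult m lim) auto
  ultimately have "sqi U f \<le> ennreal (1 + t) * ennreal m + ennreal (1 + 1 / t) * 0"
    by (intro LIMSEQ_le_const) auto
  also have "\<dots> = ennreal m + ennreal (m * t)"
    using t m(2) by (simp add: ennreal_mult[symmetric] ennreal_plus[symmetric] algebra_simps del: ennreal_plus)
  finally show "sqi U f \<le> ennreal m + ennreal (m * t)" .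
qed

text \<open>The direct method. The parallelogram law makes the gradients of a minimizing sequence Cauchy, the
  common trace on the axis transfers this to the functions, and all constraints survive in the limit.\<close>

lemma dirichlet_minimizer_exists:
  assumes h: "continuous_on UNIV h" "\<And>x. h x \<le> M" and v: "boundary_admissible h v"
  shows "\<exists>u. dirichlet_minimizer h u"
proof -
  let ?O = "Omega h"
  note O = Omega_lebesgue[OF h(1)]
  define m where "m = (INF v\<in>Collect (boundary_admissible h). elastic_energy v h)"
  have bdd: "bdd_below ((\<lambda>v. elastic_energy v h) ` Collect (boundary_admissible h))"
    using elastic_energy_nonneg by (auto intro!: bdd_belowI[of _ 0])
  have ne: "Collect (boundary_admissible h) \<noteq> {}" using v by auto
  have m_le: "m \<le> elastic_energy w h" if "boundary_admissible h w" for w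
    unfolding m_def by (rule cINF_lower[OF bdd]) (use that in simp)
  have m0: "0 \<le> m" unfolding m_def by (rule cINF_greatest[OF ne]) (rule elastic_energy_nonneg)
  have "\<exists>p. admissible_pair h (fst p) (snd p) \<and> sqi ?O (snd p) \<le> ennreal (m + 1 / Suc n)" for n
  proof -
    have "(INF v\<in>Collect (boundary_admissible h). elastic_energy v h) < m + 1 / Suc n" by (simp add: m_def)
    then obtain w where w: "boundary_admissible h w" "elastic_energy w h < m + 1 / Suc n"
      using cINF_less_iff[OF ne bdd] by auto
    obtain g where g: "admissible_pair h w g" using w(1) boundary_admissible_iff[OF h(1)] by blast
    have "sqi ?O g \<le> ennreal (m + 1 / Suc n)"
      unfolding elastic_energy_eq[OF h(1) g, symmetric] using w(2) by (intro ennreal_leI) simp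
    with g show ?thesis by (intro exI[of _ "(w, g)"]) simp
  qed
  then have "\<forall>n. \<exists>p. admissible_pair h (fst p) (snd p) \<and> sqi ?O (snd p) \<le> ennreal (m + 1 / Suc n)" by (rule allI)
  from choice[OF this] obtain p where p: "\<forall>n. admissible_pair h (fst (p n)) (snd (p n)) \<and> sqi ?O (snd (p n)) \<le> ennreal (m + 1 / Suc n)"
    by (elim exE)
  define u g where "u n = fst (p n)" and "g n = snd (p n)" for n
  have ug: "admissible_pair h (u n) (g n)" and le: "sqi ?O (g n) \<le> ennreal (m + 1 / Suc n)" for n
    using p by (auto simp: u_def g_def)
  note A = admissible_pairD[OF ug]
  have ge: "ennreal m \<le> sqi ?O g'" if "admissible_pair h u' g'" for u' g'
  proof -
    have "boundary_admissible h u'" using boundary_admissible_iff[OF h(1)] that by blast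
    then show ?thesis unfolding elastic_energy_eq[OF h(1) that, symmetric] by (intro ennreal_leI m_le)
  qed
  have diff: "sqi ?O (\<lambda>z. g i z - g j z) \<le> ennreal (2 / Suc i + 2 / Suc j)" for i j
  proof -
    have "sqi ?O (\<lambda>z. g i z - g j z) + 4 * ennreal m \<le> sqi ?O (\<lambda>z. g i z - g j z) + 4 * sqi ?O (\<lambda>z. (1/2) *\<^sub>R g i z + (1/2) *\<^sub>R g j z)"
      by (intro add_left_mono mult_left_mono ge[OF admissible_pair_mid[OF h(1) ug ug]]) auto
    also have "\<dots> = 2 * sqi ?O (g i) + 2 * sqi ?O (g j)"
      by (intro sqi_parallelogram L2_lmeas A)
    also have "\<dots> \<le> 2 * ennreal (m + 1 / Suc i) + 2 * ennreal (m + 1 / Suc j)"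
      by (intro add_mono mult_left_mono le) auto
    also have "\<dots> = 4 * ennreal m + ennreal (2 / Suc i + 2 / Suc j)"
    proof -
      have "2 * ennreal (m + 1 / Suc i) + 2 * ennreal (m + 1 / Suc j) = ennreal (2 * (m + 1 / Suc i) + 2 * (m + 1 / Suc j))"
      proof -
        have "2 * ennreal x = ennreal (2 * x)" if "x \<ge> 0" for x using that by (simp add: ennreal_mult)
        then show ?thesis using m0 by (subst ennreal_plus) (auto simp del: ennreal_plus)
      qed
      also have "2 * (m + 1 / Suc i) + 2 * (m + 1 / Suc j) = 4 * m + (2 / Suc i + 2 / Suc j)" by simp
      also have "ennreal \<dots> = ennreal (4 * m) + ennreal (2 / Suc i + 2 / Suc j)" using m0 by (intro ennreal_plus) auto
      finally show ?thesis using m0 by (simp add: ennreal_mult)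
    qed
    finally have "4 * ennreal m + sqi ?O (\<lambda>z. g i z - g j z) \<le> 4 * ennreal m + ennreal (2 / Suc i + 2 / Suc j)"
      by (simp add: add.commute)
    moreover have "4 * ennreal m \<noteq> top" by (simp add: ennreal_mult_eq_top_iff)
    ultimately show ?thesis by (simp add: ennreal_add_left_cancel_le)
  qed
  have cauchy: "\<exists>N. \<forall>i\<ge>N. \<forall>j\<ge>N. sqi ?O (\<lambda>z. g i z - g j z) \<le> ennreal e" if e: "e > 0" for e
  proof -
    obtain N :: nat where N: "4 / e < real N" using reals_Archimedean2 by blast
    have "2 / Suc i + 2 / Suc j \<le> e" if "i \<ge> N" "j \<ge> N" for i j
    proof -
      have "2 / real (Suc i) \<le> e / 2" if "i \<ge> N" for i
      proof -
        have "4 / e \<le> real (Suc i)" using N that by linarith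
        then show ?thesis using e by (simp add: field_simps)
      qed
      from this[OF that(1)] this[OF that(2)] show ?thesis by linarith
    qed
    then have "\<forall>i\<ge>N. \<forall>j\<ge>N. sqi ?O (\<lambda>z. g i z - g j z) \<le> ennreal e"
      using diff by (meson ennreal_leI order_trans)
    then show ?thesis ..
  qed
  obtain k where k: "L2 ?O k" "(\<lambda>n. sqi ?O (\<lambda>z. g n z - k z)) \<longlonglongrightarrow> 0"
    using Riesz_Fischer[of ?O g, OF A(3)] cauchy by blast
  have cauchy': "\<exists>N. \<forall>i\<ge>N. \<forall>j\<ge>N. sqi ?O (\<lambda>z. u i z - u j z) \<le> ennreal e" if e: "e > 0" for e
  proof -
    have M: "8 * M\<^sup>2 + 1 > 0" by (simp add: add_nonneg_pos)
    obtain N where N: "\<forall>i\<ge>N. \<forall>j\<ge>N. sqi ?O (\<lambda>z. g i z - g j z) \<le> ennreal (e / (8 * M\<^sup>2 + 1))"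
      using cauchy[of "e / (8 * M\<^sup>2 + 1)"] e M by auto
    have "sqi ?O (\<lambda>z. u i z - u j z) \<le> ennreal e" if "i \<ge> N" "j \<ge> N" for i j
    proof -
      have "sqi ?O (\<lambda>z. u i z - u j z) \<le> ennreal (8 * M\<^sup>2) * ennreal (e / (8 * M\<^sup>2 + 1))"
        using N that by (intro order_trans[OF admissible_pair_diff_le[OF h ug ug]] mult_left_mono) auto
      also have "\<dots> = ennreal (8 * M\<^sup>2 * (e / (8 * M\<^sup>2 + 1)))" using e M by (intro ennreal_mult[symmetric]) auto
      also have "\<dots> \<le> ennreal e" using e M by (intro ennreal_leI) (simp add: field_simps)
      finally show ?thesis .
    qed
    then show ?thesis by blast
  qed
  obtain w where w: "L2 ?O w" "(\<lambda>n. sqi ?O (\<lambda>z. u n z - w z)) \<longlonglongrightarrow> 0"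
    using Riesz_Fischer[of ?O u, OF A(1)] cauchy' by blast
  have wk: "admissible_pair h w k"
  proof -
    have 1: "has_weak_gradient ?O w k"
      by (rule has_weak_gradient_limit[OF A(1) w(1) A(2) k(1) w(2) k(2) O])
    have 2: "trace_approx a b d w k (\<lambda>x. x)" if P': "a < b" "0 < d" and sub: "pillar a b d \<subseteq> ?O" for a b d
    proof -
    have lim: "(\<lambda>n. sqi (pillar a b d) (\<lambda>z. u n z - w z)) \<longlonglongrightarrow> 0" "(\<lambda>n. sqi (pillar a b d) (\<lambda>z. g n z - k z)) \<longlonglongrightarrow> 0"
      by (rule tendsto_sandwich[where f="\<lambda>_. 0", OF _ _ _ w(2)], auto intro!: always_eventually sqi_mono_set sub pillar_lebesgue O)
        (rule tendsto_sandwich[where f="\<lambda>_. 0", OF _ _ _ k(2)], auto intro!: always_eventually sqi_mono_set sub pillar_lebesgue O)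
    have ca: "trace_approx a b d (u n) (g n) (\<lambda>x. x)" for n by (rule A(4)[OF P' sub])
    have m: "lmeas (pillar a b d) (u n)" "lmeas (pillar a b d) (g n)" for n
      by (rule lmeas_subset[OF L2_lmeas[OF A(1)] sub], rule lmeas_subset[OF L2_lmeas[OF A(3)] sub])
    have mw: "lmeas (pillar a b d) w" by (rule lmeas_subset[OF L2_lmeas[OF w(1)] sub])
    have mk: "lmeas (pillar a b d) k" by (rule lmeas_subset[OF L2_lmeas[OF k(1)] sub])
    show "trace_approx a b d w k (\<lambda>x. x)"
      by (rule trace_approx_limit[where u=u and g=g, OF ca m mw mk lim])
    qed
    show ?thesis unfolding admissible_pair_def using w(1) 1 2 by blast
  qed
  have "(\<lambda>n. sqi ?O (g n)) \<longlonglongrightarrow> ennreal m"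
  proof (rule tendsto_sandwich[where f="\<lambda>_. ennreal m" and h="\<lambda>n. ennreal (m + 1 / Suc n)"])
    have "(\<lambda>n. m + inverse (real (Suc n))) \<longlonglongrightarrow> m + 0" by (intro tendsto_add tendsto_const LIMSEQ_inverse_real_of_nat)
    then show "(\<lambda>n. ennreal (m + 1 / Suc n)) \<longlonglongrightarrow> ennreal m" by (intro tendsto_ennrealI) (simp add: inverse_eq_divide)
    show "\<forall>\<^sub>F n in sequentially. ennreal m \<le> sqi ?O (g n)" by (intro always_eventually allI ge[OF ug])
    show "\<forall>\<^sub>F n in sequentially. sqi ?O (g n) \<le> ennreal (m + 1 / Suc n)" by (intro always_eventually allI le)
  qed simp
  then have "sqi ?O k \<le> ennreal m"
    by (intro sqi_le_limit[OF L2_lmeas[OF A(3)] L2_lmeas[OF k(1)] k(2)] m0)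
  then have "ennreal (elastic_energy w h) \<le> ennreal m" unfolding elastic_energy_eq[OF h(1) wk] .
  then have "elastic_energy w h \<le> m" using m0 by simp
  moreover have "boundary_admissible h w" using wk boundary_admissible_iff[OF h(1)] by blast
  ultimately have "dirichlet_minimizer h w"
    unfolding dirichlet_minimizer_def using m_le by (blast intro: order_trans)
  then show ?thesis by blast
qed

section \<open>Cutting off the potential above a level\<close>

lemma lmeas_translate:
  fixes v :: "'a::euclidean_space"
  assumes "lmeas U f" "\<And>z. z \<in> A \<Longrightarrow> z + v \<in> U"
  shows "lmeas A (\<lambda>z. f (z + v))"
proof -
  have "(\<lambda>z. z + v) \<in> lebesgue_on A \<rightarrow>\<^sub>M lebesgue_on U"
    by (rule measurable_restrict_space3[OF measurable_translate_lebesgue]) (use assms(2) in auto)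
  then show ?thesis using assms(1) by (rule measurable_compose)
qed

lemma sqi_translate_le:
  fixes v :: "'a::euclidean_space"
  assumes "lmeas B f" "A \<in> sets lebesgue" "B \<in> sets lebesgue" "\<And>z. z \<in> A \<Longrightarrow> z + v \<in> B"
  shows "sqi A (\<lambda>z. f (z + v)) \<le> sqi B f"
proof -
  let ?F = "\<lambda>z. ennreal ((norm (f z))\<^sup>2) * indicator B z"
  have "sqi A (\<lambda>z. f (z + v)) \<le> (\<integral>\<^sup>+z. ?F (z + v) \<partial>lebesgue)"
    unfolding sqi_lebesgue[OF assms(2)] using assms(4) by (intro nn_integral_mono) (auto split: split_indicator)
  also have "\<dots> = (\<integral>\<^sup>+z. ?F z \<partial>lebesgue)"
    by (rule nn_integral_translate_lebesgue[OF sqi_indicator_measurable[OF assms(1,3)]])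
  finally show ?thesis by (simp add: sqi_lebesgue[OF assms(3)])
qed

text \<open>Segments pointing straight down stay inside a subgraph, whatever its shape. So vertical increments are controlled by the
  gradient, first on a pillar.\<close>

lemma pillar_vertical_increment:
  assumes J: "open J" and \<delta>: "0 < \<delta>" "\<delta> \<le> \<tau>"
    and u: "lmeas (pillar a b d) u" "lmeas (pillar a b d) g" and app: "trace_approx a b d u g t"
  shows "sqi (pillar a b d \<inter> (J \<times> {\<tau><..<\<tau>+\<delta>})) (\<lambda>z. u (z + (0, - \<delta>)) - u z)
    \<le> ennreal (4 * \<delta>\<^sup>2) * sqi (pillar a b d \<inter> (J \<times> {\<tau>-\<delta><..<\<tau>+\<delta>})) g"
proof (rule ennreal_le_mult_epsilon)
  let ?Q = "pillar a b d"
  define A where "A = ?Q \<inter> (J \<times> {\<tau><..<\<tau>+\<delta>})"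
  define A' where "A' = ?Q \<inter> (J \<times> {\<tau>-\<delta><..<\<tau>+\<delta>})"
  define v where "v = (0::real, - \<delta>)"
  have o: "open A" "open A'" unfolding A_def A'_def by (intro open_Int pillar_open open_Times J open_greaterThanLessThan)+
  have l: "A \<in> sets lebesgue" "A' \<in> sets lebesgue" using o by auto
  have AQ: "A \<subseteq> ?Q" "A' \<subseteq> ?Q" by (auto simp: A_def A'_def)
  have seg: "z + s *\<^sub>R v \<in> A'" if "z \<in> A" "0 < s" "s \<le> 1" for z s
  proof -
    define r where "r = s * \<delta>"
    have "r \<le> \<delta>" "0 < r" using that \<delta> by (auto simp: r_def mult_left_le_one_le)
    moreover have "z + s *\<^sub>R v = (fst z, snd z - r)" by (simp add: v_def r_def prod_eq_iff)
    ultimately show ?thesis using that(1) \<delta> by (auto simp: A_def A'_def)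
  qed
  have tr: "z + v \<in> A'" if "z \<in> A" for z using seg[OF that, of 1] by simp
  fix e :: real assume e: "e > 0"
  obtain w where w: "smooth w" "sqi ?Q (\<lambda>z. w z - u z) \<le> ennreal e" "sqi ?Q (\<lambda>z. grad w z - g z) \<le> ennreal e"
    using app e unfolding trace_approx_def by blast
  define F where "F = (\<lambda>z. w z - u z)"
  have m: "lmeas U w" "lmeas U (grad w)" for U
    using w(1) by (auto intro: lmeas_continuous smooth_continuous continuous_grad)
  have Fm: "lmeas ?Q F" unfolding F_def by (intro borel_measurable_diff m u)
  have mA: "lmeas A (\<lambda>z. w (z + v))" "lmeas A (\<lambda>z. F (z + v))" "lmeas A F"
    using lmeas_translate[OF m(1)[of UNIV], of A v] lmeas_translate[OF Fm, of A v] tr AQ lmeas_subset[OF Fm AQ(1)] by auto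
  have "sqi A' (grad w) \<le> 2 * sqi A' (\<lambda>z. grad w z - g z) + 2 * sqi A' g"
    using sqi_triangle[OF m(2) lmeas_subset[OF u(2) AQ(2)], of "\<lambda>_. 0"] by simp
  also have "\<dots> \<le> 2 * ennreal e + 2 * sqi A' g"
    by (intro add_mono mult_left_mono order_trans[OF sqi_mono_set w(3)] AQ l pillar_lebesgue) auto
  finally have gw: "sqi A' (grad w) \<le> 2 * ennreal e + 2 * sqi A' g" .
  have "sqi A (\<lambda>z. w (z + v) - w z) \<le> ennreal ((norm v)\<^sup>2) * sqi A' (grad w)"
    using smooth_translation_ineq[OF w(1), of A A' v] o seg by (simp add: sqi_lborel l)
  also have "(norm v)\<^sup>2 = \<delta>\<^sup>2" by (simp add: v_def norm_Pair)
  finally have 1: "sqi A (\<lambda>z. w (z + v) - w z) \<le> ennreal (\<delta>\<^sup>2) * sqi A' (grad w)" .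
  have FQ: "sqi B F \<le> ennreal e" if "B \<subseteq> ?Q" "B \<in> sets lebesgue" for B
    using order_trans[OF sqi_mono_set[OF that pillar_lebesgue] w(2)] by (simp add: F_def)
  have "sqi A (\<lambda>z. F (z + v) - F z) \<le> 2 * sqi A (\<lambda>z. F (z + v)) + 2 * sqi A F"
    using sqi_triangle[OF mA(2) _ mA(3), of "\<lambda>_. 0"] by (simp add: sqi_minus)
  also have "\<dots> \<le> 2 * ennreal e + 2 * ennreal e"
    by (intro add_mono mult_left_mono order_trans[OF sqi_translate_le FQ[OF AQ(2)]] FQ AQ l tr lmeas_subset[OF Fm AQ(2)]) auto
  finally have 2: "sqi A (\<lambda>z. F (z + v) - F z) \<le> 2 * ennreal e + 2 * ennreal e" .
  have "sqi A (\<lambda>z. u (z + v) - u z) = sqi A (\<lambda>z. (w (z + v) - w z) - (F (z + v) - F z))"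
    by (simp add: F_def algebra_simps)
  also have "\<dots> \<le> 2 * sqi A (\<lambda>z. w (z + v) - w z) + 2 * sqi A (\<lambda>z. F (z + v) - F z)"
    using sqi_triangle[OF borel_measurable_diff[OF mA(1) m(1)] _ borel_measurable_diff[OF mA(2,3)], of "\<lambda>_. 0"]
    by (simp add: sqi_diff_commute[of A F])
  also have "\<dots> \<le> 2 * (ennreal (\<delta>\<^sup>2) * (2 * ennreal e + 2 * sqi A' g)) + 2 * (2 * ennreal e + 2 * ennreal e)"
    by (intro add_mono mult_left_mono 2 order_trans[OF 1] gw) auto
  also have "\<dots> = ennreal (4 * \<delta>\<^sup>2) * sqi A' g + ennreal ((4 * \<delta>\<^sup>2 + 8) * e)"
  proof -
    have "ennreal ((4 * \<delta>\<^sup>2 + 8) * e) = 4 * (ennreal (\<delta>\<^sup>2) * ennreal e) + 8 * ennreal e"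
      "ennreal (4 * \<delta>\<^sup>2) = 4 * ennreal (\<delta>\<^sup>2)"
      using e by (simp_all add: ennreal_mult ennreal_plus distrib_right mult.assoc)
    moreover have "x * 4 + x * 4 = x * 8" for x :: ennreal by (simp flip: distrib_left)
    ultimately show ?thesis by (simp only:) (simp add: distrib_left distrib_right mult_ac add_ac)
  qed
  finally show "sqi (?Q \<inter> (J \<times> {\<tau><..<\<tau>+\<delta>})) (\<lambda>z. u (z + (0, - \<delta>)) - u z)
    \<le> ennreal (4 * \<delta>\<^sup>2) * sqi (?Q \<inter> (J \<times> {\<tau>-\<delta><..<\<tau>+\<delta>})) g + ennreal ((4 * \<delta>\<^sup>2 + 8) * e)"
    by (simp add: A_def A'_def v_def)
qed (use \<delta> in auto)

lemma Omega_vertical_increment: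
  assumes h: "continuous_on UNIV h" and J: "open J" and \<delta>: "0 < \<delta>" "\<delta> \<le> \<tau>" and u: "admissible_pair h u g"
  shows "sqi (Omega h \<inter> (J \<times> {\<tau><..<\<tau>+\<delta>})) (\<lambda>z. u (z + (0, - \<delta>)) - u z)
    \<le> ennreal (4 * \<delta>\<^sup>2) * sqi (Omega h \<inter> (J \<times> {\<tau>-\<delta><..<\<tau>+\<delta>})) g"
proof -
  let ?O = "Omega h"
  define S where "S = ?O \<inter> (J \<times> {\<tau><..<\<tau>+\<delta>})"
  define S' where "S' = ?O \<inter> (J \<times> {\<tau>-\<delta><..<\<tau>+\<delta>})"
  define v where "v = (0::real, - \<delta>)"
  note U = admissible_pairD[OF u]
  have o: "open S" "open S'" unfolding S_def S'_def
    by (intro open_Int Omega_open h open_Times J open_greaterThanLessThan)+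
  have l: "S \<in> sets lebesgue" "S' \<in> sets lebesgue" using o by auto
  have SO: "S \<subseteq> ?O" "S' \<subseteq> ?O" by (auto simp: S_def S'_def)
  have tr: "z + v \<in> ?O" if "z \<in> S" for z
    using that \<delta> by (cases z) (auto simp: S_def v_def Omega_iff)
  have mu: "lmeas S (\<lambda>z. u (z + v) - u z)"
    by (intro borel_measurable_diff lmeas_translate[OF L2_lmeas[OF U(1)] tr] lmeas_subset[OF L2_lmeas[OF U(1)] SO(1)])
  have mg: "lmeas S' g" by (rule lmeas_subset[OF L2_lmeas[OF U(3)] SO(2)])
  let ?F = "\<lambda>z. ennreal ((norm (u (z + v) - u z))\<^sup>2) * indicator S z"
  let ?K = "\<lambda>z. ennreal ((norm (g z))\<^sup>2) * indicator S' z"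
  let ?G = "\<lambda>z. ennreal (4 * \<delta>\<^sup>2) * ?K z"
  have Km: "?K \<in> borel_measurable lebesgue" by (rule sqi_indicator_measurable[OF mg l(2)])
  have "(\<integral>\<^sup>+z. ?F z * indicator ?O z \<partial>lebesgue) \<le> (\<integral>\<^sup>+z. ?G z * indicator ?O z \<partial>lebesgue)"
  proof (rule pillar_exhaustion[OF h])
    show "?F \<in> borel_measurable lebesgue" by (rule sqi_indicator_measurable[OF mu l(1)])
    show "?G \<in> borel_measurable lebesgue" by (rule borel_measurable_times_ennreal[OF borel_measurable_const Km])
    fix a b d :: real assume P: "a < b" "0 < d" and sub: "pillar a b d \<subseteq> ?O"
    let ?Q = "pillar a b d"
    note Q = pillar_lebesgue[of a b d]
    let ?A = "?Q \<inter> (J \<times> {\<tau><..<\<tau>+\<delta>})" and ?A' = "?Q \<inter> (J \<times> {\<tau>-\<delta><..<\<tau>+\<delta>})"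
    have A: "S \<inter> ?Q = ?A" "S' \<inter> ?Q = ?A'" using sub by (auto simp: S_def S'_def)
    have Am: "?A \<in> sets lebesgue" "?A' \<in> sets lebesgue" unfolding A[symmetric] using l Q by auto
    have "(\<integral>\<^sup>+z. ?F z * indicator ?Q z \<partial>lebesgue) = sqi ?A (\<lambda>z. u (z + v) - u z)"
      by (subst sqi_lebesgue[OF Am(1)], subst A(1)[symmetric], intro nn_integral_cong) (auto split: split_indicator)
    also have "\<dots> \<le> ennreal (4 * \<delta>\<^sup>2) * sqi ?A' g"
      unfolding v_def
      by (rule pillar_vertical_increment[OF J \<delta> lmeas_subset[OF L2_lmeas[OF U(1)] sub] lmeas_subset[OF L2_lmeas[OF U(3)] sub] U(4)[OF P sub]])
    also have "sqi ?A' g = (\<integral>\<^sup>+z. ?K z * indicator ?Q z \<partial>lebesgue)"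
      by (subst sqi_lebesgue[OF Am(2)], subst A(2)[symmetric], intro nn_integral_cong) (auto split: split_indicator)
    also have "ennreal (4 * \<delta>\<^sup>2) * \<dots> = (\<integral>\<^sup>+z. ennreal (4 * \<delta>\<^sup>2) * (?K z * indicator ?Q z) \<partial>lebesgue)"
      using Q by (intro nn_integral_cmult[symmetric] borel_measurable_times_ennreal[OF Km] borel_measurable_indicator)
    finally show "(\<integral>\<^sup>+z. ?F z * indicator ?Q z \<partial>lebesgue) \<le> (\<integral>\<^sup>+z. ?G z * indicator ?Q z \<partial>lebesgue)"
      by (simp add: mult.assoc)
  qed
  also have "\<dots> = (\<integral>\<^sup>+z. ?G z \<partial>lebesgue)"
    using subsetD[OF SO(2)] by (intro nn_integral_cong) (auto split: split_indicator)
  also have "\<dots> = ennreal (4 * \<delta>\<^sup>2) * sqi S' g"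
    unfolding sqi_lebesgue[OF l(2)] by (rule nn_integral_cmult[OF Km])
  also have "(\<integral>\<^sup>+z. ?F z * indicator ?O z \<partial>lebesgue) = sqi S (\<lambda>z. u (z + v) - u z)"
    unfolding sqi_lebesgue[OF l(1)] using subsetD[OF SO(1)] by (intro nn_integral_cong) (auto split: split_indicator)
  finally show ?thesis by (simp add: S_def S'_def v_def)
qed

text \<open>Above the level \<open>\<tau>\<close> the domain may have bottlenecks and no Poincare inequality of its own. The constant
  is taken from the box below the level and carried upwards along vertical segments.\<close>

lemma strip_Poincare:
  assumes h: "continuous_on UNIV h" and \<alpha>\<beta>: "\<alpha> < \<beta>" "\<beta> - \<alpha> \<le> \<delta>" and \<delta>: "\<delta> \<le> \<tau>"
    and J: "\<And>x. x \<in> {\<alpha><..<\<beta>} \<Longrightarrow> \<tau> < h x" and u: "admissible_pair h u g" and e: "e > 0"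
  shows "\<exists>c. sqi (Omega h \<inter> ({\<alpha><..<\<beta>} \<times> {\<tau><..<\<tau>+\<delta>})) (\<lambda>z. u z - c)
    \<le> ennreal (72 * \<delta>\<^sup>2) * sqi (Omega h \<inter> ({\<alpha><..<\<beta>} \<times> {\<tau>-\<delta><..<\<tau>+\<delta>})) g + ennreal e"
proof -
  let ?O = "Omega h" and ?J = "{\<alpha><..<\<beta>}"
  define S where "S = ?O \<inter> (?J \<times> {\<tau><..<\<tau>+\<delta>})"
  define S' where "S' = ?O \<inter> (?J \<times> {\<tau>-\<delta><..<\<tau>+\<delta>})"
  define v where "v = (0::real, - \<delta>)"
  define R where "R = box (\<alpha>, \<tau> - \<delta>) (\<beta>, \<tau>)"
  have R: "R = ?J \<times> {\<tau>-\<delta><..<\<tau>}" by (auto simp: R_def mem_box Basis_prod_def)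
  have \<delta>0: "0 < \<delta>" using \<alpha>\<beta> by linarith
  note U = admissible_pairD[OF u]
  have o: "open S" "open S'" unfolding S_def S'_def
    by (intro open_Int Omega_open h open_Times open_greaterThanLessThan)+
  have l: "S \<in> sets lebesgue" "S' \<in> sets lebesgue" "R \<in> sets lebesgue" using o by (auto simp: R_def)
  have SO: "S \<subseteq> ?O" "S' \<subseteq> ?O" by (auto simp: S_def S'_def)
  have tr: "z + v \<in> R" if "z \<in> S" for z
    using that by (cases z) (auto simp: S_def v_def R)
  have pil: "pillar \<alpha> \<beta> \<tau> \<subseteq> ?O" using J by (force simp: Omega_iff)
  have RP: "R \<subseteq> pillar \<alpha> \<beta> \<tau>" using \<delta> by (auto simp: R)
  have RS: "R \<subseteq> S'" using J \<delta> \<delta>0 by (force simp: R S'_def Omega_iff)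
  have RO: "R \<subseteq> ?O" using RS SO by blast
  note ca = U(4)[OF \<alpha>\<beta>(1) _ pil]
  have "\<exists>c. sqi R (\<lambda>z. u z - c) \<le> ennreal (2 ^ (DIM(real \<times> real) + 2) * (norm ((\<beta>, \<tau>) - (\<alpha>, \<tau> - \<delta>)))\<^sup>2) * sqi R g + ennreal (e / 2)"
    unfolding R_def
  proof (rule box_Poincare)
    show "(\<alpha>, \<tau> - \<delta>) \<bullet> b < (\<beta>, \<tau>) \<bullet> b" if "b \<in> Basis" for b
      using that \<alpha>\<beta> \<delta>0 by (auto simp: Basis_prod_def)
    show "lmeas (box (\<alpha>, \<tau> - \<delta>) (\<beta>, \<tau>)) u" "lmeas (box (\<alpha>, \<tau> - \<delta>) (\<beta>, \<tau>)) g"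
      using lmeas_subset[OF L2_lmeas[OF U(1)] RO] lmeas_subset[OF L2_lmeas[OF U(3)] RO] by (auto simp: R_def)
    show "\<exists>w. smooth w \<and> sqi (box (\<alpha>, \<tau> - \<delta>) (\<beta>, \<tau>)) (\<lambda>z. w z - u z) \<le> ennreal e' \<and> sqi (box (\<alpha>, \<tau> - \<delta>) (\<beta>, \<tau>)) (\<lambda>z. grad w z - g z) \<le> ennreal e'"
      if e': "e' > 0" for e'
    proof -
      have "0 < \<tau>" using \<delta> \<delta>0 by linarith
      then obtain w where w: "smooth w" "sqi (pillar \<alpha> \<beta> \<tau>) (\<lambda>z. w z - u z) \<le> ennreal e'" "sqi (pillar \<alpha> \<beta> \<tau>) (\<lambda>z. grad w z - g z) \<le> ennreal e'"
        using ca e' unfolding trace_approx_def by blast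
      note mono = sqi_mono_set[OF RP l(3) pillar_lebesgue]
      show ?thesis using w(1) order_trans[OF mono w(2)] order_trans[OF mono w(3)] unfolding R_def by blast
    qed
  qed (use e in auto)
  then obtain c where c: "sqi R (\<lambda>z. u z - c) \<le> ennreal (2 ^ (DIM(real \<times> real) + 2) * (norm ((\<beta>, \<tau>) - (\<alpha>, \<tau> - \<delta>)))\<^sup>2) * sqi R g + ennreal (e / 2)"
    by blast
  \<comment> \<open>the box is at most as wide as it is high, which bounds its diameter by a multiple of \<open>\<delta>\<close>; then \<open>72 = 2 * 4 + 2 * 32\<close>\<close>
  have "2 ^ (DIM(real \<times> real) + 2) * (norm ((\<beta>, \<tau>) - (\<alpha>, \<tau> - \<delta>)))\<^sup>2 = 16 * ((\<beta> - \<alpha>)\<^sup>2 + \<delta>\<^sup>2)"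
    by (simp add: norm_Pair)
  also have "\<dots> \<le> 32 * \<delta>\<^sup>2" using power_mono[of "\<beta> - \<alpha>" \<delta> 2] \<alpha>\<beta> by simp
  finally have k: "2 ^ (DIM(real \<times> real) + 2) * (norm ((\<beta>, \<tau>) - (\<alpha>, \<tau> - \<delta>)))\<^sup>2 \<le> 32 * \<delta>\<^sup>2" .
  have c': "sqi R (\<lambda>z. u z - c) \<le> ennreal (32 * \<delta>\<^sup>2) * sqi S' g + ennreal (e / 2)"
    by (rule order_trans[OF c]) (intro add_right_mono mult_mono ennreal_leI k sqi_mono_set RS l; simp)
  have m1: "lmeas S u" "lmeas R u" by (rule lmeas_subset[OF L2_lmeas[OF U(1)] SO(1)], rule lmeas_subset[OF L2_lmeas[OF U(1)] RO])
  have m2: "lmeas S (\<lambda>z. u (z + v))" by (rule lmeas_translate[OF m1(2) tr])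
  have "sqi S (\<lambda>z. u z - c) \<le> 2 * sqi S (\<lambda>z. u (z + v) - u z) + 2 * sqi S (\<lambda>z. u (z + v) - c)"
    using sqi_triangle[OF m1(1) m2, of "\<lambda>_. c"] by (simp add: sqi_diff_commute[of S u])
  also have "\<dots> \<le> 2 * (ennreal (4 * \<delta>\<^sup>2) * sqi S' g) + 2 * (ennreal (32 * \<delta>\<^sup>2) * sqi S' g + ennreal (e / 2))"
  proof (intro add_mono mult_left_mono)
    show "sqi S (\<lambda>z. u (z + v) - u z) \<le> ennreal (4 * \<delta>\<^sup>2) * sqi S' g"
      unfolding S_def S'_def v_def by (rule Omega_vertical_increment[OF h open_greaterThanLessThan \<delta>0 \<delta> u])
    have "sqi S (\<lambda>z. u (z + v) - c) \<le> sqi R (\<lambda>z. u z - c)"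
      using m1 by (intro sqi_translate_le[where f="\<lambda>z. u z - c"] borel_measurable_diff l tr) auto
    also note c'
    finally show "sqi S (\<lambda>z. u (z + v) - c) \<le> ennreal (32 * \<delta>\<^sup>2) * sqi S' g + ennreal (e / 2)" .
  qed auto
  also have "\<dots> = ennreal (72 * \<delta>\<^sup>2) * sqi S' g + ennreal e"
  proof -
    have "2 * ennreal (e / 2) = ennreal e" using e by (simp add: ennreal_mult[symmetric] flip: ennreal_numeral)
    moreover have "ennreal (72 * \<delta>\<^sup>2) = 72 * ennreal (\<delta>\<^sup>2)" "ennreal (4 * \<delta>\<^sup>2) = 4 * ennreal (\<delta>\<^sup>2)" "ennreal (32 * \<delta>\<^sup>2) = 32 * ennreal (\<delta>\<^sup>2)"
      by (simp_all add: ennreal_mult)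
    moreover have "2 * (4 * x) + 2 * (32 * x) = 72 * x" for x :: ennreal
    proof -
      have "2 * (4 * x) + 2 * (32 * x) = 8 * x + 64 * x" by (simp add: mult.assoc[symmetric])
      also have "\<dots> = 72 * x" by (simp flip: distrib_right)
      finally show ?thesis .
    qed
    ultimately show ?thesis by (simp add: distrib_left add.assoc[symmetric] mult.assoc)
  qed
  finally show ?thesis unfolding S_def S'_def by blast
qed

definition level_cutoff :: "real \<Rightarrow> real \<Rightarrow> real \<Rightarrow> real" where
  "level_cutoff \<tau> \<delta> y = smooth_step ((y - \<tau>) / \<delta>)"

definition level_cutoff' :: "real \<Rightarrow> real \<Rightarrow> real \<Rightarrow> real" where
  "level_cutoff' \<tau> \<delta> y = bump ((y - \<tau>) / \<delta>) / bump_mass / \<delta>"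

lemma level_cutoff_props:
  assumes "0 < \<delta>"
  shows "y \<le> \<tau> \<Longrightarrow> level_cutoff \<tau> \<delta> y = 0" "\<tau> + \<delta> \<le> y \<Longrightarrow> level_cutoff \<tau> \<delta> y = 1"
    "0 \<le> level_cutoff \<tau> \<delta> y" "level_cutoff \<tau> \<delta> y \<le> 1"
    "y \<le> \<tau> \<Longrightarrow> level_cutoff' \<tau> \<delta> y = 0" "\<tau> + \<delta> \<le> y \<Longrightarrow> level_cutoff' \<tau> \<delta> y = 0"
    "\<bar>level_cutoff' \<tau> \<delta> y\<bar> \<le> 1 / (bump_mass * \<delta>)"
    "(level_cutoff \<tau> \<delta> has_real_derivative level_cutoff' \<tau> \<delta> y) (at y)"
    "smooth (\<lambda>z::real \<times> real. level_cutoff \<tau> \<delta> (snd z))"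
proof -
  show "y \<le> \<tau> \<Longrightarrow> level_cutoff \<tau> \<delta> y = 0" "\<tau> + \<delta> \<le> y \<Longrightarrow> level_cutoff \<tau> \<delta> y = 1"
    "0 \<le> level_cutoff \<tau> \<delta> y" "level_cutoff \<tau> \<delta> y \<le> 1"
    "y \<le> \<tau> \<Longrightarrow> level_cutoff' \<tau> \<delta> y = 0" "\<tau> + \<delta> \<le> y \<Longrightarrow> level_cutoff' \<tau> \<delta> y = 0"
    using assms by (auto simp: level_cutoff_def level_cutoff'_def smooth_step_range smooth_step_0 smooth_step_1 bump_zero divide_le_0_iff)
  show "\<bar>level_cutoff' \<tau> \<delta> y\<bar> \<le> 1 / (bump_mass * \<delta>)"
    using divide_right_mono[OF bump_bound[of "(y - \<tau>) / \<delta>"], of \<delta>] assms bump_mass_pos by (simp add: level_cutoff'_def abs_divide abs_mult)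
  have "((\<lambda>y. (y - \<tau>) / \<delta>) has_real_derivative 1 / \<delta>) (at y)" using assms by (auto intro!: derivative_eq_intros)
  from DERIV_chain2[OF smooth_step_deriv this]
  show "(level_cutoff \<tau> \<delta> has_real_derivative level_cutoff' \<tau> \<delta> y) (at y)"
    by (simp add: level_cutoff_def[abs_def] level_cutoff'_def)
  have "smooth (\<lambda>z::real \<times> real. smooth_step ((0, 1 / \<delta>) \<bullet> z + (- \<tau> / \<delta>)))" by (rule smooth_affine[OF smooth_smooth_step])
  moreover have "(0, 1 / \<delta>) \<bullet> z + (- \<tau> / \<delta>) = (snd z - \<tau>) / \<delta>" for z :: "real \<times> real"
    using assms by (simp add: inner_prod_def field_simps)
  ultimately show "smooth (\<lambda>z::real \<times> real. level_cutoff \<tau> \<delta> (snd z))" by (simp add: level_cutoff_def)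
qed

lemma grad_level_cutoff:
  assumes "0 < \<delta>"
  shows "grad (\<lambda>z::real \<times> real. level_cutoff \<tau> \<delta> (snd z)) z = (0, level_cutoff' \<tau> \<delta> (snd z))"
proof (rule euclidean_eqI)
  fix b :: "real \<times> real" assume b: "b \<in> Basis"
  have "((\<lambda>z::real \<times> real. level_cutoff \<tau> \<delta> (snd z)) has_derivative (\<lambda>v. level_cutoff' \<tau> \<delta> (snd z) * snd v)) (at z)"
    by (rule has_derivative_compose[OF _ level_cutoff_props(8)[OF assms, unfolded has_field_derivative_def]])
      (auto intro!: derivative_eq_intros)
  then have "frechet_derivative (\<lambda>z::real \<times> real. level_cutoff \<tau> \<delta> (snd z)) (at z) = (\<lambda>v. level_cutoff' \<tau> \<delta> (snd z) * snd v)"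
    by (rule frechet_derivative_at[symmetric])
  then show "grad (\<lambda>z::real \<times> real. level_cutoff \<tau> \<delta> (snd z)) z \<bullet> b = (0, level_cutoff' \<tau> \<delta> (snd z)) \<bullet> b"
    unfolding grad_inner[OF b] by (simp add: inner_prod_def)
qed

text \<open>The gradient of the competitor consists of a part of \<open>g\<close>, and of \<open>u - c\<close> times the derivative of the cutoff. The latter is at
  most \<open>1 / (bump_mass * \<delta>)\<close>, and \<open>72 * \<delta>\<^sup>2\<close> is the constant of the Poincare inequality on the strip. Squaring the sum
  doubles both terms.\<close>

definition cut_const :: real where "cut_const = 2 + 144 / bump_mass\<^sup>2"

lemma L2_extend_zero:
  fixes f :: "'a::euclidean_space \<Rightarrow> 'b::euclidean_space"
  assumes "L2 U f" "U \<in> sets lebesgue"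
  shows "L2 UNIV (\<lambda>z. indicator U z *\<^sub>R f z)"
proof -
  have m: "(\<lambda>z. indicator U z *\<^sub>R f z) \<in> borel_measurable lebesgue"
    using assms by (subst borel_measurable_restrict_space_iff[symmetric]) (auto simp: L2_def)
  have "sqi UNIV (\<lambda>z. indicator U z *\<^sub>R f z) = sqi U f"
    using assms(2) by (subst (1 2) sqi_lebesgue) (auto intro!: nn_integral_cong split: split_indicator)
  then show ?thesis using m assms by (simp add: L2_iff lebesgue_on_UNIV_eq)
qed

lemma trace_approx_cong:
  assumes "trace_approx a b d u g t" "\<And>z. z \<in> pillar a b d \<Longrightarrow> u z = u' z" "\<And>z. z \<in> pillar a b d \<Longrightarrow> g z = g' z"
  shows "trace_approx a b d u' g' t"
proof -
  have "sqi (pillar a b d) (\<lambda>z. w z - u z) = sqi (pillar a b d) (\<lambda>z. w z - u' z)"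
    "sqi (pillar a b d) (\<lambda>z. grad w z - g z) = sqi (pillar a b d) (\<lambda>z. grad w z - g' z)" for w
    using assms(2,3) by (auto intro!: sqi_cong)
  then show ?thesis using assms(1) unfolding trace_approx_def by simp
qed

text \<open>The competitor is \<open>u\<close> outside of the tower over the component above the level \<open>\<tau>\<close>, and a constant on the part of the tower
  above \<open>\<tau> + \<delta>\<close>. A constant extends to any domain, hence the competitor also exists when the tower is reshaped above
  \<open>\<tau> + \<delta>\<close>. The cutoff \<open>\<rho>\<close> jumps on the vertical lines over the end points of the component above \<open>\<tau>\<close>, but these
  lie outside of the domain because \<open>h\<close> is at most \<open>\<tau>\<close> there.\<close>

lemma tower_competitor:
  fixes \<alpha> \<beta> \<tau> \<delta> :: real
  assumes h: "continuous_on UNIV h" and h2: "continuous_on UNIV h2" "\<And>x. h2 x \<le> M"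
    and same: "\<And>x. h2 x = h x \<or> x \<in> {\<alpha><..<\<beta>} \<and> \<tau> + \<delta> < h x \<and> \<tau> + \<delta> < h2 x"
    and \<alpha>\<beta>: "\<alpha> < \<beta>" "\<beta> - \<alpha> \<le> \<delta>" and \<delta>: "\<delta> \<le> \<tau>"
    and J: "\<And>x. x \<in> {\<alpha><..<\<beta>} \<Longrightarrow> \<tau> < h x" "h \<alpha> \<le> \<tau>" "h \<beta> \<le> \<tau>"
    and u: "admissible_pair h u g" and e: "e > 0"
  shows "\<exists>v k. admissible_pair h2 v k \<and> sqi (Omega h2) k \<le> sqi (Omega h - ({\<alpha><..<\<beta>} \<times> {\<tau><..})) g
     + ennreal cut_const * sqi (Omega h \<inter> ({\<alpha><..<\<beta>} \<times> {\<tau>-\<delta><..<\<tau>+\<delta>})) g + ennreal e"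
proof -
  define J where "J = {\<alpha><..<\<beta>}"
  let ?O = "Omega h" and ?O2 = "Omega h2"
  define S where "S = ?O \<inter> (J \<times> {\<tau><..<\<tau>+\<delta>})"
  define S' where "S' = ?O \<inter> (J \<times> {\<tau>-\<delta><..<\<tau>+\<delta>})"
  define T where "T = J \<times> {\<tau><..}"
  note U = admissible_pairD[OF u]
  note O = Omega_lebesgue[OF h] and O2 = Omega_lebesgue[OF h2(1)]
  have \<delta>0: "0 < \<delta>" and \<tau>0: "0 < \<tau>" using \<alpha>\<beta> \<delta> by auto
  note C = level_cutoff_props[OF \<delta>0, where \<tau>=\<tau>]
  have oJ: "open J" by (simp add: J_def)
  have o: "open S" "open S'" "open T" unfolding S_def S'_def T_def by (intro open_Int Omega_open h open_Times oJ open_greaterThanLessThan open_greaterThan)+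
  have l: "S \<in> sets lebesgue" "S' \<in> sets lebesgue" "T \<in> sets lebesgue" using o by auto
  define \<kappa> where "\<kappa> = 1 / (bump_mass * \<delta>)"
  have \<kappa>: "\<kappa> > 0" using \<delta>0 bump_mass_pos by (simp add: \<kappa>_def)
  define e' where "e' = e / (2 * \<kappa>\<^sup>2)"
  have e': "e' > 0" using e \<kappa> by (simp add: e'_def)
  obtain c where c: "sqi S (\<lambda>z. u z - c) \<le> ennreal (72 * \<delta>\<^sup>2) * sqi S' g + ennreal e'"
    using strip_Poincare[OF h \<alpha>\<beta> \<delta> J(1) u e'] unfolding S_def S'_def J_def by blast
  define u0 where "u0 = (\<lambda>z. indicator ?O z *\<^sub>R u z)"
  define g0 where "g0 = (\<lambda>z. indicator ?O z *\<^sub>R g z)"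
  have u0: "L2 UNIV u0" unfolding u0_def by (rule L2_extend_zero[OF U(1) O])
  have g0: "L2 UNIV g0" unfolding g0_def by (rule L2_extend_zero[OF U(3) O])
  define \<eta> where "\<eta> = (\<lambda>z::real \<times> real. level_cutoff \<tau> \<delta> (snd z))"
  define \<eta>' where "\<eta>' = (\<lambda>z::real \<times> real. level_cutoff' \<tau> \<delta> (snd z))"
  define \<rho> where "\<rho> = (\<lambda>z::real \<times> real. if fst z \<in> J then \<eta> z else 0)"
  define \<rho>' where "\<rho>' = (\<lambda>z::real \<times> real. if fst z \<in> J then (0, \<eta>' z) else (0, 0) :: real \<times> real)"
  have \<eta>s: "smooth \<eta>" unfolding \<eta>_def by (rule C(9))
  have \<eta>r: "0 \<le> \<eta> z" "\<eta> z \<le> 1" for z using C(3,4) by (auto simp: \<eta>_def)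
  have \<eta>'n: "\<bar>\<eta>' z\<bar> \<le> \<kappa>" for z using C(7)[of "snd z"] by (simp add: \<eta>'_def \<kappa>_def)
  have \<rho>r: "0 \<le> \<rho> z" "\<rho> z \<le> 1" for z using \<eta>r by (auto simp: \<rho>_def)
  have \<rho>'n: "norm (\<rho>' z) \<le> \<kappa>" for z using \<eta>'n[of z] \<kappa> by (auto simp: \<rho>'_def norm_Pair)
  have \<eta>d: "(\<eta> has_derivative (\<lambda>v. \<eta>' z * snd v)) (at z)" for z
    unfolding \<eta>_def \<eta>'_def
    by (rule has_derivative_compose[OF _ C(8)[unfolded has_field_derivative_def]]) (auto intro!: derivative_eq_intros)
  define v where "v = (\<lambda>z. (1 - \<rho> z) * u0 z + c * \<rho> z)"
  define k where "k = (\<lambda>z. (1 - \<rho> z) *\<^sub>R g0 z + (c - u0 z) *\<^sub>R \<rho>' z)"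
  have mI: "indicat_real (J \<times> (UNIV :: real set)) \<in> borel_measurable (lebesgue :: (real \<times> real) measure)"
  proof (rule borel_measurable_indicator)
    have "open (J \<times> (UNIV :: real set))" by (intro open_Times oJ open_UNIV)
    then show "J \<times> (UNIV :: real set) \<in> sets lebesgue" by auto
  qed
  have \<eta>c: "continuous_on UNIV \<eta>" by (intro smooth_continuous \<eta>s)
  have \<eta>'c: "continuous_on UNIV \<eta>'"
    unfolding \<eta>'_def level_cutoff'_def using bump_mass_pos \<delta>0
    by (intro continuous_intros continuous_on_compose2[OF smooth_continuous[OF smooth_bump, of UNIV]]) auto
  have \<eta>'c2: "continuous_on UNIV (\<lambda>z. (0::real, \<eta>' z))" by (intro continuous_on_Pair continuous_on_const \<eta>'c)
  have \<rho>m: "lmeas UNIV \<rho>" "lmeas UNIV \<rho>'"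
  proof -
    have eq: "\<rho> = (\<lambda>z. indicat_real (J \<times> UNIV) z * \<eta> z)" "\<rho>' = (\<lambda>z. indicat_real (J \<times> UNIV) z *\<^sub>R (0, \<eta>' z))"
      by (auto simp: \<rho>_def \<rho>'_def fun_eq_iff indicator_def)
    have m: "\<eta> \<in> borel_measurable lebesgue" "(\<lambda>z. (0::real, \<eta>' z)) \<in> borel_measurable lebesgue"
      using lmeas_continuous[OF \<eta>c, of UNIV] lmeas_continuous[OF \<eta>'c2, of UNIV] by (simp_all add: lebesgue_on_UNIV_eq)
    show "lmeas UNIV \<rho>" "lmeas UNIV \<rho>'"
      unfolding lebesgue_on_UNIV_eq eq by (rule borel_measurable_times[OF mI m(1)], rule borel_measurable_scaleR[OF mI m(2)])
  qed
  \<comment> \<open>near every point of the new domain the cutoff is either \<open>\<eta>\<close> or zero, so it maps test functions to test functions\<close>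
  have loc: "\<exists>W. open W \<and> z \<in> W \<and> ((\<forall>y\<in>W. \<rho> y = \<eta> y \<and> \<rho>' y = (0, \<eta>' y)) \<or> (\<forall>y\<in>W. \<rho> y = 0 \<and> \<rho>' y = (0, 0)))" if z: "z \<in> ?O2" for z
  proof -
    have "snd z < h2 (fst z)" using z by (simp add: Omega_iff)
    then have end_low: "snd z < \<tau>" if "fst z = \<alpha> \<or> fst z = \<beta>" using that same[of "fst z"] J(2,3) by auto
    consider (low) "snd z < \<tau>" | (inJ) "fst z \<in> J" | (out) "fst z < \<alpha> \<or> \<beta> < fst z"
      using end_low unfolding J_def by force
    then show ?thesis
    proof cases
      case low
      have "open {y::real \<times> real. snd y < \<tau>}" by (intro open_Collect_less continuous_intros)
      moreover have "\<forall>y\<in>{y::real \<times> real. snd y < \<tau>}. \<rho> y = 0 \<and> \<rho>' y = (0, 0)"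
        using C(1,5) by (auto simp: \<rho>_def \<rho>'_def \<eta>_def \<eta>'_def)
      ultimately show ?thesis using low by (intro exI[of _ "{y::real \<times> real. snd y < \<tau>}"]) simp
    next
      case inJ
      have "open (J \<times> (UNIV :: real set))" by (intro open_Times oJ open_UNIV)
      moreover have "\<forall>y\<in>J \<times> UNIV. \<rho> y = \<eta> y \<and> \<rho>' y = (0, \<eta>' y)" by (auto simp: \<rho>_def \<rho>'_def)
      moreover have "z \<in> J \<times> UNIV" using inJ by (cases z) auto
      ultimately show ?thesis by (intro exI[of _ "J \<times> UNIV"]) simp
    next
      case out
      let ?W = "({..<\<alpha>} \<union> {\<beta><..}) \<times> (UNIV :: real set)"
      have "open ?W" by (intro open_Times open_UNIV open_Un open_lessThan open_greaterThan)
      moreover have "\<forall>y\<in>?W. \<rho> y = 0 \<and> \<rho>' y = (0, 0)" using \<alpha>\<beta>(1) by (auto simp: \<rho>_def \<rho>'_def J_def)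
      moreover have "z \<in> ?W" using out by (cases z) auto
      ultimately show ?thesis by (intro exI[of _ ?W]) simp
    qed
  qed
  have \<rho>both: "test_function ?O2 (\<lambda>z. \<rho> z * \<phi> z) \<and> (\<forall>z b.
      frechet_derivative (\<lambda>z. \<rho> z * \<phi> z) (at z) b = \<rho> z * frechet_derivative \<phi> (at z) b + (\<rho>' z \<bullet> b) * \<phi> z)"
    if \<phi>: "test_function ?O2 \<phi>" for \<phi>
  proof -
    obtain K where K: "compact K" "K \<subseteq> ?O2" "\<And>x. x \<notin> K \<Longrightarrow> \<phi> x = 0" "smooth \<phi>"
      using test_functionE[OF \<phi>] by blast
    have cK: "open (- K)" using compact_imp_closed[OF K(1)] by auto
    have L: "\<exists>W f. open W \<and> z \<in> W \<and> smooth f \<and> (\<forall>y\<in>W. \<rho> y * \<phi> y = f y) \<and> 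
       (f has_derivative (\<lambda>b. \<rho> z * frechet_derivative \<phi> (at z) b + (\<rho>' z \<bullet> b) * \<phi> z)) (at z)" for z
    proof (cases "z \<in> K")
      case False
      have "frechet_derivative \<phi> (at z) = (\<lambda>_. 0)"
        by (rule frechet_derivative_zero_outside[OF compact_imp_closed[OF K(1)] K(3) False])
      then show ?thesis using cK K(3) False
        by (intro exI[of _ "- K"] exI[of _ "\<lambda>_. 0"]) (simp add: smooth_const)
    next
      case True
      then obtain W where W: "open W" "z \<in> W" 
        and alt: "(\<forall>y\<in>W. \<rho> y = \<eta> y \<and> \<rho>' y = (0, \<eta>' y)) \<or> (\<forall>y\<in>W. \<rho> y = 0 \<and> \<rho>' y = (0, 0))" 
        using loc[of z] K(2) by blast
      from alt show ?thesis
      proof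
        assume A: "\<forall>y\<in>W. \<rho> y = \<eta> y \<and> \<rho>' y = (0, \<eta>' y)"
        have "((\<lambda>y. \<eta> y * \<phi> y) has_derivative (\<lambda>b. \<eta> z * frechet_derivative \<phi> (at z) b + (\<eta>' z * snd b) * \<phi> z)) (at z)"
          by (rule has_derivative_mult[OF \<eta>d smooth_has_derivative[OF K(4)]])
        then show ?thesis using W A smooth_mult[OF \<eta>s K(4)]
          by (intro exI[of _ W] exI[of _ "\<lambda>y. \<eta> y * \<phi> y"]) (simp add: inner_prod_def)
      next
        assume A: "\<forall>y\<in>W. \<rho> y = 0 \<and> \<rho>' y = (0, 0)"
        then show ?thesis using W by (intro exI[of _ W] exI[of _ "\<lambda>_. 0"]) (simp add: smooth_const inner_prod_def)
      qed
    qed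
    have "smooth (\<lambda>z. \<rho> z * \<phi> z)"
    proof (rule smooth_local)
      fix z show "\<exists>U f'. open U \<and> z \<in> U \<and> smooth f' \<and> (\<forall>y\<in>U. \<rho> y * \<phi> y = f' y)" using L[of z] by blast
    qed
    then have 1: "test_function ?O2 (\<lambda>z. \<rho> z * \<phi> z)" using K by (intro test_functionI[of _ K]) auto
    have 2: "frechet_derivative (\<lambda>z. \<rho> z * \<phi> z) (at z) b = \<rho> z * frechet_derivative \<phi> (at z) b + (\<rho>' z \<bullet> b) * \<phi> z" for z b
    proof -
      obtain W f where W: "open W" "z \<in> W" "\<forall>y\<in>W. \<rho> y * \<phi> y = f y" 
         and f: "(f has_derivative (\<lambda>b. \<rho> z * frechet_derivative \<phi> (at z) b + (\<rho>' z \<bullet> b) * \<phi> z)) (at z)"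
        using L[of z] by blast
      have "((\<lambda>z. \<rho> z * \<phi> z) has_derivative (\<lambda>b. \<rho> z * frechet_derivative \<phi> (at z) b + (\<rho>' z \<bullet> b) * \<phi> z)) (at z)"
        by (rule has_derivative_transform_within_open[OF f W(1,2)]) (use W(3) in auto)
      from frechet_derivative_at[OF this, symmetric] show ?thesis by simp
    qed
    from 1 2 show ?thesis by blast
  qed
  note \<rho>test = \<rho>both[THEN conjunct1] and \<rho>der = \<rho>both[THEN conjunct2, rule_format]
  have comp: "z \<in> ?O" if "z \<in> ?O2" "fst z \<notin> J \<or> snd z \<le> \<tau> + \<delta>" for z
    using that same[of "fst z"] by (auto simp: Omega_iff J_def)
  have comp': "z \<in> ?O2" if "z \<in> ?O" "fst z \<notin> J \<or> snd z \<le> \<tau> + \<delta>" for z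
    using that same[of "fst z"] by (auto simp: Omega_iff J_def)
  have \<rho>1: "\<rho> z = 1" "\<rho>' z = (0, 0)" if "fst z \<in> J" "\<tau> + \<delta> \<le> snd z" for z
    using that C(2,6) by (auto simp: \<rho>_def \<rho>'_def \<eta>_def \<eta>'_def)
  have \<rho>0: "\<rho> z = 0" "\<rho>' z = (0, 0)" if "fst z \<notin> J \<or> snd z \<le> \<tau>" for z
    using that C(1,5) by (auto simp: \<rho>_def \<rho>'_def \<eta>_def \<eta>'_def)
  have vL: "L2 ?O2 v"
  proof -
    have 1: "L2 UNIV (\<lambda>z. (1 - \<rho> z) * u0 z)"
    proof (rule L2_mono[OF u0])
      show "lmeas UNIV (\<lambda>z. (1 - \<rho> z) * u0 z)"
        by (intro borel_measurable_times borel_measurable_diff borel_measurable_const \<rho>m L2_lmeas[OF u0])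
      show "norm ((1 - \<rho> z) * u0 z) \<le> norm (u0 z)" for z
        using \<rho>r[of z] by (simp add: abs_mult mult_left_le_one_le)
    qed
    define B where "B = box (\<alpha>, 0) (\<beta>, M)"
    have "L2 B (\<lambda>_. c)" unfolding B_def by (intro L2_continuous_bounded) auto
    from L2_extend_zero[OF this] have "L2 UNIV (\<lambda>z. indicator B z *\<^sub>R c)" by (simp add: B_def)
    then have "L2 ?O2 (\<lambda>z. indicator B z *\<^sub>R c)" by (rule L2_subset) (use O2 in auto)
    then have 2: "L2 ?O2 (\<lambda>z. c * \<rho> z)"
    proof (rule L2_mono)
      show "lmeas ?O2 (\<lambda>z. c * \<rho> z)"
        by (intro borel_measurable_times borel_measurable_const lmeas_subset[OF \<rho>m(1)] subset_UNIV)
      fix z assume z: "z \<in> ?O2"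
      show "norm (c * \<rho> z) \<le> norm (indicator B z *\<^sub>R c)"
      proof (cases "z \<in> B")
        case True
        then show ?thesis using \<rho>r[of z] by (simp add: abs_mult mult_left_le)
      next
        case False
        then have "fst z \<notin> J \<or> snd z \<le> \<tau>" using z h2(2)[of "fst z"]
          by (cases z) (auto simp: B_def mem_box Basis_prod_def Omega_iff J_def)
        then show ?thesis using \<rho>0 by simp
      qed
    qed
    show ?thesis unfolding v_def by (rule L2_add[OF L2_subset[OF 1] 2]) (use O2 in auto)
  qed
  have umL: "lmeas UNIV u0" "lmeas UNIV g0" using u0 g0 by (auto simp: L2_def)
  have km: "lmeas UNIV k"
    unfolding k_def by (intro borel_measurable_add borel_measurable_scaleR borel_measurable_diff borel_measurable_const \<rho>m umL)
  \<comment> \<open>outside of the tower nothing changes, and inside the gradient is concentrated on the strip \<open>S\<close>\<close>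
  have k_out: "k z = g z" if "z \<in> ?O2 - T" for z
  proof -
    have "fst z \<notin> J \<or> snd z \<le> \<tau>" using that by (cases z) (auto simp: T_def)
    moreover from this have "z \<in> ?O" using comp[of z] that \<delta>0 by auto
    ultimately show ?thesis using \<rho>0[of z] by (simp add: k_def g0_def zero_prod_def[symmetric])
  qed
  have OT: "?O2 - T = ?O - T"
  proof (rule set_eqI)
    fix z
    have "fst z \<notin> J \<or> snd z \<le> \<tau> + \<delta>" if "z \<notin> T" using that \<delta>0 by (cases z) (auto simp: T_def)
    then show "z \<in> ?O2 - T \<longleftrightarrow> z \<in> ?O - T" using comp[of z] comp'[of z] by blast
  qed
  have "sqi (?O2 \<inter> T) k \<le> sqi S k"
  proof -
    have zS: "z \<in> S" if "z \<in> ?O2 \<inter> T" "k z \<noteq> 0" for z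
    proof -
      have zJ: "fst z \<in> J" "\<tau> < snd z" using that by (auto simp: T_def)
      have "snd z < \<tau> + \<delta>"
      proof (rule ccontr)
        assume "\<not> snd z < \<tau> + \<delta>"
        then have "\<rho> z = 1" "\<rho>' z = (0, 0)" using \<rho>1[of z] zJ by auto
        then show False using that(2) by (simp add: k_def zero_prod_def[symmetric])
      qed
      then show ?thesis using that comp[of z] zJ by (cases z) (auto simp: S_def)
    qed
    have "ennreal ((norm (k z))\<^sup>2) * indicator (?O2 \<inter> T) z \<le> ennreal ((norm (k z))\<^sup>2) * indicator S z" for z
      using zS[of z] by (cases "k z = 0"; cases "z \<in> ?O2 \<inter> T") auto
    then show ?thesis using O2 l by (subst (1 2) sqi_lebesgue) (auto intro!: nn_integral_mono)
  qed
  also have "sqi S k \<le> 2 * sqi S (\<lambda>z. (1 - \<rho> z) *\<^sub>R g0 z) + 2 * sqi S (\<lambda>z. (c - u0 z) *\<^sub>R \<rho>' z)"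
    unfolding k_def
    by (intro sqi_add2 lmeas_subset[of _ UNIV S] borel_measurable_scaleR borel_measurable_diff borel_measurable_const \<rho>m umL subset_UNIV)
  also have "\<dots> \<le> 2 * sqi S g + 2 * sqi S (\<lambda>z. \<kappa> *\<^sub>R (u z - c))"
  proof (intro add_mono mult_left_mono sqi_mono)
    fix z assume z: "z \<in> S"
    then have "z \<in> ?O" by (simp add: S_def)
    then show "norm ((1 - \<rho> z) *\<^sub>R g0 z) \<le> norm (g z)"
      using \<rho>r[of z] by (simp add: g0_def mult_left_le_one_le)
    have "\<bar>u z - c\<bar> * norm (\<rho>' z) \<le> \<bar>u z - c\<bar> * \<kappa>" using \<rho>'n[of z] by (rule mult_left_mono) simp
    then show "norm ((c - u0 z) *\<^sub>R \<rho>' z) \<le> norm (\<kappa> *\<^sub>R (u z - c))"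
      using \<kappa> \<open>z \<in> ?O\<close> by (simp add: u0_def abs_minus_commute abs_mult mult.commute)
  qed auto
  also have "sqi S (\<lambda>z. \<kappa> *\<^sub>R (u z - c)) = ennreal (\<kappa>\<^sup>2) * sqi S (\<lambda>z. u z - c)"
    using lmeas_subset[OF L2_lmeas[OF U(1)], of S] by (intro sqi_cmult borel_measurable_diff) (auto simp: S_def)
  also have "2 * sqi S g + 2 * (ennreal (\<kappa>\<^sup>2) * sqi S (\<lambda>z. u z - c)) \<le> 2 * sqi S' g + 2 * (ennreal (\<kappa>\<^sup>2) * (ennreal (72 * \<delta>\<^sup>2) * sqi S' g + ennreal e'))"
    using \<delta>0 by (intro add_mono mult_left_mono c sqi_mono_set l) (auto simp: S_def S'_def)
  also have "\<dots> = ennreal cut_const * sqi S' g + ennreal e"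
  proof -
    define q where "q = ennreal (72 / bump_mass\<^sup>2)"
    have "\<kappa>\<^sup>2 * (72 * \<delta>\<^sup>2) = 72 / bump_mass\<^sup>2" using \<delta>0 by (simp add: \<kappa>_def power_divide power_mult_distrib)
    then have 1: "ennreal (\<kappa>\<^sup>2) * ennreal (72 * \<delta>\<^sup>2) = q" by (subst ennreal_mult[symmetric]) (auto simp: q_def)
    have "\<kappa>\<^sup>2 * e' = e / 2" using \<kappa> by (simp add: e'_def)
    then have 2: "ennreal (\<kappa>\<^sup>2) * ennreal e' = ennreal (e / 2)" using e' by (subst ennreal_mult[symmetric]) auto
    have 3: "2 * ennreal (e / 2) = ennreal e" using e by (simp add: ennreal_mult[symmetric] flip: ennreal_numeral)
    have "2 * q = ennreal (2 * (72 / bump_mass\<^sup>2))" unfolding q_def by (subst ennreal_mult) auto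
    moreover have "ennreal (2 + 144 / bump_mass\<^sup>2) = 2 + ennreal (144 / bump_mass\<^sup>2)" by (subst ennreal_plus) auto
    ultimately have 4: "ennreal cut_const = 2 + 2 * q" by (simp add: cut_const_def)
    have "2 * (ennreal (\<kappa>\<^sup>2) * (ennreal (72 * \<delta>\<^sup>2) * sqi S' g + ennreal e')) = 2 * (q * sqi S' g + ennreal (e / 2))"
      by (simp only: distrib_left mult.assoc[symmetric] 1 2)
    also have "\<dots> = 2 * q * sqi S' g + ennreal e" by (simp only: distrib_left 3 mult.assoc)
    finally show ?thesis unfolding 4 by (simp only: distrib_right add.assoc)
  qed
  finally have ET: "sqi (?O2 \<inter> T) k \<le> ennreal cut_const * sqi S' g + ennreal e" .
  have "sqi ?O2 k = sqi ((?O2 - T) \<union> (?O2 \<inter> T)) k" by (rule arg_cong[where f="\<lambda>A. sqi A k"]) blast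
  also have "\<dots> = sqi (?O2 - T) k + sqi (?O2 \<inter> T) k"
    using O2 l by (intro sqi_Un lmeas_subset[OF km]) auto
  also have "sqi (?O2 - T) k = sqi (?O2 - T) g" by (rule sqi_cong[OF k_out])
  finally have E: "sqi ?O2 k \<le> sqi (?O - T) g + ennreal cut_const * sqi S' g + ennreal e"
    using ET by (simp add: add.assoc add_left_mono OT)
  have finO: "sqi ?O g < \<infinity>" using U(3) by (simp add: L2_iff)
  have kL: "L2 ?O2 k"
  proof -
    have "sqi (?O - T) g \<le> sqi ?O g" "sqi S' g \<le> sqi ?O g" using O l by (auto intro!: sqi_mono_set simp: S'_def)
    then have "sqi (?O - T) g < top" "sqi S' g < top" using finO by (auto intro: le_less_trans)
    then have "sqi (?O - T) g + ennreal cut_const * sqi S' g + ennreal e < \<infinity>" by (simp add: ennreal_mult_less_top)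
    with E have "sqi ?O2 k < \<infinity>" by (rule le_less_trans)
    then show ?thesis using lmeas_subset[OF km subset_UNIV] by (simp add: L2_iff)
  qed
  \<comment> \<open>split a test function into \<open>\<omega> = \<phi> - \<rho> * \<phi>\<close>, which is supported where both domains agree and is tested with \<open>u\<close>, and \<open>\<psi> = \<rho> * \<phi>\<close>, which is tested with the constant \<open>c\<close>\<close>
  have wg: "has_weak_gradient ?O2 v k"
    unfolding has_weak_gradient_def
  proof (intro conjI kL allI impI ballI)
    fix \<phi> :: "real \<times> real \<Rightarrow> real" and b :: "real \<times> real" assume t: "test_function ?O2 \<phi>" and b: "b \<in> Basis"
    obtain K where K: "compact K" "K \<subseteq> ?O2" "\<And>x. x \<notin> K \<Longrightarrow> \<phi> x = 0" "smooth \<phi>"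
      using test_functionE[OF t] by blast
    define \<psi> where "\<psi> = (\<lambda>z. \<rho> z * \<phi> z)"
    define \<omega> where "\<omega> = (\<lambda>z. \<phi> z - \<psi> z)"
    define d\<phi> where "d\<phi> = (\<lambda>z. frechet_derivative \<phi> (at z) b)"
    define d\<psi> where "d\<psi> = (\<lambda>z. frechet_derivative \<psi> (at z) b)"
    define d\<omega> where "d\<omega> = (\<lambda>z. frechet_derivative \<omega> (at z) b)"
    define X where "X = (\<lambda>z. (\<rho>' z \<bullet> b) * \<phi> z)"
    have t\<psi>: "test_function ?O2 \<psi>" unfolding \<psi>_def by (rule \<rho>test[OF t])
    have s\<psi>: "smooth \<psi>" using t\<psi> by (simp add: test_function_def)
    have s\<omega>: "smooth \<omega>" unfolding \<omega>_def by (rule smooth_diff[OF K(4) s\<psi>])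
    have td: "test_function ?O2 d\<phi>" unfolding d\<phi>_def by (rule test_function_frechet[OF t b])
    have d\<psi>_eq: "d\<psi> z = \<rho> z * d\<phi> z + X z" for z
      unfolding d\<psi>_def d\<phi>_def X_def \<psi>_def by (rule \<rho>der[OF t])
    have d\<omega>_eq: "d\<omega> z = d\<phi> z - d\<psi> z" for z
    proof -
      have "(\<omega> has_derivative (\<lambda>v. frechet_derivative \<phi> (at z) v - frechet_derivative \<psi> (at z) v)) (at z)"
        unfolding \<omega>_def by (intro has_derivative_diff smooth_has_derivative K(4) s\<psi>)
      from frechet_derivative_at[OF this, symmetric] show ?thesis unfolding d\<omega>_def d\<phi>_def d\<psi>_def by simp
    qed
    have t\<omega>: "test_function ?O \<omega>"
    proof (rule test_functionI[of _ "K \<inter> ((- J) \<times> UNIV \<union> {z. snd z \<le> \<tau> + \<delta>})"])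
      have "closed ((- J) \<times> (UNIV :: real set))" using oJ by (auto intro: closed_Times)
      moreover have "closed {z::real \<times> real. snd z \<le> \<tau> + \<delta>}" by (intro closed_Collect_le continuous_intros)
      ultimately show "compact (K \<inter> ((- J) \<times> UNIV \<union> {z. snd z \<le> \<tau> + \<delta>}))"
        by (intro compact_Int_closed K(1) closed_Un)
      show "K \<inter> ((- J) \<times> UNIV \<union> {z. snd z \<le> \<tau> + \<delta>}) \<subseteq> ?O"
      proof
        fix z assume "z \<in> K \<inter> ((- J) \<times> UNIV \<union> {z. snd z \<le> \<tau> + \<delta>})"
        then have "z \<in> ?O2" "fst z \<notin> J \<or> snd z \<le> \<tau> + \<delta>" using K(2) by auto
        then show "z \<in> ?O" by (rule comp)
      qed
      show "\<omega> z = 0" if "z \<notin> K \<inter> ((- J) \<times> UNIV \<union> {z. snd z \<le> \<tau> + \<delta>})" for z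
      proof (cases "z \<in> K")
        case True
        then have "fst z \<in> J" "\<tau> + \<delta> \<le> snd z" using that by (cases z; auto)+
        then show ?thesis using \<rho>1(1)[of z] by (simp add: \<omega>_def \<psi>_def)
      qed (simp add: \<omega>_def \<psi>_def K(3))
    qed (rule s\<omega>)
    have um: "UNIV \<in> sets (lebesgue :: (real \<times> real) measure)" by auto
    have Ld: "L2 UNIV \<phi>" "L2 UNIV \<omega>" "L2 UNIV d\<psi>" "L2 UNIV d\<omega>"
      unfolding d\<psi>_def d\<omega>_def
      by (rule test_function_L2[OF t um] test_function_L2[OF t\<omega> um]
        test_function_L2[OF test_function_frechet[OF t\<psi> b] um]
        test_function_L2[OF test_function_frechet[OF t\<omega> b] um])+
    have tX: "L2 UNIV (\<lambda>z. \<rho> z * d\<phi> z)" by (rule test_function_L2[OF \<rho>test[OF td] um])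
    have LX: "L2 UNIV X" using L2_diff[OF Ld(3) tX] d\<psi>_eq by simp
    have int: "integrable lebesgue (\<lambda>z. f z * y z)" if "L2 UNIV f" "L2 UNIV y" for f y :: "real \<times> real \<Rightarrow> real"
      using L2_pair_integrable[OF that] by (simp add: lebesgue_on_UNIV_eq)
    have intc: "integrable lebesgue d\<psi>" "integrable lebesgue X"
    proof -
      have cc: "continuous_on UNIV d\<psi>" "continuous_on UNIV (\<lambda>z. \<rho> z * d\<phi> z)"
        using smooth_continuous[OF smooth_frechet[OF s\<psi> b]] \<rho>test[OF td] 
        by (auto simp: d\<psi>_def test_function_def intro: smooth_continuous)
      have z0: "d\<phi> z = 0" "\<phi> z = 0" if "z \<notin> K" for z
        using frechet_derivative_zero_outside[OF compact_imp_closed[OF K(1)] K(3) that] K(3) that by (auto simp: d\<phi>_def)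
      show i1: "integrable lebesgue d\<psi>"
        by (rule compact_support_integrable(2)[OF cc(1) K(1)]) (simp add: d\<psi>_eq X_def z0)
      have "integrable lebesgue (\<lambda>z. \<rho> z * d\<phi> z)"
        by (rule compact_support_integrable(2)[OF cc(2) K(1)]) (simp add: z0)
      from Bochner_Integration.integrable_diff[OF i1 this] show "integrable lebesgue X" by (simp add: d\<psi>_eq)
    qed
    have I\<psi>: "(LINT z|lebesgue. d\<psi> z) = 0"
      unfolding d\<psi>_def
    proof (rule integral_partial_derivative_zero[where K=K])
      show "(\<psi> has_derivative frechet_derivative \<psi> (at x)) (at x)" for x by (rule smooth_has_derivative[OF s\<psi>])
      show "continuous_on UNIV (\<lambda>x. frechet_derivative \<psi> (at x) b)" by (intro smooth_continuous smooth_frechet s\<psi> b)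
      show "\<psi> x = 0" if "x \<notin> K" for x using K(3)[OF that] by (simp add: \<psi>_def)
    qed (rule K(1))
    have I\<omega>: "(LINT z|lebesgue. u0 z * d\<omega> z) = - (LINT z|lebesgue. (g0 z \<bullet> b) * \<omega> z)"
    proof -
      have "(LINT z|lebesgue_on ?O. u z * d\<omega> z) = (LINT z|lebesgue_on ?O. u0 z * d\<omega> z)"
        by (intro Bochner_Integration.integral_cong refl) (simp add: u0_def)
      also have "\<dots> = (LINT z|lebesgue. u0 z * d\<omega> z)" by (rule test_function_UNIV_integral[OF O]) (simp add: u0_def)
      finally have 1: "(LINT z|lebesgue_on ?O. u z * d\<omega> z) = (LINT z|lebesgue. u0 z * d\<omega> z)" .
      have "(LINT z|lebesgue_on ?O. (g z \<bullet> b) * \<omega> z) = (LINT z|lebesgue_on ?O. (g0 z \<bullet> b) * \<omega> z)"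
        by (intro Bochner_Integration.integral_cong refl) (simp add: g0_def)
      also have "\<dots> = (LINT z|lebesgue. (g0 z \<bullet> b) * \<omega> z)" by (rule test_function_UNIV_integral[OF O]) (simp add: g0_def)
      finally have 2: "(LINT z|lebesgue_on ?O. (g z \<bullet> b) * \<omega> z) = (LINT z|lebesgue. (g0 z \<bullet> b) * \<omega> z)" .
      have "(LINT z|lebesgue_on ?O. u z * d\<omega> z) = - (LINT z|lebesgue_on ?O. (g z \<bullet> b) * \<omega> z)"
        unfolding d\<omega>_def by (rule has_weak_gradientD[OF U(2) t\<omega> b])
      then show ?thesis unfolding 1 2 .
    qed
    have "(LINT z|lebesgue_on ?O2. v z * d\<phi> z) = (LINT z|lebesgue. v z * d\<phi> z)"
    proof (rule test_function_UNIV_integral[OF O2])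
      fix z assume "z \<notin> ?O2"
      then have "z \<notin> K" using K(2) by blast
      then have "d\<phi> z = 0" using frechet_derivative_zero_outside[OF compact_imp_closed[OF K(1)] K(3)] by (simp add: d\<phi>_def)
      then show "v z * d\<phi> z = 0" by simp
    qed
    also have "\<dots> = (LINT z|lebesgue. u0 z * d\<omega> z + u0 z * X z + (c * d\<psi> z - c * X z))"
      by (intro Bochner_Integration.integral_cong refl) (simp add: v_def d\<omega>_eq d\<psi>_eq algebra_simps)
    also have "\<dots> = (LINT z|lebesgue. u0 z * d\<omega> z) + (LINT z|lebesgue. u0 z * X z) + (c * (LINT z|lebesgue. d\<psi> z) - c * (LINT z|lebesgue. X z))"
      using int[OF u0 Ld(4)] int[OF u0 LX] intc by simp
    also have "\<dots> = - ((LINT z|lebesgue. (g0 z \<bullet> b) * \<omega> z) - (LINT z|lebesgue. u0 z * X z) + c * (LINT z|lebesgue. X z))"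
      unfolding I\<psi> I\<omega> by simp
    also have "\<dots> = - (LINT z|lebesgue. (g0 z \<bullet> b) * \<omega> z - u0 z * X z + c * X z)"
      using int[OF L2_inner[OF g0 b] Ld(2)] int[OF u0 LX] intc by simp
    also have "(LINT z|lebesgue. (g0 z \<bullet> b) * \<omega> z - u0 z * X z + c * X z) = (LINT z|lebesgue. (k z \<bullet> b) * \<phi> z)"
      by (intro Bochner_Integration.integral_cong refl)
        (simp add: k_def \<omega>_def \<psi>_def X_def inner_add_left algebra_simps)
    also have "(LINT z|lebesgue. (k z \<bullet> b) * \<phi> z) = (LINT z|lebesgue_on ?O2. (k z \<bullet> b) * \<phi> z)"
      using K(2,3) by (intro test_function_UNIV_integral[OF O2, symmetric]) auto
    finally show "(LINT z|lebesgue_on ?O2. v z * frechet_derivative \<phi> (at z) b) = - (LINT z|lebesgue_on ?O2. (k z \<bullet> b) * \<phi> z)"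
      by (simp add: d\<phi>_def)
  qed
  \<comment> \<open>a pillar that reaches above \<open>\<tau>\<close> and meets the component lies over it, since \<open>h\<close> is at most \<open>\<tau>\<close> at its end points; there the cutoff is smooth and can be applied to the approximating functions\<close>
  have tr: "trace_approx a b d v k (\<lambda>x. x)" if P: "a < b" "0 < d" and sub2: "pillar a b d \<subseteq> ?O2" for a b d
  proof -
    let ?Q = "pillar a b d"
    have hd: "d \<le> h2 x" if "a < x" "x < b" for x
    proof (rule dense_le_bounded[OF P(2)])
      fix y assume "0 < y" "y < d"
      then have "(x, y) \<in> ?O2" using that sub2 by auto
      then show "y \<le> h2 x" by (simp add: Omega_iff)
    qed
    show ?thesis
    proof (cases "d \<le> \<tau> \<or> {a<..<b} \<inter> J = {}")
      case True
      then have z: "fst z \<notin> J \<or> snd z \<le> \<tau>" if "z \<in> ?Q" for z using that by (cases z) auto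
      have QO: "z \<in> ?O" if "z \<in> ?Q" for z
      proof (rule comp)
        show "z \<in> ?O2" using that sub2 by blast
        show "fst z \<notin> J \<or> snd z \<le> \<tau> + \<delta>" using z[OF that] \<delta>0 by linarith
      qed
      then have "?Q \<subseteq> ?O" by blast
      from U(4)[OF P this] show ?thesis
      proof (rule trace_approx_cong)
        fix z assume zQ: "z \<in> ?Q"
        show "u z = v z" "g z = k z"
          using \<rho>0[OF z[OF zQ]] QO[OF zQ] by (simp_all add: v_def k_def u0_def g0_def zero_prod_def[symmetric])
      qed
    next
      case False
      then have d\<tau>: "\<tau> < d" and meet: "{a<..<b} \<inter> J \<noteq> {}" by auto
      have "\<tau> < h x" if "a < x" "x < b" for x using hd[OF that] d\<tau> same[of x] \<delta>0 by auto
      then have "\<not> (a < \<alpha> \<and> \<alpha> < b)" "\<not> (a < \<beta> \<and> \<beta> < b)" using J(2,3) by force+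
      then have abJ: "{a<..<b} \<subseteq> J" using meet by (auto simp: J_def)
      \<comment> \<open>above \<open>\<tau> + \<delta>\<close> the old and the new domain differ, so \<open>u\<close> is approximated only below\<close>
      define d' where "d' = min d (\<tau> + \<delta>)"
      have d': "0 < d'" using P(2) \<tau>0 \<delta>0 by (simp add: d'_def)
      have sub': "pillar a b d' \<subseteq> ?Q" by (auto simp: d'_def)
      have subO: "pillar a b d' \<subseteq> ?O"
      proof
        fix z assume z: "z \<in> pillar a b d'"
        then have "z \<in> ?O2" using sub' sub2 by blast
        moreover have "snd z \<le> \<tau> + \<delta>" using z by (auto simp: d'_def)
        ultimately show "z \<in> ?O" using comp by blast
      qed
      show ?thesis
        unfolding trace_approx_def
      proof (intro allI impI)
        fix r :: real assume r: "r > 0"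
        define r' where "r' = r / (2 + 2 * \<kappa>\<^sup>2)"
        have kk: "2 + 2 * \<kappa>\<^sup>2 > 0" by (simp add: add_pos_nonneg)
        have r': "r' > 0" "(2 + 2 * \<kappa>\<^sup>2) * r' = r" using r kk by (auto simp: r'_def)
        have r'r: "r' \<le> r" using r' mult_right_mono[of 1 "2 + 2 * \<kappa>\<^sup>2" r'] by simp
        obtain w where w: "smooth w" "sqi (pillar a b d') (\<lambda>z. w z - u z) \<le> ennreal r'" 
          "sqi (pillar a b d') (\<lambda>z. grad w z - g z) \<le> ennreal r'" "sqi {a<..<b} (\<lambda>x. w (x, 0) - x) \<le> ennreal r'"
          using U(4)[OF P(1) d' subO] r'(1) unfolding trace_approx_def by blast
        define y where "y = (\<lambda>z. w z - \<eta> z * (w z - c))"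
        have swc: "smooth (\<lambda>z. w z - c)" by (rule smooth_diff[OF w(1) smooth_const])
        have sy: "smooth y" unfolding y_def by (rule smooth_diff[OF w(1) smooth_mult[OF \<eta>s swc]])
        have g\<eta>: "grad \<eta> z = (0, \<eta>' z)" for z
          unfolding \<eta>_def \<eta>'_def by (rule grad_level_cutoff[OF \<delta>0])
        have gy: "grad y z = (1 - \<eta> z) *\<^sub>R grad w z - (w z - c) *\<^sub>R (0, \<eta>' z)" for z
          unfolding y_def grad_diff[OF w(1) smooth_mult[OF \<eta>s swc]] grad_mult[OF \<eta>s swc] grad_diff[OF w(1) smooth_const] grad_const g\<eta>
          by (simp add: scaleR_diff_left)
        have Qd': "z \<in> pillar a b d' \<or> \<tau> + \<delta> \<le> snd z" if "z \<in> ?Q" for z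
          using that by (cases z) (auto simp: d'_def)
        have shrink: "sqi ?Q f \<le> sqi (pillar a b d') f'" 
          if 1: "\<And>z. z \<in> pillar a b d' \<Longrightarrow> norm (f z) \<le> norm (f' z)" and 2: "\<And>z. z \<in> ?Q \<Longrightarrow> \<tau> + \<delta> \<le> snd z \<Longrightarrow> norm (f z) = 0"
          for f :: "real \<times> real \<Rightarrow> 'x::euclidean_space" and f' :: "real \<times> real \<Rightarrow> 'y::euclidean_space"
        proof -
          have "ennreal ((norm (f z))\<^sup>2) * indicator ?Q z \<le> ennreal ((norm (f' z))\<^sup>2) * indicator (pillar a b d') z" for z
          proof (cases "z \<in> pillar a b d'")
            case True
            then have "z \<in> ?Q" using sub' by blast
            with True show ?thesis using 1[OF True] by (auto intro!: ennreal_leI power_mono)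
          next
            case False
            then have "z \<in> ?Q \<Longrightarrow> norm (f z) = 0" using Qd'[of z] 2[of z] by blast
            then show ?thesis by (cases "z \<in> ?Q") auto
          qed
          then show ?thesis using pillar_lebesgue by (subst (1 2) sqi_lebesgue) (auto intro!: nn_integral_mono)
        qed
        have QJ: "fst z \<in> J" if "z \<in> ?Q" for z using that abJ by auto
        have \<rho>\<eta>: "\<rho> z = \<eta> z" "\<rho>' z = (0, \<eta>' z)" if "z \<in> ?Q" for z using QJ[OF that] by (auto simp: \<rho>_def \<rho>'_def)
        have big: "\<eta> z = 1" "\<eta>' z = 0" if "\<tau> + \<delta> \<le> snd z" for z using that C(2,6) by (auto simp: \<eta>_def \<eta>'_def)
        have uO: "u0 z = u z" "g0 z = g z" if "z \<in> pillar a b d'" for z using that subO by (auto simp: u0_def g0_def)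
        have "sqi ?Q (\<lambda>z. y z - v z) \<le> sqi (pillar a b d') (\<lambda>z. w z - u z)"
        proof (rule shrink)
          fix z assume z: "z \<in> pillar a b d'"
          then have zQ: "z \<in> ?Q" using sub' by blast
          have "y z - v z = (1 - \<eta> z) * (w z - u z)" using \<rho>\<eta>[OF zQ] uO[OF z] by (simp add: y_def v_def algebra_simps)
          then show "norm (y z - v z) \<le> norm (w z - u z)" using \<eta>r[of z] by (simp add: abs_mult mult_left_le_one_le)
        next
          fix z assume "z \<in> ?Q" "\<tau> + \<delta> \<le> snd z"
          then show "norm (y z - v z) = 0" using \<rho>\<eta>[of z] big[of z] by (simp add: y_def v_def)
        qed
        also have "\<dots> \<le> ennreal r'" by (rule w)
        also have "\<dots> \<le> ennreal r" using r'r by (rule ennreal_leI)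
        finally have 1: "sqi ?Q (\<lambda>z. y z - v z) \<le> ennreal r" .
        define f1 where "f1 = (\<lambda>z. (1 - \<eta> z) *\<^sub>R (grad w z - g0 z))"
        define f2 where "f2 = (\<lambda>z. (u0 z - w z) *\<^sub>R (0::real, \<eta>' z))"
        have fm: "lmeas ?Q f1" "lmeas ?Q f2"
        proof -
          have "lmeas UNIV f1" unfolding f1_def
            by (intro borel_measurable_scaleR borel_measurable_diff borel_measurable_const umL lmeas_continuous[OF \<eta>c] lmeas_continuous[OF continuous_grad[OF w(1)]])
          moreover have "lmeas UNIV f2" unfolding f2_def
            by (intro borel_measurable_scaleR borel_measurable_diff umL lmeas_continuous[OF \<eta>'c2] lmeas_continuous[OF smooth_continuous[OF w(1)]])
          ultimately show "lmeas ?Q f1" "lmeas ?Q f2" by (auto intro: lmeas_subset[OF _ subset_UNIV])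
        qed
        have "sqi ?Q (\<lambda>z. grad y z - k z) = sqi ?Q (\<lambda>z. f1 z + f2 z)"
          using \<rho>\<eta> by (intro sqi_cong) (simp add: gy k_def f1_def f2_def scaleR_diff_right scaleR_diff_left algebra_simps)
        also have "\<dots> \<le> 2 * sqi ?Q f1 + 2 * sqi ?Q f2" by (rule sqi_add2[OF fm])
        also have "\<dots> \<le> 2 * ennreal r' + 2 * (ennreal (\<kappa>\<^sup>2) * ennreal r')"
        proof (intro add_mono mult_left_mono)
          have "sqi ?Q f1 \<le> sqi (pillar a b d') (\<lambda>z. grad w z - g z)"
          proof (rule shrink)
            fix z assume z: "z \<in> pillar a b d'"
            show "norm (f1 z) \<le> norm (grad w z - g z)" using uO[OF z] \<eta>r[of z] by (simp add: f1_def mult_left_le_one_le)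
          qed (simp add: f1_def big)
          then show "sqi ?Q f1 \<le> ennreal r'" using w(3) by (rule order_trans)
          have "sqi ?Q f2 \<le> sqi (pillar a b d') (\<lambda>z. \<kappa> *\<^sub>R (w z - u z))"
          proof (rule shrink)
            fix z assume z: "z \<in> pillar a b d'"
            have "\<bar>w z - u z\<bar> * \<bar>\<eta>' z\<bar> \<le> \<bar>w z - u z\<bar> * \<kappa>" using \<eta>'n[of z] by (rule mult_left_mono) simp
            then show "norm (f2 z) \<le> norm (\<kappa> *\<^sub>R (w z - u z))"
              using uO[OF z] \<kappa> by (simp add: f2_def norm_Pair abs_mult abs_minus_commute mult.commute)
          qed (simp add: f2_def big)
          also have "\<dots> = ennreal (\<kappa>\<^sup>2) * sqi (pillar a b d') (\<lambda>z. w z - u z)"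
            by (intro sqi_cmult borel_measurable_diff lmeas_subset[OF L2_lmeas[OF U(1)] subO] lmeas_continuous[OF smooth_continuous[OF w(1)]])
          also have "\<dots> \<le> ennreal (\<kappa>\<^sup>2) * ennreal r'" by (intro mult_left_mono w) auto
          finally show "sqi ?Q f2 \<le> ennreal (\<kappa>\<^sup>2) * ennreal r'" .
        qed auto
        also have "\<dots> = ennreal ((2 + 2 * \<kappa>\<^sup>2) * r')"
          using r'(1) by (simp add: ennreal_mult ennreal_plus distrib_right mult.assoc)
        also have "\<dots> = ennreal r" using r' by simp
        finally have 2: "sqi ?Q (\<lambda>z. grad y z - k z) \<le> ennreal r" .
        have "y (x, 0) = w (x, 0)" for x using C(1)[of 0] \<tau>0 by (simp add: y_def \<eta>_def)
        then have 3: "sqi {a<..<b} (\<lambda>x. y (x, 0) - x) \<le> ennreal r"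
          using order_trans[OF w(4) ennreal_leI[OF r'r]] by simp
        show "\<exists>w. smooth w \<and> sqi ?Q (\<lambda>z. w z - v z) \<le> ennreal r \<and> sqi ?Q (\<lambda>z. grad w z - k z) \<le> ennreal r \<and>
            sqi {a<..<b} (\<lambda>x. w (x, 0) - x) \<le> ennreal r"
          using sy 1 2 3 by blast
      qed
    qed
  qed
  have "admissible_pair h2 v k" unfolding admissible_pair_def using vL wg tr by blast
  then show ?thesis using E unfolding T_def S'_def J_def by blast
qed

section \<open>Exponential decay of the energy in a tower\<close>

lemma superlevel_measure:
  assumes h: "integrable lebesgue h" "\<And>x. 0 \<le> h x" "(LINT x|lebesgue. h x) = V"
    and A: "A \<in> sets lebesgue" "\<And>x. x \<in> A \<Longrightarrow> t \<le> h x" and t: "0 < t"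
  shows "ennreal t * emeasure lebesgue A \<le> ennreal V"
proof -
  have "ennreal t * emeasure lebesgue A = (\<integral>\<^sup>+x. ennreal t * indicator A x \<partial>lebesgue)"
    using A by (subst nn_integral_cmult_indicator) auto
  also have "\<dots> \<le> (\<integral>\<^sup>+x. ennreal (h x) \<partial>lebesgue)"
    using A(2) by (intro nn_integral_mono) (auto intro: ennreal_leI split: split_indicator)
  also have "\<dots> = ennreal V"
    using nn_integral_eq_integral[OF h(1)] h(2,3) by simp
  finally show ?thesis .
qed

text \<open>Chebyshev's inequality bounds the length of every subinterval, hence of the component. At an end point \<open>h\<close> cannot exceed
  \<open>t\<close>, because the component could be enlarged.\<close>

lemma superlevel_component:
  fixes h :: "real \<Rightarrow> real"
  assumes hc: "continuous_on UNIV h" and h: "integrable lebesgue h" "\<And>x. 0 \<le> h x" "(LINT x|lebesgue. h x) = V"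
    and t: "0 < t" "t < h x0"
  obtains \<alpha> \<beta> where "connected_component_set {x. t < h x} x0 = {\<alpha><..<\<beta>}" "\<alpha> < x0" "x0 < \<beta>"
    "h \<alpha> \<le> t" "h \<beta> \<le> t" "t * (\<beta> - \<alpha>) \<le> V"
proof -
  let ?U = "{x. t < h x}"
  define J where "J = connected_component_set ?U x0"
  have oU: "open ?U" using hc by (intro open_Collect_less continuous_intros)
  have oJ: "open J" unfolding J_def by (rule open_connected_component[OF oU])
  have cJ: "connected J" unfolding J_def by (rule connected_connected_component)
  have x0: "x0 \<in> J" unfolding J_def using t(2) by (simp add: connected_component_refl)
  have JU: "J \<subseteq> ?U" unfolding J_def by (rule connected_component_subset)
  have V0: "0 \<le> V" using h(2,3) by (metis integral_nonneg_AE AE_I2)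
  have conv: "y \<in> J" if "x \<in> J" "z \<in> J" "x \<le> y" "y \<le> z" for x y z
    using cJ that by (meson connected_iff_interval)
  have len: "b - a \<le> V / t" if ab: "a \<in> J" "b \<in> J" "a \<le> b" for a b
  proof -
    have "t \<le> h x" if "x \<in> {a..b}" for x using conv[OF ab(1,2), of x] that JU by (auto intro: less_imp_le)
    from superlevel_measure[OF h, where A="{a..b}" and t=t, OF _ this t(1)]
    have "ennreal t * ennreal (b - a) \<le> ennreal V" using ab(3) by simp
    then have "t * (b - a) \<le> V" using t(1) ab(3) V0 by (simp add: ennreal_mult[symmetric])
    then show ?thesis using t(1) by (simp add: field_simps)
  qed
  have up: "x \<le> x0 + V / t" if "x \<in> J" for x
    using len[OF x0 that] V0 t(1) by (cases "x0 \<le> x") (auto intro: add_increasing2)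
  have lo: "x0 - V / t \<le> x" if "x \<in> J" for x
    using len[OF that x0] V0 t(1) by (cases "x \<le> x0") (auto simp: algebra_simps intro: add_increasing2 order_trans)
  have bd: "bdd_above J" "bdd_below J" using up lo by (auto intro!: bdd_aboveI bdd_belowI)
  define \<alpha> \<beta> where "\<alpha> = Inf J" and "\<beta> = Sup J"
  have ne: "J \<noteq> {}" using x0 by auto
  have nb: "\<beta> \<notin> J"
  proof
    assume "\<beta> \<in> J"
    then obtain e where "e > 0" "ball \<beta> e \<subseteq> J" using oJ by (auto simp: open_contains_ball)
    then have "\<beta> + e / 2 \<in> J" by (auto simp: dist_real_def)
    then have "\<beta> + e / 2 \<le> \<beta>" unfolding \<beta>_def by (intro cSup_upper bd)
    then show False using \<open>e > 0\<close> by simp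
  qed
  have na: "\<alpha> \<notin> J"
  proof
    assume "\<alpha> \<in> J"
    then obtain e where "e > 0" "ball \<alpha> e \<subseteq> J" using oJ by (auto simp: open_contains_ball)
    then have "\<alpha> - e / 2 \<in> J" by (auto simp: dist_real_def)
    then have "\<alpha> \<le> \<alpha> - e / 2" unfolding \<alpha>_def by (intro cInf_lower bd)
    then show False using \<open>e > 0\<close> by simp
  qed
  have J: "J = {\<alpha><..<\<beta>}"
  proof
    show "J \<subseteq> {\<alpha><..<\<beta>}"
    proof
      fix x assume x: "x \<in> J"
      then have "\<alpha> \<le> x" "x \<le> \<beta>" unfolding \<alpha>_def \<beta>_def by (auto intro: cInf_lower cSup_upper bd)
      then show "x \<in> {\<alpha><..<\<beta>}" using na nb x by (cases "x = \<alpha>"; cases "x = \<beta>") auto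
    qed
    show "{\<alpha><..<\<beta>} \<subseteq> J"
    proof
      fix x assume x: "x \<in> {\<alpha><..<\<beta>}"
      obtain y where "y \<in> J" "y < x" using x cInf_less_iff[OF ne bd(2)] unfolding \<alpha>_def by auto
      moreover obtain z where "z \<in> J" "x < z" using x less_cSup_iff[OF ne bd(1)] unfolding \<beta>_def by auto
      ultimately show "x \<in> J" using conv[of y z x] by auto
    qed
  qed
  have \<alpha>\<beta>: "\<alpha> < x0" "x0 < \<beta>" using x0 J by auto
  have endpt: "h y \<le> t" if y: "y \<in> closure J" "y \<notin> J" for y
  proof (rule ccontr)
    assume "\<not> h y \<le> t"
    then have "insert y J \<subseteq> ?U" using JU by auto
    moreover have "connected (insert y J)"
      by (rule connected_intermediate_closure[OF cJ]) (use y closure_subset in auto)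
    ultimately have "insert y J \<subseteq> J"
      unfolding J_def using x0[unfolded J_def] by (intro connected_component_maximal) auto
    then show False using y by auto
  qed
  have "closure J = {\<alpha>..\<beta>}" unfolding J using \<alpha>\<beta> by (intro closure_greaterThanLessThan) auto
  then have "h \<alpha> \<le> t" "h \<beta> \<le> t" using endpt na nb \<alpha>\<beta> by auto
  moreover have "t * (\<beta> - \<alpha>) \<le> V"
  proof -
    have "t \<le> h x" if "x \<in> {\<alpha><..<\<beta>}" for x using that JU J by (auto intro: less_imp_le)
    from superlevel_measure[OF h, where A="{\<alpha><..<\<beta>}" and t=t, OF _ this t(1)]
    have "ennreal t * ennreal (\<beta> - \<alpha>) \<le> ennreal V" using \<alpha>\<beta> by simp
    then show ?thesis using t(1) \<alpha>\<beta> V0 by (simp add: ennreal_mult[symmetric])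
  qed
  ultimately show thesis using that[of \<alpha> \<beta>] J \<alpha>\<beta> unfolding J_def by blast
qed

definition tower :: "(real \<Rightarrow> real) \<Rightarrow> real \<Rightarrow> real \<Rightarrow> (real \<times> real) set" where
  "tower h x0 t = Omega h \<inter> (connected_component_set {x. t < h x} x0 \<times> {t<..})"

definition minimal_pair :: "(real \<Rightarrow> real) \<Rightarrow> (real \<times> real \<Rightarrow> real) \<Rightarrow> (real \<times> real \<Rightarrow> real \<times> real) \<Rightarrow> bool" where
  "minimal_pair h u g \<longleftrightarrow> admissible_pair h u g \<and> (\<forall>v k. admissible_pair h v k \<longrightarrow> sqi (Omega h) g \<le> sqi (Omega h) k)"

text \<open>Real-valued, because hole filling subtracts energies; for a square integrable \<open>g\<close> nothing is lost.\<close>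

definition tower_energy :: "(real \<Rightarrow> real) \<Rightarrow> (real \<times> real \<Rightarrow> real \<times> real) \<Rightarrow> real \<Rightarrow> real \<Rightarrow> real" where
  "tower_energy h g x0 t = enn2real (sqi (tower h x0 t) g)"

definition decay_rate :: real where "decay_rate = cut_const / (1 + cut_const)"

lemma cut_const_pos: "0 < cut_const" by (simp add: cut_const_def add_pos_nonneg)

lemma decay_rate_bounds: "0 < decay_rate" "decay_rate < 1"
  using cut_const_pos by (auto simp: decay_rate_def)

lemma tower_open: "continuous_on UNIV h \<Longrightarrow> open (tower h x0 t)"
  unfolding tower_def
  by (intro open_Int Omega_open open_Times open_connected_component open_Collect_less open_greaterThan continuous_intros)

lemma tower_lebesgue: "continuous_on UNIV h \<Longrightarrow> tower h x0 t \<in> sets lebesgue"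
  using tower_open[of h x0 t] by auto

lemma component_antimono: "s \<le> t \<Longrightarrow> connected_component_set {x. t < h x} x0 \<subseteq> connected_component_set {x. s < (h x :: real)} x0"
  by (rule connected_component_mono) auto

lemma tower_antimono: "s \<le> t \<Longrightarrow> tower h x0 t \<subseteq> tower h x0 s"
  using component_antimono[of s t h x0] by (auto simp: tower_def)

lemma tower_energy_ennreal:
  assumes "continuous_on UNIV h" "L2 (Omega h) g"
  shows "ennreal (tower_energy h g x0 t) = sqi (tower h x0 t) g" "tower_energy h g x0 t \<ge> 0"
proof -
  have "sqi (tower h x0 t) g \<le> sqi (Omega h) g"
    using assms by (intro sqi_mono_set tower_lebesgue Omega_lebesgue) (auto simp: tower_def)
  also have "\<dots> < \<infinity>" using assms(2) by (simp add: L2_iff)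
  finally show "ennreal (tower_energy h g x0 t) = sqi (tower h x0 t) g" by (simp add: tower_energy_def)
qed (simp add: tower_energy_def)

lemma tower_energy_antimono:
  assumes "continuous_on UNIV h" "L2 (Omega h) g" "s \<le> t"
  shows "tower_energy h g x0 t \<le> tower_energy h g x0 s"
proof -
  have "sqi (tower h x0 t) g \<le> sqi (tower h x0 s) g"
    using assms by (intro sqi_mono_set tower_antimono tower_lebesgue) auto
  then show ?thesis using tower_energy_ennreal[OF assms(1,2)] by (metis ennreal_le_iff)
qed

text \<open>Hole filling. The width of the component at level \<open>\<tau>\<close> is at most \<open>V / \<tau>\<close>, which does not exceed \<open>\<delta>\<close>. Cutting off at \<open>\<tau>\<close>
  does not lower the energy, so the energy above \<open>\<tau>\<close> is at most \<open>cut_const\<close> times the energy in a strip around \<open>\<tau>\<close>, and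
  the latter is lost between \<open>\<tau> - \<delta>\<close> and \<open>\<tau> + \<delta>\<close>. With \<open>E\<close> for the energy of the tower, \<open>E (\<tau> + \<delta>) \<le> cut_const * (E (\<tau> - \<delta>) - E (\<tau> + \<delta>))\<close>.\<close>

lemma tower_energy_step:
  assumes hc: "continuous_on UNIV h" and hM: "\<And>x. h x \<le> M"
    and h: "integrable lebesgue h" "\<And>x. 0 \<le> h x" "(LINT x|lebesgue. h x) = V"
    and u: "minimal_pair h u g" and \<delta>: "0 < \<delta>" "\<delta> \<le> \<tau>" "V \<le> \<tau> * \<delta>" and x0: "\<tau> < h x0"
  shows "tower_energy h g x0 (\<tau> + \<delta>) \<le> decay_rate * tower_energy h g x0 (\<tau> - \<delta>)"
proof -
  let ?O = "Omega h"
  have a: "admissible_pair h u g" using u by (simp add: minimal_pair_def)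
  note A = admissible_pairD[OF a]
  have \<tau>0: "0 < \<tau>" using \<delta> by linarith
  obtain \<alpha> \<beta> where J: "connected_component_set {x. \<tau> < h x} x0 = {\<alpha><..<\<beta>}" "\<alpha> < x0" "x0 < \<beta>"
    "h \<alpha> \<le> \<tau>" "h \<beta> \<le> \<tau>" "\<tau> * (\<beta> - \<alpha>) \<le> V"
    by (rule superlevel_component[OF hc h \<tau>0 x0])
  have "\<tau> * (\<beta> - \<alpha>) \<le> \<tau> * \<delta>" using J(6) \<delta>(3) by linarith
  then have len: "\<beta> - \<alpha> \<le> \<delta>" using \<tau>0 by simp
  have Jh: "\<tau> < h x" if "x \<in> {\<alpha><..<\<beta>}" for x
    using that J(1) connected_component_subset[of "{x. \<tau> < h x}" x0] by blast
  define T where "T = {\<alpha><..<\<beta>} \<times> {\<tau><..}"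
  define S' where "S' = ?O \<inter> ({\<alpha><..<\<beta>} \<times> {\<tau>-\<delta><..<\<tau>+\<delta>})"
  have oS: "open S'" unfolding S'_def by (intro open_Int Omega_open hc open_Times open_greaterThanLessThan)
  have oT: "open T" unfolding T_def by (intro open_Times open_greaterThanLessThan open_greaterThan)
  have l: "S' \<in> sets lebesgue" "T \<in> sets lebesgue" "?O \<in> sets lebesgue" using oS oT Omega_lebesgue[OF hc] by auto
  have gm: "lmeas B g" if "B \<subseteq> ?O" for B by (rule lmeas_subset[OF L2_lmeas[OF A(3)] that])
  have fin: "sqi B g < top" if "B \<subseteq> ?O" "B \<in> sets lebesgue" for B
    using L2_subset[OF A(3) that(1,2) l(3)] by (simp add: L2_iff)
  have tw: "?O \<inter> T = tower h x0 \<tau>" by (simp add: T_def tower_def J(1))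
  have "sqi (tower h x0 \<tau>) g \<le> ennreal cut_const * sqi S' g"
  proof (rule ennreal_le_epsilon)
    fix e :: real assume e: "0 < e"
    obtain v k where vk: "admissible_pair h v k" 
      "sqi ?O k \<le> sqi (?O - T) g + ennreal cut_const * sqi S' g + ennreal e"
      using tower_competitor[OF hc hc hM _ order_less_trans[OF J(2,3)] len \<delta>(2) Jh J(4,5) a e] unfolding T_def S'_def by blast
    have "?O = (?O - T) \<union> (?O \<inter> T)" by blast
    then have "sqi ?O g = sqi ((?O - T) \<union> (?O \<inter> T)) g" by simp
    also have "\<dots> = sqi (?O - T) g + sqi (?O \<inter> T) g"
      using l by (intro sqi_Un gm) auto
    finally have split: "sqi ?O g = sqi (?O - T) g + sqi (tower h x0 \<tau>) g" unfolding tw .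
    have "sqi ?O g \<le> sqi ?O k" using u vk(1) by (simp add: minimal_pair_def)
    also note vk(2)
    finally have "sqi (?O - T) g + sqi (tower h x0 \<tau>) g \<le> sqi (?O - T) g + (ennreal cut_const * sqi S' g + ennreal e)"
      unfolding split by (simp only: add.assoc)
    moreover have "sqi (?O - T) g < top" using l by (intro fin) auto
    ultimately show "sqi (tower h x0 \<tau>) g \<le> ennreal cut_const * sqi S' g + ennreal e"
      by (auto simp: ennreal_add_left_cancel_le)
  qed
  then have "ennreal (tower_energy h g x0 \<tau>) \<le> ennreal (cut_const * enn2real (sqi S' g))"
    using fin[of S'] l cut_const_pos by (simp add: tower_energy_ennreal[OF hc A(3)] ennreal_mult S'_def less_top)
  then have 1: "tower_energy h g x0 \<tau> \<le> cut_const * enn2real (sqi S' g)"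
    using cut_const_pos by (subst (asm) ennreal_le_iff) auto
  have "sqi S' g + sqi (tower h x0 (\<tau> + \<delta>)) g = sqi (S' \<union> tower h x0 (\<tau> + \<delta>)) g"
    by (intro sqi_Un[symmetric] l tower_lebesgue hc gm) (auto simp: S'_def tower_def)
  also have "\<dots> \<le> sqi (tower h x0 (\<tau> - \<delta>)) g"
  proof (rule sqi_mono_set)
    have "S' \<subseteq> tower h x0 (\<tau> - \<delta>)"
      unfolding S'_def tower_def J(1)[symmetric] using component_antimono[of "\<tau> - \<delta>" \<tau> h x0] \<delta>(1) by auto
    moreover have "tower h x0 (\<tau> + \<delta>) \<subseteq> tower h x0 (\<tau> - \<delta>)" using \<delta>(1) by (intro tower_antimono) auto
    ultimately show "S' \<union> tower h x0 (\<tau> + \<delta>) \<subseteq> tower h x0 (\<tau> - \<delta>)" by blast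
  qed (use l tower_lebesgue[OF hc] in auto)
  finally have "ennreal (enn2real (sqi S' g) + tower_energy h g x0 (\<tau> + \<delta>)) \<le> ennreal (tower_energy h g x0 (\<tau> - \<delta>))"
    using fin[of S'] l by (simp add: tower_energy_ennreal[OF hc A(3)] S'_def less_top)
  then have 2: "enn2real (sqi S' g) + tower_energy h g x0 (\<tau> + \<delta>) \<le> tower_energy h g x0 (\<tau> - \<delta>)"
    using tower_energy_ennreal(2)[OF hc A(3)] by (subst (asm) ennreal_le_iff) auto
  have 3: "tower_energy h g x0 (\<tau> + \<delta>) \<le> tower_energy h g x0 \<tau>"
    using \<delta>(1) by (intro tower_energy_antimono hc A) auto
  have "(1 + cut_const) * tower_energy h g x0 (\<tau> + \<delta>) \<le> cut_const * (enn2real (sqi S' g) + tower_energy h g x0 (\<tau> + \<delta>))"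
    using 1 3 by (simp add: distrib_left distrib_right)
  also have "\<dots> \<le> cut_const * tower_energy h g x0 (\<tau> - \<delta>)" using 2 cut_const_pos by (intro mult_left_mono) auto
  finally show ?thesis using cut_const_pos by (simp add: decay_rate_def field_simps)
qed

lemma tower_energy_decay:
  assumes hc: "continuous_on UNIV h" and hM: "\<And>x. h x \<le> M"
    and h: "integrable lebesgue h" "\<And>x. 0 \<le> h x" "(LINT x|lebesgue. h x) = V"
    and u: "minimal_pair h u g" and t: "0 < \<delta>" "0 < t" "V \<le> t * \<delta>" and x0: "t + 2 * real n * \<delta> < h x0"
  shows "tower_energy h g x0 (t + 2 * real n * \<delta>) \<le> decay_rate ^ n * tower_energy h g x0 t"
  using x0
proof (induction n)
  case (Suc n)
  define \<tau> where "\<tau> = t + (2 * real n + 1) * \<delta>"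
  have n\<delta>: "0 \<le> real n * \<delta>" using t by simp
  have eq: "t + 2 * real (Suc n) * \<delta> = \<tau> + \<delta>" "t + 2 * real n * \<delta> = \<tau> - \<delta>" by (auto simp: \<tau>_def algebra_simps)
  have \<tau>: "\<delta> \<le> \<tau>" "t \<le> \<tau>" using n\<delta> t by (auto simp: \<tau>_def algebra_simps)
  then have "V \<le> \<tau> * \<delta>" using t mult_right_mono[of t \<tau> \<delta>] by linarith
  moreover have "\<tau> < h x0" using Suc.prems t unfolding eq by linarith
  ultimately have "tower_energy h g x0 (\<tau> + \<delta>) \<le> decay_rate * tower_energy h g x0 (\<tau> - \<delta>)"
    by (intro tower_energy_step[OF hc hM h u t(1) \<tau>(1)])
  also have "\<dots> \<le> decay_rate * (decay_rate ^ n * tower_energy h g x0 t)"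
    using Suc.IH Suc.prems t decay_rate_bounds unfolding eq by (intro mult_left_mono) auto
  finally show ?case unfolding eq(1) power_Suc by (subst mult.assoc)
qed simp

text \<open>The lower half of the height \<open>T\<close> is reserved for a bound on the width. Above \<open>T / 2\<close> every component has length at most \<open>2 * V / T\<close>,
  so this is the step \<open>\<delta>\<close>. After \<open>n\<close> steps of the decay the remaining energy is negligible, and one more strip is used to
  make the displacement constant below the level \<open>T\<close>.\<close>

lemma reshaped_competitor:
  assumes hc: "continuous_on UNIV h" and hM: "\<And>x. h x \<le> M"
    and h: "integrable lebesgue h" "\<And>x. 0 \<le> h x" "(LINT x|lebesgue. h x) = V"
    and u: "minimal_pair h u g" and V: "0 < V" and T: "0 < T" and I: "connected I" "x0 \<in> I" "\<And>x. x \<in> I \<Longrightarrow> T < h x"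
    and h2: "continuous_on UNIV h2" "\<And>x. h2 x \<le> M2" "\<And>x. h2 x = h x \<or> x \<in> I \<and> T \<le> h2 x"
    and n: "2 * (real n + 1) * (2 * V / T) < T / 2" and e: "e > 0"
  shows "\<exists>v k. admissible_pair h2 v k \<and> sqi (Omega h2) k \<le> sqi (Omega h) g + ennreal (cut_const * decay_rate ^ n) * sqi (Omega h) g + ennreal e"
proof -
  let ?O = "Omega h"
  have a: "admissible_pair h u g" using u by (simp add: minimal_pair_def)
  note A = admissible_pairD[OF a]
  define \<delta> where "\<delta> = 2 * V / T"
  define t where "t = T / 2"
  define \<tau> where "\<tau> = t + (2 * real n + 1) * \<delta>"
  have pos: "0 < \<delta>" "0 < t" "V \<le> t * \<delta>" using V T by (auto simp: \<delta>_def t_def)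
  have n\<delta>: "0 \<le> real n * \<delta>" using pos by simp
  have eq: "t + 2 * real n * \<delta> = \<tau> - \<delta>" by (auto simp: \<tau>_def algebra_simps)
  have "2 * (real n + 1) * \<delta> < T / 2" using n by (simp only: \<delta>_def)
  then have \<tau>T: "\<tau> + \<delta> < T" by (simp add: \<tau>_def t_def algebra_simps)
  have \<tau>12: "\<delta> \<le> \<tau>" "t \<le> \<tau>" using n\<delta> pos by (auto simp: \<tau>_def algebra_simps)
  then have \<tau>: "\<delta> \<le> \<tau>" "t \<le> \<tau>" "0 < \<tau>" using pos by linarith+
  have x0: "\<tau> < h x0" using I(3)[OF I(2)] \<tau>T pos by linarith
  obtain \<alpha> \<beta> where J: "connected_component_set {x. \<tau> < h x} x0 = {\<alpha><..<\<beta>}" "\<alpha> < x0" "x0 < \<beta>"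
    "h \<alpha> \<le> \<tau>" "h \<beta> \<le> \<tau>" "\<tau> * (\<beta> - \<alpha>) \<le> V"
    by (rule superlevel_component[OF hc h \<tau>(3) x0])
  have "V \<le> \<tau> * \<delta>" using pos mult_right_mono[OF \<tau>(2), of \<delta>] by linarith
  then have "\<tau> * (\<beta> - \<alpha>) \<le> \<tau> * \<delta>" using J(6) by linarith
  then have len: "\<beta> - \<alpha> \<le> \<delta>" using \<tau>(3) by simp
  have Jh: "\<tau> < h x" if "x \<in> {\<alpha><..<\<beta>}" for x
    using that J(1) connected_component_subset[of "{x. \<tau> < h x}" x0] by blast
  have IU: "I \<subseteq> {x. \<tau> < h x}" using I(3) \<tau>T pos by force
  have IJ: "I \<subseteq> {\<alpha><..<\<beta>}" unfolding J(1)[symmetric] by (rule connected_component_maximal[OF I(2,1) IU])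
  have same: "h2 x = h x \<or> x \<in> {\<alpha><..<\<beta>} \<and> \<tau> + \<delta> < h x \<and> \<tau> + \<delta> < h2 x" for x
    using h2(3)[of x] I(3)[of x] IJ \<tau>T by auto
  obtain v k where vk: "admissible_pair h2 v k" 
    "sqi (Omega h2) k \<le> sqi (?O - ({\<alpha><..<\<beta>} \<times> {\<tau><..})) g + ennreal cut_const * sqi (?O \<inter> ({\<alpha><..<\<beta>} \<times> {\<tau>-\<delta><..<\<tau>+\<delta>})) g + ennreal e"
    using tower_competitor[OF hc h2(1,2) same order_less_trans[OF J(2,3)] len \<tau>(1) Jh J(4,5) a e] by blast
  have O: "?O \<in> sets lebesgue" by (rule Omega_lebesgue[OF hc])
  have T': "{\<alpha><..<\<beta>} \<times> {\<tau><..} \<in> sets lebesgue"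
  proof -
    have "open ({\<alpha><..<\<beta>} \<times> {\<tau><..})" by (intro open_Times open_greaterThanLessThan open_greaterThan)
    then show ?thesis by auto
  qed
  have S': "?O \<inter> ({\<alpha><..<\<beta>} \<times> {\<tau>-\<delta><..<\<tau>+\<delta>}) \<in> sets lebesgue"
  proof -
    have "open (?O \<inter> ({\<alpha><..<\<beta>} \<times> {\<tau>-\<delta><..<\<tau>+\<delta>}))" by (intro open_Int Omega_open hc open_Times open_greaterThanLessThan)
    then show ?thesis by auto
  qed
  have "sqi (?O \<inter> ({\<alpha><..<\<beta>} \<times> {\<tau>-\<delta><..<\<tau>+\<delta>})) g \<le> sqi (tower h x0 (\<tau> - \<delta>)) g"
    using component_antimono[of "\<tau> - \<delta>" \<tau> h x0] pos(1)
    by (intro sqi_mono_set S' tower_lebesgue hc) (auto simp: tower_def J(1)[symmetric])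
  also have "\<dots> = ennreal (tower_energy h g x0 (t + 2 * real n * \<delta>))" by (simp add: eq tower_energy_ennreal(1)[OF hc A(3)])
  also have "\<dots> \<le> ennreal (decay_rate ^ n * tower_energy h g x0 t)"
  proof (intro ennreal_leI tower_energy_decay[OF hc hM h u pos])
    show "t + 2 * real n * \<delta> < h x0" unfolding eq using x0 pos by linarith
  qed
  also have "\<dots> = ennreal (decay_rate ^ n) * sqi (tower h x0 t) g"
    using decay_rate_bounds tower_energy_ennreal(2)[OF hc A(3)] by (simp add: ennreal_mult tower_energy_ennreal(1)[OF hc A(3)])
  also have "\<dots> \<le> ennreal (decay_rate ^ n) * sqi ?O g"
    by (intro mult_left_mono sqi_mono_set O tower_lebesgue hc) (auto simp: tower_def)
  finally have S: "sqi (?O \<inter> ({\<alpha><..<\<beta>} \<times> {\<tau>-\<delta><..<\<tau>+\<delta>})) g \<le> ennreal (decay_rate ^ n) * sqi ?O g" .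
  have "sqi (Omega h2) k \<le> sqi ?O g + ennreal cut_const * (ennreal (decay_rate ^ n) * sqi ?O g) + ennreal e"
    by (rule order_trans[OF vk(2)]) (intro add_mono mult_left_mono S sqi_mono_set O sets.Diff T' order_refl; simp)
  also have "\<dots> = sqi ?O g + ennreal (cut_const * decay_rate ^ n) * sqi ?O g + ennreal e"
    using cut_const_pos decay_rate_bounds by (simp add: ennreal_mult mult.assoc)
  finally show ?thesis using vk(1) by blast
qed

section \<open>Weak derivatives on intervals\<close>

lemma L2_Icc_integrable:
  assumes "L2 {a..b} (g :: real \<Rightarrow> real)"
  shows "integrable (lebesgue_on {a..b}) g"
proof -
  have "L2 {a..b} (\<lambda>_. 1::real)" by (intro L2_continuous_bounded) auto
  from L2_pair_integrable[OF assms this] show ?thesis by simp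
qed

lemma L2_Icc_integral:
  assumes "L2 {a..b} (g :: real \<Rightarrow> real)"
  shows "(LINT x|lebesgue_on {a..b}. g x) = integral {a..b} g" "g integrable_on {a..b}"
  using lebesgue_integral_eq_integral[OF L2_Icc_integrable[OF assms]] integrable_on_lebesgue_on[OF L2_Icc_integrable[OF assms]] by auto

lemma continuous_Icc_integral:
  assumes "continuous_on {a..b} (f :: real \<Rightarrow> real)"
  shows "(LINT x|lebesgue_on {a..b}. f x) = integral {a..b} f"
  using lebesgue_integral_eq_integral[OF continuous_imp_integrable_real[OF assms]] by simp

lemma L2_square_integral_bound:
  assumes g: "L2 {A..B} (g :: real \<Rightarrow> real)" and xy: "A \<le> x" "x \<le> y" "y \<le> B"
  shows "ennreal ((integral {x..y} (\<lambda>t. \<bar>g t\<bar>))\<^sup>2) \<le> ennreal (y - x) * sqi {A..B} g"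
    "ennreal ((integral {x..y} g)\<^sup>2) \<le> ennreal (y - x) * sqi {A..B} g"
proof -
  have sub: "{x..y} \<subseteq> {A..B}" using xy by auto
  have L: "L2 {x..y} g" by (rule L2_subset[OF g sub]) auto
  have La: "L2 {x..y} (\<lambda>t. \<bar>g t\<bar>)" by (rule L2_mono[OF L]) (use L in \<open>auto simp: L2_def\<close>)
  have L1: "L2 {x..y} (\<lambda>_. 1::real)" by (intro L2_continuous_bounded) auto
  have one: "sqi {x..y} (\<lambda>_. 1::real) = ennreal (y - x)" unfolding sqi_def using xy by (subst nn_lebesgue_on) auto
  have "sqi {x..y} (\<lambda>t. \<bar>g t\<bar>) = sqi {x..y} g" by (simp add: sqi_def)
  moreover have le: "sqi {x..y} g \<le> sqi {A..B} g" by (intro sqi_mono_set sub) auto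
  ultimately show "ennreal ((integral {x..y} (\<lambda>t. \<bar>g t\<bar>))\<^sup>2) \<le> ennreal (y - x) * sqi {A..B} g"
    using L2_Cauchy_Schwarz[OF La L1] unfolding one by (simp add: L2_Icc_integral[OF La] mult.commute) (meson mult_left_mono order_trans zero_le)
  show "ennreal ((integral {x..y} g)\<^sup>2) \<le> ennreal (y - x) * sqi {A..B} g"
    using L2_Cauchy_Schwarz[OF L L1] le unfolding one by (simp add: L2_Icc_integral[OF L] mult.commute) (meson mult_left_mono order_trans zero_le)
qed

text \<open>Sum the increments over \<open>n + 1\<close> equal cells.\<close>

lemma const_if_superlinear_increments:
  fixes F :: "real \<Rightarrow> real"
  assumes AB: "A \<le> B" and F: "\<And>x y. A \<le> x \<Longrightarrow> x \<le> y \<Longrightarrow> y \<le> B \<Longrightarrow> \<bar>F y - F x\<bar> \<le> C * ((y - x) * sqrt (y - x))"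
  shows "F B = F A"
proof -
  define d where "d n = (B - A) / real (Suc n)" for n
  have "\<bar>F B - F A\<bar> \<le> C * (B - A) * sqrt (d n)" for n
  proof -
    define x where "x i = A + real i * d n" for i
    have d0: "0 \<le> d n" using AB by (simp add: d_def)
    have xn: "x (Suc n) = B" "x 0 = A" by (auto simp: x_def d_def)
    have xs: "A \<le> x i" "x (Suc i) - x i = d n" for i using d0 by (auto simp: x_def algebra_simps)
    have xB: "x i \<le> B" if "i \<le> Suc n" for i
    proof -
      have "real i * d n \<le> real (Suc n) * d n" using that d0 by (intro mult_right_mono) auto
      then show ?thesis by (simp add: x_def d_def)
    qed
    have "F B - F A = (\<Sum>i<Suc n. F (x (Suc i)) - F (x i))"
      using sum_lessThan_telescope[of "\<lambda>i. F (x i)" "Suc n"] by (simp only: xn)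
    then have "\<bar>F B - F A\<bar> \<le> (\<Sum>i<Suc n. \<bar>F (x (Suc i)) - F (x i)\<bar>)" by (simp only: sum_abs)
    also have "\<dots> \<le> (\<Sum>i<Suc n. C * (d n * sqrt (d n)))"
    proof (rule sum_mono)
      fix i assume i: "i \<in> {..<Suc n}"
      have "x i \<le> x (Suc i)" using xs(2)[of i] d0 by linarith
      then show "\<bar>F (x (Suc i)) - F (x i)\<bar> \<le> C * (d n * sqrt (d n))"
        using F[of "x i" "x (Suc i)"] xs(1)[of i] xB[of "Suc i"] i unfolding xs(2) by simp
    qed
    also have "\<dots> = C * (real (Suc n) * d n) * sqrt (d n)" by (simp add: mult_ac)
    also have "real (Suc n) * d n = B - A" by (simp add: d_def)
    finally show ?thesis .
  qed
  moreover have "(\<lambda>n. C * (B - A) * sqrt (d n)) \<longlonglongrightarrow> C * (B - A) * sqrt ((B - A) * 0)"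
    unfolding d_def divide_inverse by (intro tendsto_intros LIMSEQ_inverse_real_of_nat)
  ultimately have "\<bar>F B - F A\<bar> \<le> C * (B - A) * sqrt ((B - A) * 0)" by (intro LIMSEQ_le_const) auto
  then show ?thesis by simp
qed

text \<open>Integration by parts for a \<open>C\<^sup>1\<close> function and a primitive of an \<open>L\<^sup>2\<close> function: the defect has increments of
  order \<open>3/2\<close>, because \<open>w\<close> is Hoelder continuous of exponent \<open>1/2\<close>.\<close>

lemma integration_by_parts_primitive:
  fixes w g \<psi> \<psi>' :: "real \<Rightarrow> real"
  assumes AB: "A \<le> B" and g: "L2 {A..B} g" and w: "\<And>x. x \<in> {A..B} \<Longrightarrow> w x = w A + integral {A..x} g"
    and \<psi>: "\<And>x. (\<psi> has_real_derivative \<psi>' x) (at x)" and \<psi>'c: "continuous_on UNIV \<psi>'"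
  shows "integral {A..B} (\<lambda>x. \<psi>' x * w x) = \<psi> B * w B - \<psi> A * w A - integral {A..B} (\<lambda>x. \<psi> x * g x)"
proof -
  have gi: "g integrable_on {x..y}" if "A \<le> x" "y \<le> B" for x y
    using L2_Icc_integral(2)[OF g] by (rule integrable_on_subinterval) (use that in auto)
  have w2: "w y - w x = integral {x..y} g" if "A \<le> x" "x \<le> y" "y \<le> B" for x y
    using w[of x] w[of y] Henstock_Kurzweil_Integration.integral_combine[of A x y g] gi[of A y] that by simp
  have wc: "continuous_on {A..B} w"
  proof -
    have "continuous_on {A..B} (\<lambda>x. w A + integral {A..x} g)"
      by (intro continuous_on_add continuous_on_const indefinite_integral_continuous_1 L2_Icc_integral(2)[OF g])
    then show ?thesis by (rule continuous_on_eq) (rule w[symmetric])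
  qed
  have \<psi>c: "continuous_on S \<psi>" for S
    using \<psi> by (intro continuous_at_imp_continuous_on ballI DERIV_isCont) blast
  have \<psi>L: "L2 {A..B} \<psi>" by (intro L2_continuous_bounded \<psi>c) auto
  have \<psi>g: "integrable (lebesgue_on {A..B}) (\<lambda>x. \<psi> x * g x)" by (rule L2_pair_integrable[OF \<psi>L g])
  define H where "H = (\<lambda>x. \<psi>' x * w x + \<psi> x * g x)"
  have i1: "(\<lambda>x. \<psi>' x * w x) integrable_on {A..B}"
    by (intro integrable_continuous_interval continuous_on_mult continuous_on_subset[OF \<psi>'c] wc) auto
  have i2: "(\<lambda>x. \<psi> x * g x) integrable_on {A..B}" using integrable_on_lebesgue_on[OF \<psi>g] by auto
  have Hi: "H integrable_on {x..y}" if "A \<le> x" "y \<le> B" for x y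
    unfolding H_def using integrable_on_subinterval[OF i1, of x y] integrable_on_subinterval[OF i2, of x y] that by (auto intro: integrable_add)
  define F where "F x = \<psi> x * w x - integral {A..x} H" for x
  have "bounded (\<psi>' ` {A..B})"
    by (intro compact_imp_bounded compact_continuous_image continuous_on_subset[OF \<psi>'c]) auto
  then obtain L where "\<forall>y\<in>\<psi>' ` {A..B}. norm y \<le> L" unfolding bounded_iff by blast
  then have L: "\<bar>\<psi>' x\<bar> \<le> L" if "x \<in> {A..B}" for x using that by simp
  have L0: "0 \<le> L" using L[of A] AB by auto
  define S where "S = enn2real (sqi {A..B} g)"
  have S: "sqi {A..B} g = ennreal S" "0 \<le> S" using g by (auto simp: S_def L2_iff less_top)
  have gb: "\<bar>integral {x..y} g\<bar> \<le> sqrt S * sqrt (y - x)" "integral {x..y} (\<lambda>t. \<bar>g t\<bar>) \<le> sqrt S * sqrt (y - x)"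
    if xy: "A \<le> x" "x \<le> y" "y \<le> B" for x y
  proof -
    have "(integral {x..y} g)\<^sup>2 \<le> (y - x) * S" "(integral {x..y} (\<lambda>t. \<bar>g t\<bar>))\<^sup>2 \<le> (y - x) * S"
      using L2_square_integral_bound[OF g xy] xy S by (simp_all add: ennreal_mult[symmetric])
    then show "\<bar>integral {x..y} g\<bar> \<le> sqrt S * sqrt (y - x)" "integral {x..y} (\<lambda>t. \<bar>g t\<bar>) \<le> sqrt S * sqrt (y - x)"
      using real_le_rsqrt[of "\<bar>integral {x..y} g\<bar>" "(y - x) * S"] real_le_rsqrt[of "integral {x..y} (\<lambda>t. \<bar>g t\<bar>)" "(y - x) * S"]
      by (simp_all add: real_sqrt_mult mult.commute)
  qed
  have "F B = F A"
  proof (rule const_if_superlinear_increments[OF AB])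
    fix x y assume xy: "A \<le> x" "x \<le> y" "y \<le> B"
    have sub: "{x..y} \<subseteq> {A..B}" using xy by auto
    have \<psi>i: "(\<psi>' has_integral (\<psi> y - \<psi> x)) {x..y}"
      by (rule fundamental_theorem_of_calculus[OF xy(2)])
        (use \<psi> in \<open>auto simp: has_real_derivative_iff_has_vector_derivative[symmetric] intro: has_field_derivative_at_within\<close>)
    have gI: "(g has_integral (w y - w x)) {x..y}" using gi[of x y] w2[of x y] xy by (simp add: integrable_integral)
    have HI: "(H has_integral (integral {A..y} H - integral {A..x} H)) {x..y}"
    proof -
      have "integral {A..x} H + integral {x..y} H = integral {A..y} H"
        using xy by (intro Henstock_Kurzweil_Integration.integral_combine Hi) auto
      then have "integral {x..y} H = integral {A..y} H - integral {A..x} H" by linarith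
      then show ?thesis using integrable_integral[OF Hi[of x y]] xy by metis
    qed
    \<comment> \<open>the increment of \<open>\<psi> * w\<close> is the integral of \<open>H\<close> with \<open>w\<close> frozen at \<open>y\<close> and \<open>\<psi>\<close> frozen at \<open>x\<close>\<close>
    have I: "((\<lambda>t. (w y * \<psi>' t + \<psi> x * g t) - H t) has_integral
        (w y * (\<psi> y - \<psi> x) + \<psi> x * (w y - w x)) - (integral {A..y} H - integral {A..x} H)) {x..y}"
      by (intro has_integral_diff has_integral_add has_integral_mult_right \<psi>i gI HI)
    have "(w y * (\<psi> y - \<psi> x) + \<psi> x * (w y - w x)) - (integral {A..y} H - integral {A..x} H) = F y - F x"
      by (simp add: F_def algebra_simps)
    moreover have "((\<lambda>t. L * (sqrt S * sqrt (y - x)) + (L * (y - x)) * \<bar>g t\<bar>) has_integral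
        (L * (sqrt S * sqrt (y - x))) * (y - x) + (L * (y - x)) * integral {x..y} (\<lambda>t. \<bar>g t\<bar>)) {x..y}"
    proof (intro has_integral_add has_integral_mult_right)
      show "((\<lambda>t. L * (sqrt S * sqrt (y - x))) has_integral L * (sqrt S * sqrt (y - x)) * (y - x)) {x..y}"
        using has_integral_const_real[of "L * (sqrt S * sqrt (y - x))" x y] xy by (simp add: mult.commute)
      have Lg: "L2 {x..y} g" by (rule L2_subset[OF g sub]) auto
      have "L2 {x..y} (\<lambda>t. \<bar>g t\<bar>)" by (rule L2_mono[OF Lg]) (use Lg in \<open>auto simp: L2_def\<close>)
      then show "((\<lambda>t. \<bar>g t\<bar>) has_integral integral {x..y} (\<lambda>t. \<bar>g t\<bar>)) {x..y}"
        by (intro integrable_integral L2_Icc_integral(2))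
    qed
    moreover have "norm ((w y * \<psi>' t + \<psi> x * g t) - H t) \<le> L * (sqrt S * sqrt (y - x)) + (L * (y - x)) * \<bar>g t\<bar>" if t: "t \<in> {x..y}" for t
    proof -
      have t': "A \<le> t" "t \<le> B" "x \<le> t" "t \<le> y" using t xy by auto
      have 1: "\<bar>w y - w t\<bar> \<le> sqrt S * sqrt (y - x)"
      proof -
        have "\<bar>w y - w t\<bar> \<le> sqrt S * sqrt (y - t)" using w2[of t y] gb(1)[of t y] t' xy by simp
        also have "\<dots> \<le> sqrt S * sqrt (y - x)" using t' S(2) by (intro mult_left_mono) auto
        finally show ?thesis .
      qed
      have 2: "\<bar>\<psi> x - \<psi> t\<bar> \<le> L * (y - x)"
      proof (cases "x = t")
        case False
        then obtain z where "x < z" "z < t" "\<psi> t - \<psi> x = (t - x) * \<psi>' z" using MVT2[of x t \<psi> \<psi>'] \<psi> t' by auto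
        moreover from this have "\<bar>(t - x) * \<psi>' z\<bar> \<le> (y - x) * L"
          using L[of z] t' xy unfolding abs_mult by (intro mult_mono) auto
        ultimately show ?thesis by (simp add: abs_minus_commute mult.commute)
      qed (use L0 xy in simp)
      have "(w y * \<psi>' t + \<psi> x * g t) - H t = \<psi>' t * (w y - w t) + (\<psi> x - \<psi> t) * g t" by (simp add: H_def algebra_simps)
      also have "norm \<dots> \<le> \<bar>\<psi>' t\<bar> * \<bar>w y - w t\<bar> + \<bar>\<psi> x - \<psi> t\<bar> * \<bar>g t\<bar>" by (simp add: abs_mult[symmetric] abs_triangle_ineq)
      also have "\<dots> \<le> L * (sqrt S * sqrt (y - x)) + (L * (y - x)) * \<bar>g t\<bar>"
        using L[of t] t' L0 by (intro add_mono mult_mono 1 2) auto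
      finally show ?thesis .
    qed
    ultimately have "\<bar>F y - F x\<bar> \<le> (L * (sqrt S * sqrt (y - x))) * (y - x) + (L * (y - x)) * integral {x..y} (\<lambda>t. \<bar>g t\<bar>)"
      using integral_norm_bound_integral[of "\<lambda>t. (w y * \<psi>' t + \<psi> x * g t) - H t" "{x..y}" "\<lambda>t. L * (sqrt S * sqrt (y - x)) + (L * (y - x)) * \<bar>g t\<bar>"] I
      by (simp add: integral_unique has_integral_integrable)
    also have "\<dots> \<le> (L * (sqrt S * sqrt (y - x))) * (y - x) + (L * (y - x)) * (sqrt S * sqrt (y - x))"
      using L0 xy by (intro add_left_mono mult_left_mono gb(2)) auto
    also have "\<dots> = (2 * L * sqrt S) * ((y - x) * sqrt (y - x))" by (simp add: algebra_simps)
    finally show "\<bar>F y - F x\<bar> \<le> (2 * L * sqrt S) * ((y - x) * sqrt (y - x))" .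
  qed
  then have "integral {A..B} H = \<psi> B * w B - \<psi> A * w A" by (simp add: F_def)
  moreover have "integral {A..B} H = integral {A..B} (\<lambda>x. \<psi>' x * w x) + integral {A..B} (\<lambda>x. \<psi> x * g x)"
    unfolding H_def by (rule Henstock_Kurzweil_Integration.integral_add[OF i1 i2])
  ultimately show ?thesis by linarith
qed

definition primitive_on :: "real set \<Rightarrow> (real \<Rightarrow> real) \<Rightarrow> (real \<Rightarrow> real) \<Rightarrow> bool" where
  "primitive_on I u g \<longleftrightarrow> L2 I g \<and> (\<forall>a\<in>I. \<forall>b\<in>I. a \<le> b \<longrightarrow> u b - u a = integral {a..b} g)"

lemma primitive_onD:
  assumes "primitive_on I u g"
  shows "L2 I g" "a \<in> I \<Longrightarrow> b \<in> I \<Longrightarrow> a \<le> b \<Longrightarrow> u b - u a = integral {a..b} g"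
  using assms by (auto simp: primitive_on_def)

lemma smooth_real_derivative:
  assumes "smooth (\<phi> :: real \<Rightarrow> real)"
  shows "(\<phi> has_real_derivative frechet_derivative \<phi> (at x) 1) (at x)"
proof -
  have l: "linear (frechet_derivative \<phi> (at x))" by (rule has_derivative_linear[OF smooth_has_derivative[OF assms]])
  have eq: "frechet_derivative \<phi> (at x) = (\<lambda>t. frechet_derivative \<phi> (at x) 1 * t)"
  proof
    fix t show "frechet_derivative \<phi> (at x) t = frechet_derivative \<phi> (at x) 1 * t"
      using linear_cmul[OF l, of t 1] by (simp add: mult.commute)
  qed
  have "(\<phi> has_derivative (\<lambda>t. frechet_derivative \<phi> (at x) 1 * t)) (at x)"
    by (subst eq[symmetric]) (rule smooth_has_derivative[OF assms])
  then show ?thesis by (simp add: has_field_derivative_def)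
qed

lemma primitive_Icc_continuous:
  assumes "primitive_on {A..B} u g"
  shows "continuous_on {A..B} u"
proof (cases "A \<le> B")
  case True
  have "continuous_on {A..B} (\<lambda>x. u A + integral {A..x} g)"
    by (intro continuous_on_add continuous_on_const indefinite_integral_continuous_1 L2_Icc_integral(2) primitive_onD[OF assms])
  then show ?thesis
  proof (rule continuous_on_eq)
    show "u A + integral {A..x} g = u x" if "x \<in> {A..B}" for x
      using primitive_onD(2)[OF assms, of A x] that by auto
  qed
qed simp

lemma primitive_subset:
  assumes "primitive_on I u g" "J \<subseteq> I" "J \<in> sets lebesgue" "I \<in> sets lebesgue"
  shows "primitive_on J u g"
  using assms L2_subset[of I g J] unfolding primitive_on_def by blast

text \<open>Integration by parts on a compact subinterval whose end points are outside of the support of the test function.\<close>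

lemma primitive_weak_gradient:
  assumes I: "open I" "convex I" and u: "primitive_on I u g"
  shows "has_weak_gradient I u g"
  unfolding has_weak_gradient_def
proof (intro conjI allI impI ballI primitive_onD[OF u])
  fix \<phi> :: "real \<Rightarrow> real" and b :: real assume t: "test_function I \<phi>" and "b \<in> Basis"
  then have b: "b = 1" by simp
  have Im: "I \<in> sets lebesgue" using I by auto
  obtain K where K: "compact K" "K \<subseteq> I" "\<And>x. x \<notin> K \<Longrightarrow> \<phi> x = 0" "smooth \<phi>"
    using test_functionE[OF t] by blast
  let ?d = "\<lambda>x. frechet_derivative \<phi> (at x) 1"
  have d0: "?d x = 0" if "x \<notin> K" for x
    using frechet_derivative_zero_outside[OF compact_imp_closed[OF K(1)] K(3) that] by simp
  show "(LINT x|lebesgue_on I. u x * frechet_derivative \<phi> (at x) b) = - (LINT x|lebesgue_on I. (g x \<bullet> b) * \<phi> x)"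
  proof (cases "K = {}")
    case True
    then have "?d x = 0" "\<phi> x = 0" for x using d0 K(3) by auto
    then show ?thesis using b by simp
  next
    case False
    obtain a where a: "a \<in> K" "\<And>x. x \<in> K \<Longrightarrow> a \<le> x" using compact_attains_inf[OF K(1) False] by blast
    obtain c where c: "c \<in> K" "\<And>x. x \<in> K \<Longrightarrow> x \<le> c" using compact_attains_sup[OF K(1) False] by blast
    obtain r1 where r1: "r1 > 0" "ball a r1 \<subseteq> I" using I(1) a(1) K(2) by (meson open_contains_ball subsetD)
    obtain r2 where r2: "r2 > 0" "ball c r2 \<subseteq> I" using I(1) c(1) K(2) by (meson open_contains_ball subsetD)
    define A where "A = a - r1 / 2"
    define B where "B = c + r2 / 2"
    have "A \<in> ball a r1" "B \<in> ball c r2" using r1(1) r2(1) by (simp_all add: A_def B_def dist_real_def)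
    then have AI: "A \<in> I" "B \<in> I" using r1(2) r2(2) by blast+
    have AK: "A \<notin> K" "B \<notin> K" using a(2)[of A] c(2)[of B] r1(1) r2(1) by (auto simp: A_def B_def)
    have KAB: "K \<subseteq> {A..B}" using a(2) c(2) r1(1) r2(1) by (force simp: A_def B_def)
    have AB: "A \<le> B" using KAB a(1) by auto
    have ABI: "{A..B} \<subseteq> I" using I(2) AI by (metis atLeastatMost_subset_iff closed_segment_eq_real_ivl closed_segment_subset AB)
    have pAB: "primitive_on {A..B} u g" by (rule primitive_subset[OF u ABI]) (use Im in auto)
    have uc: "continuous_on {A..B} u" by (rule primitive_Icc_continuous[OF pAB])
    have gL: "L2 {A..B} g" by (rule primitive_onD(1)[OF pAB])
    have \<phi>L: "L2 {A..B} \<phi>" by (intro L2_continuous_bounded smooth_continuous K) auto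
    have dc: "continuous_on UNIV ?d" by (intro smooth_continuous smooth_frechet K) simp
    have "(LINT x|lebesgue_on I. u x * ?d x) = (LINT x|lebesgue_on {A..B}. u x * ?d x)"
    proof -
      have "?d x = 0" if "x \<notin> I \<or> x \<notin> {A..B}" for x using d0 K(2) KAB that by blast
      then show ?thesis by (subst (1 2) test_function_UNIV_integral) (use Im in auto)
    qed
    also have "\<dots> = integral {A..B} (\<lambda>x. u x * ?d x)"
      by (intro continuous_Icc_integral continuous_on_mult uc continuous_on_subset[OF dc]) auto
    also have "\<dots> = integral {A..B} (\<lambda>x. ?d x * u x)" by (simp add: mult.commute)
    also have "\<dots> = \<phi> B * u B - \<phi> A * u A - integral {A..B} (\<lambda>x. \<phi> x * g x)"
    proof (rule integration_by_parts_primitive[OF AB gL _ smooth_real_derivative[OF K(4)] dc])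
      show "u x = u A + integral {A..x} g" if "x \<in> {A..B}" for x
        using primitive_onD(2)[OF pAB, of A x] that by auto
    qed
    also have "\<dots> = - integral {A..B} (\<lambda>x. \<phi> x * g x)" using AK K(3) by simp
    also have "integral {A..B} (\<lambda>x. \<phi> x * g x) = (LINT x|lebesgue_on {A..B}. \<phi> x * g x)"
      using lebesgue_integral_eq_integral[OF L2_pair_integrable[OF \<phi>L gL]] by simp
    also have "\<dots> = (LINT x|lebesgue_on I. \<phi> x * g x)"
    proof -
      have "\<phi> x = 0" if "x \<notin> I \<or> x \<notin> {A..B}" for x using K(2,3) KAB that by blast
      then show ?thesis by (subst (1 2) test_function_UNIV_integral) (use Im in auto)
    qed
    finally show ?thesis using b by (simp add: mult.commute)
  qed
qed

text \<open>The kernels live on \<open>{y<..<y + 1 / n}\<close>, to the right of \<open>y\<close>, so \<open>y\<close> may be the left end point of the interval.\<close>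

lemma mollify_limit:
  assumes ay: "a \<le> y" "y < c" and u: "continuous_on {a..c} u"
  shows "(\<lambda>n. integral {a..c} (\<lambda>x. u x * (real n * (bump (real n * (x - y)) / bump_mass)))) \<longlonglongrightarrow> u y"
proof (rule LIMSEQ_I)
  define W where "W n x = real n * (bump (real n * (x - y)) / bump_mass)" for n x
  fix e :: real assume e: "e > 0"
  have "y \<in> {a..c}" using ay by auto
  then obtain d where d: "d > 0" "\<And>x. x \<in> {a..c} \<Longrightarrow> dist x y < d \<Longrightarrow> dist (u x) (u y) < e / 2"
    using u e unfolding continuous_on_iff by (meson half_gt_zero)
  obtain N :: nat where N: "max (1 / d) (1 / (c - y)) < real N" using reals_Archimedean2 by blast
  show "\<exists>no. \<forall>n\<ge>no. norm (integral {a..c} (\<lambda>x. u x * (real n * (bump (real n * (x - y)) / bump_mass))) - u y) < e"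
  proof (intro exI allI impI)
    fix n assume n: "n \<ge> N"
    have "1 / d < real n" "1 / (c - y) < real n" using N n by (meson less_le_trans max_less_iff_conj of_nat_mono)+
    then have nd: "1 < real n * d" "1 < real n * (c - y)" using d(1) ay by (simp_all add: pos_divide_less_eq)
    have n0: "real n > 0" using nd d(1) by (auto simp: zero_less_mult_iff intro: gr0I)
    have Wc: "continuous_on S (W n)" for S
      unfolding W_def using bump_mass_pos
      by (intro continuous_intros continuous_on_compose2[OF smooth_continuous[OF smooth_bump, of UNIV]]) auto
    have W0: "0 \<le> W n x" for x unfolding W_def using bump_nonneg bump_mass_pos by auto
    have "((\<lambda>x. smooth_step (real n * (x - y))) has_real_derivative W n x) (at x)" for x
    proof -
      have "((\<lambda>x. real n * (x - y)) has_real_derivative real n) (at x)" by (auto intro!: derivative_eq_intros)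
      from DERIV_chain2[OF smooth_step_deriv this] show ?thesis by (simp add: W_def mult.commute)
    qed
    then have "(W n has_integral (smooth_step (real n * (c - y)) - smooth_step (real n * (a - y)))) {a..c}"
      using ay by (intro fundamental_theorem_of_calculus) (auto simp: has_real_derivative_iff_has_vector_derivative[symmetric] intro: has_field_derivative_at_within)
    moreover have "smooth_step (real n * (c - y)) = 1" using nd by (intro smooth_step_1) simp
    moreover have "smooth_step (real n * (a - y)) = 0" using ay by (intro smooth_step_0) (simp add: mult_nonneg_nonpos)
    ultimately have WI: "(W n has_integral 1) {a..c}" by simp
    have I1: "(\<lambda>x. u x * W n x) integrable_on {a..c}" by (intro integrable_continuous_interval continuous_on_mult u Wc)
    have I2: "((\<lambda>x. u x * W n x - u y * W n x) has_integral (integral {a..c} (\<lambda>x. u x * W n x) - u y * 1)) {a..c}"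
      by (intro has_integral_diff integrable_integral I1 has_integral_mult_right WI)
    have I3: "((\<lambda>x. e / 2 * W n x) has_integral (e / 2 * 1)) {a..c}" by (intro has_integral_mult_right WI)
    have I4: "norm (u x * W n x - u y * W n x) \<le> e / 2 * W n x" if x: "x \<in> {a..c}" for x
    proof (cases "W n x = 0")
      case False
      then have "bump (real n * (x - y)) \<noteq> 0" by (auto simp: W_def)
      then have "0 < real n * (x - y)" "real n * (x - y) < 1" using bump_zero[of "real n * (x - y)"] by linarith+
      then have "real n * (x - y) < real n * d" "0 < x - y" using n0 nd(1) by (linarith, simp add: zero_less_mult_iff)
      from this(1) have "x - y < d" by (rule mult_left_less_imp_less) simp
      then have "dist x y < d" using \<open>0 < x - y\<close> by (simp add: dist_real_def)
      then have "\<bar>u x - u y\<bar> \<le> e / 2" using d(2)[OF x] by (simp add: dist_real_def less_imp_le)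
      then have "\<bar>u x - u y\<bar> * W n x \<le> e / 2 * W n x" using W0 by (rule mult_right_mono)
      then show ?thesis using W0[of x] by (simp add: left_diff_distrib[symmetric] abs_mult)
    qed simp
    have "norm (integral {a..c} (\<lambda>x. u x * W n x) - u y) \<le> e / 2"
      using integral_norm_bound_integral[OF has_integral_integrable[OF I2] has_integral_integrable[OF I3] I4]
      unfolding integral_unique[OF I2] integral_unique[OF I3] by simp
    then show "norm (integral {a..c} (\<lambda>x. u x * (real n * (bump (real n * (x - y)) / bump_mass))) - u y) < e"
      using e unfolding W_def by linarith
  qed
qed

text \<open>Test with the difference of two steep steps at \<open>a\<close> and \<open>b\<close>. It tends to the indicator of the interval, and its derivative
  tends to the difference of the evaluations at \<open>a\<close> and \<open>b\<close>. The steps rise to the right of their base points, which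
  requires a point \<open>c\<close> beyond \<open>b\<close>.\<close>

lemma weak_gradient_primitive:
  assumes I: "open I" "convex I" and uc: "continuous_on I u" and u: "has_weak_gradient I u g"
  shows "primitive_on I u g"
  unfolding primitive_on_def
proof (intro conjI ballI impI)
  show gL: "L2 I g" by (rule has_weak_gradient_L2[OF u])
  have Im: "I \<in> sets lebesgue" using I by auto
  fix a b assume ab: "a \<in> I" "b \<in> I" "a \<le> b"
  obtain r where r: "r > 0" "ball b r \<subseteq> I" using I(1) ab(2) by (meson open_contains_ball)
  define c where "c = b + r / 2"
  have cI: "c \<in> I" using r by (auto simp: c_def dist_real_def intro!: subsetD[OF r(2)])
  have bc: "b < c" using r by (simp add: c_def)
  have acI: "{a..c} \<subseteq> I" using I(2) ab cI bc by (metis closed_segment_eq_real_ivl closed_segment_subset less_imp_le order_trans)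
  have ucc: "continuous_on {a..c} u" by (rule continuous_on_subset[OF uc acI])
  have gLc: "L2 {a..c} g" by (rule L2_subset[OF gL acI]) (use Im in auto)
  have gi: "integrable (lebesgue_on {a..c}) g" by (rule L2_Icc_integrable[OF gLc])
  define \<phi> where "\<phi> n x = smooth_step (real n * (x - a)) - smooth_step (real n * (x - b))" for n x
  define W where "W y n x = real n * (bump (real n * (x - y)) / bump_mass)" for y n x
  have sm: "smooth (\<phi> n)" for n
  proof -
    have s: "smooth (\<lambda>x::real. smooth_step (real n \<bullet> x + (- real n * y)))" for y by (intro smooth_affine smooth_smooth_step)
    have "smooth (\<lambda>x::real. smooth_step (real n \<bullet> x + (- real n * a)) - smooth_step (real n \<bullet> x + (- real n * b)))"
      by (intro smooth_diff s)
    then show ?thesis by (simp add: \<phi>_def[abs_def] right_diff_distrib)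
  qed
  have der: "((\<lambda>x. smooth_step (real n * (x - y))) has_real_derivative W y n x) (at x)" for x y n
  proof -
    have "((\<lambda>x. real n * (x - y)) has_real_derivative real n) (at x)" by (auto intro!: derivative_eq_intros)
    from DERIV_chain2[OF smooth_step_deriv this] show ?thesis by (simp add: W_def mult.commute)
  qed
  have fd: "frechet_derivative (\<phi> n) (at x) 1 = W a n x - W b n x" for n x
  proof -
    have "(\<phi> n has_real_derivative W a n x - W b n x) (at x)" unfolding \<phi>_def[abs_def] by (intro DERIV_diff der)
    from DERIV_unique[OF smooth_real_derivative[OF sm] this] show ?thesis .
  qed
  have Wc: "continuous_on S (W y n)" for S y n
    unfolding W_def using bump_mass_pos
    by (intro continuous_intros continuous_on_compose2[OF smooth_continuous[OF smooth_bump, of UNIV]]) auto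
  obtain N :: nat where N: "1 / (c - b) < real N" using reals_Archimedean2 by blast
  have big: "1 \<le> real n * (x - b)" if "n \<ge> N" "x \<ge> c" for n x
  proof -
    have "1 / (c - b) \<le> real n" using N that(1) by (meson less_imp_le of_nat_mono order_trans)
    then have "1 \<le> real n * (c - b)" using bc by (simp add: pos_divide_le_eq)
    also have "\<dots> \<le> real n * (x - b)" using that(2) by (intro mult_left_mono) auto
    finally show ?thesis .
  qed
  have zero: "\<phi> n x = 0" if n: "n \<ge> N" and x: "x \<notin> {a..c}" for n x
  proof (cases "x < a")
    case True
    then show ?thesis using ab(3) by (simp add: \<phi>_def smooth_step_0 mult_nonneg_nonpos)
  next
    case False
    then have "x \<ge> c" using x by auto
    then have "1 \<le> real n * (x - b)" using big n by blast
    moreover have "real n * (x - b) \<le> real n * (x - a)" using ab(3) by (intro mult_left_mono) auto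
    ultimately show ?thesis by (simp add: \<phi>_def smooth_step_1)
  qed
  have "u b - u a = (LINT x|lebesgue_on {a..c}. g x * indicator {a<..b} x)"
  proof (rule LIMSEQ_unique)
    have "(\<lambda>n. integral {a..c} (\<lambda>x. u x * W b n x) - integral {a..c} (\<lambda>x. u x * W a n x)) \<longlonglongrightarrow> u b - u a"
      unfolding W_def using ab(3) bc by (intro tendsto_diff mollify_limit ucc) auto
    moreover have "integral {a..c} (\<lambda>x. u x * W b n x) - integral {a..c} (\<lambda>x. u x * W a n x) = (LINT x|lebesgue_on {a..c}. g x * \<phi> n x)"
      if n: "n \<ge> N" for n
    proof -
      have t: "test_function I (\<phi> n)" by (rule test_functionI[OF sm _ acI zero[OF n]]) auto
      have d0: "frechet_derivative (\<phi> n) (at x) 1 = 0" if "x \<notin> {a..c}" for x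
        using frechet_derivative_zero_outside[of "{a..c}" "\<phi> n" x] zero[OF n] that by simp
      have "(LINT x|lebesgue_on I. u x * frechet_derivative (\<phi> n) (at x) 1) = (LINT x|lebesgue_on {a..c}. u x * frechet_derivative (\<phi> n) (at x) 1)"
      proof -
        have "frechet_derivative (\<phi> n) (at x) 1 = 0" if "x \<notin> I" for x using d0 acI that by blast
        then show ?thesis using d0 by (subst (1 2) test_function_UNIV_integral) (use Im in auto)
      qed
      also have "\<dots> = integral {a..c} (\<lambda>x. u x * W a n x - u x * W b n x)"
        unfolding fd right_diff_distrib by (intro continuous_Icc_integral continuous_on_diff continuous_on_mult ucc Wc)
      also have "\<dots> = integral {a..c} (\<lambda>x. u x * W a n x) - integral {a..c} (\<lambda>x. u x * W b n x)"
        by (intro Henstock_Kurzweil_Integration.integral_diff integrable_continuous_interval continuous_on_mult ucc Wc)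
      finally have 1: "(LINT x|lebesgue_on I. u x * frechet_derivative (\<phi> n) (at x) 1) = integral {a..c} (\<lambda>x. u x * W a n x) - integral {a..c} (\<lambda>x. u x * W b n x)" .
      have 2: "(LINT x|lebesgue_on I. (g x \<bullet> 1) * \<phi> n x) = (LINT x|lebesgue_on {a..c}. g x * \<phi> n x)"
      proof -
        have "\<phi> n x = 0" if "x \<notin> I" for x using zero[OF n] acI that by blast
        then show ?thesis using zero[OF n] by (subst (1 2) test_function_UNIV_integral) (use Im in auto)
      qed
      show ?thesis using has_weak_gradientD[OF u t, of 1] unfolding 1 2 by simp
    qed
    ultimately show "(\<lambda>n. LINT x|lebesgue_on {a..c}. g x * \<phi> n x) \<longlonglongrightarrow> u b - u a"
      by (rule Lim_transform_eventually[OF _ eventually_sequentiallyI[of N]])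
    show "(\<lambda>n. LINT x|lebesgue_on {a..c}. g x * \<phi> n x) \<longlonglongrightarrow> (LINT x|lebesgue_on {a..c}. g x * indicator {a<..b} x)"
    proof (rule integral_dominated_convergence[where w="\<lambda>x. \<bar>g x\<bar>"])
      show "(\<lambda>x. g x * indicator {a<..b} x) \<in> borel_measurable (lebesgue_on {a..c})"
        using bc by (intro borel_measurable_times borel_measurable_integrable[OF gi] borel_measurable_indicator) (auto simp: sets_restrict_space_iff)
      show "(\<lambda>x. g x * \<phi> n x) \<in> borel_measurable (lebesgue_on {a..c})" for n
        by (intro borel_measurable_times borel_measurable_integrable[OF gi] lmeas_continuous smooth_continuous sm)
      show "integrable (lebesgue_on {a..c}) (\<lambda>x. \<bar>g x\<bar>)" using gi by (rule integrable_abs)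
      show "AE x in lebesgue_on {a..c}. norm (g x * \<phi> n x) \<le> \<bar>g x\<bar>" for n
      proof (rule AE_I2)
        fix x
        have "\<bar>\<phi> n x\<bar> \<le> 1" unfolding \<phi>_def using smooth_step_range[of "real n * (x - a)"] smooth_step_range[of "real n * (x - b)"] by linarith
        then show "norm (g x * \<phi> n x) \<le> \<bar>g x\<bar>" by (simp add: abs_mult mult_left_le)
      qed
      have st: "(\<lambda>n. smooth_step (real n * t)) \<longlonglongrightarrow> (if 0 < t then 1 else 0)" for t
      proof (cases "0 < t")
        case True
        obtain M :: nat where M: "1 / t < real M" using reals_Archimedean2 by blast
        have "smooth_step (real n * t) = 1" if "n \<ge> M" for n
        proof (rule smooth_step_1)
          have "1 / t \<le> real n" using M that by (meson less_imp_le of_nat_mono order_trans)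
          then show "1 \<le> real n * t" using True by (simp add: pos_divide_le_eq)
        qed
        then show ?thesis using True by (intro tendsto_eventually eventually_sequentiallyI[of M]) auto
      next
        case False
        then have "smooth_step (real n * t) = 0" for n by (intro smooth_step_0) (simp add: mult_nonneg_nonpos)
        then show ?thesis using False by simp
      qed
      show "AE x in lebesgue_on {a..c}. (\<lambda>n. g x * \<phi> n x) \<longlonglongrightarrow> g x * indicator {a<..b} x"
      proof (intro AE_I2 tendsto_mult tendsto_const)
        fix x
        have "(\<lambda>n. \<phi> n x) \<longlonglongrightarrow> (if 0 < x - a then 1 else 0) - (if 0 < x - b then 1 else 0)"
          unfolding \<phi>_def by (intro tendsto_diff st)
        moreover have "(if 0 < x - a then 1 else 0) - (if 0 < x - b then 1 else 0) = indicat_real {a<..b} x" using ab(3) by (auto split: split_indicator)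
        ultimately show "(\<lambda>n. \<phi> n x) \<longlonglongrightarrow> indicator {a<..b} x" by simp
      qed
    qed
  qed
  also have "\<dots> = (LINT x|lebesgue_on {a..b}. g x)"
  proof -
    have ac: "{a..c} \<in> sets lebesgue" "{a..b} \<in> sets lebesgue" by auto
    have N: "{a} \<in> null_sets lebesgue" by simp
    have "(LINT x|lebesgue_on {a..c}. g x * indicator {a<..b} x) = (LINT x|lebesgue. indicator {a..c} x *\<^sub>R (g x * indicator {a<..b} x))"
      by (rule integral_restrict_space) auto
    also have "\<dots> = (LINT x|lebesgue. indicator {a..b} x *\<^sub>R g x)"
    proof (rule integral_cong_AE)
      have ab': "L2 {a..b} g" by (rule L2_subset[OF gLc]) (use bc in auto)
      have "integrable (lebesgue_on {a..c}) (\<lambda>x. g x * indicator {a<..b} x)"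
      proof (rule integrable_real_mult_indicator[OF _ gi])
        have "{a<..b} \<subseteq> {a..c}" using bc by auto
        then show "{a<..b} \<in> sets (lebesgue_on {a..c})" by (simp add: sets_restrict_space_iff)
      qed
      then show "(\<lambda>x. indicator {a..c} x *\<^sub>R (g x * indicator {a<..b} x)) \<in> borel_measurable lebesgue"
        using ac by (auto simp: integrable_restrict_space)
      show "(\<lambda>x. indicator {a..b} x *\<^sub>R g x) \<in> borel_measurable lebesgue"
        using L2_Icc_integrable[OF ab'] ac by (auto simp: integrable_restrict_space)
      show "AE x in lebesgue. indicator {a..c} x *\<^sub>R (g x * indicator {a<..b} x) = indicator {a..b} x *\<^sub>R g x"
        using AE_not_in[OF N] by eventually_elim (use bc in \<open>auto split: split_indicator\<close>)
    qed
    also have "\<dots> = (LINT x|lebesgue_on {a..b}. g x)" by (rule integral_restrict_space[symmetric]) auto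
    finally show ?thesis .
  qed
  also have "\<dots> = integral {a..b} g"
    by (rule L2_Icc_integral(1)[OF L2_subset[OF gLc]]) (use bc in auto)
  finally show "u b - u a = integral {a..b} g" .
qed

section \<open>The volume-constrained parabola\<close>

lemma sqi_Pythagoras:
  fixes f \<psi> :: "'a::euclidean_space \<Rightarrow> real"
  assumes f: "L2 I f" and \<psi>: "L2 I \<psi>" and orth: "(LINT x|lebesgue_on I. f x * \<psi> x) = 0"
  shows "sqi I (\<lambda>x. f x + \<psi> x) = sqi I f + sqi I \<psi>"
proof -
  have i: "integrable (lebesgue_on I) (\<lambda>x. (f x)\<^sup>2)" "integrable (lebesgue_on I) (\<lambda>x. (\<psi> x)\<^sup>2)"
    using f \<psi> by (auto simp: L2_def)
  have "(LINT x|lebesgue_on I. (norm (f x + \<psi> x))\<^sup>2) = (LINT x|lebesgue_on I. (f x)\<^sup>2 + 2 * (f x * \<psi> x) + (\<psi> x)\<^sup>2)"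
    by (intro Bochner_Integration.integral_cong) (auto simp: power2_sum)
  also have "\<dots> = (LINT x|lebesgue_on I. (norm (f x))\<^sup>2) + (LINT x|lebesgue_on I. (norm (\<psi> x))\<^sup>2)"
    using i L2_pair_integrable[OF f \<psi>] orth by simp
  finally have "ennreal (LINT x|lebesgue_on I. (norm (f x + \<psi> x))\<^sup>2) = ennreal (LINT x|lebesgue_on I. (norm (f x))\<^sup>2) + ennreal (LINT x|lebesgue_on I. (norm (\<psi> x))\<^sup>2)"
    by simp
  then show ?thesis unfolding sqi_L2[OF L2_add[OF f \<psi>]] sqi_L2[OF f] sqi_L2[OF \<psi>] .
qed

lemma open_interval_sets: "{\<alpha><..<\<beta>::real} \<in> sets lebesgue" "bounded {\<alpha><..<\<beta>::real}"
  unfolding box_real(1)[symmetric] by auto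

text \<open>A function of class \<open>H1\<close> on the open interval is a primitive there; continuity extends this to the end points.\<close>

lemma primitive_closure:
  assumes \<alpha>\<beta>: "\<alpha> < \<beta>" and u: "primitive_on {\<alpha><..<\<beta>} u g" and uc: "continuous_on {\<alpha>..\<beta>} u"
  shows "primitive_on {\<alpha>..\<beta>} u (\<lambda>x. indicator {\<alpha><..<\<beta>} x *\<^sub>R g x)"
proof -
  define g' where "g' = (\<lambda>x. indicator {\<alpha><..<\<beta>} x *\<^sub>R g x)"
  have gU: "L2 UNIV g'" unfolding g'_def by (intro L2_extend_zero primitive_onD[OF u] open_interval_sets)
  have gL: "L2 {\<alpha>..\<beta>} g'" by (rule L2_subset[OF gU]) auto
  have gi: "g' integrable_on {a..b}" if "\<alpha> \<le> a" "b \<le> \<beta>" for a b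
    by (rule integrable_on_subinterval[OF L2_Icc_integral(2)[OF gL]]) (use that in auto)
  define D where "D x = u x - integral {\<alpha>..x} g'" for x
  have Dc: "continuous_on {\<alpha>..\<beta>} D"
    unfolding D_def by (intro continuous_on_diff uc indefinite_integral_continuous_1 L2_Icc_integral(2)[OF gL])
  have comb: "integral {\<alpha>..b} g' - integral {\<alpha>..a} g' = integral {a..b} g'" if "\<alpha> \<le> a" "a \<le> b" "b \<le> \<beta>" for a b
    using Henstock_Kurzweil_Integration.integral_combine[of \<alpha> a b g'] gi[of \<alpha> b] that by simp
  have Dab: "D b = D a" if ab: "a \<in> {\<alpha><..<\<beta>}" "b \<in> {\<alpha><..<\<beta>}" "a \<le> b" for a b
  proof -
    have "integral {a..b} g' = integral {a..b} g"
      unfolding g'_def by (rule Henstock_Kurzweil_Integration.integral_cong) (use ab in auto)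
    then show ?thesis using primitive_onD(2)[OF u ab] comb[of a b] ab by (simp add: D_def)
  qed
  define m where "m = (\<alpha> + \<beta>) / 2"
  have "D x = D m" if "x \<in> {\<alpha><..<\<beta>}" for x
    using Dab[of x m] Dab[of m x] that by (cases "x \<le> m") (auto simp: m_def)
  moreover have "closure {\<alpha><..<\<beta>} = {\<alpha>..\<beta>}" using \<alpha>\<beta> by (rule closure_greaterThanLessThan)
  ultimately have Dm: "D x = D m" if "x \<in> {\<alpha>..\<beta>}" for x
    using continuous_constant_on_closure[of "{\<alpha><..<\<beta>}" D "D m" x] Dc that by simp
  show ?thesis
    unfolding primitive_on_def g'_def[symmetric]
  proof (intro conjI gL ballI impI)
    fix a b assume ab: "a \<in> {\<alpha>..\<beta>}" "b \<in> {\<alpha>..\<beta>}" "a \<le> b"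
    then show "u b - u a = integral {a..b} g'" using Dm[of a] Dm[of b] comb[of a b] by (simp add: D_def)
  qed
qed

lemma primitive_C1:
  assumes "\<And>x. (p has_real_derivative p' x) (at x)" "continuous_on UNIV p'" "bounded I" "I \<in> sets lebesgue"
  shows "primitive_on I p p'"
  unfolding primitive_on_def
proof (intro conjI ballI impI)
  show "L2 I p'" by (intro L2_continuous_bounded assms)
  fix a b :: real assume "a \<le> b"
  then have "(p' has_integral (p b - p a)) {a..b}"
    by (intro fundamental_theorem_of_calculus)
      (use assms(1) in \<open>auto simp: has_real_derivative_iff_has_vector_derivative[symmetric] intro: has_field_derivative_at_within\<close>)
  then show "p b - p a = integral {a..b} p'" by (simp add: integral_unique)
qed

lemma primitive_diff:
  assumes u: "primitive_on {A..B} u g" and v: "primitive_on {A..B} v k"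
  shows "primitive_on {A..B} (\<lambda>x. u x - v x) (\<lambda>x. g x - k x)"
  unfolding primitive_on_def
proof (intro conjI ballI impI)
  show "L2 {A..B} (\<lambda>x. g x - k x)" by (intro L2_diff primitive_onD[OF u] primitive_onD[OF v])
  fix a b assume ab: "a \<in> {A..B}" "b \<in> {A..B}" "a \<le> b"
  have "g integrable_on {a..b}" "k integrable_on {a..b}"
    using integrable_on_subinterval[OF L2_Icc_integral(2)[OF primitive_onD(1)[OF u]], of a b]
      integrable_on_subinterval[OF L2_Icc_integral(2)[OF primitive_onD(1)[OF v]], of a b] ab by auto
  then show "u b - v b - (u a - v a) = integral {a..b} (\<lambda>x. g x - k x)"
    using primitive_onD(2)[OF u ab] primitive_onD(2)[OF v ab] by (simp add: Henstock_Kurzweil_Integration.integral_diff)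
qed

lemma sqi_Icc_Ioo: 
  fixes f :: "real \<Rightarrow> real"
  assumes "lmeas {\<alpha>..\<beta>} f"
  shows "sqi {\<alpha>..\<beta>} f = sqi {\<alpha><..<\<beta>} f"
proof -
  have N: "{\<alpha>, \<beta>} \<in> null_sets lebesgue" by (simp add: negligible_iff_null_sets[symmetric])
  have "AE x in lebesgue. ennreal ((norm (f x))\<^sup>2) * indicator {\<alpha>..\<beta>} x = ennreal ((norm (f x))\<^sup>2) * indicator {\<alpha><..<\<beta>} x"
    using AE_not_in[OF N] by eventually_elim (auto split: split_indicator)
  then show ?thesis by (subst (1 2) sqi_lebesgue) (auto intro: nn_integral_cong_AE)
qed

lemma primitive_Poincare:
  assumes w: "primitive_on {\<alpha>..\<beta>} w f" and w0: "w \<alpha> = 0" and \<alpha>\<beta>: "\<alpha> < \<beta>"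
  shows "sqi {\<alpha><..<\<beta>} w \<le> ennreal ((\<beta> - \<alpha>)\<^sup>2) * sqi {\<alpha><..<\<beta>} f"
proof -
  let ?J = "{\<alpha><..<\<beta>}"
  have fL: "L2 {\<alpha>..\<beta>} f" by (rule primitive_onD(1)[OF w])
  have eq: "sqi {\<alpha>..\<beta>} f = sqi ?J f" by (rule sqi_Icc_Ioo[OF L2_lmeas[OF fL]])
  have pt: "ennreal ((norm (w x))\<^sup>2) \<le> ennreal (\<beta> - \<alpha>) * sqi ?J f" if x: "x \<in> ?J" for x
  proof -
    have "w x = integral {\<alpha>..x} f" using primitive_onD(2)[OF w, of \<alpha> x] x w0 by auto
    then have "ennreal ((norm (w x))\<^sup>2) \<le> ennreal (x - \<alpha>) * sqi ?J f"
      using L2_square_integral_bound(2)[OF fL, of \<alpha> x] x unfolding eq by simp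
    also have "\<dots> \<le> ennreal (\<beta> - \<alpha>) * sqi ?J f" using x by (intro mult_right_mono ennreal_leI) auto
    finally show ?thesis .
  qed
  have "sqi ?J w \<le> (\<integral>\<^sup>+x. ennreal (\<beta> - \<alpha>) * sqi ?J f * indicator ?J x \<partial>lborel)"
    unfolding sqi_lborel[OF open_interval_sets(1)] using pt
    by (intro nn_integral_mono) (auto simp: sqi_lborel[OF open_interval_sets(1)] split: split_indicator)
  also have "\<dots> = ennreal (\<beta> - \<alpha>) * sqi ?J f * ennreal (\<beta> - \<alpha>)"
    using \<alpha>\<beta> by (subst nn_integral_cmult_indicator) auto
  also have "\<dots> = ennreal ((\<beta> - \<alpha>)\<^sup>2) * sqi ?J f"
    using \<alpha>\<beta> by (simp add: power2_eq_square ennreal_mult mult_ac)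
  finally show ?thesis .
qed

text \<open>Integrating by parts moves the derivative to the affine function, where it becomes a constant, and \<open>w\<close> has mean zero.\<close>

lemma affine_orthogonality:
  assumes w: "primitive_on {\<alpha>..\<beta>} w f" and \<alpha>\<beta>: "\<alpha> < \<beta>" and bd: "w \<alpha> = 0" "w \<beta> = 0" and vol: "integral {\<alpha>..\<beta>} w = 0"
  shows "(LINT x|lebesgue_on {\<alpha><..<\<beta>}. f x * (c0 * x + c1)) = 0"
proof -
  have fL: "L2 {\<alpha>..\<beta>} f" by (rule primitive_onD(1)[OF w])
  have "integral {\<alpha>..\<beta>} (\<lambda>x. c0 * w x) = (c0 * \<beta> + c1) * w \<beta> - (c0 * \<alpha> + c1) * w \<alpha> - integral {\<alpha>..\<beta>} (\<lambda>x. (c0 * x + c1) * f x)"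
  proof (rule integration_by_parts_primitive[OF _ fL])
    show "w x = w \<alpha> + integral {\<alpha>..x} f" if "x \<in> {\<alpha>..\<beta>}" for x
      using primitive_onD(2)[OF w, of \<alpha> x] that by auto
  qed (use \<alpha>\<beta> in \<open>auto intro!: derivative_eq_intros\<close>)
  then have 0: "integral {\<alpha>..\<beta>} (\<lambda>x. f x * (c0 * x + c1)) = 0" using bd vol by (simp add: mult.commute)
  have fJ: "L2 {\<alpha><..<\<beta>} f" by (rule L2_subset[OF fL]) (use open_interval_sets in auto)
  have "L2 {\<alpha><..<\<beta>} (\<lambda>x. c0 * x + c1)" by (intro L2_continuous_bounded open_interval_sets continuous_intros)
  from lebesgue_integral_eq_integral[OF L2_pair_integrable[OF fJ this] open_interval_sets(1)]
  show ?thesis using 0 by (simp add: integral_open_interval_real)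
qed

lemma parabola_exists:
  fixes k :: "real \<Rightarrow> real"
  assumes \<alpha>\<beta>: "\<alpha> < \<beta>" and kc: "continuous_on {\<alpha>..\<beta>} k" and ks: "\<And>x. x \<in> {\<alpha>..\<beta>} \<Longrightarrow> s \<le> k x"
  obtains p c0 c1 where "\<And>x. (p has_real_derivative c0 * x + c1) (at x)" "p \<alpha> = s" "p \<beta> = s"
    "\<And>x. x \<in> {\<alpha>..\<beta>} \<Longrightarrow> s \<le> p x" "integral {\<alpha>..\<beta>} p = integral {\<alpha>..\<beta>} k"
proof -
  define L where "L = \<beta> - \<alpha>"
  have L: "L > 0" using \<alpha>\<beta> by (simp add: L_def)
  define A where "A = integral {\<alpha>..\<beta>} k - s * L"
  have "integral {\<alpha>..\<beta>} (\<lambda>_. s) \<le> integral {\<alpha>..\<beta>} k"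
    by (intro integral_le integrable_continuous_interval kc ks continuous_on_const)
  then have A: "0 \<le> A" using \<alpha>\<beta> by (simp add: A_def L_def mult.commute)
  \<comment> \<open>the integral of \<open>(x - \<alpha>) * (\<beta> - x)\<close> is \<open>L ^ 3 / 6\<close>\<close>
  define a where "a = 6 * A / L ^ 3"
  have a: "0 \<le> a" using A L by (simp add: a_def)
  define p where "p x = s + a * ((x - \<alpha>) * (\<beta> - x))" for x
  define P where "P x = s * x + a * (L * (x - \<alpha>)\<^sup>2 / 2 - (x - \<alpha>) ^ 3 / 3)" for x
  have d: "(p has_real_derivative (- 2 * a) * x + a * (\<alpha> + \<beta>)) (at x)" for x
    unfolding p_def[abs_def] by (auto intro!: derivative_eq_intros simp: algebra_simps)
  have "(P has_real_derivative p x) (at x)" for x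
  proof -
    have "(P has_real_derivative s + a * (L * (x - \<alpha>) - (x - \<alpha>)\<^sup>2)) (at x)"
      unfolding P_def[abs_def] by (auto intro!: derivative_eq_intros simp: field_simps)
    moreover have "L * (x - \<alpha>) - (x - \<alpha>)\<^sup>2 = (x - \<alpha>) * (\<beta> - x)" by (simp add: L_def power2_eq_square algebra_simps)
    ultimately show ?thesis by (simp add: p_def)
  qed
  then have "(p has_integral (P \<beta> - P \<alpha>)) {\<alpha>..\<beta>}"
    using \<alpha>\<beta> by (intro fundamental_theorem_of_calculus) (auto simp: has_real_derivative_iff_has_vector_derivative[symmetric] intro: has_field_derivative_at_within)
  then have "integral {\<alpha>..\<beta>} p = P \<beta> - P \<alpha>" by (rule integral_unique)
  also have "\<dots> = s * L + a * (L * L\<^sup>2 / 2 - L ^ 3 / 3)"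
    by (simp add: P_def L_def right_diff_distrib)
  also have "L * L\<^sup>2 / 2 - L ^ 3 / 3 = L ^ 3 / 6" by (simp add: power2_eq_square power3_eq_cube)
  also have "a * (L ^ 3 / 6) = A" using L by (simp add: a_def)
  finally have "integral {\<alpha>..\<beta>} p = integral {\<alpha>..\<beta>} k" unfolding A_def by simp
  moreover have "s \<le> p x" if "x \<in> {\<alpha>..\<beta>}" for x using that a by (simp add: p_def)
  moreover have "p \<alpha> = s" "p \<beta> = s" by (auto simp: p_def)
  ultimately show thesis by (intro that[of p, OF d])
qed

text \<open>The derivative of the parabola is affine, hence orthogonal to the derivative of \<open>w - p\<close>. So the energy excess of \<open>w\<close> is the energy
  of \<open>w - p\<close>, which also bounds \<open>w - p\<close> because this difference vanishes at the end points.\<close>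

lemma parabola_excess:
  fixes w p :: "real \<Rightarrow> real"
  assumes \<alpha>\<beta>: "\<alpha> < \<beta>" and w: "primitive_on {\<alpha>..\<beta>} w f"
    and p: "\<And>x. (p has_real_derivative c0 * x + c1) (at x)"
    and bd: "w \<alpha> = p \<alpha>" "w \<beta> = p \<beta>" and vol: "integral {\<alpha>..\<beta>} w = integral {\<alpha>..\<beta>} p"
  shows "sqi {\<alpha><..<\<beta>} f = sqi {\<alpha><..<\<beta>} (\<lambda>x. f x - (c0 * x + c1)) + sqi {\<alpha><..<\<beta>} (\<lambda>x. c0 * x + c1)"
    "sqi {\<alpha><..<\<beta>} (\<lambda>x. w x - p x) \<le> ennreal ((\<beta> - \<alpha>)\<^sup>2) * sqi {\<alpha><..<\<beta>} (\<lambda>x. f x - (c0 * x + c1))"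
proof -
  have pp: "primitive_on {\<alpha>..\<beta>} p (\<lambda>x. c0 * x + c1)"
    by (rule primitive_C1[OF p]) (auto intro: continuous_intros)
  have d: "primitive_on {\<alpha>..\<beta>} (\<lambda>x. w x - p x) (\<lambda>x. f x - (c0 * x + c1))" by (rule primitive_diff[OF w pp])
  have "integral {\<alpha>..\<beta>} (\<lambda>x. w x - p x) = 0"
    using vol primitive_Icc_continuous[OF w] primitive_Icc_continuous[OF pp]
    by (subst Henstock_Kurzweil_Integration.integral_diff) (auto intro: integrable_continuous_interval)
  from affine_orthogonality[OF d \<alpha>\<beta> _ _ this] 
  have orth: "(LINT x|lebesgue_on {\<alpha><..<\<beta>}. (f x - (c0 * x + c1)) * (c0 * x + c1)) = 0" using bd by simp
  have L: "L2 {\<alpha><..<\<beta>} (\<lambda>x. f x - (c0 * x + c1))"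
    by (rule L2_subset[OF primitive_onD(1)[OF d]]) (use open_interval_sets in auto)
  have L': "L2 {\<alpha><..<\<beta>} (\<lambda>x. c0 * x + c1)" by (intro L2_continuous_bounded open_interval_sets continuous_intros)
  show "sqi {\<alpha><..<\<beta>} f = sqi {\<alpha><..<\<beta>} (\<lambda>x. f x - (c0 * x + c1)) + sqi {\<alpha><..<\<beta>} (\<lambda>x. c0 * x + c1)"
    using sqi_Pythagoras[OF L L' orth] by simp
  show "sqi {\<alpha><..<\<beta>} (\<lambda>x. w x - p x) \<le> ennreal ((\<beta> - \<alpha>)\<^sup>2) * sqi {\<alpha><..<\<beta>} (\<lambda>x. f x - (c0 * x + c1))"
    by (rule primitive_Poincare[OF d _ \<alpha>\<beta>]) (simp add: bd)
qed

lemma L2_continuous_Icc: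
  assumes "continuous_on {\<alpha>..\<beta>} (f :: real \<Rightarrow> real)"
  shows "L2 {\<alpha>..\<beta>} f"
  unfolding L2_def
proof
  show "integrable (lebesgue_on {\<alpha>..\<beta>}) (\<lambda>x. (norm (f x))\<^sup>2)"
    by (intro continuous_imp_integrable_real continuous_intros assms)
  show "lmeas {\<alpha>..\<beta>} f" by (rule borel_measurable_integrable[OF continuous_imp_integrable_real[OF assms]])
qed

lemma interval_integral_Ioo:
  assumes "continuous_on {\<alpha>..\<beta>} (f :: real \<Rightarrow> real)"
  shows "(LINT x|lebesgue_on {\<alpha><..<\<beta>}. f x) = integral {\<alpha>..\<beta>} f"
proof -
  have "L2 {\<alpha><..<\<beta>} f" by (rule L2_subset[OF L2_continuous_Icc[OF assms]]) (use open_interval_sets in auto)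
  moreover have "L2 {\<alpha><..<\<beta>} (\<lambda>_. 1::real)" by (intro L2_continuous_bounded open_interval_sets continuous_intros)
  ultimately have "integrable (lebesgue_on {\<alpha><..<\<beta>}) f" using L2_pair_integrable by force
  from lebesgue_integral_eq_integral[OF this open_interval_sets(1)] show ?thesis by (simp add: integral_open_interval_real)
qed

text \<open>The parabola is a competitor, so the minimizer has no energy excess and agrees with the parabola almost everywhere. It
  remains to apply the excess estimate to \<open>k\<close>.\<close>

lemma constrained_minimizer_near:
  assumes \<alpha>\<beta>: "\<alpha> < \<beta>" and k: "primitive_on {\<alpha>..\<beta>} k g"
    and p: "\<And>x. (p has_real_derivative c0 * x + c1) (at x)"
    and bd: "k \<alpha> = p \<alpha>" "k \<beta> = p \<beta>" and vol: "integral {\<alpha>..\<beta>} k = integral {\<alpha>..\<beta>} p"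
    and m: "constrained_minimizer k {\<alpha><..<\<beta>} hs"
  shows "ennreal ((L2_norm {\<alpha><..<\<beta>} (\<lambda>x. k x - hs x))\<^sup>2) \<le> ennreal (2 * (\<beta> - \<alpha>)\<^sup>2) * sqi {\<alpha><..<\<beta>} (\<lambda>x. g x - (c0 * x + c1))"
proof -
  let ?J = "{\<alpha><..<\<beta>}" and ?q = "\<lambda>x. c0 * x + c1"
  note J = open_interval_sets[of \<alpha> \<beta>]
  have cl: "closure ?J = {\<alpha>..\<beta>}" using \<alpha>\<beta> by (rule closure_greaterThanLessThan)
  have fr: "frontier ?J = {\<alpha>, \<beta>}" using \<alpha>\<beta> by (auto simp: frontier_def cl)
  have kc: "continuous_on {\<alpha>..\<beta>} k" by (rule primitive_Icc_continuous[OF k])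
  have pc: "continuous_on S p" for S using p by (intro continuous_at_imp_continuous_on ballI DERIV_isCont) blast
  have qc: "continuous_on UNIV ?q" by (intro continuous_intros)
  have qL: "L2 ?J ?q" by (intro L2_continuous_bounded J qc)
  have wp: "has_weak_gradient ?J p ?q"
    by (intro primitive_weak_gradient primitive_C1[OF p qc] J) auto
  have pL: "L2 ?J p" by (intro L2_continuous_bounded J pc)
  have comp: "constrained_competitor k ?J p"
    unfolding constrained_competitor_def cl fr
    using pL wp bd vol by (auto simp: H1_def interval_integral_Ioo[OF kc] interval_integral_Ioo[OF pc] intro: pc)
  have hs: "constrained_competitor k ?J hs" and le: "dirichlet_energy ?J hs \<le> dirichlet_energy ?J p"
    using m comp by (auto simp: constrained_minimizer_def)
  then have hsH: "H1 ?J hs" "continuous_on {\<alpha>..\<beta>} hs" "(LINT x|lebesgue_on ?J. hs x) = (LINT x|lebesgue_on ?J. k x)"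
    "hs \<alpha> = k \<alpha>" "hs \<beta> = k \<beta>"
    unfolding constrained_competitor_def cl fr by auto
  obtain f where f: "has_weak_gradient ?J hs f" using hsH(1) by (auto simp: H1_def)
  have hsL: "L2 ?J hs" using hsH(1) by (simp add: H1_def)
  have "primitive_on ?J hs f"
    by (rule weak_gradient_primitive[OF _ _ _ f]) (use hsH(2) in \<open>auto intro: continuous_on_subset\<close>)
  from primitive_closure[OF \<alpha>\<beta> this hsH(2)]
  have pr: "primitive_on {\<alpha>..\<beta>} hs (\<lambda>x. indicator ?J x *\<^sub>R f x)" .
  have hv: "integral {\<alpha>..\<beta>} hs = integral {\<alpha>..\<beta>} p"
    using hsH(3) vol by (simp add: interval_integral_Ioo[OF kc] interval_integral_Ioo[OF hsH(2)])
  note ex = parabola_excess[OF \<alpha>\<beta> pr p _ _ hv]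
  have c1: "sqi ?J (\<lambda>x. indicator ?J x *\<^sub>R f x) = sqi ?J f" by (rule sqi_cong) simp
  have c2: "sqi ?J (\<lambda>x. indicator ?J x *\<^sub>R f x - ?q x) = sqi ?J (\<lambda>x. f x - ?q x)" by (rule sqi_cong) simp
  have "sqi ?J f \<le> sqi ?J ?q"
    using le by (simp add: dirichlet_energy_eq[OF _ f, symmetric] dirichlet_energy_eq[OF _ wp, symmetric] ennreal_leI)
  moreover have "sqi ?J f = sqi ?J ?q + sqi ?J (\<lambda>x. f x - ?q x)" using ex(1) hsH bd unfolding c1 c2 by (simp add: add.commute)
  moreover have "sqi ?J ?q \<noteq> top" using qL by (simp add: L2_iff less_top)
  ultimately have "sqi ?J (\<lambda>x. f x - ?q x) = 0" 
    using ennreal_add_left_cancel_le[of "sqi ?J ?q" "sqi ?J (\<lambda>x. f x - ?q x)" 0] by auto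
  then have 0: "sqi ?J (\<lambda>x. hs x - p x) = 0" using ex(2) hsH bd unfolding c2 by simp
  have kL: "L2 ?J k"
    by (rule L2_subset[OF L2_continuous_Icc[OF kc]]) (use J in auto)
  have "ennreal ((L2_norm ?J (\<lambda>x. k x - hs x))\<^sup>2) = sqi ?J (\<lambda>x. k x - hs x)"
    by (rule L2_norm_sqi[OF L2_diff[OF kL hsL]])
  also have "\<dots> \<le> 2 * sqi ?J (\<lambda>x. k x - p x) + 2 * sqi ?J (\<lambda>x. p x - hs x)"
    by (intro sqi_triangle L2_lmeas kL pL hsL)
  also have "\<dots> = 2 * sqi ?J (\<lambda>x. k x - p x)" using 0 by (simp add: sqi_diff_commute[of ?J p hs])
  also have "\<dots> \<le> 2 * (ennreal ((\<beta> - \<alpha>)\<^sup>2) * sqi ?J (\<lambda>x. g x - ?q x))"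
    by (intro mult_left_mono parabola_excess(2)[OF \<alpha>\<beta> k p bd vol]) simp
  also have "\<dots> = ennreal (2 * (\<beta> - \<alpha>)\<^sup>2) * sqi ?J (\<lambda>x. g x - ?q x)" by (simp add: ennreal_mult mult.assoc)
  finally show ?thesis .
qed

section \<open>Gluing and scaling\<close>

text \<open>The modification \<open>p - k\<close> vanishes at the end points, so no boundary terms arise when it is integrated by parts over the
  interval.\<close>

lemma glue_weak_gradient:
  fixes k g p p' :: "real \<Rightarrow> real"
  assumes \<alpha>\<beta>: "\<alpha> < \<beta>" and kc: "continuous_on UNIV k" and k: "has_weak_gradient UNIV k g"
    and p: "\<And>x. (p has_real_derivative p' x) (at x)" "continuous_on UNIV p'" and bd: "k \<alpha> = p \<alpha>" "k \<beta> = p \<beta>"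
  shows "has_weak_gradient UNIV (\<lambda>x. if x \<in> {\<alpha><..<\<beta>} then p x else k x) (\<lambda>x. if x \<in> {\<alpha><..<\<beta>} then p' x else g x)"
  unfolding has_weak_gradient_def
proof (intro conjI allI impI ballI)
  let ?J = "{\<alpha><..<\<beta>}"
  note J = open_interval_sets[of \<alpha> \<beta>]
  have gL: "L2 UNIV g" by (rule has_weak_gradient_L2[OF k])
  have gJ: "L2 {\<alpha>..\<beta>} g" by (rule L2_subset[OF gL]) auto
  have pc: "continuous_on S p" for S using p(1) by (intro continuous_at_imp_continuous_on ballI DERIV_isCont) blast
  have dL: "L2 {\<alpha>..\<beta>} (\<lambda>x. p' x - g x)" by (intro L2_diff L2_continuous_bounded p gJ) auto
  have dJ: "L2 ?J (\<lambda>x. p' x - g x)" by (rule L2_subset[OF dL]) (use J in auto)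
  have eq: "(\<lambda>x. if x \<in> ?J then p' x else g x) = (\<lambda>x. g x + indicator ?J x *\<^sub>R (p' x - g x))"
    "(\<lambda>x. if x \<in> ?J then p x else k x) = (\<lambda>x. k x + indicator ?J x *\<^sub>R (p x - k x))"
    by (auto simp: fun_eq_iff split: split_indicator)
  show "L2 UNIV (\<lambda>x. if x \<in> ?J then p' x else g x)"
    unfolding eq by (intro L2_add gL L2_extend_zero dJ J)
  have prk: "primitive_on UNIV k g" by (rule weak_gradient_primitive[OF open_UNIV convex_UNIV kc k])
  have prJ: "primitive_on {\<alpha>..\<beta>} k g" by (rule primitive_subset[OF prk]) auto
  have prp: "primitive_on {\<alpha>..\<beta>} p p'" by (rule primitive_C1[OF p]) auto
  have prd: "primitive_on {\<alpha>..\<beta>} (\<lambda>x. p x - k x) (\<lambda>x. p' x - g x)" by (rule primitive_diff[OF prp prJ])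
  fix \<phi> :: "real \<Rightarrow> real" and b :: real assume t: "test_function UNIV \<phi>" and "b \<in> Basis"
  then have b: "b = 1" by simp
  obtain K where K: "compact K" "K \<subseteq> UNIV" "\<And>x. x \<notin> K \<Longrightarrow> \<phi> x = 0" "smooth \<phi>"
    by (rule test_functionE[OF t], rule that)
  let ?d = "\<lambda>x. frechet_derivative \<phi> (at x) 1"
  have td: "test_function UNIV ?d" by (rule test_function_frechet[OF t]) simp
  have dc: "continuous_on S ?d" for S by (rule smooth_continuous) (use td in \<open>simp add: test_function_def\<close>)
  have d0: "?d x = 0" if "x \<notin> K" for x
    using frechet_derivative_zero_outside[OF compact_imp_closed[OF K(1)] K(3) that] by simp
  have \<phi>L: "L2 UNIV \<phi>" "L2 UNIV ?d" by (rule test_function_L2[OF t], simp, rule test_function_L2[OF td], simp)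
  have \<phi>J: "L2 ?J \<phi>" "L2 ?J ?d" by (rule test_function_L2[OF t J(1)], rule test_function_L2[OF td J(1)])
  have pkJ: "L2 ?J (\<lambda>x. p x - k x)"
    by (rule L2_continuous_bounded[OF _ J(2,1)]) (intro continuous_on_diff pc kc)
  have ext: "(LINT x|lebesgue. indicator ?J x *\<^sub>R f x) = (LINT x|lebesgue_on ?J. f x)" for f :: "real \<Rightarrow> real"
    using J by (subst integral_restrict_space) auto
  have exti: "integrable lebesgue (\<lambda>x. indicator ?J x *\<^sub>R f x)" if "integrable (lebesgue_on ?J) f" for f :: "real \<Rightarrow> real"
    using that J by (subst (asm) integrable_restrict_space) auto
  have i1: "integrable lebesgue (\<lambda>x. k x * ?d x)"
    by (rule compact_support_integrable(2)[OF _ K(1)]) (auto simp: d0 intro!: continuous_on_mult kc dc)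
  have i2: "integrable lebesgue (\<lambda>x. indicator ?J x *\<^sub>R ((p x - k x) * ?d x))" by (rule exti[OF L2_pair_integrable[OF pkJ \<phi>J(2)]])
  have i3: "integrable lebesgue (\<lambda>x. g x * \<phi> x)" using L2_pair_integrable[OF gL \<phi>L(1)] by (simp add: lebesgue_on_UNIV_eq)
  have i4: "integrable lebesgue (\<lambda>x. indicator ?J x *\<^sub>R ((p' x - g x) * \<phi> x))" by (rule exti[OF L2_pair_integrable[OF dJ \<phi>J(1)]])
  have "(LINT x|lebesgue_on ?J. (p x - k x) * ?d x) = integral {\<alpha>..\<beta>} (\<lambda>x. ?d x * (p x - k x))"
    by (subst interval_integral_Ioo) (auto simp: mult.commute intro!: continuous_on_mult continuous_on_diff pc dc continuous_on_subset[OF kc])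
  also have "\<dots> = \<phi> \<beta> * (p \<beta> - k \<beta>) - \<phi> \<alpha> * (p \<alpha> - k \<alpha>) - integral {\<alpha>..\<beta>} (\<lambda>x. \<phi> x * (p' x - g x))"
  proof (rule integration_by_parts_primitive[OF _ dL _ smooth_real_derivative[OF K(4)] dc])
    show "p x - k x = p \<alpha> - k \<alpha> + integral {\<alpha>..x} (\<lambda>x. p' x - g x)" if "x \<in> {\<alpha>..\<beta>}" for x
      using primitive_onD(2)[OF prd, of \<alpha> x] that by auto
  qed (use \<alpha>\<beta> in simp)
  also have "\<dots> = - integral {\<alpha>..\<beta>} (\<lambda>x. (p' x - g x) * \<phi> x)" using bd by (simp add: mult.commute)
  also have "integral {\<alpha>..\<beta>} (\<lambda>x. (p' x - g x) * \<phi> x) = (LINT x|lebesgue_on ?J. (p' x - g x) * \<phi> x)"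
    using lebesgue_integral_eq_integral[OF L2_pair_integrable[OF dJ \<phi>J(1)] J(1)] by (simp add: integral_open_interval_real)
  finally have part: "(LINT x|lebesgue_on ?J. (p x - k x) * ?d x) = - (LINT x|lebesgue_on ?J. (p' x - g x) * \<phi> x)" .
  have "(LINT x|lebesgue. (if x \<in> ?J then p x else k x) * ?d x) = (LINT x|lebesgue. k x * ?d x + indicator ?J x *\<^sub>R ((p x - k x) * ?d x))"
    by (intro Bochner_Integration.integral_cong) (auto simp: algebra_simps split: split_indicator)
  also have "\<dots> = (LINT x|lebesgue. k x * ?d x) + (LINT x|lebesgue_on ?J. (p x - k x) * ?d x)"
    using i1 i2 by (simp add: ext[symmetric])
  also have "(LINT x|lebesgue. k x * ?d x) = - (LINT x|lebesgue. g x * \<phi> x)"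
    using has_weak_gradientD[OF k t, of 1] by (simp add: lebesgue_on_UNIV_eq)
  also have "- (LINT x|lebesgue. g x * \<phi> x) + (LINT x|lebesgue_on ?J. (p x - k x) * ?d x)
      = - (LINT x|lebesgue. g x * \<phi> x + indicator ?J x *\<^sub>R ((p' x - g x) * \<phi> x))"
    unfolding part using i3 i4 by (simp add: ext[symmetric])
  also have "(LINT x|lebesgue. g x * \<phi> x + indicator ?J x *\<^sub>R ((p' x - g x) * \<phi> x)) = (LINT x|lebesgue. (if x \<in> ?J then p' x else g x) * \<phi> x)"
    by (intro Bochner_Integration.integral_cong) (auto simp: algebra_simps split: split_indicator)
  finally show "(LINT x|lebesgue_on UNIV. (if x \<in> ?J then p x else k x) * frechet_derivative \<phi> (at x) b) =
      - (LINT x|lebesgue_on UNIV. ((if x \<in> ?J then p' x else g x) \<bullet> b) * \<phi> x)"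
    using b by (simp add: lebesgue_on_UNIV_eq)
qed

lemma lmeas_scale:
  fixes f :: "real \<Rightarrow> real"
  assumes "lmeas UNIV f" "c \<noteq> 0"
  shows "lmeas UNIV (\<lambda>x. f (c * x))"
proof -
  have "(\<lambda>x::real. c * x) \<in> lebesgue \<rightarrow>\<^sub>M lebesgue"
    using lebesgue_affine_measurable[where c="\<lambda>_::real. c" and t=0] assms(2) by simp
  then show ?thesis using assms(1) by (auto simp: lebesgue_on_UNIV_eq intro: measurable_compose)
qed

lemma sqi_scale:
  fixes f :: "real \<Rightarrow> real"
  assumes f: "lmeas UNIV f" and c: "c2 > 0"
  shows "sqi UNIV (\<lambda>x. c1 * f (c2 * x)) = ennreal (c1\<^sup>2 / c2) * sqi UNIV f"
proof -
  have m: "(\<lambda>x. ennreal ((norm (f x))\<^sup>2)) \<in> borel_measurable lebesgue" using f by (simp add: lebesgue_on_UNIV_eq)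
  have "sqi UNIV f = ennreal c2 * sqi UNIV (\<lambda>x. f (c2 * x))"
    using nn_integral_real_affine_lebesgue[OF m, of c2 0] c by (simp add: sqi_def lebesgue_on_UNIV_eq)
  then have "ennreal (c1\<^sup>2 / c2) * sqi UNIV f = ennreal (c1\<^sup>2) * sqi UNIV (\<lambda>x. f (c2 * x))"
    using c by (simp add: mult.assoc[symmetric] ennreal_mult[symmetric])
  moreover have "sqi UNIV (\<lambda>x. c1 * f (c2 * x)) = ennreal (c1\<^sup>2) * sqi UNIV (\<lambda>x. f (c2 * x))"
    using sqi_cmult[OF lmeas_scale[OF f], of c2 c1] c by simp
  ultimately show ?thesis by simp
qed

lemma L2_scale:
  fixes f :: "real \<Rightarrow> real"
  assumes f: "L2 UNIV f" and c: "c2 > 0"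
  shows "L2 UNIV (\<lambda>x. c1 * f (c2 * x))"
  using f lmeas_scale[OF L2_lmeas[OF f], of c2] c
  by (auto simp: L2_iff sqi_scale ennreal_mult_less_top intro!: borel_measurable_times)

lemma has_weak_gradient_scale:
  fixes u g :: "real \<Rightarrow> real"
  assumes u: "has_weak_gradient UNIV u g" and c: "c2 > 0"
  shows "has_weak_gradient UNIV (\<lambda>x. c1 * u (c2 * x)) (\<lambda>x. c1 * c2 * g (c2 * x))"
  unfolding has_weak_gradient_def
proof (intro conjI allI impI ballI L2_scale has_weak_gradient_L2[OF u] c)
  fix \<phi> :: "real \<Rightarrow> real" and b :: real assume t: "test_function UNIV \<phi>" and "b \<in> Basis"
  then have b: "b = 1" by simp
  obtain K where K: "compact K" "K \<subseteq> UNIV" "\<And>x. x \<notin> K \<Longrightarrow> \<phi> x = 0" "smooth \<phi>"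
    by (rule test_functionE[OF t], rule that)
  define \<theta> where "\<theta> = (\<lambda>y. \<phi> (y / c2))"
  have s\<theta>: "smooth \<theta>" using smooth_affine[OF K(4), of "1 / c2" 0] by (simp add: \<theta>_def)
  have t\<theta>: "test_function UNIV \<theta>"
  proof (rule test_functionI[OF s\<theta>, of "(\<lambda>x. c2 * x) ` K"])
    show "compact ((\<lambda>x. c2 * x) ` K)" by (intro compact_continuous_image K(1) continuous_intros)
    show "\<theta> x = 0" if "x \<notin> (\<lambda>x. c2 * x) ` K" for x
    proof -
      have "x / c2 \<notin> K" using that c by (auto simp: image_iff)
      then show ?thesis using K(3) by (simp add: \<theta>_def)
    qed
  qed auto
  have d: "frechet_derivative \<theta> (at (c2 * x)) 1 = frechet_derivative \<phi> (at x) 1 / c2" for x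
  proof -
    have "((\<lambda>y. y / c2) has_real_derivative 1 / c2) (at (c2 * x))" using c by (auto intro!: derivative_eq_intros)
    moreover have "(\<phi> has_real_derivative frechet_derivative \<phi> (at x) 1) (at ((c2 * x) / c2))"
      using smooth_real_derivative[OF K(4), of x] c by simp
    ultimately have "(\<theta> has_real_derivative frechet_derivative \<phi> (at x) 1 * (1 / c2)) (at (c2 * x))"
      unfolding \<theta>_def by (intro DERIV_chain2)
    from DERIV_unique[OF smooth_real_derivative[OF s\<theta>] this] show ?thesis by simp
  qed
  have aff: "(LINT x|lebesgue. F x) = c2 * (LINT x|lebesgue. F (c2 * x))" for F :: "real \<Rightarrow> real"
    using lebesgue_integral_real_affine[of c2 F 0] c by simp
  have "(LINT x|lebesgue. u x * frechet_derivative \<theta> (at x) 1) = - (LINT x|lebesgue. g x * \<theta> x)"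
    using has_weak_gradientD[OF u t\<theta>, of 1] by (simp add: lebesgue_on_UNIV_eq)
  then have "c2 * (LINT x|lebesgue. u (c2 * x) * (frechet_derivative \<phi> (at x) 1 / c2)) = - (c2 * (LINT x|lebesgue. g (c2 * x) * \<phi> x))"
    unfolding aff[of "\<lambda>x. u x * frechet_derivative \<theta> (at x) 1"] aff[of "\<lambda>x. g x * \<theta> x"] d using c by (simp add: \<theta>_def)
  then have "(LINT x|lebesgue. u (c2 * x) * frechet_derivative \<phi> (at x) 1) = - (c2 * (LINT x|lebesgue. g (c2 * x) * \<phi> x))"
    using c by simp
  then show "(LINT x|lebesgue_on UNIV. c1 * u (c2 * x) * frechet_derivative \<phi> (at x) b) = - (LINT x|lebesgue_on UNIV. ((c1 * c2 * g (c2 * x)) \<bullet> b) * \<phi> x)"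
    using b by (simp add: lebesgue_on_UNIV_eq mult.assoc)
qed

section \<open>Profiles and their rescalings\<close>

text \<open>The conditions on \<open>h\<close> in \<open>admissible\<close>, with a weak derivative as a parameter.\<close>

definition profile :: "real \<Rightarrow> (real \<Rightarrow> real) \<Rightarrow> (real \<Rightarrow> real) \<Rightarrow> bool" where
  "profile V h g \<longleftrightarrow> continuous_on UNIV h \<and> L2 UNIV h \<and> has_weak_gradient UNIV h g \<and> (\<forall>x. 0 \<le> h x) \<and>
     integrable lebesgue h \<and> (LINT x|lebesgue. h x) = V"

lemma profileD:
  assumes "profile V h g"
  shows "continuous_on UNIV h" "L2 UNIV h" "has_weak_gradient UNIV h g" "\<And>x. 0 \<le> h x"
    "integrable lebesgue h" "(LINT x|lebesgue. h x) = V" "L2 UNIV g"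
  using assms has_weak_gradient_L2[of UNIV h g] unfolding profile_def by auto

lemma admissible_profile: "(u, h) \<in> admissible V \<longleftrightarrow> 0 < V \<and> (\<exists>g. profile V h g) \<and> boundary_admissible h u"
  unfolding admissible_def profile_def H1_def by auto

lemma profile_surface:
  assumes "profile V h g"
  shows "ennreal (surface_energy h) = sqi UNIV g"
  unfolding surface_energy_def by (rule dirichlet_energy_eq[OF open_UNIV profileD(3)[OF assms]])

text \<open>By the Cauchy-Schwarz inequality \<open>h\<close> varies on a unit interval at most by the square root of the surface energy. A peak
  higher than \<open>V\<close> plus this root would stay above \<open>V\<close> on a unit interval and contain too much volume.\<close>

lemma profile_bounded:
  assumes h: "profile V h g"
  obtains M where "\<And>x. h x \<le> M"
proof -
  note D = profileD[OF h]
  have "V = (LINT x|lebesgue. h x)" using D(6) by simp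
  also have "\<dots> \<ge> 0" using D(4) by simp
  finally have V: "0 \<le> V" .
  define r where "r = surface_energy h"
  have r: "0 \<le> r" "sqi UNIV g = ennreal r"
    using profile_surface[OF h] dirichlet_energy_nonneg[of UNIV h] by (auto simp: r_def surface_energy_def)
  have prim: "primitive_on UNIV h g" by (rule weak_gradient_primitive[OF open_UNIV convex_UNIV D(1,3)])
  have "h x \<le> V + sqrt r" for x
  proof (rule ccontr)
    assume "\<not> h x \<le> V + sqrt r"
    then have t: "h x - sqrt r > V" by simp
    have gL: "L2 {x..x+1} g" by (rule L2_subset[OF D(7)]) auto
    have gr: "sqi {x..x+1} g \<le> ennreal r" unfolding r(2)[symmetric] by (rule sqi_mono_set) auto
    have low: "h x - sqrt r \<le> h y" if y: "y \<in> {x..x+1}" for y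
    proof -
      have "h y - h x = integral {x..y} g" using primitive_onD(2)[OF prim, of x y] y by auto
      then have "ennreal ((h y - h x)\<^sup>2) \<le> ennreal (y - x) * sqi {x..x+1} g"
        using L2_square_integral_bound(2)[OF gL, of x y] y by simp
      also have "\<dots> \<le> ennreal 1 * ennreal r" using y by (intro mult_mono gr ennreal_leI) auto
      finally have "(h y - h x)\<^sup>2 \<le> r" using r(1) by simp
      then have "\<bar>h y - h x\<bar> \<le> sqrt r" by (metis real_sqrt_abs real_sqrt_le_mono)
      then show ?thesis by simp
    qed
    have "ennreal (h x - sqrt r) * emeasure lebesgue {x..x+1} \<le> ennreal V"
      by (rule superlevel_measure[OF D(5,4,6)]) (use low t V in auto)
    then have "ennreal (h x - sqrt r) \<le> ennreal V" by simp
    then show False using t V by simp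
  qed
  then show thesis by (rule that)
qed

lemma profile_scale:
  assumes h: "profile V h g" and c: "0 < c1" "0 < c2"
  shows "profile (c1 / c2 * V) (\<lambda>x. c1 * h (c2 * x)) (\<lambda>x. c1 * c2 * g (c2 * x))"
    "sqi UNIV (\<lambda>x. c1 * c2 * g (c2 * x)) = ennreal (c1\<^sup>2 * c2) * sqi UNIV g"
proof -
  note D = profileD[OF h]
  have "continuous_on UNIV (\<lambda>x. h (c2 * x))"
    by (rule continuous_on_compose2[OF D(1)]) (auto intro!: continuous_intros)
  then have 1: "continuous_on UNIV (\<lambda>x. c1 * h (c2 * x))" by (intro continuous_intros)
  have "integrable lebesgue (\<lambda>x. h (0 + c2 * x))" using lebesgue_integrable_real_affine[OF D(5), of c2 0] c by simp
  then have 2: "integrable lebesgue (\<lambda>x. c1 * h (c2 * x))" by simp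
  have "V = c2 * (LINT x|lebesgue. h (c2 * x))"
    using lebesgue_integral_real_affine[of c2 h 0] c D(6) by simp
  then have 3: "(LINT x|lebesgue. c1 * h (c2 * x)) = c1 / c2 * V" using c by simp
  show "profile (c1 / c2 * V) (\<lambda>x. c1 * h (c2 * x)) (\<lambda>x. c1 * c2 * g (c2 * x))"
    unfolding profile_def using 1 2 3 L2_scale[OF D(2) c(2), of c1] has_weak_gradient_scale[OF D(3) c(2), of c1] D(4) c by auto
  have "(c1 * c2)\<^sup>2 / c2 = c1\<^sup>2 * c2" using c by (simp add: power2_eq_square)
  then show "sqi UNIV (\<lambda>x. c1 * c2 * g (c2 * x)) = ennreal (c1\<^sup>2 * c2) * sqi UNIV g"
    using sqi_scale[OF L2_lmeas[OF D(7)] c(2), of "c1 * c2"] by simp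
qed

text \<open>All exponents of the scaling are multiples of \<open>1/5\<close>.\<close>

lemma fifth_root_powers:
  fixes V :: real
  assumes V: "0 < V" and z: "z = V powr (1/5)"
  shows "0 < z" "V = z ^ 5" "V powr (3/5) = z ^ 3" "V powr (2/5) = z\<^sup>2" "V powr (4/5) = z ^ 4"
    "V powr (- 2/5) = 1 / z\<^sup>2" "V powr (- 3/5) = 1 / z ^ 3" "V powr (- 4/5) = 1 / z ^ 4"
proof -
  have p: "z ^ n = V powr (real n / 5)" for n using V by (simp add: z powr_power)
  show "0 < z" using V z by simp
  show 5: "V = z ^ 5" using p[of 5] V by simp
  show 3: "V powr (3/5) = z ^ 3" and 2: "V powr (2/5) = z\<^sup>2" and 4: "V powr (4/5) = z ^ 4"
    using p[of 3] p[of 2] p[of 4] by auto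
  show "V powr (- 2/5) = 1 / z\<^sup>2" "V powr (- 3/5) = 1 / z ^ 3" "V powr (- 4/5) = 1 / z ^ 4"
    using powr_minus_divide[of V "2/5"] powr_minus_divide[of V "3/5"] powr_minus_divide[of V "4/5"] 2 3 4 by simp_all
qed

lemma profile_rescale:
  assumes h: "profile V h g" and V: "0 < V"
  obtains g' where "profile 1 (rescale V h) g'"
proof -
  define z where "z = V powr (1/5)"
  note Z = fifth_root_powers[OF V z_def]
  have "(1 / z ^ 3) / z\<^sup>2 * V = 1" using Z(1) by (simp add: Z(2) field_simps eval_nat_numeral)
  then show thesis
    using that profile_scale(1)[OF h, of "1 / z ^ 3" "z\<^sup>2"] Z(1) unfolding rescale_def Z(4,7) by auto
qed

lemma profile_unscale:
  assumes k: "profile 1 k g" and V: "0 < V"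
  obtains g' where "profile V (unscale V k) g'" "sqi UNIV g' = ennreal (V powr (4/5)) * sqi UNIV g"
proof -
  define z where "z = V powr (1/5)"
  note Z = fifth_root_powers[OF V z_def]
  have 1: "z ^ 3 / (1 / z\<^sup>2) * 1 = V" using Z(1) by (simp add: Z(2) field_simps eval_nat_numeral)
  have 2: "(z ^ 3)\<^sup>2 * (1 / z\<^sup>2) = z ^ 4" using Z(1) by (simp add: field_simps eval_nat_numeral)
  note S = profile_scale[OF k, of "z ^ 3" "1 / z\<^sup>2", unfolded 1 2]
  have u: "unscale V k = (\<lambda>x. z ^ 3 * k (1 / z\<^sup>2 * x))" unfolding unscale_def Z(3,6) by simp
  show thesis by (rule that; (unfold u Z(5))?; rule S) (use Z(1) in auto)
qed

section \<open>Minimizers of the total energy\<close>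

lemma dirichlet_minimizer_pair:
  assumes h: "continuous_on UNIV h" and u: "dirichlet_minimizer h u"
  obtains g where "minimal_pair h u g"
proof -
  obtain g where g: "admissible_pair h u g"
    using u boundary_admissible_iff[OF h] unfolding dirichlet_minimizer_def by auto
  have "sqi (Omega h) g \<le> sqi (Omega h) k" if k: "admissible_pair h v k" for v k
  proof -
    have "boundary_admissible h v" using k boundary_admissible_iff[OF h] by auto
    then have "elastic_energy u h \<le> elastic_energy v h" using u by (simp add: dirichlet_minimizer_def)
    then show ?thesis by (simp add: elastic_energy_eq[OF h g, symmetric] elastic_energy_eq[OF h k, symmetric] ennreal_leI)
  qed
  then show thesis by (intro that[of g]) (auto simp: minimal_pair_def g)
qed

text \<open>The displacement chosen in the definition of \<open>G\<close> is some Dirichlet minimizer, and all of them have the same energy.\<close>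

lemma G_rescale:
  assumes uh: "(u, h) \<in> admissible V" and u: "dirichlet_minimizer h u"
  shows "G V (rescale V h) = V powr (- 4/5) * (surface_energy h + elastic_energy u h)"
proof -
  have V: "0 < V" using uh by (simp add: admissible_def)
  define v where "v = (SOME v. dirichlet_minimizer h v)"
  have v: "dirichlet_minimizer h v" unfolding v_def by (rule someI[of "dirichlet_minimizer h", OF u])
  have "elastic_energy u h = elastic_energy v h"
    using u v unfolding dirichlet_minimizer_def by (intro antisym) auto
  then show ?thesis by (simp add: G_def unscale_rescale[OF V] v_def[symmetric] Let_def)
qed

definition total_minimizer :: "real \<Rightarrow> (real \<times> real \<Rightarrow> real) \<Rightarrow> (real \<Rightarrow> real) \<Rightarrow> bool" where
  "total_minimizer V u h \<longleftrightarrow> (u, h) \<in> admissible V \<and> dirichlet_minimizer h u \<and>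
     (\<forall>v h'. (v, h') \<in> admissible V \<longrightarrow> surface_energy h + elastic_energy u h \<le> surface_energy h' + elastic_energy v h')"

text \<open>Replacing the displacement of an admissible pair by a Dirichlet minimizer yields a rescaled profile and does not raise the
  energy. So a minimizer among rescaled profiles is one among all admissible pairs.\<close>

lemma G_minimizer_total:
  assumes k: "G_minimizer V k"
  obtains u h where "total_minimizer V u h" "k = rescale V h"
proof -
  obtain u h where uh: "(u, h) \<in> admissible V" "dirichlet_minimizer h u" "k = rescale V h"
    using k unfolding G_minimizer_def rescaled_profiles_def by auto
  have V: "0 < V" using uh by (simp add: admissible_def)
  have "surface_energy h + elastic_energy u h \<le> surface_energy h' + elastic_energy v h'"
    if vh: "(v, h') \<in> admissible V" for v h'
  proof -
    obtain g where g: "profile V h' g" and bd: "boundary_admissible h' v" using vh by (auto simp: admissible_profile)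
    obtain M where M: "\<And>x. h' x \<le> M" by (rule profile_bounded[OF g], rule that)
    from dirichlet_minimizer_exists[OF profileD(1)[OF g] M bd]
    obtain w where w: "dirichlet_minimizer h' w" by auto
    have wh: "(w, h') \<in> admissible V"
      using V g w by (auto simp: admissible_profile dirichlet_minimizer_def)
    then have "rescale V h' \<in> rescaled_profiles V" using w by (auto simp: rescaled_profiles_def)
    then have "G V k \<le> G V (rescale V h')" using k by (simp add: G_minimizer_def)
    then have "surface_energy h + elastic_energy u h \<le> surface_energy h' + elastic_energy w h'"
      using V by (simp add: uh(3) G_rescale[OF uh(1,2)] G_rescale[OF wh w])
    also have "elastic_energy w h' \<le> elastic_energy v h'" using w bd by (simp add: dirichlet_minimizer_def)
    finally show ?thesis by simp
  qed
  then show thesis using that uh by (auto simp: total_minimizer_def)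
qed

lemma bump_profile:
  obtains g where "profile 1 (\<lambda>x. bump x / bump_mass) g"
proof -
  define b where "b = (\<lambda>x. bump x / bump_mass)"
  have b0: "b x = 0" if "x \<notin> {0..1}" for x using that bump_zero[of x] by (auto simp: b_def)
  have s: "smooth b" using smooth_mult[OF smooth_bump smooth_const[of "1 / bump_mass"]] by (simp add: b_def)
  have t: "test_function UNIV b" by (rule test_functionI[OF s, of "{0..1}"]) (auto simp: b0)
  have "grad b = (\<lambda>x. frechet_derivative b (at x) 1)" by (simp add: grad_def fun_eq_iff)
  moreover have "L2 UNIV (\<lambda>x. frechet_derivative b (at x) 1)"
    by (rule test_function_L2[OF test_function_frechet[OF t]]) auto
  ultimately have L: "L2 UNIV (grad b)" by simp
  have c: "continuous_on S b" for S by (rule smooth_continuous[OF s])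
  have "(LINT x|lebesgue. b x) = (LINT x|lebesgue_on {0..1}. b x)"
    by (rule test_function_UNIV_integral[symmetric]) (auto simp: b0)
  also have "\<dots> = integral {0..1} b" by (rule continuous_Icc_integral[OF c])
  also have "\<dots> = 1" using bump_mass_pos by (simp add: b_def bump_mass_def[symmetric])
  finally have "profile 1 b (grad b)"
    unfolding profile_def
    using c smooth_weak_gradient[OF s _ L] test_function_L2[OF t, of UNIV] bump_nonneg bump_mass_pos
      compact_support_integrable(2)[OF c compact_Icc b0] by (auto simp: b_def)
  then show thesis by (rule that[unfolded b_def[symmetric]])
qed

lemma grad_fst: "grad fst z = ((1, 0) :: real \<times> real)"
proof (rule euclidean_eqI)
  fix b :: "real \<times> real" assume b: "b \<in> Basis"
  have "((fst :: real \<times> real \<Rightarrow> real) has_derivative fst) (at z)"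
    by (rule bounded_linear_imp_has_derivative[OF bounded_linear_fst])
  then have "frechet_derivative fst (at z) = (fst :: real \<times> real \<Rightarrow> real)" by (rule frechet_derivative_at[symmetric])
  then show "grad fst z \<bullet> b = (1, 0) \<bullet> b" unfolding grad_inner[OF b] by (simp add: inner_prod_def)
qed

lemma fst_admissible_pair:
  assumes h: "continuous_on UNIV h" and b: "bounded (Omega h)"
  shows "admissible_pair h fst (\<lambda>_. (1, 0))"
proof -
  have s: "smooth (fst :: real \<times> real \<Rightarrow> real)"
    using smooth_inner[of "(1, 0) :: real \<times> real"] by (simp add: inner_prod_def)
  have g: "grad fst = (\<lambda>z. (1, 0) :: real \<times> real)" by (rule ext) (rule grad_fst)
  have U: "Omega h \<in> sets lebesgue" by (rule Omega_lebesgue[OF h])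
  have "has_weak_gradient (Omega h) fst (grad fst)"
    by (rule smooth_weak_gradient[OF s U]) (unfold g, intro L2_continuous_bounded b U continuous_intros)
  moreover have "L2 (Omega h) (fst :: real \<times> real \<Rightarrow> real)" by (intro L2_continuous_bounded b U continuous_intros)
  moreover have "trace_approx a c d fst (\<lambda>_. (1, 0)) (\<lambda>x. x)" for a c d
    unfolding trace_approx_def using s by (auto simp: g sqi_def intro!: exI[of _ fst])
  ultimately show ?thesis by (simp add: admissible_pair_def g)
qed

text \<open>Compare with the profile \<open>V * bump x / bump_mass\<close> and the displacement \<open>u (x, y) = x\<close>, whose gradient has length one. The
  elastic energy is the area of the subgraph, which lies in a box of area \<open>V / bump_mass\<close>.\<close>

lemma total_energy_bound:
  obtains B1 B2 where "0 < B1" "0 \<le> B2"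
    "\<And>V u h. total_minimizer V u h \<Longrightarrow> surface_energy h + elastic_energy u h \<le> B1 * V + B2 * V\<^sup>2"
proof (rule that)
  let ?b = "\<lambda>x. bump x / bump_mass"
  show "0 < 1 / bump_mass" using bump_mass_pos by simp
  show "0 \<le> surface_energy ?b" by (simp add: surface_energy_def dirichlet_energy_nonneg)
  fix V u h assume m: "total_minimizer V u h"
  then have V: "0 < V" by (simp add: total_minimizer_def admissible_def)
  obtain g where g: "profile 1 ?b g" by (rule bump_profile)
  define k where "k = (\<lambda>x. V * ?b x)"
  have k: "profile V k (\<lambda>x. V * g x)" and kS: "sqi UNIV (\<lambda>x. V * g x) = ennreal (V\<^sup>2) * sqi UNIV g"
    using profile_scale[OF g V, of 1] by (simp_all add: k_def)
  note D = profileD[OF k]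
  have "ennreal (surface_energy k) = ennreal (V\<^sup>2 * surface_energy ?b)"
    unfolding profile_surface[OF k] kS profile_surface[OF g, symmetric]
    by (simp add: ennreal_mult surface_energy_def dirichlet_energy_nonneg)
  then have S: "surface_energy k = V\<^sup>2 * surface_energy ?b"
    by (simp add: surface_energy_def dirichlet_energy_nonneg)
  let ?C = "cbox (0, 0) (1, V / bump_mass) :: (real \<times> real) set"
  have sub: "Omega k \<subseteq> ?C"
  proof
    fix z assume z: "z \<in> Omega k"
    then have z': "0 < snd z" "snd z < k (fst z)" by (auto simp: Omega_iff)
    have "k x \<le> V / bump_mass" for x
    proof -
      have "?b x \<le> 1 / bump_mass" using bump_bound[of x] by linarith
      from mult_left_mono[OF this, of V] V show ?thesis by (simp add: k_def)
    qed
    from this[of "fst z"] have "snd z \<le> V / bump_mass" using z' by simp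
    moreover have "fst z \<in> {0..1}"
      using z' bump_zero[of "fst z"] by (force simp: k_def)
    ultimately show "z \<in> ?C" using z' by (cases z) auto
  qed
  have ap: "admissible_pair k fst (\<lambda>_. (1, 0))"
    by (rule fst_admissible_pair[OF D(1)]) (rule bounded_subset[OF bounded_cbox sub])
  have U: "Omega k \<in> sets lebesgue" by (rule Omega_lebesgue[OF D(1)])
  have "ennreal (elastic_energy fst k) = sqi (Omega k) (\<lambda>_. (1, 0) :: real \<times> real)" by (rule elastic_energy_eq[OF D(1) ap])
  also have "\<dots> \<le> sqi ?C (\<lambda>_. (1, 0) :: real \<times> real)" by (rule sqi_mono_set[OF sub U]) auto
  also have "\<dots> = emeasure lebesgue ?C" by (simp add: sqi_lebesgue norm_Pair)
  also have "\<dots> = ennreal (V / bump_mass)"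
    using V bump_mass_pos by (subst emeasure_lborel_cbox_eq[symmetric, simplified] | simp add: emeasure_lborel_cbox_eq Basis_prod_def)+
  finally have E: "elastic_energy fst k \<le> 1 / bump_mass * V" using V bump_mass_pos by simp
  have "(fst, k) \<in> admissible V"
    using V k ap boundary_admissible_iff[OF D(1)] by (auto simp: admissible_profile)
  then have "surface_energy h + elastic_energy u h \<le> surface_energy k + elastic_energy fst k"
    using m by (simp add: total_minimizer_def)
  then show "surface_energy h + elastic_energy u h \<le> 1 / bump_mass * V + surface_energy ?b * V\<^sup>2"
    using S E by (simp add: mult.commute)
qed

text \<open>Compare the minimizer with the reshaped profile and the displacement from \<open>reshaped_competitor\<close>; the old elastic energy
  cancels.\<close>

lemma reshaped_surface_energy:
  assumes m: "total_minimizer V u h" and T: "0 < T" and I: "connected I" "x0 \<in> I" "\<And>x. x \<in> I \<Longrightarrow> T < h x"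
    and h2: "profile V h2 g2" "\<And>x. h2 x = h x \<or> x \<in> I \<and> T \<le> h2 x"
    and n: "8 * (real n + 1) * V < T\<^sup>2"
  shows "surface_energy h \<le> surface_energy h2 + cut_const * decay_rate ^ n * elastic_energy u h"
proof -
  obtain gh where V: "0 < V" and gh: "profile V h gh" and du: "dirichlet_minimizer h u"
    and min: "\<And>v h'. (v, h') \<in> admissible V \<Longrightarrow> surface_energy h + elastic_energy u h \<le> surface_energy h' + elastic_energy v h'"
    using m by (auto simp: total_minimizer_def admissible_profile)
  note D = profileD[OF gh] and D2 = profileD[OF h2(1)]
  obtain M where M: "\<And>x. h x \<le> M" by (rule profile_bounded[OF gh]) blast
  obtain M2 where M2: "\<And>x. h2 x \<le> M2" by (rule profile_bounded[OF h2(1)]) blast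
  obtain g where g: "minimal_pair h u g" by (rule dirichlet_minimizer_pair[OF D(1) du])
  then have ap: "admissible_pair h u g" by (simp add: minimal_pair_def)
  let ?c = "cut_const * decay_rate ^ n"
  have c: "0 \<le> ?c" using cut_const_pos decay_rate_bounds by simp
  note E0 = elastic_energy_nonneg[of u h]
  have n': "2 * (real n + 1) * (2 * V / T) < T / 2"
    using n T by (simp add: field_simps power2_eq_square)
  have "surface_energy h \<le> surface_energy h2 + ?c * elastic_energy u h + e" if e: "e > 0" for e
  proof -
    obtain v k where vk: "admissible_pair h2 v k"
      "sqi (Omega h2) k \<le> sqi (Omega h) g + ennreal ?c * sqi (Omega h) g + ennreal e"
      using reshaped_competitor[OF D(1) M D(5,4,6) g V T I D2(1) M2 h2(2) n' e] by blast
    have "ennreal (elastic_energy v h2) \<le> ennreal (elastic_energy u h + ?c * elastic_energy u h + e)"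
      using vk(2) c E0 e
      by (simp add: elastic_energy_eq[OF D2(1) vk(1), symmetric] elastic_energy_eq[OF D(1) ap, symmetric] ennreal_mult[symmetric])
    then have "elastic_energy v h2 \<le> elastic_energy u h + ?c * elastic_energy u h + e"
      by (rule ennreal_le_iff[THEN iffD1, rotated]) (use mult_nonneg_nonneg[OF c E0] E0 e in linarith)
    moreover have "(v, h2) \<in> admissible V"
      using V h2(1) vk(1) boundary_admissible_iff[OF D2(1)] by (auto simp: admissible_profile)
    ultimately show ?thesis using min[of v h2] by simp
  qed
  then show ?thesis by (rule field_le_epsilon)
qed

section \<open>Replacing the top by a parabola\<close>

text \<open>The parabola stays above the boundary value \<open>s\<close>, because its volume is at least that of the constant \<open>s\<close>. So the new
  profile differs from \<open>k\<close> only above this level.\<close>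

lemma parabola_replacement:
  assumes k: "profile V k g" and \<alpha>\<beta>: "\<alpha> < \<beta>" and ks: "k \<alpha> = s" "k \<beta> = s" "\<And>x. x \<in> {\<alpha>..\<beta>} \<Longrightarrow> s \<le> k x" and s: "0 \<le> s"
  obtains k2 g2 D where "profile V k2 g2" "\<And>x. k2 x = k x \<or> x \<in> {\<alpha><..<\<beta>} \<and> s \<le> k2 x"
    "0 \<le> D" "sqi UNIV g = sqi UNIV g2 + ennreal D"
    "\<And>hs. constrained_minimizer k {\<alpha><..<\<beta>} hs \<Longrightarrow> (L2_norm {\<alpha><..<\<beta>} (\<lambda>x. k x - hs x))\<^sup>2 \<le> 2 * (\<beta> - \<alpha>)\<^sup>2 * D"
proof -
  let ?J = "{\<alpha><..<\<beta>}"
  note K = profileD[OF k] and J = open_interval_sets[of \<alpha> \<beta>]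
  have kc: "continuous_on S k" for S using K(1) by (rule continuous_on_subset) simp
  obtain p c0 c1 where p: "\<And>x. (p has_real_derivative c0 * x + c1) (at x)" "p \<alpha> = s" "p \<beta> = s"
    "\<And>x. x \<in> {\<alpha>..\<beta>} \<Longrightarrow> s \<le> p x" "integral {\<alpha>..\<beta>} p = integral {\<alpha>..\<beta>} k"
    by (rule parabola_exists[OF \<alpha>\<beta> kc ks(3)], assumption, rule that)
  let ?q = "\<lambda>x. c0 * x + c1"
  have pc: "continuous_on S p" for S using p(1) by (intro continuous_at_imp_continuous_on ballI DERIV_isCont) blast
  have qc: "continuous_on UNIV ?q" by (intro continuous_intros)
  have prk: "primitive_on UNIV k g" by (rule weak_gradient_primitive[OF open_UNIV convex_UNIV K(1,3)])
  have prJ: "primitive_on {\<alpha>..\<beta>} k g" by (rule primitive_subset[OF prk]) auto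
  define k2 where "k2 = (\<lambda>x. if x \<in> ?J then p x else k x)"
  define g2 where "g2 = (\<lambda>x. if x \<in> ?J then ?q x else g x)"
  have bd: "k \<alpha> = p \<alpha>" "k \<beta> = p \<beta>" using ks p by auto
  have w2: "has_weak_gradient UNIV k2 g2"
    unfolding k2_def g2_def by (rule glue_weak_gradient[OF \<alpha>\<beta> K(1,3) p(1) qc bd])
  have gL: "L2 ?J g" by (rule L2_subset[OF K(7)]) (use J in auto)
  have qL: "L2 ?J ?q" by (intro L2_continuous_bounded J qc)
  \<comment> \<open>projection to the interval, which shows that the glued function is continuous\<close>
  define c where "c x = max \<alpha> (min \<beta> x)" for x
  have k2c: "k2 = (\<lambda>x. k x + (p (c x) - k (c x)))"
    using \<alpha>\<beta> bd by (auto simp: k2_def c_def fun_eq_iff max_def min_def)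
  have cc: "continuous_on UNIV c" unfolding c_def[abs_def] by (intro continuous_intros)
  have C: "continuous_on UNIV k2"
    unfolding k2c by (intro continuous_on_add continuous_on_diff kc continuous_on_compose2[OF pc cc] continuous_on_compose2[OF kc cc]) auto
  have k2i: "k2 = (\<lambda>x. k x + indicator ?J x *\<^sub>R (p x - k x))"
    by (auto simp: k2_def fun_eq_iff split: split_indicator)
  have dL: "L2 ?J (\<lambda>x. p x - k x)" by (intro L2_continuous_bounded[OF _ J(2,1)] continuous_on_diff pc kc)
  have L: "L2 UNIV k2" unfolding k2i by (intro L2_add K L2_extend_zero dL J)
  have "L2 ?J (\<lambda>_. 1::real)" by (intro L2_continuous_bounded J continuous_intros)
  then have di: "integrable (lebesgue_on ?J) (\<lambda>x. p x - k x)" using L2_pair_integrable[OF dL] by force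
  then have di': "integrable lebesgue (\<lambda>x. indicator ?J x *\<^sub>R (p x - k x))"
    using J by (subst (asm) integrable_restrict_space) auto
  have "(LINT x|lebesgue. indicator ?J x *\<^sub>R (p x - k x)) = (LINT x|lebesgue_on ?J. p x - k x)"
    using J by (subst integral_restrict_space) auto
  also have "\<dots> = integral {\<alpha>..\<beta>} (\<lambda>x. p x - k x)" by (intro interval_integral_Ioo continuous_on_diff pc kc)
  also have "\<dots> = 0" using p(5) by (subst Henstock_Kurzweil_Integration.integral_diff) (auto intro: integrable_continuous_interval pc kc)
  finally have vol: "(LINT x|lebesgue. k2 x) = V" unfolding k2i using di' K(5,6) by simp
  have int: "integrable lebesgue k2" unfolding k2i using di' K(5) by simp
  have low: "k2 x = k x \<or> x \<in> ?J \<and> s \<le> k2 x" for x using p(4)[of x] by (auto simp: k2_def)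
  have pos: "0 \<le> k2 x" for x using low[of x] K(4)[of x] s by auto
  have P2: "profile V k2 g2" unfolding profile_def using C L w2 pos int vol by auto
  have dqL: "L2 ?J (\<lambda>x. g x - ?q x)" by (rule L2_diff[OF gL qL])
  define D where "D = (LINT x|lebesgue_on ?J. (norm (g x - ?q x))\<^sup>2)"
  have D: "0 \<le> D" "sqi ?J (\<lambda>x. g x - ?q x) = ennreal D" using sqi_L2[OF dqL] by (simp_all add: D_def)
  have split: "sqi UNIV f = sqi ?J f + sqi (- ?J) f" if "L2 UNIV f" for f :: "real \<Rightarrow> real"
    using sqi_Un[of ?J "- ?J" f] L2_lmeas[OF that] J(1) by (simp add: Compl_in_sets_lebesgue)
  have "sqi UNIV g = (ennreal D + sqi ?J ?q) + sqi (- ?J) g"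
    unfolding split[OF K(7)] using parabola_excess(1)[OF \<alpha>\<beta> prJ p(1) bd p(5)[symmetric]] D by simp
  also have "sqi ?J ?q = sqi ?J g2" by (rule sqi_cong) (simp add: g2_def)
  also have "sqi (- ?J) g = sqi (- ?J) g2" by (rule sqi_cong) (auto simp: g2_def)
  finally have S: "sqi UNIV g = sqi UNIV g2 + ennreal D"
    unfolding split[OF profileD(7)[OF P2]] by (simp add: add_ac)
  have N: "(L2_norm ?J (\<lambda>x. k x - hs x))\<^sup>2 \<le> 2 * (\<beta> - \<alpha>)\<^sup>2 * D" if "constrained_minimizer k ?J hs" for hs
  proof -
    have "ennreal ((L2_norm ?J (\<lambda>x. k x - hs x))\<^sup>2) \<le> ennreal (2 * (\<beta> - \<alpha>)\<^sup>2) * ennreal D"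
      using constrained_minimizer_near[OF \<alpha>\<beta> prJ p(1) bd p(5)[symmetric] that] unfolding D(2) .
    also have "\<dots> = ennreal (2 * (\<beta> - \<alpha>)\<^sup>2 * D)" using D by (simp add: ennreal_mult)
    finally show ?thesis using D by simp
  qed
  show thesis by (rule that[OF P2 low D(1) S N])
qed

section \<open>Exponential closeness\<close>

lemma polynomial_exp_absorb:
  fixes z :: real
  assumes z: "0 < z" and b: "0 < b" and B: "0 \<le> B1" "0 \<le> B2"
  shows "(B1 * z + B2 * z ^ 6) * exp (- b * z) \<le> (B1 * (2 / b) + B2 * 720 * (2 / b) ^ 6) * exp (- (b / 2) * z)"
proof -
  define y where "y = b * z / 2"
  have y: "0 \<le> y" "z = 2 / b * y" using z b by (auto simp: y_def)
  have 1: "z \<le> 2 / b * exp y" 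
    using mult_left_mono[OF power_le_fact_exp[OF y(1), of 1], of "2 / b"] b y(2) by simp
  have "z ^ 6 = (2 / b) ^ 6 * y ^ 6" by (simp only: y(2) power_mult_distrib)
  also have "\<dots> \<le> (2 / b) ^ 6 * (720 * exp y)"
    using power_le_fact_exp[OF y(1), of 6] b by (intro mult_left_mono) (auto simp: fact_numeral)
  finally have 6: "z ^ 6 \<le> (2 / b) ^ 6 * (720 * exp y)" .
  have "B1 * z + B2 * z ^ 6 \<le> B1 * (2 / b * exp y) + B2 * ((2 / b) ^ 6 * (720 * exp y))"
    by (intro add_mono mult_left_mono 1 6 B)
  also have "\<dots> = (B1 * (2 / b) + B2 * 720 * (2 / b) ^ 6) * exp y" by (simp add: algebra_simps)
  finally have "(B1 * z + B2 * z ^ 6) * exp (- b * z) \<le> (B1 * (2 / b) + B2 * 720 * (2 / b) ^ 6) * exp y * exp (- b * z)"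
    by (rule mult_right_mono) simp
  also have "\<dots> = (B1 * (2 / b) + B2 * 720 * (2 / b) ^ 6) * exp (- (b / 2) * z)"
    by (simp add: mult.assoc mult_exp_exp y_def)
  finally show ?thesis .
qed

text \<open>In the original variables the level is \<open>T = V powr (3/5) * s\<close>, so the condition on the number \<open>n\<close> of decay steps becomes \<open>n + 1 < q\<close>
  for \<open>q = s\<^sup>2 * V powr (1/5) / 8\<close>. If \<open>q\<close> is at most one there is no such \<open>n\<close>; then the trivial bound by the total energy has
  the claimed form, as the power of \<open>decay_rate\<close> is at least one.\<close>

lemma rescaled_surface_excess:
  assumes m: "total_minimizer V u h" and k: "k = rescale V h" "profile 1 k g"
    and s: "0 < s" and I: "connected I" "I \<noteq> {}" "\<And>x. x \<in> I \<Longrightarrow> s < k x"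
    and k2: "profile 1 k2 g2" "\<And>x. k2 x = k x \<or> x \<in> I \<and> s \<le> k2 x"
    and D: "0 \<le> D" "sqi UNIV g = sqi UNIV g2 + ennreal D"
    and B: "surface_energy h + elastic_energy u h \<le> B"
  shows "V powr (4/5) * D \<le> (cut_const + 1) * decay_rate powr (s\<^sup>2 * V powr (1/5) / 8 - 2) * B"
proof -
  have V: "0 < V" using m by (simp add: total_minimizer_def admissible_def)
  define z where "z = V powr (1/5)"
  note Z = fifth_root_powers[OF V z_def]
  define q where "q = s\<^sup>2 * z / 8"
  have hk: "h = unscale V k" using unscale_rescale[OF V] k(1) by simp
  obtain gh where gh: "profile V h gh" "sqi UNIV gh = ennreal (V powr (4/5)) * sqi UNIV g"
    unfolding hk by (rule profile_unscale[OF k(2) V])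
  define h2 where "h2 = unscale V k2"
  obtain gh2 where gh2: "profile V h2 gh2" "sqi UNIV gh2 = ennreal (V powr (4/5)) * sqi UNIV g2"
    unfolding h2_def by (rule profile_unscale[OF k2(1) V])
  have S0: "0 \<le> surface_energy f" for f by (simp add: surface_energy_def dirichlet_energy_nonneg)
  have "ennreal (surface_energy h) = ennreal (surface_energy h2) + ennreal (V powr (4/5) * D)"
    unfolding profile_surface[OF gh(1)] profile_surface[OF gh2(1)] gh(2) gh2(2) D(2)
    using D(1) by (simp add: distrib_left ennreal_mult)
  then have S: "surface_energy h = surface_energy h2 + V powr (4/5) * D"
    using S0 D(1) by (simp add: ennreal_plus[symmetric] del: ennreal_plus)
  note E0 = elastic_energy_nonneg[of u h]
  have B0: "0 \<le> B" using B S0[of h] E0 by linarith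
  have r: "0 < decay_rate" "decay_rate < 1" by (rule decay_rate_bounds)+
  note c = cut_const_pos
  have "V powr (4/5) * D \<le> (cut_const + 1) * decay_rate powr (q - 2) * B"
  proof (cases "1 < q")
    case True
    \<comment> \<open>the largest \<open>n\<close> with \<open>n + 1 < q\<close>\<close>
    define n where "n = nat (\<lceil>q\<rceil> - 2)"
    have n: "real n = real_of_int \<lceil>q\<rceil> - 2" unfolding n_def using True by (simp add: nat_diff_distrib) linarith
    then have nq: "real n + 1 < q" "q - 2 \<le> real n" by linarith+
    define T where "T = z ^ 3 * s"
    have T: "0 < T" using Z(1) s by (simp add: T_def)
    have hz: "h = (\<lambda>x. z ^ 3 * k (1 / z\<^sup>2 * x))" "h2 = (\<lambda>x. z ^ 3 * k2 (1 / z\<^sup>2 * x))"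
      unfolding hk h2_def unscale_def Z(3,6) by simp_all
    define J where "J = (\<lambda>x. z\<^sup>2 * x) ` I"
    have J: "x \<in> J \<longleftrightarrow> 1 / z\<^sup>2 * x \<in> I" for x using Z(1) by (auto simp: J_def image_iff intro!: bexI[of _ "x / z\<^sup>2"])
    obtain x0 where x0: "x0 \<in> J" using I(2) by (auto simp: J_def)
    have Jc: "connected J" unfolding J_def by (intro connected_continuous_image continuous_intros I)
    have "8 * (real n + 1) * V < 8 * q * V" using nq V by simp
    also have "\<dots> = T\<^sup>2" by (simp add: q_def T_def Z(2) eval_nat_numeral algebra_simps)
    finally have nT: "8 * (real n + 1) * V < T\<^sup>2" .
    have "surface_energy h \<le> surface_energy h2 + cut_const * decay_rate ^ n * elastic_energy u h"
    proof (rule reshaped_surface_energy[OF m T Jc x0 _ gh2(1) _ nT])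
      show "T < h x" if "x \<in> J" for x using I(3)[of "1 / z\<^sup>2 * x"] that J Z(1) by (simp add: hz T_def)
      show "h2 x = h x \<or> x \<in> J \<and> T \<le> h2 x" for x using k2(2)[of "1 / z\<^sup>2 * x"] J[of x] Z(1) by (auto simp: hz T_def)
    qed
    then have "V powr (4/5) * D \<le> cut_const * decay_rate ^ n * elastic_energy u h" using S by simp
    also have "\<dots> = cut_const * (decay_rate powr real n * elastic_energy u h)" using r by (simp add: powr_realpow)
    also have "\<dots> \<le> (cut_const + 1) * (decay_rate powr (q - 2) * B)"
      using r c nq E0 B S0[of h] by (intro mult_mono powr_mono') auto
    finally show ?thesis by (simp add: mult.assoc)
  next
    case False
    have "1 \<le> decay_rate powr (q - 2)" using powr_mono'[of "q - 2" 0 decay_rate] False r by simp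
    then have "1 * 1 \<le> (cut_const + 1) * decay_rate powr (q - 2)" using c by (intro mult_mono) auto
    from mult_right_mono[OF this B0] show ?thesis using S B S0[of h2] E0 by simp
  qed
  then show ?thesis by (simp add: q_def z_def)
qed

text \<open>In \<open>z = V powr (1/5)\<close> the bound for the total energy is a polynomial of degree ten and the scaling factor of the surface energy is \<open>z ^ 4\<close>,
  which leaves \<open>B1 * z + B2 * z ^ 6\<close> in front of the exponential.\<close>

lemma energy_excess_decay:
  assumes \<epsilon>: "0 < \<epsilon>" and B: "0 < B1" "0 \<le> B2"
  obtains K b where "0 < K" "0 < b"
    "\<And>V s D. 0 < V \<Longrightarrow> \<epsilon> \<le> s \<Longrightarrow> V powr (4/5) * D \<le> (cut_const + 1) * decay_rate powr (s\<^sup>2 * V powr (1/5) / 8 - 2) * (B1 * V + B2 * V\<^sup>2)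
      \<Longrightarrow> D \<le> K * exp (- b * V powr (1/5))"
proof -
  define a where "a = - ln decay_rate"
  have a: "0 < a" "decay_rate = exp (- a)" using decay_rate_bounds by (auto simp: a_def)
  define b where "b = a * \<epsilon>\<^sup>2 / 8"
  have b: "0 < b" using a \<epsilon> by (simp add: b_def)
  define P where "P = B1 * (2 / b) + B2 * 720 * (2 / b) ^ 6"
  have P: "0 < P" using b B by (simp add: P_def add_pos_nonneg)
  define K where "K = (cut_const + 1) * exp (2 * a) * P"
  have K: "0 < K" using P cut_const_pos by (simp add: K_def)
  have "D \<le> K * exp (- (b / 2) * V powr (1/5))"
    if V: "0 < V" and s: "\<epsilon> \<le> s"
      and D: "V powr (4/5) * D \<le> (cut_const + 1) * decay_rate powr (s\<^sup>2 * V powr (1/5) / 8 - 2) * (B1 * V + B2 * V\<^sup>2)" for V s D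
  proof -
    define z where "z = V powr (1/5)"
    note Z = fifth_root_powers[OF V z_def]
    have "\<epsilon>\<^sup>2 \<le> s\<^sup>2" using s \<epsilon> by (intro power_mono) auto
    then have "a * (\<epsilon>\<^sup>2 * z / 8) \<le> a * (s\<^sup>2 * z / 8)" using a Z(1) by (intro mult_left_mono divide_right_mono mult_right_mono) auto
    then have "decay_rate powr (s\<^sup>2 * z / 8 - 2) \<le> exp (2 * a - b * z)"
      unfolding a(2) by (simp add: powr_def b_def algebra_simps)
    then have dr: "decay_rate powr (s\<^sup>2 * z / 8 - 2) \<le> exp (2 * a) * exp (- b * z)" by (simp add: mult_exp_exp)
    have V2: "B1 * V + B2 * V\<^sup>2 = z ^ 4 * (B1 * z + B2 * z ^ 6)" by (simp add: Z(2) algebra_simps eval_nat_numeral)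
    have "z ^ 4 * D \<le> (cut_const + 1) * decay_rate powr (s\<^sup>2 * z / 8 - 2) * (z ^ 4 * (B1 * z + B2 * z ^ 6))"
      using D unfolding V2 Z(5) z_def[symmetric] .
    also have "\<dots> = z ^ 4 * ((cut_const + 1) * decay_rate powr (s\<^sup>2 * z / 8 - 2) * (B1 * z + B2 * z ^ 6))" by (simp add: mult_ac)
    finally have "D \<le> (cut_const + 1) * decay_rate powr (s\<^sup>2 * z / 8 - 2) * (B1 * z + B2 * z ^ 6)"
      using Z(1) by (simp only: mult_le_cancel_left_pos zero_less_power)
    also have "\<dots> \<le> (cut_const + 1) * (exp (2 * a) * exp (- b * z)) * (B1 * z + B2 * z ^ 6)"
      using Z(1) B cut_const_pos by (intro mult_right_mono mult_left_mono dr) auto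
    also have "\<dots> = (cut_const + 1) * exp (2 * a) * ((B1 * z + B2 * z ^ 6) * exp (- b * z))" by (simp add: mult_ac)
    also have "\<dots> \<le> (cut_const + 1) * exp (2 * a) * (P * exp (- (b / 2) * z))"
      unfolding P_def using B cut_const_pos by (intro mult_left_mono polynomial_exp_absorb Z(1) b) auto
    also have "\<dots> = K * exp (- (b / 2) * z)" by (simp add: K_def mult_ac)
    finally show ?thesis by (simp add: z_def)
  qed
  then show thesis using that[OF K half_gt_zero[OF b]] by blast
qed

theorem proposition3p40:
  fixes \<epsilon> :: real
  assumes "\<epsilon> > 0"
  shows "\<exists>C\<^sub>0 > 0. \<exists>C\<^sub>1 > 0. \<forall>V > critical_volume. \<forall>h\<^sub>V. G_minimizer V h\<^sub>V \<longrightarrow>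
    (\<forall>s \<ge> \<epsilon>. \<forall>I h\<^sub>s. largest_component {x. h\<^sub>V x > s} I \<and> constrained_minimizer h\<^sub>V I h\<^sub>s \<longrightarrow>
      L2_norm I (\<lambda>x. h\<^sub>V x - h\<^sub>s x) \<le> C\<^sub>0 * exp (- C\<^sub>1 * V powr (1/5)))"
proof -
  obtain B1 B2 where B: "0 < B1" "0 \<le> B2"
    "\<And>V u h. total_minimizer V u h \<Longrightarrow> surface_energy h + elastic_energy u h \<le> B1 * V + B2 * V\<^sup>2"
    by (rule total_energy_bound) blast
  obtain K b where K: "0 < K" "0 < b"
    "\<And>V s D. 0 < V \<Longrightarrow> \<epsilon> \<le> s \<Longrightarrow> V powr (4/5) * D \<le> (cut_const + 1) * decay_rate powr (s\<^sup>2 * V powr (1/5) / 8 - 2) * (B1 * V + B2 * V\<^sup>2)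
      \<Longrightarrow> D \<le> K * exp (- b * V powr (1/5))"
    by (rule energy_excess_decay[OF assms B(1,2)]) blast
  \<comment> \<open>the interval has length at most \<open>1 / \<epsilon>\<close>, and the square of the norm is at most \<open>2 * (1 / \<epsilon>)\<^sup>2\<close> times the excess, so the constants are \<open>sqrt (2 * K) / \<epsilon>\<close> and \<open>b / 2\<close>\<close>
  have "L2_norm I (\<lambda>x. k x - hs x) \<le> sqrt (2 * K) / \<epsilon> * exp (- (b / 2) * V powr (1/5))"
    if G: "G_minimizer V k" and s: "\<epsilon> \<le> s" and I: "largest_component {x. k x > s} I" and hs: "constrained_minimizer k I hs"
    for V k s I hs
  proof -
    have s0: "0 < s" using s assms by simp
    obtain u h where m: "total_minimizer V u h" and k: "k = rescale V h" by (rule G_minimizer_total[OF G])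
    then have V: "0 < V" and "\<exists>gh. profile V h gh" by (auto simp: total_minimizer_def admissible_profile)
    then obtain g where g: "profile 1 k g" unfolding k using profile_rescale by blast
    note D = profileD[OF g]
    obtain x0 where x0: "s < k x0" "I = connected_component_set {x. s < k x} x0"
      using I by (auto simp: largest_component_def components_def)
    obtain \<alpha> \<beta> where \<alpha>\<beta>: "connected_component_set {x. s < k x} x0 = {\<alpha><..<\<beta>}" "\<alpha> < x0" "x0 < \<beta>"
      "k \<alpha> \<le> s" "k \<beta> \<le> s" "s * (\<beta> - \<alpha>) \<le> 1"
      by (rule superlevel_component[OF D(1,5,4,6) s0 x0(1)])
    then have IJ: "I = {\<alpha><..<\<beta>}" and lt: "\<alpha> < \<beta>" using x0(2) by auto
    have above: "s < k x" if "x \<in> {\<alpha><..<\<beta>}" for x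
      using that connected_component_subset[of "{x. s < k x}" x0] unfolding \<alpha>\<beta>(1) by auto
    have cl: "closure {\<alpha><..<\<beta>} = {\<alpha>..\<beta>}" using lt by (rule closure_greaterThanLessThan)
    have ge: "s \<le> k x" if "x \<in> {\<alpha>..\<beta>}" for x
      by (rule continuous_ge_on_closure[of "{\<alpha><..<\<beta>}" k x s])
        (use that above in \<open>auto simp: cl less_imp_le intro: continuous_on_subset[OF D(1)]\<close>)
    have eq: "k \<alpha> = s" "k \<beta> = s" using ge[of \<alpha>] ge[of \<beta>] \<alpha>\<beta>(4,5) lt by auto
    obtain k2 g2 E where k2: "profile 1 k2 g2" "\<And>x. k2 x = k x \<or> x \<in> {\<alpha><..<\<beta>} \<and> s \<le> k2 x"
      and E: "0 \<le> E" "sqi UNIV g = sqi UNIV g2 + ennreal E"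
      and near: "\<And>hs. constrained_minimizer k {\<alpha><..<\<beta>} hs \<Longrightarrow> (L2_norm {\<alpha><..<\<beta>} (\<lambda>x. k x - hs x))\<^sup>2 \<le> 2 * (\<beta> - \<alpha>)\<^sup>2 * E"
      by (rule parabola_replacement[OF g lt eq ge]) (use s0 in auto)
    have "V powr (4/5) * E \<le> (cut_const + 1) * decay_rate powr (s\<^sup>2 * V powr (1/5) / 8 - 2) * (B1 * V + B2 * V\<^sup>2)"
      by (rule rescaled_surface_excess[OF m k g s0 _ _ above k2 E B(3)[OF m]]) (use \<alpha>\<beta>(2,3) lt in auto)
    from K(3)[OF V s this] have EK: "E \<le> K * exp (- b * V powr (1/5))" .
    have "(\<beta> - \<alpha>) \<le> 1 / s" using \<alpha>\<beta>(6) s0 by (simp add: field_simps)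
    also have "\<dots> \<le> 1 / \<epsilon>" using s assms by (intro divide_left_mono) auto
    finally have "(\<beta> - \<alpha>)\<^sup>2 \<le> (1 / \<epsilon>)\<^sup>2" using lt by (intro power_mono) auto
    then have "2 * (\<beta> - \<alpha>)\<^sup>2 * E \<le> 2 * (1 / \<epsilon>)\<^sup>2 * (K * exp (- b * V powr (1/5)))"
      using E EK by (intro mult_mono) auto
    also have "\<dots> = (sqrt (2 * K) / \<epsilon> * exp (- (b / 2) * V powr (1/5)))\<^sup>2"
      using K(1) by (simp add: power_mult_distrib power_divide exp_of_nat_mult[symmetric])
    finally have "(L2_norm I (\<lambda>x. k x - hs x))\<^sup>2 \<le> (sqrt (2 * K) / \<epsilon> * exp (- (b / 2) * V powr (1/5)))\<^sup>2"
      using near hs unfolding IJ by fastforce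
    then show ?thesis by (rule power2_le_imp_le) (use K(1) assms in simp)
  qed
  moreover have "0 < sqrt (2 * K) / \<epsilon>" "0 < b / 2" using K assms by auto
  ultimately show ?thesis by blast
qed

end
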